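(* Consider the infinitely delayed stochastic evolution equation $$dX(t)=b(t,X_t)\,dt+\sigma(t,X_t)\,dW(t),\quad t\in[0,T],\qquad X(t)=\gamma(t),\quad t\in(-\infty,0].\qquad(\ast)$$ Suppose that: (1) (uniform Lipschitz condition) there exists a constant $L_1>0$ such that for all $t\in[0,T]$ and $x,x'\in C_\lambda((-\infty,T];H)$, $$\|b(t,x)-b(t,x')\|_H+\|\sigma(t,x)-\sigma(t,x')\|_{\mathcal L_2}\leqslant L_1\|x-x'\|_{\lambda,T};$$ (2) $\mathbb E\big[\int_0^T\|b(t,0)\|_H^2dt\big]+\mathbb E\big[\int_0^T\|\sigma(t,0)\|_{\mathcal L_2}^2dt\big]<\infty$. Then for any given initial data $\gamma_0\in L^2(\mathcal F_0;C_\lambda((-\infty,0];H))$ such that $\gamma(\cdot)\in\mathcal M^2_{\mathcal F}(-\infty,0;H)$, equation $(\ast)$ admits a unique solution $X(\cdot)$ (in the sense defined in the context).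
   Context: $T>0$ and $\lambda>0$ are fixed. $H$ is a real separable Hilbert space with norm $\|\cdot\|_H$; $\mathcal L_2(\mathbb R^m,H)$ is the space of Hilbert-Schmidt operators from $\mathbb R^m$ to $H$ with norm $\|\cdot\|_{\mathcal L_2}$. $(\Omega,\mathcal F,\{\mathcal F_t\}_{t\geqslant0},P)$ is a complete filtered probability space satisfying the usual conditions and $W=\{W(t)\}_{t\geqslant 0}$ is an $m$-dimensional cylindrical Brownian motion on $\mathbb R^m$ adapted to $\{\mathcal F_t\}$; $\mathcal F_t:=\mathcal F_0$ for $t<0$. For $\tau\leqslant T$, $C_\lambda((-\infty,\tau];H)$ is the space of continuous $x:(-\infty,\tau]\to H$ with $\|x\|_{\lambda,\tau}:=\sup_{\theta\leqslant \tau}e^{\lambda\theta}\|x(\theta)\|_H<\infty$ and $\lim_{\theta\to-\infty}e^{\lambda\theta}x(\theta)=0$. $L^2(\mathcal F_0;C_\lambda((-\infty,0];H))$ is the space of $\mathcal F_0$-measurable $C_\lambda((-\infty,0];H)$-valued random variables with square integrable norm. $\mathcal M^2_{\mathcal F}(I;H)$ is the space of progressively measurable $H$-valued processes $X$ with $\mathbb E\int_I\|X(t)\|_H^2dt<\infty$. For a process $X$, $X_t:=\{X(t-\theta):0\leqslant\theta<\infty\}$ denotes its past trajectory up to $t$; it is regarded as an element of $C_\lambda((-\infty,T];H)$ through the non-anticipative extension equal to $X(s)$ for $s\leqslant t$ and to $X(t)$ for $t<s\leqslant T$. In particular $\gamma_0=\{\gamma(\theta):-\infty<\theta\leqslant0\}$.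 The coefficients $b:[0,T]\times\Omega\times C_\lambda((-\infty,T];H)\to H$ and $\sigma:[0,T]\times\Omega\times C_\lambda((-\infty,T];H)\to\mathcal L_2(\mathbb R^m,H)$ are progressively measurable in $(t,\omega)$ for each fixed path. Solution: an $\mathcal F$-adapted continuous process $X(\cdot)$ on $(-\infty,T]$ is called a solution of $(\ast)$ if $(\ast)$ holds $P$-a.s. and $X_t\in C_\lambda((-\infty,t];H)$ for all $t\in[0,T]$. *)

theory Defs
  imports "HOL-Probability.Probability"
begin

section \<open>Filtered probability spaces and processes\<close>

text \<open>
  The time index of the filtration is the whole real line, with \<open>F t = F 0\<close> for \<open>t < 0\<close>.
  Only the sigma-algebras of the measures \<open>F t\<close> matter.
\<close>

locale usual_filtered_prob_space =
  prob_space M + complete_measure M + filtration "space M" F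
  for M :: "'w measure" and F :: "real \<Rightarrow> 'w measure" +
  assumes sets_F_subset: "sets (F t) \<subseteq> sets M"
    and null_sets_F0: "null_sets M \<subseteq> sets (F 0)"
    and F_right_continuous: "0 \<le> t \<Longrightarrow> sets (F t) = (\<Inter>s\<in>{t<..}. sets (F s))"
    and F_negative: "t < 0 \<Longrightarrow> sets (F t) = sets (F 0)"

definition prog_measurable ::
  "(real \<Rightarrow> 'w measure) \<Rightarrow> real set \<Rightarrow> (real \<Rightarrow> 'w \<Rightarrow> 'e::topological_space) \<Rightarrow> bool" where
  "prog_measurable F I X \<longleftrightarrow>
     (\<forall>t\<in>I. (\<lambda>(s, \<omega>). X s \<omega>) \<in> borel_measurable (restrict_space borel (I \<inter> {..t}) \<Otimes>\<^sub>M F t))"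

definition adapted_continuous ::
  "(real \<Rightarrow> 'w measure) \<Rightarrow> real set \<Rightarrow> (real \<Rightarrow> 'w \<Rightarrow> 'e::topological_space) \<Rightarrow> bool" where
  "adapted_continuous F I X \<longleftrightarrow>
     (\<forall>t\<in>I. X t \<in> borel_measurable (F t) \<and>
       (\<forall>\<omega>\<in>space (F t). continuous_on I (\<lambda>s. X s \<omega>)))"

definition M2_space ::
  "'w measure \<Rightarrow> (real \<Rightarrow> 'w measure) \<Rightarrow> real set \<Rightarrow>
   (real \<Rightarrow> 'w \<Rightarrow> 'h::{real_inner, banach, second_countable_topology}) set" where
  "M2_space M F I = {X. prog_measurable F I X \<and>
     (\<integral>\<^sup>+ \<omega>. (\<integral>\<^sup>+ t\<in>I. ennreal ((norm (X t \<omega>))\<^sup>2) \<partial>lborel) \<partial>M) < \<infinity>}"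

text \<open>
  A cylindrical Brownian motion on the finite-dimensional space \<open>real ^ 'm\<close> is represented by its
  \<open>real ^ 'm\<close>-valued version \<open>W\<close>, the cylindrical process being \<open>h \<mapsto> W t \<bullet> h\<close>.  The increments are
  independent of the past of the filtration, not just of the past of \<open>W\<close>.
\<close>

definition brownian_motion ::
  "'w measure \<Rightarrow> (real \<Rightarrow> 'w measure) \<Rightarrow> (real \<Rightarrow> 'w \<Rightarrow> real ^ 'm) \<Rightarrow> bool" where
  "brownian_motion M F W \<longleftrightarrow>
     (\<forall>t\<ge>0. W t \<in> borel_measurable (F t)) \<and>
     (AE \<omega> in M. W 0 \<omega> = 0) \<and>
     (AE \<omega> in M. continuous_on {0..} (\<lambda>t. W t \<omega>)) \<and>
     (\<forall>s t. 0 \<le> s \<and> s < t \<longrightarrow>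
        prob_space.indep_set M (sets (F s))
          {(\<lambda>\<omega>. W t \<omega> - W s \<omega>) -` A \<inter> space M | A. A \<in> sets borel} \<and>
        prob_space.indep_vars M (\<lambda>_. borel) (\<lambda>i \<omega>. (W t \<omega> - W s \<omega>) $ i) UNIV \<and>
        (\<forall>i. distributed M lborel (\<lambda>\<omega>. (W t \<omega> - W s \<omega>) $ i) (normal_density 0 (sqrt (t - s)))))"

section \<open>Hilbert-Schmidt operators and the stochastic integral\<close>

text \<open>
  Every linear operator on a Euclidean space is bounded and Hilbert-Schmidt, so the space of
  Hilbert-Schmidt operators is the type \<open>'a \<Rightarrow>\<^sub>L 'b\<close>.  The library norm on that type is the operator
  norm; it is equivalent to the Hilbert-Schmidt norm and hence has the same Borel sets.
\<close>

definition hs_norm :: "('a::euclidean_space \<Rightarrow>\<^sub>L 'b::real_inner) \<Rightarrow> real" where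
  "hs_norm A = sqrt (\<Sum>e\<in>Basis. (norm (blinfun_apply A e))\<^sup>2)"

text \<open>
  The simple process \<open>\<Sum>k<n. \<one>\<^bsub>(p k, p (k+1)]\<^esub> \<xi> k\<close> is given by its length \<open>n\<close>, its partition
  points \<open>p\<close> and its coefficients \<open>\<xi>\<close>.
\<close>

definition simple_process ::
  "(real \<Rightarrow> 'w measure) \<Rightarrow> real \<Rightarrow> nat \<Rightarrow> (nat \<Rightarrow> real) \<Rightarrow>
   (nat \<Rightarrow> 'w \<Rightarrow> ((real ^ 'm) \<Rightarrow>\<^sub>L 'h::{real_inner, banach, second_countable_topology})) \<Rightarrow> bool" where
  "simple_process F T n p \<xi> \<longleftrightarrow>
     0 \<le> p 0 \<and> p n \<le> T \<and> (\<forall>k<n. p k < p (Suc k)) \<and>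
     (\<forall>k<n. \<xi> k \<in> borel_measurable (F (p k)) \<and>
       (\<exists>C. \<forall>\<omega>\<in>space (F (p k)). norm (\<xi> k \<omega>) \<le> C))"

definition simple_value ::
  "nat \<Rightarrow> (nat \<Rightarrow> real) \<Rightarrow> (nat \<Rightarrow> 'w \<Rightarrow> ((real ^ 'm) \<Rightarrow>\<^sub>L 'h::real_inner)) \<Rightarrow>
   real \<Rightarrow> 'w \<Rightarrow> ((real ^ 'm) \<Rightarrow>\<^sub>L 'h)" where
  "simple_value n p \<xi> s \<omega> = (\<Sum>k<n. indicator {p k<..p (Suc k)} s *\<^sub>R \<xi> k \<omega>)"

definition simple_integral ::
  "(real \<Rightarrow> 'w \<Rightarrow> real ^ 'm) \<Rightarrow> nat \<Rightarrow> (nat \<Rightarrow> real) \<Rightarrow>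
   (nat \<Rightarrow> 'w \<Rightarrow> ((real ^ 'm) \<Rightarrow>\<^sub>L 'h::real_inner)) \<Rightarrow> real \<Rightarrow> 'w \<Rightarrow> 'h" where
  "simple_integral W n p \<xi> t \<omega> =
     (\<Sum>k<n. blinfun_apply (\<xi> k \<omega>) (W (min (p (Suc k)) t) \<omega> - W (min (p k) t) \<omega>))"

text \<open>
  \<open>I\<close> is a continuous version of the Ito integral \<open>t \<mapsto> \<integral>\<^sub>0\<^sup>t \<Phi> dW\<close> on \<open>[0, T]\<close>, for a progressively
  measurable \<open>\<Phi>\<close> whose square is only required to be pathwise integrable: simple processes tend
  to \<open>\<Phi>\<close> in probability, in the norm of \<open>L\<^sup>2(0, T)\<close>, and their integrals tend to \<open>I\<close> in
  probability.  Such an \<open>I\<close> is unique up to indistinguishability.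
\<close>

definition is_ito_integral ::
  "'w measure \<Rightarrow> (real \<Rightarrow> 'w measure) \<Rightarrow> (real \<Rightarrow> 'w \<Rightarrow> real ^ 'm) \<Rightarrow> real \<Rightarrow>
   (real \<Rightarrow> 'w \<Rightarrow> ((real ^ 'm) \<Rightarrow>\<^sub>L 'h::{real_inner, banach, second_countable_topology})) \<Rightarrow>
   (real \<Rightarrow> 'w \<Rightarrow> 'h) \<Rightarrow> bool" where
  "is_ito_integral M F W T \<Phi> I \<longleftrightarrow>
     prog_measurable F {0..T} \<Phi> \<and>
     (AE \<omega> in M. (\<integral>\<^sup>+ s\<in>{0..T}. ennreal ((hs_norm (\<Phi> s \<omega>))\<^sup>2) \<partial>lborel) < \<infinity>) \<and>
     adapted_continuous F {0..T} I \<and>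
     (\<exists>n p \<xi>.
        (\<forall>j. simple_process F T (n j) (p j) (\<xi> j)) \<and>
        (\<forall>\<epsilon>>0. (\<lambda>j::nat. measure M {\<omega>\<in>space M. ennreal \<epsilon> <
            (\<integral>\<^sup>+ s\<in>{0..T}. ennreal ((hs_norm (simple_value (n j) (p j) (\<xi> j) s \<omega> - \<Phi> s \<omega>))\<^sup>2) \<partial>lborel)})
          \<longlonglongrightarrow> 0) \<and>
        (\<forall>t\<in>{0..T}. \<forall>\<epsilon>>0. (\<lambda>j. measure M {\<omega>\<in>space M.
            \<epsilon> < norm (simple_integral W (n j) (p j) (\<xi> j) t \<omega> - I t \<omega>)}) \<longlonglongrightarrow> 0))"

section \<open>Path spaces\<close>

text \<open>
  A path on \<open>(-\<infinity>, \<tau>]\<close> is represented by a function on the whole real line of which only the values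
  at arguments \<open>\<le> \<tau>\<close> matter; \<open>clam_norm\<close> is thus a seminorm on the representing functions, whose
  null space consists of the functions vanishing on \<open>(-\<infinity>, \<tau>]\<close>.
\<close>

definition clam_norm :: "real \<Rightarrow> real \<Rightarrow> (real \<Rightarrow> 'h::real_normed_vector) \<Rightarrow> real" where
  "clam_norm l \<tau> x = (SUP \<theta>\<in>{..\<tau>}. exp (l * \<theta>) * norm (x \<theta>))"

definition Clam :: "real \<Rightarrow> real \<Rightarrow> (real \<Rightarrow> 'h::real_normed_vector) set" where
  "Clam l \<tau> = {x. continuous_on {..\<tau>} x \<and>
     bdd_above ((\<lambda>\<theta>. exp (l * \<theta>) * norm (x \<theta>)) ` {..\<tau>}) \<and>
     ((\<lambda>\<theta>. exp (l * \<theta>) *\<^sub>R x \<theta>) \<longlongrightarrow> 0) at_bot}"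

definition clam_borel :: "real \<Rightarrow> real \<Rightarrow> (real \<Rightarrow> 'h::real_normed_vector) measure" where
  "clam_borel l \<tau> = sigma (Clam l \<tau>)
     {U. U \<subseteq> Clam l \<tau> \<and>
         (\<forall>x\<in>U. \<exists>e>0. \<forall>y\<in>Clam l \<tau>. clam_norm l \<tau> (\<lambda>\<theta>. y \<theta> - x \<theta>) < e \<longrightarrow> y \<in> U)}"

text \<open>
  The random variable is the path \<open>\<gamma>\<^sub>0 = {\<gamma>(\<theta>) : \<theta> \<le> 0}\<close> of the process \<open>\<gamma>\<close>.
\<close>

definition L2_initial ::
  "'w measure \<Rightarrow> (real \<Rightarrow> 'w measure) \<Rightarrow> real \<Rightarrow> (real \<Rightarrow> 'w \<Rightarrow> 'h::real_normed_vector) set" where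
  "L2_initial M F l = {\<gamma>. (\<lambda>\<omega> \<theta>. \<gamma> \<theta> \<omega>) \<in> measurable (F 0) (clam_borel l 0) \<and>
     integrable M (\<lambda>\<omega>. (clam_norm l 0 (\<lambda>\<theta>. \<gamma> \<theta> \<omega>))\<^sup>2)}"

text \<open>The trajectory up to time \<open>t\<close>, extended by its value at \<open>t\<close>.\<close>

definition past :: "(real \<Rightarrow> 'w \<Rightarrow> 'h) \<Rightarrow> real \<Rightarrow> 'w \<Rightarrow> (real \<Rightarrow> 'h)" where
  "past X t \<omega> = (\<lambda>s. X (min s t) \<omega>)"

section \<open>The stochastic evolution equation\<close>

definition is_solution ::
  "'w measure \<Rightarrow> (real \<Rightarrow> 'w measure) \<Rightarrow> (real \<Rightarrow> 'w \<Rightarrow> real ^ 'm) \<Rightarrow> real \<Rightarrow> real \<Rightarrow>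
   (real \<Rightarrow> 'w \<Rightarrow> (real \<Rightarrow> 'h::{real_inner, banach, second_countable_topology}) \<Rightarrow> 'h) \<Rightarrow>
   (real \<Rightarrow> 'w \<Rightarrow> (real \<Rightarrow> 'h) \<Rightarrow> ((real ^ 'm) \<Rightarrow>\<^sub>L 'h)) \<Rightarrow>
   (real \<Rightarrow> 'w \<Rightarrow> 'h) \<Rightarrow> (real \<Rightarrow> 'w \<Rightarrow> 'h) \<Rightarrow> bool" where
  "is_solution M F W l T b \<sigma> \<gamma> X \<longleftrightarrow>
     adapted_continuous F {..T} X \<and>
     (\<forall>t\<in>{0..T}. \<forall>\<omega>\<in>space M. (\<lambda>\<theta>. X \<theta> \<omega>) \<in> Clam l t) \<and>
     (AE \<omega> in M. set_integrable lborel {0..T} (\<lambda>s. b s \<omega> (past X s \<omega>))) \<and>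
     (\<exists>I. is_ito_integral M F W T (\<lambda>s \<omega>. \<sigma> s \<omega> (past X s \<omega>)) I \<and>
       (AE \<omega> in M.
         (\<forall>t\<le>0. X t \<omega> = \<gamma> t \<omega>) \<and>
         (\<forall>t\<in>{0..T}. X t \<omega> =
            \<gamma> 0 \<omega> + (LINT s:{0..t}|lborel. b s \<omega> (past X s \<omega>)) + I t \<omega>)))"

end

theory Submission
  imports Defs
begin

text \<open>
  For square integrable integrands the Ito integral \<open>I\<close> of \<open>\<Phi>\<close> satisfies Doob's inequality
  \<open>E sup\<^sub>s\<^sub>\<le>\<^sub>t |I s|\<^sup>2 \<le> c E \<integral>\<^sub>0\<^sup>t |\<Phi>|\<^sup>2 ds\<close>.  The past of two processes with the same initial path differs,
  in the weighted norm, by at most a constant times the supremum of their difference on \<open>[0, t]\<close>,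
  so the map sending \<open>X\<close> to \<open>\<gamma> 0 + \<integral> b(s, X\<^sub>s) ds + \<integral> \<sigma>(s, X\<^sub>s) dW\<close> satisfies a Volterra estimate for
  \<open>E sup\<^sub>s\<^sub>\<le>\<^sub>t |X s - Z s|\<^sup>2\<close>, and Picard iteration converges.  An arbitrary solution need not be square
  integrable.  Uniqueness therefore follows from the same estimate on the event that the supremum
  of the difference is at most \<open>R\<close>, where the stochastic integral is localised, and Gronwall's lemma.
\<close>

section \<open>The Hilbert-Schmidt norm and Brownian increments\<close>

text \<open>Localisation rests on the tail bound \<open>elem_tail_bound\<close>, P(|integral| > c,
  energy <= \<kappa>) <= \<kappa> / c^2, which, unlike the isometry, survives convergence in
  probability, the only convergence that \<open>is_ito_integral\<close> provides.
  \<open>adapted_continuous\<close> asks for continuity for every outcome, whereas Brownian paths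
  are continuous only almost surely; since null sets lie in every \<open>F t\<close>, processes are
  redefined on null sets without losing adaptedness. The coefficients are measurable only for each
  fixed path; their measurability along X comes from the Lipschitz condition and the separability of
  the path space. Mean square distances are kept squared and in \<open>ennreal\<close>: each
  triangle inequality then costs a factor 2, and constants such as 64 are not sharp, but only their
  finiteness matters. The rate 16^-n leaves room for the weight 4^n, under which the squared
  increments of an approximating sequence still sum; the increments themselves are then at most 2^-n
  times a finite random factor, uniformly in time.\<close>

lemma countable_dense_imp_countable_basis:
  fixes D :: "'a::metric_space set"
  assumes "countable D" and dense: "\<And>x e. e > 0 \<Longrightarrow> \<exists>d\<in>D. dist d x < e"
  shows "\<exists>B::'a set set. countable B \<and> topological_basis B"
proof (intro exI conjI)
  let ?B = "(\<lambda>(d, n::nat). ball d (1 / Suc n)) ` (D \<times> UNIV)"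
  show "countable ?B" using assms(1) by auto
  show "topological_basis ?B"
  proof (rule topological_basisI)
    fix O' and x :: 'a assume "open O'" "x \<in> O'"
    then obtain e where e: "e > 0" "ball x e \<subseteq> O'" by (meson openE)
    obtain n :: nat where n: "1 / Suc n < e / 2"
      using nat_approx_posE[of "e / 2"] e(1) by auto
    obtain d where d: "d \<in> D" "dist d x < 1 / Suc n" using dense[of "1 / Suc n" x] by auto
    have "ball d (1 / Suc n) \<subseteq> ball x e"
    proof
      fix y assume "y \<in> ball d (1 / Suc n)"
      with d(2) n have "dist x y < e" using dist_triangle[of x y d] by (simp add: dist_commute)
      then show "y \<in> ball x e" by simp
    qed
    with d e(2) show "\<exists>B'\<in>?B. x \<in> B' \<and> B' \<subseteq> O'"
      by (intro bexI[of _ "ball d (1 / Suc n)"]) auto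
  qed auto
qed

lemma norm_blinfun_le_sum_Basis:
  fixes A :: "'a::euclidean_space \<Rightarrow>\<^sub>L 'b::real_normed_vector"
  shows "norm A \<le> (\<Sum>e\<in>Basis. norm (A e))"
proof (rule norm_blinfun_bound)
  show "0 \<le> (\<Sum>e\<in>Basis. norm (A e))" by (simp add: sum_nonneg)
  fix x :: 'a
  have "A x = A (\<Sum>e\<in>Basis. (x \<bullet> e) *\<^sub>R e)" by (simp add: euclidean_representation)
  also have "\<dots> = (\<Sum>e\<in>Basis. (x \<bullet> e) *\<^sub>R A e)" by (simp add: blinfun.sum_right blinfun.scaleR_right)
  also have "norm \<dots> \<le> (\<Sum>e\<in>Basis. norm x * norm (A e))"
    by (rule sum_norm_le) (simp add: mult_right_mono Basis_le_norm)
  finally show "norm (A x) \<le> (\<Sum>e\<in>Basis. norm (A e)) * norm x"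
    by (simp add: sum_distrib_left mult.commute)
qed

text \<open>Second countability gives measurability of sums and pairs of operator-valued maps and is
  required for their Bochner integrals. An operator on a Euclidean space is determined by its values
  on \<open>Basis\<close>; choosing these in a countable dense set of the target gives a countable
  dense set of operators.\<close>

instance blinfun :: (euclidean_space, "{real_normed_vector, second_countable_topology}")
  second_countable_topology
proof
  obtain D :: "'b set" where D: "countable D" "\<And>X. open X \<Longrightarrow> X \<noteq> {} \<Longrightarrow> \<exists>d\<in>D. d \<in> X"
    using countable_dense_setE by blast
  define op :: "('a \<Rightarrow> 'b) \<Rightarrow> 'a \<Rightarrow>\<^sub>L 'b" where
    "op f = (\<Sum>e\<in>Basis. blinfun_scaleR_left (f e) o\<^sub>L blinfun_inner_left e)" for f
  have op: "op f e = f e" if "e \<in> Basis" for f e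
  proof -
    have "op f e = (\<Sum>b\<in>Basis. (e \<bullet> b) *\<^sub>R f b)" by (simp add: op_def blinfun.sum_left)
    also have "\<dots> = (\<Sum>b\<in>Basis. if e = b then f b else 0)"
      using that by (intro sum.cong) (auto simp: inner_Basis)
    finally show ?thesis using that by simp
  qed
  let ?E = "op ` (Pi\<^sub>E Basis (\<lambda>_. D))"
  have "countable ?E" using D(1) by (intro countable_image countable_PiE) auto
  moreover have "\<exists>d\<in>?E. dist d A < e" if "e > 0" for A :: "'a \<Rightarrow>\<^sub>L 'b" and e :: real
  proof -
    let ?n = "real DIM('a)"
    have "\<forall>i. \<exists>d. d \<in> D \<and> dist d (A i) < e / ?n"
    proof
      fix i
      have "0 < e / ?n" using that by simp
      then show "\<exists>d. d \<in> D \<and> dist d (A i) < e / ?n" using D(2)[of "ball (A i) (e / ?n)"] by (auto simp: dist_commute)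
    qed
    from choice[OF this] obtain f where f: "\<And>i. f i \<in> D" "\<And>i. dist (f i) (A i) < e / ?n" by auto
    let ?g = "restrict f Basis"
    have "norm (op ?g - A) \<le> (\<Sum>i\<in>Basis. norm ((op ?g - A) i))" by (rule norm_blinfun_le_sum_Basis)
    also have "\<dots> = (\<Sum>i\<in>Basis. dist (f i) (A i))"
    proof (rule sum.cong)
      fix i :: 'a assume i: "i \<in> Basis"
      then have "op ?g i = f i" using op[OF i, of ?g] by simp
      then show "norm ((op ?g - A) i) = dist (f i) (A i)"
        by (simp only: blinfun.diff_left dist_norm)
    qed (rule refl)
    also have "\<dots> < (\<Sum>i\<in>(Basis::'a set). e / ?n)" by (rule sum_strict_mono) (simp_all add: f(2))
    also have "\<dots> = e" by simp
    finally have "dist (op ?g) A < e" by (simp add: dist_norm)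
    moreover have "?g \<in> Pi\<^sub>E Basis (\<lambda>_. D)" using f by auto
    ultimately show ?thesis by (rule bexI[OF _ imageI])
  qed
  ultimately have "\<exists>B::('a \<Rightarrow>\<^sub>L 'b) set set. countable B \<and> topological_basis B"
    by (intro countable_dense_imp_countable_basis[of ?E])
  then obtain B :: "('a \<Rightarrow>\<^sub>L 'b) set set" where B: "countable B" "topological_basis B" by (elim exE conjE)
  show "\<exists>B::('a \<Rightarrow>\<^sub>L 'b) set set. countable B \<and> open = generate_topology B"
    by (intro exI[of _ B] conjI B(1) topological_basis_imp_subbasis[OF B(2)])
qed

definition hs_inner :: "('a::euclidean_space \<Rightarrow>\<^sub>L 'b::real_inner) \<Rightarrow> ('a \<Rightarrow>\<^sub>L 'b) \<Rightarrow> real" where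
  "hs_inner A B = (\<Sum>e\<in>Basis. A e \<bullet> B e)"

lemma hs_norm_nonneg [simp]: "0 \<le> hs_norm A"
  by (simp add: hs_norm_def sum_nonneg)

lemma hs_norm_0 [simp]: "hs_norm 0 = 0"
  by (simp add: hs_norm_def)

lemma hs_norm_sq: "(hs_norm A)\<^sup>2 = (\<Sum>e\<in>Basis. (norm (A e))\<^sup>2)"
  by (simp add: hs_norm_def sum_nonneg)

lemma hs_norm_sq_inner: "(hs_norm A)\<^sup>2 = hs_inner A A"
  by (simp add: hs_norm_sq hs_inner_def power2_norm_eq_inner)

lemma hs_norm_uminus: "hs_norm (- A) = hs_norm A"
  by (simp add: hs_norm_def blinfun.minus_left)

lemma hs_norm_minus_commute: "hs_norm (A - B) = hs_norm (B - A)"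
  using hs_norm_uminus[of "A - B"] by simp

lemma norm_add_sq_le: "(norm (x + y :: 'a::real_normed_vector))\<^sup>2 \<le> 2 * (norm x)\<^sup>2 + 2 * (norm y)\<^sup>2"
proof -
  have "(norm (x + y))\<^sup>2 \<le> (norm x + norm y)\<^sup>2" by (simp add: norm_triangle_ineq power_mono)
  also have "\<dots> \<le> 2 * (norm x)\<^sup>2 + 2 * (norm y)\<^sup>2"
    using sum_squares_bound[of "norm x" "norm y"] by (simp add: power2_sum)
  finally show ?thesis .
qed

lemma hs_norm_add_sq_le: "(hs_norm (A + B))\<^sup>2 \<le> 2 * (hs_norm A)\<^sup>2 + 2 * (hs_norm B)\<^sup>2"
proof -
  have "(hs_norm (A + B))\<^sup>2 \<le> (\<Sum>e\<in>Basis. 2 * (norm (A e))\<^sup>2 + 2 * (norm (B e))\<^sup>2)"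
    unfolding hs_norm_sq by (intro sum_mono) (simp add: blinfun.add_left norm_add_sq_le)
  then show ?thesis by (simp add: hs_norm_sq sum.distrib sum_distrib_left)
qed

text \<open>Cauchy-Schwarz against the constant vector 1. Together with
  \<open>hs_norm_le_norm\<close> this moves between the operator norm, to which Borel sets and
  boundedness refer, and the Hilbert-Schmidt norm of the estimates.\<close>

lemma norm_le_hs_norm:
  fixes A :: "'a::euclidean_space \<Rightarrow>\<^sub>L 'b::real_inner"
  shows "norm A \<le> sqrt DIM('a) * hs_norm A"
proof -
  have "norm A \<le> (\<Sum>e\<in>Basis. \<bar>1\<bar> * \<bar>norm (A e)\<bar>)"
    using norm_blinfun_le_sum_Basis[of A] by simp
  also have "\<dots> \<le> L2_set (\<lambda>_. 1) (Basis :: 'a set) * L2_set (\<lambda>e. norm (A e)) Basis"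
    by (rule L2_set_mult_ineq)
  finally show ?thesis by (simp add: L2_set_def hs_norm_def)
qed

lemma hs_norm_le_norm:
  fixes A :: "'a::euclidean_space \<Rightarrow>\<^sub>L 'b::real_inner"
  shows "hs_norm A \<le> sqrt DIM('a) * norm A"
proof -
  have "(\<Sum>e\<in>Basis. (norm (A e))\<^sup>2) \<le> (\<Sum>e\<in>(Basis::'a set). (norm A)\<^sup>2)"
    by (intro sum_mono power_mono) (metis norm_blinfun norm_Basis mult.right_neutral, simp)
  then have "hs_norm A \<le> sqrt (DIM('a) * (norm A)\<^sup>2)"
    by (simp add: hs_norm_def)
  then show ?thesis by (simp add: real_sqrt_mult)
qed

lemma continuous_hs_norm: "continuous_on UNIV (hs_norm :: ('a::euclidean_space \<Rightarrow>\<^sub>L 'b::real_inner) \<Rightarrow> real)"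
  unfolding hs_norm_def by (intro continuous_intros)

lemma borel_measurable_hs_norm [measurable (raw)]:
  "f \<in> borel_measurable M \<Longrightarrow> (\<lambda>x. hs_norm (f x)) \<in> borel_measurable M"
  using borel_measurable_continuous_onI[OF continuous_hs_norm] by (rule measurable_compose[rotated])

lemma borel_measurable_blinfun_apply [measurable (raw)]:
  fixes f :: "'w \<Rightarrow> 'a::euclidean_space \<Rightarrow>\<^sub>L 'b::{real_normed_vector, second_countable_topology}"
  assumes [measurable]: "f \<in> borel_measurable M" "g \<in> borel_measurable M"
  shows "(\<lambda>x. f x (g x)) \<in> borel_measurable M"
proof -
  have "continuous_on UNIV (\<lambda>p::('a \<Rightarrow>\<^sub>L 'b) \<times> 'a. blinfun_apply (fst p) (snd p))" by (intro continuous_intros)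
  from measurable_compose[OF borel_measurable_Pair[OF assms] borel_measurable_continuous_onI[OF this]]
  show ?thesis by simp
qed

lemma borel_measurable_hs_inner [measurable (raw)]:
  fixes f g :: "'w \<Rightarrow> 'a::euclidean_space \<Rightarrow>\<^sub>L 'b::{real_inner, second_countable_topology}"
  assumes [measurable]: "f \<in> borel_measurable M" "g \<in> borel_measurable M"
  shows "(\<lambda>x. hs_inner (f x) (g x)) \<in> borel_measurable M"
  unfolding hs_inner_def by measurable

section \<open>Moments of Brownian increments weighted by variables of the past\<close>

locale brownian_basis = usual_filtered_prob_space M F
  for M :: "'w measure" and F :: "real \<Rightarrow> 'w measure" +
  fixes W :: "real \<Rightarrow> 'w \<Rightarrow> real ^ 'm" and T :: real
  assumes bm: "brownian_motion M F W" and T_pos: "0 < T"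
begin

lemma subalgebra_F: "subalgebra M (F t)"
  using sets_F_subset by (auto simp: subalgebra_def space_F)

lemma measurable_F_M: "f \<in> measurable (F t) N \<Longrightarrow> f \<in> measurable M N"
  by (rule measurable_from_subalg[OF subalgebra_F])

lemma measurable_F_mono: "s \<le> t \<Longrightarrow> f \<in> measurable (F s) N \<Longrightarrow> f \<in> measurable (F t) N"
  by (rule measurable_from_subalg) (auto simp: subalgebra_def space_F sets_F_mono)

lemma null_sets_in_F: "N \<in> null_sets M \<Longrightarrow> N \<in> sets (F t)"
  using null_sets_F0 F_negative[of t] sets_F_mono[of 0 t] by (cases "t < 0") auto

text \<open>Every subset of a null set is measurable by completeness and lies in every
  \<open>F t\<close>, so changing a variable on such a set keeps it adapted. This is what permits
  passing to continuous versions.\<close>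

lemma adapted_AE_cong:
  assumes f: "f \<in> borel_measurable (F t)" and ae: "AE x in M. f x = g x"
  shows "g \<in> borel_measurable (F t)"
proof (rule measurableI)
  from ae obtain N where N: "{x\<in>space M. f x \<noteq> g x} \<subseteq> N" "N \<in> null_sets M"
    by (auto elim!: AE_E simp: null_sets_def)
  fix A :: "'a set" assume A: "A \<in> sets borel"
  have "g -` A \<inter> space M = (f -` A \<inter> space M - N) \<union> (g -` A \<inter> space M \<inter> N)"
    using N(1) by auto
  moreover have "g -` A \<inter> space M \<inter> N \<in> null_sets M"
    by (rule complete2[OF _ N(2)]) auto
  moreover have "f -` A \<inter> space M \<in> sets (F t)"
    using measurable_sets[OF f A] by (simp add: space_F)
  ultimately show "g -` A \<inter> space (F t) \<in> sets (F t)"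
    using null_sets_in_F[OF N(2), of t] null_sets_in_F[of "g -` A \<inter> space M \<inter> N" t]
    unfolding space_F by (metis sets.Diff sets.Un)
qed simp

lemma W_meas: "0 \<le> s \<Longrightarrow> s \<le> t \<Longrightarrow> W s \<in> borel_measurable (F t)"
  using bm measurable_F_mono[of s t "W s" borel] unfolding brownian_motion_def by auto

lemma W_meas_M: "0 \<le> s \<Longrightarrow> W s \<in> borel_measurable M"
  using W_meas[of s s] measurable_F_M by auto

text \<open>Turns independence of sigma-algebras into independence of variables, for which the
  product formula for expectations is available. The function \<open>g\<close> will be a coordinate
  or a product of two coordinates.\<close>

lemma increment_indep:
  fixes g :: "real ^ 'm \<Rightarrow> real"
  assumes "0 \<le> s" "s < t" and Y: "Y \<in> borel_measurable (F s)" and g: "g \<in> borel_measurable borel"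
  shows "indep_var borel Y borel (\<lambda>\<omega>. g (W t \<omega> - W s \<omega>))"
proof -
  let ?D = "\<lambda>\<omega>. W t \<omega> - W s \<omega>"
  have [measurable]: "?D \<in> borel_measurable M" using W_meas_M assms by auto
  have [measurable]: "Y \<in> borel_measurable M" "g \<in> borel_measurable borel"
    using Y g measurable_F_M by auto
  let ?V = "vimage_algebra (space M) ?D borel"
  have V: "sets ?V = {?D -` A \<inter> space M | A. A \<in> sets borel}"
    by (rule sets_vimage_algebra2) auto
  have i: "indep_set (sets (F s)) (sets ?V)"
    unfolding V using bm assms by (auto simp: brownian_motion_def)
  have 1: "sigma_sets (space M) {Y -` A \<inter> space M | A. A \<in> sets borel} \<subseteq> sets (F s)"
    using sets.sigma_sets_subset[of "{Y -` A \<inter> space M | A. A \<in> sets borel}" "F s"] measurable_sets[OF Y]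
    unfolding space_F by auto
  have "(\<lambda>\<omega>. g (?D \<omega>)) -` A \<inter> space M \<in> sets ?V" if "A \<in> sets borel" for A
    unfolding V mem_Collect_eq
    by (rule exI[of _ "g -` A"]) (use measurable_sets[OF g that] in auto)
  then have 2: "sigma_sets (space M) {(\<lambda>\<omega>. g (?D \<omega>)) -` A \<inter> space M | A. A \<in> sets borel} \<subseteq> sets ?V"
    using sets.sigma_sets_subset[of "{(\<lambda>\<omega>. g (?D \<omega>)) -` A \<inter> space M | A. A \<in> sets borel}" ?V]
    unfolding space_vimage_algebra by auto
  show ?thesis unfolding indep_var_eq
  proof (intro conjI)
    show "indep_set (sigma_sets (space M) {Y -` A \<inter> space M | A. A \<in> sets borel})
      (sigma_sets (space M) {(\<lambda>\<omega>. g (?D \<omega>)) -` A \<inter> space M | A. A \<in> sets borel})"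
      using i 1 2 unfolding indep_sets2_eq by (meson subset_iff order_trans)
  qed measurable
qed

lemma increment_normal:
  "0 \<le> s \<Longrightarrow> s < t \<Longrightarrow> distributed M lborel (\<lambda>\<omega>. (W t \<omega> - W s \<omega>) $ i) (normal_density 0 (sqrt (t - s)))"
  using bm by (auto simp: brownian_motion_def)

lemma increment_sq:
  assumes "0 \<le> s" "s \<le> t"
  shows "integrable M (\<lambda>\<omega>. (W t \<omega> $ i - W s \<omega> $ i)\<^sup>2)"
    and "expectation (\<lambda>\<omega>. (W t \<omega> $ i - W s \<omega> $ i)\<^sup>2) = t - s"
    and "integrable M (\<lambda>\<omega>. W t \<omega> $ i - W s \<omega> $ i)"
    and "expectation (\<lambda>\<omega>. W t \<omega> $ i - W s \<omega> $ i) = 0"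
proof -
  have "integrable M (\<lambda>\<omega>. (W t \<omega> $ i - W s \<omega> $ i)\<^sup>2) \<and>
    expectation (\<lambda>\<omega>. (W t \<omega> $ i - W s \<omega> $ i)\<^sup>2) = t - s \<and>
    integrable M (\<lambda>\<omega>. W t \<omega> $ i - W s \<omega> $ i) \<and> expectation (\<lambda>\<omega>. W t \<omega> $ i - W s \<omega> $ i) = 0"
  proof (cases "s = t")
    case False
    with assms have st: "s < t" by simp
    note D = increment_normal[OF assms(1) st, of i]
    have pos: "0 < sqrt (t - s)" using st by simp
    have e: "expectation (\<lambda>\<omega>. (W t \<omega> - W s \<omega>) $ i) = 0"
      by (rule normal_distributed_expectation[OF pos D])
    have v: "variance (\<lambda>\<omega>. (W t \<omega> - W s \<omega>) $ i) = (sqrt (t - s))\<^sup>2"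
      by (rule normal_distributed_variance[OF pos D])
    have "integrable M (\<lambda>\<omega>. ((W t \<omega> - W s \<omega>) $ i)^2)"
      using distributed_integrable[OF D, of "\<lambda>x. x^2"] integrable_normal_moment[OF pos, of 0 2] by simp
    moreover have "integrable M (\<lambda>\<omega>. ((W t \<omega> - W s \<omega>) $ i))"
      using distributed_integrable[OF D, of "\<lambda>x. x"] integrable_normal_moment[OF pos, of 0 1] by simp
    ultimately show ?thesis using e v st by simp
  qed simp
  then show "integrable M (\<lambda>\<omega>. (W t \<omega> $ i - W s \<omega> $ i)\<^sup>2)"
    and "expectation (\<lambda>\<omega>. (W t \<omega> $ i - W s \<omega> $ i)\<^sup>2) = t - s"
    and "integrable M (\<lambda>\<omega>. W t \<omega> $ i - W s \<omega> $ i)"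
    and "expectation (\<lambda>\<omega>. W t \<omega> $ i - W s \<omega> $ i) = 0" by auto
qed

text \<open>Different coordinates of an increment are independent and centred, so their mixed moment
  is a product of zeros.\<close>

lemma increment_prod:
  assumes "0 \<le> s" "s \<le> t"
  shows "integrable M (\<lambda>\<omega>. (W t \<omega> $ i - W s \<omega> $ i) * (W t \<omega> $ j - W s \<omega> $ j)) \<and>
    expectation (\<lambda>\<omega>. (W t \<omega> $ i - W s \<omega> $ i) * (W t \<omega> $ j - W s \<omega> $ j)) = (if i = j then t - s else 0)"
proof -
  consider "s = t" | "s < t" "i = j" | "s < t" "i \<noteq> j" using assms by linarith
  then show ?thesis
  proof cases
    case 3
    have "indep_vars (\<lambda>_. borel) (\<lambda>i \<omega>. (W t \<omega> - W s \<omega>) $ i) UNIV"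
      using bm assms(1) 3(1) unfolding brownian_motion_def by blast
    then have I: "indep_vars (\<lambda>_. borel) (\<lambda>i \<omega>. (W t \<omega> - W s \<omega>) $ i) {i, j}"
      by (rule indep_vars_subset) auto
    have k: "integrable M (\<lambda>\<omega>. (W t \<omega> - W s \<omega>) $ k)" for k
      using increment_sq(3)[OF assms] by simp
    show ?thesis
      using indep_vars_integrable[OF _ I k] indep_vars_lebesgue_integral[OF _ I k]
        increment_sq(4)[OF assms] 3 by simp
  qed (use increment_sq[OF assms] in \<open>auto simp: power2_eq_square\<close>)
qed

lemma increment_mult:
  assumes "0 \<le> s" "s \<le> t" and Y: "Y \<in> borel_measurable (F s)" "integrable M Y"
  shows "integrable M (\<lambda>\<omega>. Y \<omega> * (W t \<omega> $ i - W s \<omega> $ i))"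
    and "expectation (\<lambda>\<omega>. Y \<omega> * (W t \<omega> $ i - W s \<omega> $ i)) = 0"
    and "integrable M (\<lambda>\<omega>. Y \<omega> * ((W t \<omega> $ i - W s \<omega> $ i) * (W t \<omega> $ j - W s \<omega> $ j)))"
    and "expectation (\<lambda>\<omega>. Y \<omega> * ((W t \<omega> $ i - W s \<omega> $ i) * (W t \<omega> $ j - W s \<omega> $ j)))
      = (if i = j then t - s else 0) * expectation Y"
proof -
  have "integrable M (\<lambda>\<omega>. Y \<omega> * (W t \<omega> $ i - W s \<omega> $ i)) \<and>
    expectation (\<lambda>\<omega>. Y \<omega> * (W t \<omega> $ i - W s \<omega> $ i)) = 0 \<and>
    integrable M (\<lambda>\<omega>. Y \<omega> * ((W t \<omega> $ i - W s \<omega> $ i) * (W t \<omega> $ j - W s \<omega> $ j))) \<and>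
    expectation (\<lambda>\<omega>. Y \<omega> * ((W t \<omega> $ i - W s \<omega> $ i) * (W t \<omega> $ j - W s \<omega> $ j)))
      = (if i = j then t - s else 0) * expectation Y"
  \<comment> \<open>\<open>brownian_motion\<close> provides independence and the normal law for
    \<open>s < t\<close> only; for \<open>s = t\<close> the increment is 0.\<close>
  proof (cases "s = t")
    case False
    then have st: "s < t" using assms by simp
    have 1: "indep_var borel Y borel (\<lambda>\<omega>. W t \<omega> $ i - W s \<omega> $ i)"
      using increment_indep[OF assms(1) st Y(1), of "\<lambda>x. x $ i"] by simp
    have 2: "indep_var borel Y borel (\<lambda>\<omega>. (W t \<omega> $ i - W s \<omega> $ i) * (W t \<omega> $ j - W s \<omega> $ j))"
      using increment_indep[OF assms(1) st Y(1), of "\<lambda>x. x $ i * x $ j"] by simp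
    show ?thesis
      using indep_var_integrable[OF 1 Y(2)] indep_var_lebesgue_integral[OF 1 Y(2)]
        indep_var_integrable[OF 2 Y(2)] indep_var_lebesgue_integral[OF 2 Y(2)]
        increment_prod[OF assms(1,2), of i j] increment_sq[OF assms(1,2), of i]
      by (simp add: mult.commute)
  qed simp
  then show "integrable M (\<lambda>\<omega>. Y \<omega> * (W t \<omega> $ i - W s \<omega> $ i))"
    and "expectation (\<lambda>\<omega>. Y \<omega> * (W t \<omega> $ i - W s \<omega> $ i)) = 0"
    and "integrable M (\<lambda>\<omega>. Y \<omega> * ((W t \<omega> $ i - W s \<omega> $ i) * (W t \<omega> $ j - W s \<omega> $ j)))"
    and "expectation (\<lambda>\<omega>. Y \<omega> * ((W t \<omega> $ i - W s \<omega> $ i) * (W t \<omega> $ j - W s \<omega> $ j)))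
      = (if i = j then t - s else 0) * expectation Y" by auto
qed

end

text \<open>The length of the intersection of the intervals from \<open>a\<close> to
  \<open>b\<close> and from \<open>c\<close> to \<open>d\<close>. It is also the covariance of the
  increments of one coordinate of \<open>W\<close> over these intervals.\<close>

definition overlap :: "real \<Rightarrow> real \<Rightarrow> real \<Rightarrow> real \<Rightarrow> real" where
  "overlap a b c d = max 0 (min b d - max a c)"

lemma sum_Basis_vec: "(\<Sum>e\<in>(Basis :: (real ^ 'm) set). f e) = (\<Sum>i\<in>UNIV. f (axis i 1))"
proof -
  have "(Basis :: (real ^ 'm) set) = (\<lambda>i. axis i 1) ` UNIV" by (auto simp: Basis_vec_def)
  moreover have "inj (\<lambda>i. axis i 1 :: real ^ 'm)" by (auto simp: inj_on_def axis_eq_axis)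
  ultimately show ?thesis using sum.reindex[of "\<lambda>i. axis i 1 :: real ^ 'm" UNIV f] by simp
qed

lemma blinfun_apply_vec:
  fixes A :: "(real ^ 'm) \<Rightarrow>\<^sub>L 'h::real_normed_vector"
  shows "A x = (\<Sum>i\<in>UNIV. (x $ i) *\<^sub>R A (axis i 1))"
proof -
  have "A x = A (\<Sum>e\<in>Basis. (x \<bullet> e) *\<^sub>R e)" by (simp add: euclidean_representation)
  also have "\<dots> = (\<Sum>e\<in>Basis. (x \<bullet> e) *\<^sub>R A e)" by (simp add: blinfun.sum_right blinfun.scaleR_right)
  finally show ?thesis by (simp add: sum_Basis_vec inner_axis)
qed

lemma borel_measurable_vec_component [measurable (raw)]:
  fixes f :: "'w \<Rightarrow> real ^ 'm"
  assumes "f \<in> borel_measurable M"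
  shows "(\<lambda>x. f x $ i) \<in> borel_measurable M"
proof -
  have "continuous_on UNIV (\<lambda>x::real ^ 'm. x $ i)" by (intro continuous_intros)
  from measurable_compose[OF assms borel_measurable_continuous_onI[OF this]] show ?thesis .
qed

lemma norm_blinfun_axis: "norm (blinfun_apply A (axis i 1 :: real ^ 'm)) \<le> norm A"
  using norm_blinfun[of A "axis i 1"] by simp

section \<open>Ito isometry for a pair of intervals\<close>

context brownian_basis
begin

lemma bounded_mult_integrable:
  fixes Y Z :: "'w \<Rightarrow> real"
  assumes "Y \<in> borel_measurable M" "\<And>\<omega>. \<omega> \<in> space M \<Longrightarrow> \<bar>Y \<omega>\<bar> \<le> B" "integrable M Z"
  shows "integrable M (\<lambda>\<omega>. Y \<omega> * Z \<omega>)"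
proof (rule Bochner_Integration.integrable_bound)
  show "integrable M (\<lambda>\<omega>. B * Z \<omega>)" using assms by simp
  show "AE \<omega> in M. norm (Y \<omega> * Z \<omega>) \<le> norm (B * Z \<omega>)"
    using assms(2) by (intro AE_I2) (fastforce simp: abs_mult intro!: mult_right_mono)
qed (use assms in measurable)

text \<open>Both increments are split at the end points that fall inside the other interval. Two
  pieces are then either disjoint or equal. For disjoint pieces \<open>Y\<close> times the earlier
  increment is known when the later one starts, so the expectation vanishes; only an equal pair
  contributes, and its length is the overlap.\<close>

lemma increment_cross_ordered:
  assumes "0 \<le> a" "a \<le> b" "c \<le> d" "a \<le> c" and Y: "Y \<in> borel_measurable (F c)"
    and B: "\<And>\<omega>. \<omega> \<in> space M \<Longrightarrow> \<bar>Y \<omega>\<bar> \<le> B"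
  shows "integrable M (\<lambda>\<omega>. Y \<omega> * ((W b \<omega> $ i - W a \<omega> $ i) * (W d \<omega> $ j - W c \<omega> $ j))) \<and>
    expectation (\<lambda>\<omega>. Y \<omega> * ((W b \<omega> $ i - W a \<omega> $ i) * (W d \<omega> $ j - W c \<omega> $ j)))
      = (if i = j then overlap a b c d else 0) * expectation Y"
proof -
  have YM: "Y \<in> borel_measurable M" using Y measurable_F_M by auto
  have Yint: "integrable M Y"
    using bounded_mult_integrable[OF YM B, of "\<lambda>_. 1"] by simp
  have disj: "integrable M (\<lambda>\<omega>. Y \<omega> * ((W q \<omega> $ i' - W p \<omega> $ i') * (W v \<omega> $ j' - W u \<omega> $ j'))) \<and>
      expectation (\<lambda>\<omega>. Y \<omega> * ((W q \<omega> $ i' - W p \<omega> $ i') * (W v \<omega> $ j' - W u \<omega> $ j'))) = 0"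
    if pq: "0 \<le> p" "p \<le> q" "q \<le> u" "u \<le> v" "c \<le> u" for p q u v i' j'
  proof -
    have m: "(\<lambda>\<omega>. Y \<omega> * (W q \<omega> $ i' - W p \<omega> $ i')) \<in> borel_measurable (F u)"
    proof -
      have [measurable]: "W q \<in> borel_measurable (F u)" "W p \<in> borel_measurable (F u)"
        "Y \<in> borel_measurable (F u)"
        using W_meas[of q u] W_meas[of p u] measurable_F_mono[OF pq(5) Y] pq by auto
      show ?thesis by measurable
    qed
    have I: "integrable M (\<lambda>\<omega>. Y \<omega> * (W q \<omega> $ i' - W p \<omega> $ i'))"
      using bounded_mult_integrable[OF YM B] increment_sq[of p q i'] pq by auto
    show ?thesis
      using increment_mult(1,2)[OF _ pq(4) m I, of j'] pq by (simp add: mult.assoc)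
  qed
  have same: "integrable M (\<lambda>\<omega>. Y \<omega> * ((W q \<omega> $ i - W c \<omega> $ i) * (W q \<omega> $ j - W c \<omega> $ j))) \<and>
     expectation (\<lambda>\<omega>. Y \<omega> * ((W q \<omega> $ i - W c \<omega> $ i) * (W q \<omega> $ j - W c \<omega> $ j)))
     = (if i = j then q - c else 0) * expectation Y" if "c \<le> q" for q
    using increment_mult(3,4)[OF _ that Y Yint] assms by simp
  consider "b \<le> c" | "c \<le> b" "b \<le> d" | "c \<le> b" "d \<le> b" by linarith
  then show ?thesis
  proof cases
    case 1
    then show ?thesis using disj[of a b c d i j] assms by (auto simp: overlap_def)
  next
    case 2
    let ?t1 = "\<lambda>\<omega>. Y \<omega> * ((W c \<omega> $ i - W a \<omega> $ i) * (W d \<omega> $ j - W c \<omega> $ j))"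
    let ?t2 = "\<lambda>\<omega>. Y \<omega> * ((W b \<omega> $ i - W c \<omega> $ i) * (W b \<omega> $ j - W c \<omega> $ j))"
    let ?t3 = "\<lambda>\<omega>. Y \<omega> * ((W b \<omega> $ i - W c \<omega> $ i) * (W d \<omega> $ j - W b \<omega> $ j))"
    have e: "(\<lambda>\<omega>. Y \<omega> * ((W b \<omega> $ i - W a \<omega> $ i) * (W d \<omega> $ j - W c \<omega> $ j))) = (\<lambda>\<omega>. ?t1 \<omega> + ?t2 \<omega> + ?t3 \<omega>)"
      by (auto simp: algebra_simps)
    have "overlap a b c d = b - c" using 2 assms by (simp add: overlap_def)
    then show ?thesis unfolding e
      using disj[of a c c d i j] disj[of c b b d i j] same[of b] 2 assms by simp
  next
    case 3
    let ?t1 = "\<lambda>\<omega>. Y \<omega> * ((W c \<omega> $ i - W a \<omega> $ i) * (W d \<omega> $ j - W c \<omega> $ j))"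
    let ?t2 = "\<lambda>\<omega>. Y \<omega> * ((W d \<omega> $ i - W c \<omega> $ i) * (W d \<omega> $ j - W c \<omega> $ j))"
    let ?t3 = "\<lambda>\<omega>. Y \<omega> * ((W d \<omega> $ j - W c \<omega> $ j) * (W b \<omega> $ i - W d \<omega> $ i))"
    have e: "(\<lambda>\<omega>. Y \<omega> * ((W b \<omega> $ i - W a \<omega> $ i) * (W d \<omega> $ j - W c \<omega> $ j))) = (\<lambda>\<omega>. ?t1 \<omega> + ?t2 \<omega> + ?t3 \<omega>)"
      by (auto simp: algebra_simps)
    have "overlap a b c d = d - c" using 3 assms by (simp add: overlap_def)
    then show ?thesis unfolding e
      using disj[of a c c d i j] disj[of c d d b j i] same[of d] 3 assms by simp
  qed
qed

lemma increment_cross: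
  assumes "0 \<le> a" "a \<le> b" "0 \<le> c" "c \<le> d" and Y: "Y \<in> borel_measurable (F (max a c))"
    and B: "\<And>\<omega>. \<omega> \<in> space M \<Longrightarrow> \<bar>Y \<omega>\<bar> \<le> B"
  shows "integrable M (\<lambda>\<omega>. Y \<omega> * ((W b \<omega> $ i - W a \<omega> $ i) * (W d \<omega> $ j - W c \<omega> $ j)))"
    and "expectation (\<lambda>\<omega>. Y \<omega> * ((W b \<omega> $ i - W a \<omega> $ i) * (W d \<omega> $ j - W c \<omega> $ j)))
      = (if i = j then overlap a b c d else 0) * expectation Y"
proof (atomize (full), cases "a \<le> c")
  case True
  then show "integrable M (\<lambda>\<omega>. Y \<omega> * ((W b \<omega> $ i - W a \<omega> $ i) * (W d \<omega> $ j - W c \<omega> $ j))) \<and>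
    expectation (\<lambda>\<omega>. Y \<omega> * ((W b \<omega> $ i - W a \<omega> $ i) * (W d \<omega> $ j - W c \<omega> $ j)))
      = (if i = j then overlap a b c d else 0) * expectation Y"
    using increment_cross_ordered[of a b c d Y B i j] assms by (simp add: max_def)
next
  case False
  have e: "(\<lambda>\<omega>. Y \<omega> * ((W b \<omega> $ i - W a \<omega> $ i) * (W d \<omega> $ j - W c \<omega> $ j))) =
     (\<lambda>\<omega>. Y \<omega> * ((W d \<omega> $ j - W c \<omega> $ j) * (W b \<omega> $ i - W a \<omega> $ i)))"
    by (simp add: mult.commute)
  have "overlap c d a b = overlap a b c d" by (simp add: overlap_def min.commute max.commute)
  with False show "integrable M (\<lambda>\<omega>. Y \<omega> * ((W b \<omega> $ i - W a \<omega> $ i) * (W d \<omega> $ j - W c \<omega> $ j))) \<and>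
    expectation (\<lambda>\<omega>. Y \<omega> * ((W b \<omega> $ i - W a \<omega> $ i) * (W d \<omega> $ j - W c \<omega> $ j)))
      = (if i = j then overlap a b c d else 0) * expectation Y"
    unfolding e using increment_cross_ordered[of c d a b Y B j i] assms by (auto simp: max_def)
qed

text \<open>Expanding both vectors in coordinates of \<open>W\<close>, only equal coordinates
  survive, and their coefficients add up to the Hilbert-Schmidt inner product. The weight \<rho>
  later carries the decision whether the integral has been stopped.\<close>

lemma increment_hs:
  fixes \<xi> \<eta> :: "'w \<Rightarrow> (real ^ 'm) \<Rightarrow>\<^sub>L 'h::{real_inner, second_countable_topology}"
  assumes "0 \<le> a" "a \<le> b" "0 \<le> c" "c \<le> d"
    and [measurable]: "\<rho> \<in> borel_measurable (F (max a c))"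
      "\<xi> \<in> borel_measurable (F (max a c))" "\<eta> \<in> borel_measurable (F (max a c))"
    and B: "\<And>\<omega>. \<omega> \<in> space M \<Longrightarrow> \<bar>\<rho> \<omega>\<bar> \<le> B1" "\<And>\<omega>. \<omega> \<in> space M \<Longrightarrow> norm (\<xi> \<omega>) \<le> B2"
      "\<And>\<omega>. \<omega> \<in> space M \<Longrightarrow> norm (\<eta> \<omega>) \<le> B3"
  shows "integrable M (\<lambda>\<omega>. \<rho> \<omega> * (\<xi> \<omega> (W b \<omega> - W a \<omega>) \<bullet> \<eta> \<omega> (W d \<omega> - W c \<omega>)))"
    and "expectation (\<lambda>\<omega>. \<rho> \<omega> * (\<xi> \<omega> (W b \<omega> - W a \<omega>) \<bullet> \<eta> \<omega> (W d \<omega> - W c \<omega>)))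
      = overlap a b c d * expectation (\<lambda>\<omega>. \<rho> \<omega> * hs_inner (\<xi> \<omega>) (\<eta> \<omega>))"
proof (atomize (full))
  let ?Y = "\<lambda>i j \<omega>. \<rho> \<omega> * (\<xi> \<omega> (axis i 1) \<bullet> \<eta> \<omega> (axis j 1))"
  have Ym: "?Y i j \<in> borel_measurable (F (max a c))" for i j by measurable
  have YB: "\<bar>?Y i j \<omega>\<bar> \<le> B1 * (B2 * B3)" if "\<omega> \<in> space M" for i j \<omega>
  proof -
    have "\<bar>\<xi> \<omega> (axis i 1) \<bullet> \<eta> \<omega> (axis j 1)\<bar> \<le> norm (\<xi> \<omega> (axis i 1)) * norm (\<eta> \<omega> (axis j 1))"
      by (rule Cauchy_Schwarz_ineq2)
    also have "\<dots> \<le> B2 * B3"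
      using B(2,3)[OF that] norm_blinfun_axis[of "\<xi> \<omega>" i] norm_blinfun_axis[of "\<eta> \<omega>" j]
      by (intro mult_mono) (auto intro: order_trans order_trans[OF norm_ge_zero])
    finally show ?thesis
      using B(1)[OF that] by (auto simp: abs_mult intro!: mult_mono order_trans[OF abs_ge_zero])
  qed
  have Yint: "integrable M (?Y i j)" for i j
    using bounded_mult_integrable[OF measurable_F_M[OF Ym] YB, where Z="\<lambda>_. 1"] by simp
  note C = increment_cross[OF assms(1-4) Ym YB]
  have e: "\<rho> \<omega> * (\<xi> \<omega> (W b \<omega> - W a \<omega>) \<bullet> \<eta> \<omega> (W d \<omega> - W c \<omega>)) =
     (\<Sum>i\<in>UNIV. \<Sum>j\<in>UNIV. ?Y i j \<omega> * ((W b \<omega> $ i - W a \<omega> $ i) * (W d \<omega> $ j - W c \<omega> $ j)))" for \<omega>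
    by (subst blinfun_apply_vec[of "\<xi> \<omega>"], subst blinfun_apply_vec[of "\<eta> \<omega>"])
       (simp add: inner_sum_left inner_sum_right sum_distrib_left mult_ac, rule sum.swap)
  have I: "integrable M (\<lambda>\<omega>. \<Sum>i\<in>UNIV. \<Sum>j\<in>UNIV. ?Y i j \<omega> * ((W b \<omega> $ i - W a \<omega> $ i) * (W d \<omega> $ j - W c \<omega> $ j)))"
    by (intro Bochner_Integration.integrable_sum C)
  have "expectation (\<lambda>\<omega>. \<Sum>i\<in>UNIV. \<Sum>j\<in>UNIV. ?Y i j \<omega> * ((W b \<omega> $ i - W a \<omega> $ i) * (W d \<omega> $ j - W c \<omega> $ j)))
    = (\<Sum>i\<in>UNIV. \<Sum>j\<in>UNIV. (if i = j then overlap a b c d else 0) * expectation (?Y i j))"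
    by (simp add: Bochner_Integration.integral_sum C Bochner_Integration.integrable_sum)
  also have "\<dots> = (\<Sum>i\<in>UNIV. overlap a b c d * expectation (?Y i i))"
    by (intro sum.cong refl) (simp add: if_distrib[of "\<lambda>x. x * _"] sum.delta cong: if_cong)
  also have "\<dots> = overlap a b c d * expectation (\<lambda>\<omega>. \<rho> \<omega> * hs_inner (\<xi> \<omega>) (\<eta> \<omega>))"
    by (simp add: hs_inner_def sum_Basis_vec sum_distrib_left Bochner_Integration.integral_sum Yint)
  finally show "integrable M (\<lambda>\<omega>. \<rho> \<omega> * (\<xi> \<omega> (W b \<omega> - W a \<omega>) \<bullet> \<eta> \<omega> (W d \<omega> - W c \<omega>))) \<and>
    expectation (\<lambda>\<omega>. \<rho> \<omega> * (\<xi> \<omega> (W b \<omega> - W a \<omega>) \<bullet> \<eta> \<omega> (W d \<omega> - W c \<omega>)))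
      = overlap a b c d * expectation (\<lambda>\<omega>. \<rho> \<omega> * hs_inner (\<xi> \<omega>) (\<eta> \<omega>))"
    unfolding e using I by simp
qed

section \<open>Integrals of elementary processes\<close>

text \<open>
  Unlike in \<open>simple_process\<close>, the intervals \<open>(p k, q k]\<close> may overlap and are indexed by an arbitrary
  finite set, so that differences of elementary processes are again elementary without passing to
  a common refinement.
\<close>

definition elem_family ::
  "'k set \<Rightarrow> ('k \<Rightarrow> real) \<Rightarrow> ('k \<Rightarrow> real) \<Rightarrow> ('k \<Rightarrow> 'w \<Rightarrow> (real ^ 'm) \<Rightarrow>\<^sub>L 'h::{real_inner, banach, second_countable_topology}) \<Rightarrow> bool"
where
  "elem_family K p q \<xi> \<longleftrightarrow> finite K \<and> (\<forall>k\<in>K. 0 \<le> p k \<and> p k \<le> q k \<and>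
     \<xi> k \<in> borel_measurable (F (p k)) \<and> (\<exists>C. \<forall>\<omega>\<in>space M. norm (\<xi> k \<omega>) \<le> C))"

definition elem_value ::
  "'k set \<Rightarrow> ('k \<Rightarrow> real) \<Rightarrow> ('k \<Rightarrow> real) \<Rightarrow> ('k \<Rightarrow> 'w \<Rightarrow> (real ^ 'm) \<Rightarrow>\<^sub>L 'h::{real_inner, banach, second_countable_topology}) \<Rightarrow>
   real \<Rightarrow> 'w \<Rightarrow> (real ^ 'm) \<Rightarrow>\<^sub>L 'h" where
  "elem_value K p q \<xi> s \<omega> = (\<Sum>k\<in>K. indicator {p k<..q k} s *\<^sub>R \<xi> k \<omega>)"

definition elem_integral ::
  "'k set \<Rightarrow> ('k \<Rightarrow> real) \<Rightarrow> ('k \<Rightarrow> real) \<Rightarrow> ('k \<Rightarrow> 'w \<Rightarrow> (real ^ 'm) \<Rightarrow>\<^sub>L 'h::{real_inner, banach, second_countable_topology}) \<Rightarrow>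
   real \<Rightarrow> 'w \<Rightarrow> 'h" where
  "elem_integral K p q \<xi> t \<omega> = (\<Sum>k\<in>K. \<xi> k \<omega> (W (min (q k) t) \<omega> - W (min (p k) t) \<omega>))"

lemma elem_familyD:
  assumes "elem_family K p q \<xi>" "k \<in> K"
  shows "0 \<le> p k" "p k \<le> q k" "\<xi> k \<in> borel_measurable (F (p k))"
  using assms by (auto simp: elem_family_def)

lemma elem_family_bound:
  assumes "elem_family K p q \<xi>"
  obtains C where "\<And>k \<omega>. k \<in> K \<Longrightarrow> \<omega> \<in> space M \<Longrightarrow> norm (\<xi> k \<omega>) \<le> C" "0 \<le> C"
proof -
  from assms have "\<forall>k\<in>K. \<exists>C. \<forall>\<omega>\<in>space M. norm (\<xi> k \<omega>) \<le> C" and K: "finite K"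
    by (auto simp: elem_family_def)
  from bchoice[OF this(1)] obtain c where c: "\<forall>k\<in>K. \<forall>\<omega>\<in>space M. norm (\<xi> k \<omega>) \<le> c k" by auto
  show ?thesis
  proof (rule that[of "\<Sum>k\<in>K. \<bar>c k\<bar>"])
    fix k \<omega> assume k: "k \<in> K" "\<omega> \<in> space M"
    then have "norm (\<xi> k \<omega>) \<le> \<bar>c k\<bar>" using c by force
    also have "\<dots> \<le> (\<Sum>k\<in>K. \<bar>c k\<bar>)" using K k(1) by (intro member_le_sum) auto
    finally show "norm (\<xi> k \<omega>) \<le> (\<Sum>k\<in>K. \<bar>c k\<bar>)" .
  qed (auto intro: sum_nonneg)
qed

text \<open>An increment of the integral over \<open>(s, t]\<close> is an integral over intervals clamped to \<open>[s, t]\<close>;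
  coefficients belonging to intervals that start after \<open>t\<close> are dropped, so that all
  remaining ones are measurable at the left end of the clamped interval.\<close>

definition clamp_to :: "real \<Rightarrow> real \<Rightarrow> real \<Rightarrow> real" where
  "clamp_to s t x = max s (min x t)"

definition early :: "real \<Rightarrow> ('k \<Rightarrow> real) \<Rightarrow> ('k \<Rightarrow> 'w \<Rightarrow> 'e::zero) \<Rightarrow> 'k \<Rightarrow> 'w \<Rightarrow> 'e" where
  "early t p \<xi> k \<omega> = (if p k < t then \<xi> k \<omega> else 0)"

lemma elem_integral_increment:
  assumes "elem_family K p q \<xi>" "s \<le> t"
  shows "elem_integral K p q \<xi> t \<omega> - elem_integral K p q \<xi> s \<omega> =
    (\<Sum>k\<in>K. early t p \<xi> k \<omega> (W (clamp_to s t (q k)) \<omega> - W (clamp_to s t (p k)) \<omega>))"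
  unfolding elem_integral_def sum_subtractf[symmetric]
proof (rule sum.cong)
  fix k assume "k \<in> K"
  then have "p k \<le> q k" by (rule elem_familyD(2)[OF assms(1)])
  then show "\<xi> k \<omega> (W (min (q k) t) \<omega> - W (min (p k) t) \<omega>) - \<xi> k \<omega> (W (min (q k) s) \<omega> - W (min (p k) s) \<omega>)
    = early t p \<xi> k \<omega> (W (clamp_to s t (q k)) \<omega> - W (clamp_to s t (p k)) \<omega>)"
    using assms(2) by (auto simp: early_def clamp_to_def min_def max_def blinfun.diff_right)
qed simp

lemma early_measurable:
  assumes "elem_family K p q \<xi>" "k \<in> K" "s \<le> t" "clamp_to s t (p k) \<le> u"
  shows "early t p \<xi> k \<in> borel_measurable (F u)"
proof (cases "p k < t")
  case True
  then have "p k \<le> u" using assms by (auto simp: clamp_to_def max_def min_def split: if_splits)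
  moreover have "early t p \<xi> k = \<xi> k" using True by (auto simp: early_def)
  ultimately show ?thesis using measurable_F_mono[OF _ elem_familyD(3)[OF assms(1,2)]] by simp
next
  case False
  then have "early t p \<xi> k = (\<lambda>_. 0)" by (auto simp: early_def)
  then show ?thesis by simp
qed

lemma clamp_to_le: "s \<le> t \<Longrightarrow> s \<le> clamp_to s t x" "s \<le> t \<Longrightarrow> clamp_to s t x \<le> t"
  "x \<le> y \<Longrightarrow> clamp_to s t x \<le> clamp_to s t y"
  by (auto simp: clamp_to_def)

lemma elem_integral_measurable:
  assumes E: "elem_family K p q \<xi>" and "0 \<le> t"
  shows "elem_integral K p q \<xi> t \<in> borel_measurable (F t)"
proof -
  have "min (q k) 0 = 0" "min (p k) 0 = 0" if "k \<in> K" for k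
    using elem_familyD[OF E that] by auto
  then have "elem_integral K p q \<xi> 0 \<omega> = 0" for \<omega>
    by (simp add: elem_integral_def)
  then have e: "elem_integral K p q \<xi> t = (\<lambda>\<omega>. \<Sum>k\<in>K. early t p \<xi> k \<omega> (W (clamp_to 0 t (q k)) \<omega> - W (clamp_to 0 t (p k)) \<omega>))"
    using elem_integral_increment[OF E assms(2)] by (auto simp: fun_eq_iff)
  show ?thesis unfolding e
  proof (rule borel_measurable_sum)
    fix k assume k: "k \<in> K"
    have [measurable]: "early t p \<xi> k \<in> borel_measurable (F t)"
      by (rule early_measurable[OF E k assms(2)]) (use assms in \<open>simp add: clamp_to_le\<close>)
    have [measurable]: "W (clamp_to 0 t x) \<in> borel_measurable (F t)" for x
      by (rule W_meas) (use assms in \<open>simp_all add: clamp_to_le\<close>)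
    show "(\<lambda>\<omega>. early t p \<xi> k \<omega> (W (clamp_to 0 t (q k)) \<omega> - W (clamp_to 0 t (p k)) \<omega>)) \<in> borel_measurable (F t)"
      by measurable
  qed
qed

lemma overlap_clamp:
  assumes "s \<le> t"
  shows "overlap (clamp_to s t a) (clamp_to s t b) (clamp_to s t c) (clamp_to s t d)
    = max 0 (min t (min b d) - max s (max a c))"
proof -
  have "min (clamp_to s t b) (clamp_to s t d) = clamp_to s t (min b d)"
    "max (clamp_to s t a) (clamp_to s t c) = clamp_to s t (max a c)"
    using clamp_to_le(3)[of b d s t] clamp_to_le(3)[of d b s t] clamp_to_le(3)[of a c s t] clamp_to_le(3)[of c a s t]
    by (cases "b \<le> d"; cases "a \<le> c"; simp add: min_absorb1 min_absorb2 max_absorb1 max_absorb2)+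
  moreover have "max 0 (clamp_to s t y - clamp_to s t x) = max 0 (min t y - max s x)" for x y
    using assms by (auto simp: clamp_to_def min_def max_def)
  ultimately show ?thesis by (simp add: overlap_def)
qed

text \<open>Joins the two roles of \<open>overlap\<close>: as a covariance of clamped increments and
  as a time integral of a product of indicators. The isometry is the equality of these two.\<close>

lemma overlap_indicator:
  assumes "s \<le> t"
  shows "has_bochner_integral lborel (\<lambda>u. indicator {s..t} u * (indicator {a<..b} u * indicator {c<..d} u) :: real)
    (overlap (clamp_to s t a) (clamp_to s t b) (clamp_to s t c) (clamp_to s t d))"
proof -
  have e: "indicator {s..t} u * (indicator {a<..b} u * indicator {c<..d} u) =
     (indicator ({s..t} \<inter> {max a c<..min b d}) u :: real)" for u
    by (auto simp: indicator_def)
  have "emeasure lborel ({s..t} \<inter> {max a c<..min b d}) =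
     ennreal (overlap (clamp_to s t a) (clamp_to s t b) (clamp_to s t c) (clamp_to s t d))"
  proof (cases "max a c < s")
    case True
    then have "{s..t} \<inter> {max a c<..min b d} = {s..min t (min b d)}" by auto
    moreover have "max s (max a c) = s" using True by (intro max_absorb1 less_imp_le)
    ultimately show ?thesis
      by (simp only: overlap_clamp[OF assms] emeasure_lborel_Icc_eq) (simp add: max_def)
  next
    case False
    then have "{s..t} \<inter> {max a c<..min b d} = {max a c<..min t (min b d)}" by auto
    moreover have "max s (max a c) = max a c" using False by (intro max_absorb2) (unfold not_less)
    moreover have "emeasure lborel {x<..y} = ennreal (max 0 (y - x))" for x y :: real
      by (cases "x \<le> y") (simp_all add: max_def)
    ultimately show ?thesis by (simp only: overlap_clamp[OF assms])
  qed
  moreover have "0 \<le> overlap (clamp_to s t a) (clamp_to s t b) (clamp_to s t c) (clamp_to s t d)"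
    by (simp add: overlap_def)
  ultimately show ?thesis unfolding e
    by (subst has_bochner_integral_iff) (simp add: measure_def)
qed

text \<open>The integral of the squared Hilbert-Schmidt norm of \<open>elem_value\<close> over
  \<open>{s..t}\<close>, multiplied out. As a finite sum in the coefficients it is compared term by
  term with the second moment of the increment, and its measurability is immediate.\<close>

definition elem_energy ::
  "'k set \<Rightarrow> ('k \<Rightarrow> real) \<Rightarrow> ('k \<Rightarrow> real) \<Rightarrow> ('k \<Rightarrow> 'w \<Rightarrow> (real ^ 'm) \<Rightarrow>\<^sub>L 'h::{real_inner, banach, second_countable_topology}) \<Rightarrow>
   real \<Rightarrow> real \<Rightarrow> 'w \<Rightarrow> real" where
  "elem_energy K p q \<xi> s t \<omega> = (\<Sum>k\<in>K. \<Sum>j\<in>K. overlap (clamp_to s t (p k)) (clamp_to s t (q k)) (clamp_to s t (p j)) (clamp_to s t (q j))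
      * hs_inner (\<xi> k \<omega>) (\<xi> j \<omega>))"

lemma elem_energy_integral:
  assumes "elem_family K p q \<xi>" "s \<le> t"
  shows "has_bochner_integral lborel (\<lambda>u. indicator {s..t} u * (hs_norm (elem_value K p q \<xi> u \<omega>))\<^sup>2) (elem_energy K p q \<xi> s t \<omega>)"
proof -
  have e: "indicator {s..t} u * (hs_norm (elem_value K p q \<xi> u \<omega>))\<^sup>2 =
    (\<Sum>k\<in>K. \<Sum>j\<in>K. (indicator {s..t} u * (indicator {p k<..q k} u * indicator {p j<..q j} u)) * hs_inner (\<xi> k \<omega>) (\<xi> j \<omega>))" for u
  proof -
    have "(hs_norm (elem_value K p q \<xi> u \<omega>))\<^sup>2 = (\<Sum>e\<in>Basis. \<Sum>k\<in>K. \<Sum>j\<in>K.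
       indicator {p k<..q k} u * indicator {p j<..q j} u * (\<xi> k \<omega> e \<bullet> \<xi> j \<omega> e))"
      by (simp add: hs_norm_sq_inner hs_inner_def elem_value_def blinfun.sum_left blinfun.scaleR_left
        inner_sum_left inner_sum_right mult_ac)
         (intro sum.cong refl, simp add: sum_distrib_left inner_commute mult_ac)
    also have "\<dots> = (\<Sum>k\<in>K. \<Sum>j\<in>K. \<Sum>e\<in>Basis.
       indicator {p k<..q k} u * indicator {p j<..q j} u * (\<xi> k \<omega> e \<bullet> \<xi> j \<omega> e))"
      by (subst sum.swap, intro sum.cong refl, rule sum.swap)
    finally have A: "(hs_norm (elem_value K p q \<xi> u \<omega>))\<^sup>2 = (\<Sum>k\<in>K. \<Sum>j\<in>K. \<Sum>e\<in>Basis.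
       indicator {p k<..q k} u * indicator {p j<..q j} u * (\<xi> k \<omega> e \<bullet> \<xi> j \<omega> e))" .
    show ?thesis unfolding A hs_inner_def sum_distrib_left by (intro sum.cong refl) (simp only: mult_ac)
  qed
  show ?thesis unfolding e elem_energy_def
    by (intro has_bochner_integral_sum has_bochner_integral_mult_left overlap_indicator assms)
qed

text \<open>A coefficient whose interval starts at \<open>t\<close> or later has overlap 0 with
  everything in \<open>{s..t}\<close>, so it may be replaced by 0. In this form all coefficients are
  known at time \<open>t\<close>, as \<open>increment_hs\<close> and measurability in
  \<open>F t\<close> require.\<close>

lemma elem_energy_eq:
  assumes "elem_family K p q \<xi>" "s \<le> t"
  shows "elem_energy K p q \<xi> s t \<omega> = (\<Sum>k\<in>K. \<Sum>j\<in>K. overlap (clamp_to s t (p k)) (clamp_to s t (q k)) (clamp_to s t (p j)) (clamp_to s t (q j))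
      * hs_inner (early t p \<xi> k \<omega>) (early t p \<xi> j \<omega>))"
proof -
  have "overlap (clamp_to s t (p k)) (clamp_to s t (q k)) (clamp_to s t (p j)) (clamp_to s t (q j)) = 0"
    if "k \<in> K" "j \<in> K" "t \<le> p k \<or> t \<le> p j" for k j
  proof -
    have "t \<le> max s (max (p k) (p j))" using that by (simp add: le_max_iff_disj)
    then show ?thesis unfolding overlap_clamp[OF assms(2)]
      by (intro max_absorb1) (simp add: min.coboundedI1)
  qed
  then have "overlap (clamp_to s t (p k)) (clamp_to s t (q k)) (clamp_to s t (p j)) (clamp_to s t (q j)) * hs_inner (\<xi> k \<omega>) (\<xi> j \<omega>)
    = overlap (clamp_to s t (p k)) (clamp_to s t (q k)) (clamp_to s t (p j)) (clamp_to s t (q j))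
      * hs_inner (early t p \<xi> k \<omega>) (early t p \<xi> j \<omega>)" if "k \<in> K" "j \<in> K" for k j
    using that by (cases "t \<le> p k \<or> t \<le> p j") (simp_all add: early_def)
  then show ?thesis unfolding elem_energy_def by (intro sum.cong refl)
qed

text \<open>With an arbitrary bounded weight from \<open>F s\<close> this is the Ito isometry
  conditionally on \<open>F s\<close>, stated without conditional expectations.\<close>

lemma elem_isometry_weighted:
  assumes E: "elem_family K p q \<xi>" and st: "0 \<le> s" "s \<le> t"
    and \<rho>: "\<rho> \<in> borel_measurable (F s)" and B: "\<And>\<omega>. \<omega> \<in> space M \<Longrightarrow> \<bar>\<rho> \<omega>\<bar> \<le> B"
  shows "integrable M (\<lambda>\<omega>. \<rho> \<omega> * (norm (elem_integral K p q \<xi> t \<omega> - elem_integral K p q \<xi> s \<omega>))\<^sup>2)"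
    and "integrable M (\<lambda>\<omega>. \<rho> \<omega> * elem_energy K p q \<xi> s t \<omega>)"
    and "expectation (\<lambda>\<omega>. \<rho> \<omega> * (norm (elem_integral K p q \<xi> t \<omega> - elem_integral K p q \<xi> s \<omega>))\<^sup>2)
      = expectation (\<lambda>\<omega>. \<rho> \<omega> * elem_energy K p q \<xi> s t \<omega>)"
proof -
  obtain C where C: "\<And>k \<omega>. k \<in> K \<Longrightarrow> \<omega> \<in> space M \<Longrightarrow> norm (\<xi> k \<omega>) \<le> C" "0 \<le> C"
    using elem_family_bound[OF E] by metis
  let ?c = "clamp_to s t" and ?x = "early t p \<xi>"
  let ?T = "\<lambda>k j \<omega>. \<rho> \<omega> * (?x k \<omega> (W (?c (q k)) \<omega> - W (?c (p k)) \<omega>) \<bullet> ?x j \<omega> (W (?c (q j)) \<omega> - W (?c (p j)) \<omega>))"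
  let ?o = "\<lambda>k j. overlap (?c (p k)) (?c (q k)) (?c (p j)) (?c (q j))"
  have xC: "norm (?x k \<omega>) \<le> C" if "k \<in> K" "\<omega> \<in> space M" for k \<omega>
    using C that by (auto simp: early_def)
  have meas: "?x k \<in> borel_measurable (F (max (?c (p k)) (?c (p j))))"
      "?x k \<in> borel_measurable (F (max (?c (p j)) (?c (p k))))" if "k \<in> K" for k j
    by (rule early_measurable[OF E that st(2)], simp)+
  have rm: "\<rho> \<in> borel_measurable (F (max (?c (p i)) (?c (p j))))" for i j
    by (rule measurable_F_mono[OF _ \<rho>]) (use clamp_to_le(1)[OF st(2)] in \<open>auto simp: le_max_iff_disj\<close>)
  have pq: "0 \<le> ?c (p k)" "?c (p k) \<le> ?c (q k)" if "k \<in> K" for k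
    using elem_familyD[OF E that] st clamp_to_le(1)[OF st(2), of "p k"] by (auto intro: clamp_to_le)
  have T: "integrable M (?T k j)"
    "expectation (?T k j) = ?o k j * expectation (\<lambda>\<omega>. \<rho> \<omega> * hs_inner (?x k \<omega>) (?x j \<omega>))"
    if "k \<in> K" "j \<in> K" for k j
    using increment_hs[OF pq[OF that(1)] pq[OF that(2)] rm meas(1)[OF that(1)] meas(2)[OF that(2)]
        B xC[OF that(1)] xC[OF that(2)]] by auto
  have hi: "integrable M (\<lambda>\<omega>. \<rho> \<omega> * hs_inner (?x k \<omega>) (?x j \<omega>))" if "k \<in> K" "j \<in> K" for k j
  proof (rule bounded_mult_integrable[OF measurable_F_M[OF \<rho>] B])
    have m: "?x k \<in> borel_measurable M" "?x j \<in> borel_measurable M"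
      using measurable_F_M[OF meas(1)[OF that(1)]] measurable_F_M[OF meas(1)[OF that(2)]] by auto
    show "integrable M (\<lambda>\<omega>. hs_inner (?x k \<omega>) (?x j \<omega>))"
    proof (rule integrable_const_bound)
      show "AE \<omega> in M. norm (hs_inner (?x k \<omega>) (?x j \<omega>)) \<le> (\<Sum>e\<in>(Basis::(real^'m) set). C * C)"
      proof (rule AE_I2)
        fix \<omega> assume w: "\<omega> \<in> space M"
        have "norm (hs_inner (?x k \<omega>) (?x j \<omega>)) \<le> (\<Sum>e\<in>(Basis::(real^'m) set). \<bar>?x k \<omega> e \<bullet> ?x j \<omega> e\<bar>)"
          unfolding hs_inner_def real_norm_def by (rule sum_abs)
        also have "\<dots> \<le> (\<Sum>e\<in>(Basis::(real^'m) set). C * C)"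
        proof (rule sum_mono)
          fix e :: "real^'m" assume e: "e \<in> Basis"
          have b: "norm (?x i \<omega> e) \<le> C" if "i \<in> K" for i
            using norm_blinfun[of "?x i \<omega>" e] xC[OF that w] e by simp
          show "\<bar>?x k \<omega> e \<bullet> ?x j \<omega> e\<bar> \<le> C * C"
            by (rule order_trans[OF Cauchy_Schwarz_ineq2]) (intro mult_mono b that C norm_ge_zero)
        qed
        finally show "norm (hs_inner (?x k \<omega>) (?x j \<omega>)) \<le> (\<Sum>e\<in>(Basis::(real^'m) set). C * C)" .
      qed
    qed (use m in measurable)
  qed
  have 1: "\<rho> \<omega> * (norm (elem_integral K p q \<xi> t \<omega> - elem_integral K p q \<xi> s \<omega>))\<^sup>2 = (\<Sum>k\<in>K. \<Sum>j\<in>K. ?T k j \<omega>)" for \<omega>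
    unfolding elem_integral_increment[OF E st(2)] power2_norm_eq_inner
    by (simp add: inner_sum_left inner_sum_right sum_distrib_left, rule sum.swap)
  have 2: "\<rho> \<omega> * elem_energy K p q \<xi> s t \<omega> = (\<Sum>k\<in>K. \<Sum>j\<in>K. ?o k j * (\<rho> \<omega> * hs_inner (?x k \<omega>) (?x j \<omega>)))" for \<omega>
    unfolding elem_energy_eq[OF E st(2)] by (simp add: sum_distrib_left mult_ac)
  show "integrable M (\<lambda>\<omega>. \<rho> \<omega> * (norm (elem_integral K p q \<xi> t \<omega> - elem_integral K p q \<xi> s \<omega>))\<^sup>2)"
    unfolding 1 by (intro Bochner_Integration.integrable_sum T)
  show "integrable M (\<lambda>\<omega>. \<rho> \<omega> * elem_energy K p q \<xi> s t \<omega>)"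
    unfolding 2 by (intro Bochner_Integration.integrable_sum integrable_mult_right hi)
  show "expectation (\<lambda>\<omega>. \<rho> \<omega> * (norm (elem_integral K p q \<xi> t \<omega> - elem_integral K p q \<xi> s \<omega>))\<^sup>2)
      = expectation (\<lambda>\<omega>. \<rho> \<omega> * elem_energy K p q \<xi> s t \<omega>)"
    unfolding 1 2 by (simp add: Bochner_Integration.integral_sum Bochner_Integration.integrable_sum T hi)
qed

text \<open>The martingale property in tested form. Since the coefficients are bounded, the product
  of \<eta> with a coefficient is integrable and known at the left end of the clamped interval,
  where the next increment has mean 0.\<close>

lemma elem_orthogonal:
  assumes E: "elem_family K p q \<xi>" and st: "0 \<le> s" "s \<le> t"
    and \<eta>: "\<eta> \<in> borel_measurable (F s)" "integrable M (\<lambda>\<omega>. norm (\<eta> \<omega>))"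
  shows "integrable M (\<lambda>\<omega>. \<eta> \<omega> \<bullet> (elem_integral K p q \<xi> t \<omega> - elem_integral K p q \<xi> s \<omega>))"
    and "expectation (\<lambda>\<omega>. \<eta> \<omega> \<bullet> (elem_integral K p q \<xi> t \<omega> - elem_integral K p q \<xi> s \<omega>)) = 0"
proof -
  obtain C where C: "\<And>k \<omega>. k \<in> K \<Longrightarrow> \<omega> \<in> space M \<Longrightarrow> norm (\<xi> k \<omega>) \<le> C" "0 \<le> C"
    using elem_family_bound[OF E] by metis
  let ?c = "clamp_to s t" and ?x = "early t p \<xi>"
  let ?T = "\<lambda>k i \<omega>. (\<eta> \<omega> \<bullet> ?x k \<omega> (axis i 1)) * (W (?c (q k)) \<omega> $ i - W (?c (p k)) \<omega> $ i)"
  have T: "integrable M (?T k i) \<and> expectation (?T k i) = 0" if k: "k \<in> K" for k i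
  proof -
    have sc: "0 \<le> ?c (p k)" "s \<le> ?c (p k)" "?c (p k) \<le> ?c (q k)"
      using elem_familyD[OF E k] st clamp_to_le(1)[OF st(2), of "p k"] by (auto intro: clamp_to_le)
    have [measurable]: "?x k \<in> borel_measurable (F (?c (p k)))"
      by (rule early_measurable[OF E k st(2)]) simp
    have [measurable]: "\<eta> \<in> borel_measurable (F (?c (p k)))" by (rule measurable_F_mono[OF sc(2) \<eta>(1)])
    have m: "(\<lambda>\<omega>. \<eta> \<omega> \<bullet> ?x k \<omega> (axis i 1)) \<in> borel_measurable (F (?c (p k)))" by measurable
    have "integrable M (\<lambda>\<omega>. \<eta> \<omega> \<bullet> ?x k \<omega> (axis i 1))"
    proof (rule Bochner_Integration.integrable_bound)
      show "integrable M (\<lambda>\<omega>. norm (\<eta> \<omega>) * C)" using \<eta>(2) by simp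
      show "AE \<omega> in M. norm (\<eta> \<omega> \<bullet> ?x k \<omega> (axis i 1)) \<le> norm (norm (\<eta> \<omega>) * C)"
      proof (rule AE_I2)
        fix \<omega> assume w: "\<omega> \<in> space M"
        have "norm (?x k \<omega> (axis i 1)) \<le> C"
          using norm_blinfun_axis[of "?x k \<omega>" i] C(1)[OF k w] C(2) by (auto simp: early_def)
        then show "norm (\<eta> \<omega> \<bullet> ?x k \<omega> (axis i 1)) \<le> norm (norm (\<eta> \<omega>) * C)"
          using C(2) by (auto intro!: order_trans[OF Cauchy_Schwarz_ineq2] mult_left_mono)
      qed
    qed (use measurable_F_M[OF m] in simp)
    from increment_mult(1,2)[OF sc(1,3) m this, of i] show ?thesis by simp
  qed
  have e: "\<eta> \<omega> \<bullet> (elem_integral K p q \<xi> t \<omega> - elem_integral K p q \<xi> s \<omega>) = (\<Sum>k\<in>K. \<Sum>i\<in>UNIV. ?T k i \<omega>)" for \<omega>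
    unfolding elem_integral_increment[OF E st(2)]
    by (subst blinfun_apply_vec) (simp add: inner_sum_right mult_ac)
  show "integrable M (\<lambda>\<omega>. \<eta> \<omega> \<bullet> (elem_integral K p q \<xi> t \<omega> - elem_integral K p q \<xi> s \<omega>))"
    unfolding e by (intro Bochner_Integration.integrable_sum) (use T in auto)
  show "expectation (\<lambda>\<omega>. \<eta> \<omega> \<bullet> (elem_integral K p q \<xi> t \<omega> - elem_integral K p q \<xi> s \<omega>)) = 0"
    unfolding e by (simp add: Bochner_Integration.integral_sum Bochner_Integration.integrable_sum T)
qed

end

section \<open>Doob's inequality and complete spaces of continuous processes\<close>

text \<open>
  Taking \<open>s k = |X (p k)|\<close> for a martingale \<open>X\<close>, the sum has nonnegative expectation, which gives
  Doob's \<open>L\<^sup>2\<close> inequality without a maximal inequality.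
\<close>

lemma doob_pathwise:
  fixes s :: "nat \<Rightarrow> real"
  assumes s: "\<And>k. 0 \<le> s k"
  defines "m \<equiv> \<lambda>n. Max (s ` {..n})"
  shows "(m n)\<^sup>2 \<le> 4 * (s n)\<^sup>2 - 4 * (\<Sum>k<n. m k * (s (Suc k) - s k))"
proof -
  \<comment> \<open>A sharper bound than the claim, suited to induction: when the maximum jumps from
    \<open>m n\<close> to \<open>s (Suc n)\<close>, the right side gains half the square of the
    jump.\<close>
  have "(\<Sum>k<n. m k * (s (Suc k) - s k)) \<le> m n * s n - (m n)\<^sup>2 / 2"
  proof (induction n)
    case 0
    then show ?case by (simp add: m_def power2_eq_square)
  next
    case (Suc n)
    have m: "m (Suc n) = max (s (Suc n)) (m n)"
      unfolding m_def by (simp add: atMost_Suc Max_insert)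
    have "(\<Sum>k<Suc n. m k * (s (Suc k) - s k)) \<le> m n * s (Suc n) - (m n)\<^sup>2 / 2"
      using Suc by (simp add: algebra_simps)
    also have "\<dots> \<le> m (Suc n) * s (Suc n) - (m (Suc n))\<^sup>2 / 2"
      using sum_squares_ge_zero[of "s (Suc n) - m n" 0] unfolding m
      by (cases "s (Suc n) \<le> m n") (simp_all add: max_def power2_eq_square algebra_simps)
    finally show ?case .
  qed
  \<comment> \<open>The inequality \<open>4 * m * s <= 4 * s^2 + m^2\<close> absorbs the mixed
    product and leaves Doob's constant 4.\<close>
  moreover have "0 \<le> (2 * s n - m n)\<^sup>2" by simp
  ultimately show ?thesis by (simp add: power2_eq_square algebra_simps)
qed

lemma integrable_inner_L2:
  fixes X Y :: "'w \<Rightarrow> 'h::{real_inner, second_countable_topology}"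
  assumes [measurable]: "X \<in> borel_measurable M" "Y \<in> borel_measurable M"
    and "integrable M (\<lambda>\<omega>. (norm (X \<omega>))\<^sup>2)" "integrable M (\<lambda>\<omega>. (norm (Y \<omega>))\<^sup>2)"
  shows "integrable M (\<lambda>\<omega>. X \<omega> \<bullet> Y \<omega>)"
proof (rule Bochner_Integration.integrable_bound)
  show "integrable M (\<lambda>\<omega>. (norm (X \<omega>))\<^sup>2 + (norm (Y \<omega>))\<^sup>2)" using assms by simp
  have "\<bar>X \<omega> \<bullet> Y \<omega>\<bar> \<le> (norm (X \<omega>))\<^sup>2 + (norm (Y \<omega>))\<^sup>2" for \<omega>
  proof -
    have "\<bar>X \<omega> \<bullet> Y \<omega>\<bar> \<le> norm (X \<omega>) * norm (Y \<omega>)" by (rule Cauchy_Schwarz_ineq2)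
    also have "\<dots> \<le> 2 * norm (X \<omega>) * norm (Y \<omega>)" by simp
    also have "\<dots> \<le> (norm (X \<omega>))\<^sup>2 + (norm (Y \<omega>))\<^sup>2" by (rule sum_squares_bound)
    finally show ?thesis .
  qed
  then show "AE \<omega> in M. norm (X \<omega> \<bullet> Y \<omega>) \<le> norm ((norm (X \<omega>))\<^sup>2 + (norm (Y \<omega>))\<^sup>2)"
    by (auto intro!: AE_I2 order_trans[OF _ abs_ge_self])
qed measurable

lemma integrable_L2_diff:
  fixes X Y :: "'w \<Rightarrow> 'h::{real_inner, second_countable_topology}"
  assumes [measurable]: "X \<in> borel_measurable M" "Y \<in> borel_measurable M"
    and "integrable M (\<lambda>\<omega>. (norm (X \<omega>))\<^sup>2)" "integrable M (\<lambda>\<omega>. (norm (Y \<omega>))\<^sup>2)"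
  shows "integrable M (\<lambda>\<omega>. (norm (X \<omega> - Y \<omega>))\<^sup>2)"
proof (rule Bochner_Integration.integrable_bound)
  show "integrable M (\<lambda>\<omega>. 2 * (norm (X \<omega>))\<^sup>2 + 2 * (norm (Y \<omega>))\<^sup>2)" using assms by simp
  show "AE \<omega> in M. norm ((norm (X \<omega> - Y \<omega>))\<^sup>2) \<le> norm (2 * (norm (X \<omega>))\<^sup>2 + 2 * (norm (Y \<omega>))\<^sup>2)"
    using norm_add_sq_le[of "X _" "- Y _"] by (intro AE_I2) simp
qed measurable

section \<open>Running suprema and their dyadic approximation\<close>

definition sup_sq :: "(real \<Rightarrow> 'w \<Rightarrow> 'h::real_normed_vector) \<Rightarrow> real \<Rightarrow> 'w \<Rightarrow> ennreal" where
  "sup_sq X t \<omega> = (SUP s\<in>{0..t}. ennreal ((norm (X s \<omega>))\<^sup>2))"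

text \<open>Suprema over finitely many times, nested in \<open>n\<close>. For a continuous path they
  increase to \<open>sup_sq\<close>, which yields both measurability of the supremum and the passage
  from discrete to continuous time.\<close>

definition dyadic_sup_sq :: "(real \<Rightarrow> 'w \<Rightarrow> 'h::real_normed_vector) \<Rightarrow> real \<Rightarrow> nat \<Rightarrow> 'w \<Rightarrow> ennreal" where
  "dyadic_sup_sq X t n \<omega> = (SUP k\<in>{..2 ^ n}. ennreal ((norm (X (t * real k / 2 ^ n) \<omega>))\<^sup>2))"

lemma sup_sq_upper: "0 \<le> s \<Longrightarrow> s \<le> t \<Longrightarrow> ennreal ((norm (X s \<omega>))\<^sup>2) \<le> sup_sq X t \<omega>"
  unfolding sup_sq_def by (rule SUP_upper) simp

lemma sup_sq_mono: "s \<le> t \<Longrightarrow> sup_sq X s \<omega> \<le> sup_sq X t \<omega>"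
  unfolding sup_sq_def by (rule SUP_subset_mono) auto

lemma sup_sq_least: "(\<And>s. 0 \<le> s \<Longrightarrow> s \<le> t \<Longrightarrow> ennreal ((norm (X s \<omega>))\<^sup>2) \<le> c) \<Longrightarrow> sup_sq X t \<omega> \<le> c"
  unfolding sup_sq_def by (rule SUP_least) simp

lemma dyadic_time:
  assumes "0 \<le> t" "k \<le> 2 ^ n"
  shows "0 \<le> t * real k / 2 ^ n" "t * real k / 2 ^ n \<le> t"
proof -
  have "real k \<le> 2 ^ n" using assms(2) by (metis of_nat_le_iff of_nat_numeral of_nat_power)
  then show "t * real k / 2 ^ n \<le> t" using assms(1) by (simp add: divide_le_eq mult_left_mono)
qed (use assms in simp)

lemma dyadic_sup_sq_measurable:
  fixes X :: "real \<Rightarrow> 'w \<Rightarrow> 'h::{real_normed_vector, second_countable_topology}"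
  assumes "0 \<le> t" and X: "\<And>s. 0 \<le> s \<Longrightarrow> s \<le> t \<Longrightarrow> X s \<in> borel_measurable N"
  shows "dyadic_sup_sq X t n \<in> borel_measurable N"
proof -
  have "(\<lambda>\<omega>. ennreal ((norm (X (t * real k / 2 ^ n) \<omega>))\<^sup>2)) \<in> borel_measurable N" if "k \<in> {..2 ^ n}" for k :: nat
  proof -
    have [measurable]: "X (t * real k / 2 ^ n) \<in> borel_measurable N"
      using dyadic_time[OF assms(1)] that by (intro X) auto
    show ?thesis by measurable
  qed
  then show ?thesis unfolding dyadic_sup_sq_def[abs_def] by (intro borel_measurable_SUP) auto
qed

lemma incseq_dyadic_sup_sq: "incseq (\<lambda>n. dyadic_sup_sq X t n \<omega>)"
proof (rule incseq_SucI)
  fix n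
  show "dyadic_sup_sq X t n \<omega> \<le> dyadic_sup_sq X t (Suc n) \<omega>"
    unfolding dyadic_sup_sq_def
  proof (rule SUP_mono)
    fix k :: nat assume "k \<in> {..2 ^ n}"
    then show "\<exists>j\<in>{..2 ^ Suc n}. ennreal ((norm (X (t * real k / 2 ^ n) \<omega>))\<^sup>2) \<le> ennreal ((norm (X (t * real j / 2 ^ Suc n) \<omega>))\<^sup>2)"
      by (intro bexI[of _ "2 * k"]) auto
  qed
qed

lemma sup_sq_dyadic:
  assumes c: "continuous_on {0..t} (\<lambda>s. X s \<omega>)" and t: "0 \<le> t"
  shows "sup_sq X t \<omega> = (SUP n. dyadic_sup_sq X t n \<omega>)"
proof (rule antisym)
  show "(SUP n. dyadic_sup_sq X t n \<omega>) \<le> sup_sq X t \<omega>"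
    unfolding dyadic_sup_sq_def using dyadic_time[OF t] by (intro SUP_least sup_sq_upper) auto
  show "sup_sq X t \<omega> \<le> (SUP n. dyadic_sup_sq X t n \<omega>)"
  proof (rule sup_sq_least)
    fix s assume s: "0 \<le> s" "s \<le> t"
    \<comment> \<open>The points \<open>t * k n / 2 ^ n\<close> approximate \<open>s\<close> with
      error at most \<open>t / 2 ^ n\<close>. For \<open>t = 0\<close> the quotient
      \<open>s / t\<close> is 0 by convention, and \<open>s\<close> is 0 as well.\<close>
    define k where "k n = nat \<lfloor>s / t * 2 ^ n\<rfloor>" for n :: nat
    have st: "0 \<le> s / t" "s / t \<le> 1" using s by (auto simp: divide_le_eq_1)
    have kb: "k n \<le> 2 ^ n" for n
    proof -
      have "s / t * 2 ^ n \<le> 1 * 2 ^ n" by (rule mult_right_mono[OF st(2)]) simp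
      then have "\<lfloor>s / t * 2 ^ n\<rfloor> \<le> \<lfloor>(2::real) ^ n\<rfloor>" by (intro floor_mono) simp
      also have "\<dots> = 2 ^ n" by (metis floor_of_int of_int_numeral of_int_power)
      finally show ?thesis by (simp add: k_def)
    qed
    have near: "\<bar>t * real (k n) / 2 ^ n - s\<bar> \<le> t * (1/2) ^ n" for n
    proof (cases "t = 0")
      case False
      with t have t0: "0 < t" by simp
      have "\<bar>real (k n) - s / t * 2 ^ n\<bar> \<le> 1"
      proof -
        have "real (k n) = of_int \<lfloor>s / t * 2 ^ n\<rfloor>" unfolding k_def
            by (intro of_nat_nat) (use mult_nonneg_nonneg[OF st(1), of "2 ^ n"] in \<open>simp only: zero_le_floor zero_le_power zero_le_numeral\<close>)
        then show ?thesis
          using of_int_floor_le[of "s / t * 2 ^ n"] real_of_int_floor_add_one_gt[of "s / t * 2 ^ n"] by linarith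
      qed
      then have "\<bar>real (k n) - s / t * 2 ^ n\<bar> * (t / 2 ^ n) \<le> 1 * (t / 2 ^ n)"
        by (rule mult_right_mono) (use t0 in simp)
      also have "\<bar>real (k n) - s / t * 2 ^ n\<bar> * (t / 2 ^ n) = \<bar>(real (k n) - s / t * 2 ^ n) * (t / 2 ^ n)\<bar>"
        using t0 by (simp add: abs_mult)
      also have "(real (k n) - s / t * 2 ^ n) * (t / 2 ^ n) = t * real (k n) / 2 ^ n - s"
        using t0 by (simp add: field_simps)
      finally show ?thesis by (simp add: power_one_over)
    qed (use s in simp)
    have "(\<lambda>n. (1/2) ^ n) \<longlonglongrightarrow> (0::real)"
      by (rule LIMSEQ_realpow_zero) auto
    then have "(\<lambda>n. t * (1/2) ^ n) \<longlonglongrightarrow> 0" by (rule tendsto_mult_right_zero)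
    moreover have "\<forall>\<^sub>F n in sequentially. norm (t * real (k n) / 2 ^ n - s) \<le> t * (1/2) ^ n"
      by (rule eventuallyI) (unfold real_norm_def, rule near)
    ultimately have "(\<lambda>n. t * real (k n) / 2 ^ n - s) \<longlonglongrightarrow> 0"
      by (rule Lim_null_comparison[rotated])
    then have lim: "(\<lambda>n. t * real (k n) / 2 ^ n) \<longlonglongrightarrow> s" by (rule LIM_zero_cancel)
    have "(\<lambda>n. X (t * real (k n) / 2 ^ n) \<omega>) \<longlonglongrightarrow> X s \<omega>"
      by (rule continuous_on_tendsto_compose[OF c lim]) (use s dyadic_time[OF t kb] in auto)
    then have l: "(\<lambda>n. ennreal ((norm (X (t * real (k n) / 2 ^ n) \<omega>))\<^sup>2)) \<longlonglongrightarrow> ennreal ((norm (X s \<omega>))\<^sup>2)"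
      by (intro tendsto_intros tendsto_ennrealI)
    have "ennreal ((norm (X (t * real (k n) / 2 ^ n) \<omega>))\<^sup>2) \<le> (SUP n. dyadic_sup_sq X t n \<omega>)" for n
      by (rule SUP_upper2[of n]) (auto simp: dyadic_sup_sq_def intro!: SUP_upper kb)
    then show "ennreal ((norm (X s \<omega>))\<^sup>2) \<le> (SUP n. dyadic_sup_sq X t n \<omega>)"
      by (intro LIMSEQ_le_const2[OF l]) blast
  qed
qed

lemma sup_sq_add_le: "sup_sq (\<lambda>s \<omega>. X s \<omega> + Y s \<omega>) t \<omega> \<le> 2 * sup_sq X t \<omega> + 2 * sup_sq Y t \<omega>"
proof (rule sup_sq_least)
  fix s assume s: "0 \<le> s" "s \<le> t"
  have "ennreal ((norm (X s \<omega> + Y s \<omega>))\<^sup>2) \<le> ennreal (2 * (norm (X s \<omega>))\<^sup>2 + 2 * (norm (Y s \<omega>))\<^sup>2)"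
    by (rule ennreal_leI[OF norm_add_sq_le])
  also have "\<dots> = 2 * ennreal ((norm (X s \<omega>))\<^sup>2) + 2 * ennreal ((norm (Y s \<omega>))\<^sup>2)"
    by (simp add: ennreal_plus ennreal_mult)
  also have "\<dots> \<le> 2 * sup_sq X t \<omega> + 2 * sup_sq Y t \<omega>"
    by (intro add_mono mult_left_mono sup_sq_upper s) auto
  finally show "ennreal ((norm (X s \<omega> + Y s \<omega>))\<^sup>2) \<le> 2 * sup_sq X t \<omega> + 2 * sup_sq Y t \<omega>" .
qed

lemma sup_sq_minus_commute: "sup_sq (\<lambda>s \<omega>. X s \<omega> - Y s \<omega>) t \<omega> = sup_sq (\<lambda>s \<omega>. Y s \<omega> - X s \<omega>) t \<omega>"
  unfolding sup_sq_def by (simp add: norm_minus_commute)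

lemma sup_sq_triangle: "sup_sq (\<lambda>s \<omega>. X s \<omega> - Z s \<omega>) t \<omega>
   \<le> 2 * sup_sq (\<lambda>s \<omega>. X s \<omega> - Y s \<omega>) t \<omega> + 2 * sup_sq (\<lambda>s \<omega>. Y s \<omega> - Z s \<omega>) t \<omega>"
  using sup_sq_add_le[of "\<lambda>s \<omega>. X s \<omega> - Y s \<omega>" "\<lambda>s \<omega>. Y s \<omega> - Z s \<omega>" t \<omega>] by simp

context brownian_basis
begin

lemma sup_sq_measurable:
  fixes X :: "real \<Rightarrow> 'w \<Rightarrow> 'h::{real_normed_vector, second_countable_topology}"
  assumes X: "adapted_continuous F {0..T} X" and t: "0 \<le> t" "t \<le> T"
  shows "sup_sq X t \<in> borel_measurable (F t)"
proof -
  have "sup_sq X t \<omega> = (SUP n. dyadic_sup_sq X t n \<omega>)" if "\<omega> \<in> space (F t)" for \<omega>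
  proof (rule sup_sq_dyadic[OF _ t(1)])
    have "continuous_on {0..T} (\<lambda>s. X s \<omega>)" using X t that by (auto simp: adapted_continuous_def)
    then show "continuous_on {0..t} (\<lambda>s. X s \<omega>)" by (rule continuous_on_subset) (use t in auto)
  qed
  moreover have "(\<lambda>\<omega>. SUP n. dyadic_sup_sq X t n \<omega>) \<in> borel_measurable (F t)"
  proof (intro borel_measurable_SUP dyadic_sup_sq_measurable t(1))
    fix s assume s: "0 \<le> s" "s \<le> t"
    then have "X s \<in> borel_measurable (F s)" using X t by (auto simp: adapted_continuous_def)
    then show "X s \<in> borel_measurable (F t)" by (rule measurable_F_mono[OF s(2)])
  qed auto
  ultimately show ?thesis by (simp cong: measurable_cong)
qed

text \<open>Testing against square integrable vectors of the past replaces conditional expectations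
  in a Hilbert space. It is stable enough for elementary integrals and is exactly what
  \<open>doob_discrete\<close> consumes.\<close>

definition L2_martingale :: "(real \<Rightarrow> 'w \<Rightarrow> 'h::{real_inner, second_countable_topology}) \<Rightarrow> bool" where
  "L2_martingale X \<longleftrightarrow>
    (\<forall>t\<in>{0..T}. X t \<in> borel_measurable (F t) \<and> integrable M (\<lambda>\<omega>. (norm (X t \<omega>))\<^sup>2)) \<and>
    (\<forall>s t \<eta>. 0 \<le> s \<and> s \<le> t \<and> t \<le> T \<and> \<eta> \<in> borel_measurable (F s) \<and> integrable M (\<lambda>\<omega>. (norm (\<eta> \<omega>))\<^sup>2) \<longrightarrow>
       expectation (\<lambda>\<omega>. \<eta> \<omega> \<bullet> (X t \<omega> - X s \<omega>)) = 0)"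

lemma L2_martingaleD:
  assumes "L2_martingale X"
  shows "0 \<le> t \<Longrightarrow> t \<le> T \<Longrightarrow> X t \<in> borel_measurable (F t)"
    and "0 \<le> t \<Longrightarrow> t \<le> T \<Longrightarrow> integrable M (\<lambda>\<omega>. (norm (X t \<omega>))\<^sup>2)"
    and "\<lbrakk>0 \<le> s; s \<le> t; t \<le> T; \<eta> \<in> borel_measurable (F s); integrable M (\<lambda>\<omega>. (norm (\<eta> \<omega>))\<^sup>2)\<rbrakk>
      \<Longrightarrow> expectation (\<lambda>\<omega>. \<eta> \<omega> \<bullet> (X t \<omega> - X s \<omega>)) = 0"
  using assms by (auto simp: L2_martingale_def)

text \<open>The pathwise inequality is applied to the norms of X. By the subgradient inequality
  \<open>sgn x \<bullet> (y - x) <= norm y - norm x\<close>, its sum is at least the sum of the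
  increments of X tested against \<open>?\<eta> k\<close>, the running maximum times
  \<open>sgn (X (p k))\<close>. These test vectors belong to the past, so that sum has expectation 0
  and no separate treatment of the submartingale of norms arises.\<close>

lemma doob_discrete:
  fixes p :: "nat \<Rightarrow> real" and X :: "real \<Rightarrow> 'w \<Rightarrow> 'h::{real_inner, second_countable_topology}"
  assumes X: "L2_martingale X" and p: "\<And>k. k \<le> n \<Longrightarrow> 0 \<le> p k \<and> p k \<le> T" "\<And>i k. i \<le> k \<Longrightarrow> k \<le> n \<Longrightarrow> p i \<le> p k"
  shows "(\<integral>\<^sup>+\<omega>. ennreal ((Max ((\<lambda>k. norm (X (p k) \<omega>)) ` {..n}))\<^sup>2) \<partial>M) \<le> 4 * (\<integral>\<^sup>+\<omega>. ennreal ((norm (X (p n) \<omega>))\<^sup>2) \<partial>M)"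
proof -
  let ?m = "\<lambda>k \<omega>. Max ((\<lambda>k. norm (X (p k) \<omega>)) ` {..k})"
  let ?\<eta> = "\<lambda>k \<omega>. ?m k \<omega> *\<^sub>R sgn (X (p k) \<omega>)"
  have Xm: "X (p k) \<in> borel_measurable (F (p k))" and Xi: "integrable M (\<lambda>\<omega>. (norm (X (p k) \<omega>))\<^sup>2)" if "k \<le> n" for k
    using X p(1)[OF that] by (auto simp: L2_martingale_def)
  have XM[measurable]: "X (p k) \<in> borel_measurable M" if "k \<le> n" for k
    using Xm[OF that] by (rule measurable_F_M)
  have Xm': "X (p i) \<in> borel_measurable (F (p k))" if "i \<le> k" "k \<le> n" for i k
    by (rule measurable_F_mono[OF p(2)[OF that] Xm]) (use that in linarith)
  have mm: "?m k \<in> borel_measurable (F (p k))" if "k \<le> n" for k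
    by (intro borel_measurable_Max borel_measurable_norm) (use Xm'[OF _ that] in auto)
  have m0: "0 \<le> ?m k \<omega>" for k \<omega>
    by (rule order_trans[OF norm_ge_zero Max_ge[of _ "norm (X (p 0) \<omega>)"]]) auto
  have mi: "integrable M (\<lambda>\<omega>. (?m k \<omega>)\<^sup>2)" if k: "k \<le> n" for k
  proof (rule Bochner_Integration.integrable_bound)
    show "integrable M (\<lambda>\<omega>. \<Sum>i\<le>k. (norm (X (p i) \<omega>))\<^sup>2)"
      by (intro Bochner_Integration.integrable_sum Xi) (use k in auto)
    show "(\<lambda>\<omega>. (?m k \<omega>)\<^sup>2) \<in> borel_measurable M" by (intro borel_measurable_power measurable_F_M[OF mm[OF k]])
    have "(?m k \<omega>)\<^sup>2 \<le> (\<Sum>i\<le>k. (norm (X (p i) \<omega>))\<^sup>2)" for \<omega>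
    proof -
      have "?m k \<omega> \<in> (\<lambda>k. norm (X (p k) \<omega>)) ` {..k}" by (rule Max_in) auto
      then obtain i where i: "?m k \<omega> = norm (X (p i) \<omega>)" "i \<in> {..k}" by (rule imageE)
      show ?thesis unfolding i(1) using i(2) by (intro member_le_sum) simp_all
    qed
    then show "AE \<omega> in M. norm ((?m k \<omega>)\<^sup>2) \<le> norm (\<Sum>i\<le>k. (norm (X (p i) \<omega>))\<^sup>2)"
      by (auto intro!: AE_I2 order_trans[OF _ abs_ge_self])
  qed
  have \<eta>m: "?\<eta> k \<in> borel_measurable (F (p k))" if "k \<le> n" for k
  proof -
    note [measurable] = mm[OF that] Xm[OF that]
    show ?thesis unfolding sgn_div_norm by measurable
  qed
  have \<eta>i: "integrable M (\<lambda>\<omega>. (norm (?\<eta> k \<omega>))\<^sup>2)" if "k \<le> n" for k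
  proof (rule Bochner_Integration.integrable_bound[OF mi[OF that]])
    show "(\<lambda>\<omega>. (norm (?\<eta> k \<omega>))\<^sup>2) \<in> borel_measurable M"
      by (rule borel_measurable_power[OF measurable_compose[OF measurable_F_M[OF \<eta>m[OF that]] borel_measurable_norm]])
    have "norm (?\<eta> k \<omega>) \<le> ?m k \<omega>" for \<omega>
      by (simp add: norm_sgn m0 abs_of_nonneg)
    then show "AE \<omega> in M. norm ((norm (?\<eta> k \<omega>))\<^sup>2) \<le> norm ((?m k \<omega>)\<^sup>2)"
      by (auto intro!: AE_I2 power_mono simp del: norm_scaleR)
  qed
  have \<eta>X: "expectation (\<lambda>\<omega>. ?\<eta> k \<omega> \<bullet> (X (p (Suc k)) \<omega> - X (p k) \<omega>)) = 0"
    and \<eta>Xi: "integrable M (\<lambda>\<omega>. ?\<eta> k \<omega> \<bullet> (X (p (Suc k)) \<omega> - X (p k) \<omega>))" if "k < n" for k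
  proof -
    have k: "k \<le> n" "Suc k \<le> n" using that by auto
    show "expectation (\<lambda>\<omega>. ?\<eta> k \<omega> \<bullet> (X (p (Suc k)) \<omega> - X (p k) \<omega>)) = 0"
      by (rule L2_martingaleD(3)[OF X _ _ _ \<eta>m[OF k(1)] \<eta>i[OF k(1)]])
         (use p(1)[OF k(1)] p(1)[OF k(2)] p(2)[of k "Suc k"] k in auto)
    show "integrable M (\<lambda>\<omega>. ?\<eta> k \<omega> \<bullet> (X (p (Suc k)) \<omega> - X (p k) \<omega>))"
      by (intro integrable_inner_L2 measurable_F_M[OF \<eta>m[OF k(1)]] \<eta>i integrable_L2_diff Xi k borel_measurable_diff XM)
  qed
  let ?R = "\<lambda>\<omega>. 4 * (norm (X (p n) \<omega>))\<^sup>2 - 4 * (\<Sum>k<n. ?\<eta> k \<omega> \<bullet> (X (p (Suc k)) \<omega> - X (p k) \<omega>))"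
  have le: "(?m n \<omega>)\<^sup>2 \<le> ?R \<omega>" for \<omega>
  proof -
    have "(\<Sum>k<n. ?\<eta> k \<omega> \<bullet> (X (p (Suc k)) \<omega> - X (p k) \<omega>)) \<le> (\<Sum>k<n. ?m k \<omega> * (norm (X (p (Suc k)) \<omega>) - norm (X (p k) \<omega>)))"
    proof (rule sum_mono)
      fix k
      have "sgn x \<bullet> (y - x) \<le> norm y - norm x" for x y :: 'h
      proof -
        have "sgn x \<bullet> y \<le> norm (sgn x) * norm y" by (rule norm_cauchy_schwarz)
        also have "\<dots> \<le> norm y" by (simp add: norm_sgn)
        finally have "sgn x \<bullet> y \<le> norm y" .
        moreover have "sgn x \<bullet> x = norm x"
          by (cases "x = 0") (simp_all add: sgn_div_norm power2_norm_eq_inner[symmetric] power2_eq_square)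
        ultimately show ?thesis by (simp add: inner_diff_right)
      qed
      then show "?\<eta> k \<omega> \<bullet> (X (p (Suc k)) \<omega> - X (p k) \<omega>) \<le> ?m k \<omega> * (norm (X (p (Suc k)) \<omega>) - norm (X (p k) \<omega>))"
        unfolding inner_scaleR_left by (intro mult_left_mono m0)
    qed
    with doob_pathwise[of "\<lambda>k. norm (X (p k) \<omega>)" n] show ?thesis by simp
  qed
  let ?S = "\<lambda>\<omega>. \<Sum>k<n. ?\<eta> k \<omega> \<bullet> (X (p (Suc k)) \<omega> - X (p k) \<omega>)"
  have Si: "integrable M ?S" by (intro Bochner_Integration.integrable_sum \<eta>Xi) simp
  have S0: "expectation ?S = 0"
    by (subst Bochner_Integration.integral_sum) (auto simp only: lessThan_iff \<eta>Xi \<eta>X sum.neutral_const intro!: sum.neutral)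
  have Ri: "integrable M ?R"
    by (rule Bochner_Integration.integrable_diff[OF integrable_mult_right integrable_mult_right[OF Si]]) (use Xi[of n] in simp)
  have Re: "expectation ?R = 4 * expectation (\<lambda>\<omega>. (norm (X (p n) \<omega>))\<^sup>2)"
  proof -
    have "expectation ?R = expectation (\<lambda>\<omega>. 4 * (norm (X (p n) \<omega>))\<^sup>2) - expectation (\<lambda>\<omega>. 4 * ?S \<omega>)"
      by (rule Bochner_Integration.integral_diff[OF integrable_mult_right integrable_mult_right[OF Si]]) (use Xi[of n] in simp)
    also have "expectation (\<lambda>\<omega>. 4 * ?S \<omega>) = 4 * expectation ?S" by (rule integral_mult_right_zero)
    finally show ?thesis unfolding S0 by simp
  qed
  have "(\<integral>\<^sup>+\<omega>. ennreal ((?m n \<omega>)\<^sup>2) \<partial>M) = ennreal (expectation (\<lambda>\<omega>. (?m n \<omega>)\<^sup>2))"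
    using mi[of n] by (intro nn_integral_eq_integral) auto
  also have "\<dots> \<le> ennreal (expectation ?R)"
    using mi[of n] Ri le by (intro ennreal_leI integral_mono) auto
  also have "\<dots> = 4 * ennreal (expectation (\<lambda>\<omega>. (norm (X (p n) \<omega>))\<^sup>2))"
    unfolding Re by (simp add: ennreal_mult)
  also have "ennreal (expectation (\<lambda>\<omega>. (norm (X (p n) \<omega>))\<^sup>2)) = (\<integral>\<^sup>+\<omega>. ennreal ((norm (X (p n) \<omega>))\<^sup>2) \<partial>M)"
    using Xi[of n] by (intro nn_integral_eq_integral[symmetric]) auto
  finally show ?thesis .
qed

lemma doob_L2:
  fixes X :: "real \<Rightarrow> 'w \<Rightarrow> 'h::{real_inner, second_countable_topology}"
  assumes X: "L2_martingale X" and c: "AE \<omega> in M. continuous_on {0..T} (\<lambda>s. X s \<omega>)" and t: "0 \<le> t" "t \<le> T"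
  shows "(\<integral>\<^sup>+\<omega>. sup_sq X t \<omega> \<partial>M) \<le> 4 * (\<integral>\<^sup>+\<omega>. ennreal ((norm (X t \<omega>))\<^sup>2) \<partial>M)"
proof -
  have XM: "X s \<in> borel_measurable M" if "0 \<le> s" "s \<le> T" for s
    using X that measurable_F_M[of "X s" s] by (auto simp: L2_martingale_def)
  have "(\<integral>\<^sup>+\<omega>. sup_sq X t \<omega> \<partial>M) = (\<integral>\<^sup>+\<omega>. (SUP n. dyadic_sup_sq X t n \<omega>) \<partial>M)"
  proof (rule nn_integral_cong_AE)
    show "AE \<omega> in M. sup_sq X t \<omega> = (SUP n. dyadic_sup_sq X t n \<omega>)"
      using c
    proof eventually_elim
      case (elim \<omega>)
      have "continuous_on {0..t} (\<lambda>s. X s \<omega>)" by (rule continuous_on_subset[OF elim]) (use t in auto)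
      then show ?case by (rule sup_sq_dyadic) (rule t)
    qed
  qed
  also have "\<dots> = (SUP n. \<integral>\<^sup>+\<omega>. dyadic_sup_sq X t n \<omega> \<partial>M)"
  proof (rule nn_integral_monotone_convergence_SUP)
    show "incseq (dyadic_sup_sq X t)"
      using incseq_dyadic_sup_sq[of X t] by (auto simp: incseq_def le_fun_def)
    show "dyadic_sup_sq X t n \<in> borel_measurable M" for n
      using t by (intro dyadic_sup_sq_measurable XM) auto
  qed
  also have "\<dots> \<le> 4 * (\<integral>\<^sup>+\<omega>. ennreal ((norm (X t \<omega>))\<^sup>2) \<partial>M)"
  proof (rule SUP_least)
    fix n :: nat
    let ?p = "\<lambda>k. t * real k / 2 ^ n"
    have "(\<integral>\<^sup>+\<omega>. dyadic_sup_sq X t n \<omega> \<partial>M) \<le> (\<integral>\<^sup>+\<omega>. ennreal ((Max ((\<lambda>k. norm (X (?p k) \<omega>)) ` {..2 ^ n}))\<^sup>2) \<partial>M)"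
      unfolding dyadic_sup_sq_def
      by (intro nn_integral_mono SUP_least ennreal_leI power_mono Max_ge) auto
    also have "\<dots> \<le> 4 * (\<integral>\<^sup>+\<omega>. ennreal ((norm (X (?p (2 ^ n)) \<omega>))\<^sup>2) \<partial>M)"
    proof (rule doob_discrete[OF X])
      fix k :: nat assume "k \<le> 2 ^ n"
      then show "0 \<le> ?p k \<and> ?p k \<le> T" using dyadic_time[OF t(1)] t(2) by force
      fix i assume "i \<le> k"
      then show "?p i \<le> ?p k" using t by (intro divide_right_mono mult_left_mono) auto
    qed
    finally show "(\<integral>\<^sup>+\<omega>. dyadic_sup_sq X t n \<omega> \<partial>M) \<le> 4 * (\<integral>\<^sup>+\<omega>. ennreal ((norm (X t \<omega>))\<^sup>2) \<partial>M)" by simp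
  qed
  finally show ?thesis .
qed

lemma elem_integral_L2_martingale:
  assumes E: "elem_family K p q \<xi>"
  shows "L2_martingale (elem_integral K p q \<xi>)"
  unfolding L2_martingale_def
proof (intro conjI ballI allI impI)
  fix t assume t: "t \<in> {0..T}"
  show "elem_integral K p q \<xi> t \<in> borel_measurable (F t)" using elem_integral_measurable[OF E] t by auto
  have "min (q k) 0 = 0" "min (p k) 0 = 0" if "k \<in> K" for k
    using elem_familyD[OF E that] by auto
  then have 0: "elem_integral K p q \<xi> 0 \<omega> = 0" for \<omega>
    by (simp add: elem_integral_def)
  show "integrable M (\<lambda>\<omega>. (norm (elem_integral K p q \<xi> t \<omega>))\<^sup>2)"
    using elem_isometry_weighted(1)[OF E, of 0 t "\<lambda>_. 1" 1] t by (simp add: 0)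
next
  fix s t and \<eta> :: "'w \<Rightarrow> 'b"
  assume A: "0 \<le> s \<and> s \<le> t \<and> t \<le> T \<and> \<eta> \<in> borel_measurable (F s) \<and> integrable M (\<lambda>\<omega>. (norm (\<eta> \<omega>))\<^sup>2)"
  have "integrable M (\<lambda>\<omega>. norm (\<eta> \<omega>))"
  proof (rule Bochner_Integration.integrable_bound)
    show "integrable M (\<lambda>\<omega>. 1 + (norm (\<eta> \<omega>))\<^sup>2)" using A by simp
    have "norm (norm (\<eta> \<omega>)) \<le> norm (1 + (norm (\<eta> \<omega>))\<^sup>2)" for \<omega>
    proof -
      have "norm (\<eta> \<omega>) \<le> 1 + (norm (\<eta> \<omega>))\<^sup>2"
        using sum_squares_bound[of "norm (\<eta> \<omega>)" 1] norm_ge_zero[of "\<eta> \<omega>"]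
        unfolding power_one mult_1_right by linarith
      then show ?thesis by simp
    qed
    then show "AE \<omega> in M. norm (norm (\<eta> \<omega>)) \<le> norm (1 + (norm (\<eta> \<omega>))\<^sup>2)" by (rule AE_I2)
    have "\<eta> \<in> borel_measurable M" using A measurable_F_M by blast
    then show "(\<lambda>\<omega>. norm (\<eta> \<omega>)) \<in> borel_measurable M" by (rule measurable_compose[OF _ borel_measurable_norm])
  qed
  then show "expectation (\<lambda>\<omega>. \<eta> \<omega> \<bullet> (elem_integral K p q \<xi> t \<omega> - elem_integral K p q \<xi> s \<omega>)) = 0"
    by (intro elem_orthogonal(2)[OF E]) (use A in auto)
qed

end

lemma power_sq_4: "((2::real) ^ n)\<^sup>2 = 4 ^ n" "((1 / 2 :: real) ^ n)\<^sup>2 = (1 / 4) ^ n"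
  by (simp_all only: power2_eq_square power_mult_distrib[symmetric]) simp_all

section \<open>Completeness with respect to the mean square supremum distance\<close>

context brownian_basis
begin

lemma adapted_continuousD:
  assumes "adapted_continuous F I X" "t \<in> I"
  shows "X t \<in> borel_measurable (F t)" "\<omega> \<in> space M \<Longrightarrow> continuous_on I (\<lambda>s. X s \<omega>)"
  using assms by (auto simp: adapted_continuous_def space_F)

lemma adapted_continuous_diff:
  fixes X Y :: "real \<Rightarrow> 'w \<Rightarrow> 'h::{real_normed_vector, second_countable_topology}"
  assumes "adapted_continuous F I X" "adapted_continuous F I Y"
  shows "adapted_continuous F I (\<lambda>s \<omega>. X s \<omega> - Y s \<omega>)"
  using assms unfolding adapted_continuous_def
  by (intro ballI conjI borel_measurable_diff continuous_on_diff) auto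

text \<open>Lets a process be set to 0 off an almost sure event and remain adapted, even at time
  0.\<close>

lemma conull_in_F:
  assumes "AE \<omega> in M. P \<omega>" "{\<omega>\<in>space M. P \<omega>} \<in> sets M"
  shows "{\<omega>\<in>space M. P \<omega>} \<in> sets (F t)"
proof -
  have "{\<omega>\<in>space M. \<not> P \<omega>} \<in> null_sets M"
    using assms by (subst (asm) AE_iff_null) auto
  then have "{\<omega>\<in>space M. \<not> P \<omega>} \<in> sets (F t)" by (rule null_sets_in_F)
  from sets.compl_sets[OF this] have "space M - {\<omega>\<in>space M. \<not> P \<omega>} \<in> sets (F t)" by (simp add: space_F)
  moreover have "space M - {\<omega>\<in>space M. \<not> P \<omega>} = {\<omega>\<in>space M. P \<omega>}" by auto
  ultimately show ?thesis by simp
qed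

text \<open>The variable \<open>V\<close>, the sum of the squared increments with weights 4^n, has
  finite expectation because 4^n times 16^-n is summable. Where \<open>V\<close> is finite, the
  increments are at most \<open>sqrt V\<close> times 2^-n uniformly in time, so the limit is
  continuous; elsewhere it is set to 0. The same \<open>V\<close> dominates the tails, which gives
  convergence in mean square and not only almost surely.\<close>

lemma adapted_continuous_complete:
  fixes X :: "nat \<Rightarrow> real \<Rightarrow> 'w \<Rightarrow> 'h::{banach, second_countable_topology}"
  assumes ac: "\<And>n. adapted_continuous F {0..T} (X n)"
    and bound: "\<And>n. (\<integral>\<^sup>+\<omega>. sup_sq (\<lambda>s \<omega>. X (Suc n) s \<omega> - X n s \<omega>) T \<omega> \<partial>M) \<le> ennreal (C * (1 / 16) ^ n)"
  obtains Y where "adapted_continuous F {0..T} Y"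
    "(\<lambda>n. \<integral>\<^sup>+\<omega>. sup_sq (\<lambda>s \<omega>. X n s \<omega> - Y s \<omega>) T \<omega> \<partial>M) \<longlonglongrightarrow> 0"
proof -
  define D where "D n s \<omega> = X (Suc n) s \<omega> - X n s \<omega>" for n s \<omega>
  have Dm: "sup_sq (D n) T \<in> borel_measurable M" for n
    unfolding D_def[abs_def] using T_pos
    by (intro measurable_F_M[of _ T] sup_sq_measurable adapted_continuous_diff ac) auto
  define V where "V \<omega> = (\<Sum>n. ennreal (4 ^ n) * sup_sq (D n) T \<omega>)" for \<omega>
  have Vm: "V \<in> borel_measurable M" unfolding V_def[abs_def] using Dm by measurable
  have "(\<integral>\<^sup>+\<omega>. V \<omega> \<partial>M) = (\<Sum>n. \<integral>\<^sup>+\<omega>. ennreal (4 ^ n) * sup_sq (D n) T \<omega> \<partial>M)"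
    unfolding V_def using Dm by (intro nn_integral_suminf) measurable
  \<comment> \<open>\<open>C\<close> may be negative; \<open>max C 0\<close> makes the factors
    multiply correctly under \<open>ennreal\<close>.\<close>
  also have "\<dots> \<le> (\<Sum>n. ennreal (max C 0 * (1 / 4) ^ n))"
  proof (intro suminf_le summableI)
    fix n
    have "(\<integral>\<^sup>+\<omega>. ennreal (4 ^ n) * sup_sq (D n) T \<omega> \<partial>M) = ennreal (4 ^ n) * (\<integral>\<^sup>+\<omega>. sup_sq (D n) T \<omega> \<partial>M)"
      by (rule nn_integral_cmult[OF Dm])
    also have "\<dots> \<le> ennreal (4 ^ n) * ennreal (C * (1 / 16) ^ n)"
      using bound[of n] by (intro mult_left_mono) (auto simp: D_def[abs_def])
    also have "\<dots> \<le> ennreal (4 ^ n) * ennreal (max C 0 * (1 / 16) ^ n)"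
      by (intro mult_left_mono ennreal_leI mult_right_mono) auto
    also have "\<dots> = ennreal (4 ^ n * (max C 0 * (1 / 16) ^ n))"
      by (rule ennreal_mult'[symmetric]) simp
    also have "4 ^ n * (max C 0 * (1 / 16) ^ n) = max C 0 * (1 / 4 :: real) ^ n"
      using power_mult_distrib[of 4 "1/16 :: real" n] by simp
    finally show "(\<integral>\<^sup>+\<omega>. ennreal (4 ^ n) * sup_sq (D n) T \<omega> \<partial>M) \<le> ennreal (max C 0 * (1 / 4) ^ n)" .
  qed
  also have "\<dots> < \<infinity>"
  proof -
    have "summable (\<lambda>n. max C 0 * (1 / 4 :: real) ^ n)" by (intro summable_mult summable_geometric) simp
    then have "(\<Sum>n. ennreal (max C 0 * (1 / 4) ^ n)) = ennreal (\<Sum>n. max C 0 * (1 / 4) ^ n)"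
      by (intro suminf_ennreal2) auto
    then show ?thesis by simp
  qed
  finally have Vint: "(\<integral>\<^sup>+\<omega>. V \<omega> \<partial>M) < \<infinity>" .
  define G where "G = {\<omega>\<in>space M. V \<omega> \<noteq> \<infinity>}"
  have AEV: "AE \<omega> in M. V \<omega> \<noteq> \<infinity>" using nn_integral_PInf_AE[OF Vm] Vint by auto
  have GF: "G \<in> sets (F t)" for t
    unfolding G_def using Vm by (intro conull_in_F AEV) measurable
  define v where "v \<omega> = sqrt (enn2real (V \<omega>))" for \<omega>
  have Db: "norm (D n s \<omega>) \<le> v \<omega> * (1 / 2) ^ n" if "\<omega> \<in> G" "s \<in> {0..T}" for n s \<omega>
  proof -
    have fin: "V \<omega> < \<infinity>" using that by (auto simp: G_def top.not_eq_extremum)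
    have "ennreal (4 ^ n * (norm (D n s \<omega>))\<^sup>2) = ennreal (4 ^ n) * ennreal ((norm (D n s \<omega>))\<^sup>2)"
      by (rule ennreal_mult') simp
    also have "\<dots> \<le> ennreal (4 ^ n) * sup_sq (D n) T \<omega>"
      using that by (intro mult_left_mono sup_sq_upper) auto
    also have "\<dots> \<le> V \<omega>"
      unfolding V_def using sum_le_suminf[of "\<lambda>n. ennreal (4 ^ n) * sup_sq (D n) T \<omega>" "{n}"] by auto
    also have "V \<omega> = ennreal (enn2real (V \<omega>))" using fin by simp
    finally have "4 ^ n * (norm (D n s \<omega>))\<^sup>2 \<le> enn2real (V \<omega>)" by simp
    then have "(2 ^ n * norm (D n s \<omega>))\<^sup>2 \<le> enn2real (V \<omega>)"
      unfolding power_mult_distrib power_sq_4 .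
    then have "2 ^ n * norm (D n s \<omega>) \<le> v \<omega>" unfolding v_def by (rule real_le_rsqrt)
    then show ?thesis by (simp add: field_simps)
  qed
  define Y where "Y s \<omega> = (if \<omega> \<in> G then X 0 s \<omega> + (\<Sum>n. D n s \<omega>) else 0)" for s \<omega>
  have tele: "(\<Sum>i<n. D i s \<omega>) = X n s \<omega> - X 0 s \<omega>" for n s \<omega>
    unfolding D_def by (rule sum_lessThan_telescope)
  have sumv: "summable (\<lambda>n. v \<omega> * (1 / 2) ^ n)" for \<omega>
    by (intro summable_mult summable_geometric) simp
  have unif: "uniform_limit {0..T} (\<lambda>n s. X n s \<omega>) (\<lambda>s. Y s \<omega>) sequentially" if "\<omega> \<in> G" for \<omega>
  proof -
    have "uniform_limit {0..T} (\<lambda>n s. \<Sum>i<n. D i s \<omega>) (\<lambda>s. suminf (\<lambda>i. D i s \<omega>)) sequentially"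
      using Db[OF that] sumv by (rule Weierstrass_m_test)
    then have "uniform_limit {0..T} (\<lambda>n s. X 0 s \<omega> + (\<Sum>i<n. D i s \<omega>)) (\<lambda>s. X 0 s \<omega> + suminf (\<lambda>i. D i s \<omega>)) sequentially"
      by (intro uniform_limit_add uniform_limit_const)
    then show ?thesis using that unfolding tele Y_def by simp
  qed
  have Yc: "continuous_on {0..T} (\<lambda>s. Y s \<omega>)" if "\<omega> \<in> space M" for \<omega>
  proof (cases "\<omega> \<in> G")
    case True
    have "\<And>n. continuous_on {0..T} (\<lambda>s. X n s \<omega>)"
      using adapted_continuousD(2)[OF ac _ that, of 0] T_pos by auto
    then show ?thesis
      by (intro uniform_limit_theorem[OF _ unif[OF True]]) auto
  qed (simp add: Y_def)
  have Ym: "Y t \<in> borel_measurable (F t)" if "t \<in> {0..T}" for t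
  proof (rule borel_measurable_LIMSEQ_metric)
    fix n
    have [measurable]: "X n t \<in> borel_measurable (F t)" "G \<in> sets (F t)" using adapted_continuousD(1)[OF ac that] GF by auto
    show "(\<lambda>\<omega>. if \<omega> \<in> G then X n t \<omega> else 0) \<in> borel_measurable (F t)" by measurable
  next
    fix \<omega> assume "\<omega> \<in> space (F t)"
    show "(\<lambda>n. if \<omega> \<in> G then X n t \<omega> else 0) \<longlonglongrightarrow> Y t \<omega>"
    proof (cases "\<omega> \<in> G")
      case True
      from tendsto_uniform_limitI[OF unif[OF this] that] True show ?thesis by simp
    qed (simp add: Y_def)
  qed
  have YA: "adapted_continuous F {0..T} Y"
    using Yc Ym by (auto simp: adapted_continuous_def space_F)
  \<comment> \<open>The tail of the geometric series with ratio 1/2 is 2 times its first term;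
    squaring gives \<open>4 * (1 / 4) ^ n\<close>.\<close>
  have tail: "sup_sq (\<lambda>s \<omega>. X n s \<omega> - Y s \<omega>) T \<omega> \<le> ennreal (4 * (1 / 4) ^ n) * V \<omega>" if "\<omega> \<in> G" for n \<omega>
  proof (rule sup_sq_least)
    fix s assume s: "0 \<le> s" "s \<le> T"
    then have s': "s \<in> {0..T}" by simp
    have sm: "summable (\<lambda>i. norm (D i s \<omega>))"
      using Db[OF that s'] by (intro summable_comparison_test'[OF sumv[of \<omega>], of 0]) auto
    have "Y s \<omega> - X n s \<omega> = (\<Sum>i. D i s \<omega>) - (\<Sum>i<n. D i s \<omega>)"
      unfolding tele using that by (simp add: Y_def)
    also have "\<dots> = (\<Sum>i. D (i + n) s \<omega>)"
      using suminf_minus_initial_segment[OF summable_norm_cancel[OF sm], of n] by simp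
    finally have "norm (X n s \<omega> - Y s \<omega>) = norm (\<Sum>i. D (i + n) s \<omega>)" by (metis norm_minus_commute)
    also have "\<dots> \<le> (\<Sum>i. v \<omega> * (1 / 2) ^ (i + n))"
    proof (rule norm_suminf_le)
      show "norm (D (i + n) s \<omega>) \<le> v \<omega> * (1 / 2) ^ (i + n)" for i by (rule Db[OF that s'])
      show "summable (\<lambda>i. v \<omega> * (1 / 2) ^ (i + n))" using sumv[of \<omega>] by (rule summable_ignore_initial_segment)
    qed
    also have "\<dots> = v \<omega> * (1 / 2) ^ n * (\<Sum>i. (1 / 2) ^ i)"
      by (subst suminf_mult[symmetric]) (simp_all add: power_add mult_ac summable_geometric)
    also have "\<dots> = 2 * (v \<omega> * (1 / 2) ^ n)" by (simp add: suminf_geometric)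
    finally have "(norm (X n s \<omega> - Y s \<omega>))\<^sup>2 \<le> (2 * (v \<omega> * (1 / 2) ^ n))\<^sup>2" by (rule power_mono) simp
    also have "\<dots> = 4 * (1 / 4) ^ n * enn2real (V \<omega>)"
      unfolding v_def power_mult_distrib power_sq_4 by simp
    finally have "ennreal ((norm (X n s \<omega> - Y s \<omega>))\<^sup>2) \<le> ennreal (4 * (1 / 4) ^ n * enn2real (V \<omega>))" by (rule ennreal_leI)
    also have "\<dots> = ennreal (4 * (1 / 4) ^ n) * ennreal (enn2real (V \<omega>))" by (rule ennreal_mult') simp
    also have "ennreal (enn2real (V \<omega>)) = V \<omega>" using that by (simp add: G_def top.not_eq_extremum)
    finally show "ennreal ((norm (X n s \<omega> - Y s \<omega>))\<^sup>2) \<le> ennreal (4 * (1 / 4) ^ n) * V \<omega>" .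
  qed
  have "(\<integral>\<^sup>+\<omega>. sup_sq (\<lambda>s \<omega>. X n s \<omega> - Y s \<omega>) T \<omega> \<partial>M) \<le> ennreal (4 * (1 / 4) ^ n) * (\<integral>\<^sup>+\<omega>. V \<omega> \<partial>M)" for n
  proof -
    have "(\<integral>\<^sup>+\<omega>. sup_sq (\<lambda>s \<omega>. X n s \<omega> - Y s \<omega>) T \<omega> \<partial>M) \<le> (\<integral>\<^sup>+\<omega>. ennreal (4 * (1 / 4) ^ n) * V \<omega> \<partial>M)"
    proof (rule nn_integral_mono_AE)
      show "AE \<omega> in M. sup_sq (\<lambda>s \<omega>. X n s \<omega> - Y s \<omega>) T \<omega> \<le> ennreal (4 * (1 / 4) ^ n) * V \<omega>"
        using AEV AE_space by eventually_elim (rule tail, simp add: G_def)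
    qed
    also have "\<dots> = ennreal (4 * (1 / 4) ^ n) * (\<integral>\<^sup>+\<omega>. V \<omega> \<partial>M)" by (rule nn_integral_cmult[OF Vm])
    finally show ?thesis .
  qed
  note le = this
  have lim: "(\<lambda>n. ennreal (4 * (1 / 4) ^ n) * (\<integral>\<^sup>+\<omega>. V \<omega> \<partial>M)) \<longlonglongrightarrow> 0"
  proof -
    have "(\<lambda>n. 4 * (1 / 4 :: real) ^ n) \<longlonglongrightarrow> 0"
      by (intro tendsto_mult_right_zero LIMSEQ_realpow_zero) auto
    then have "(\<lambda>n. ennreal (4 * (1 / 4) ^ n)) \<longlonglongrightarrow> ennreal 0" by (rule tendsto_ennrealI)
    then have "(\<lambda>n. (\<integral>\<^sup>+\<omega>. V \<omega> \<partial>M) * ennreal (4 * (1 / 4) ^ n)) \<longlonglongrightarrow> (\<integral>\<^sup>+\<omega>. V \<omega> \<partial>M) * ennreal 0"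
      by (rule ennreal_tendsto_cmult[OF Vint[unfolded infinity_ennreal_def]])
    then show ?thesis by (simp add: mult.commute)
  qed
  have "(\<lambda>n. \<integral>\<^sup>+\<omega>. sup_sq (\<lambda>s \<omega>. X n s \<omega> - Y s \<omega>) T \<omega> \<partial>M) \<longlonglongrightarrow> 0"
    by (rule tendsto_sandwich[OF eventuallyI eventuallyI tendsto_const lim]) (rule zero_le, rule le)
  with YA show ?thesis by (rule that)
qed

end

section \<open>Approximation by simple processes\<close>

text \<open>
  On each cell of the mesh \<open>d\<close> the function is replaced by its mean over the previous cell, so that
  the approximation of a progressively measurable process is nonanticipating.
\<close>

definition lag_avg :: "real \<Rightarrow> (real \<Rightarrow> 'e::{banach, second_countable_topology}) \<Rightarrow> real \<Rightarrow> 'e" where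
  "lag_avg d f t = (1 / d) *\<^sub>R (LINT u|lborel. indicator {u. \<lceil>u / d\<rceil> + 1 = \<lceil>t / d\<rceil>} u *\<^sub>R f u)"

lemma cell_eq:
  assumes "0 < d"
  shows "{u. \<lceil>u / d\<rceil> = k} = {(of_int k - 1) * d <.. of_int k * d}"
  using assms by (auto simp: ceiling_eq_iff field_simps)

lemma lag_cell_eq:
  assumes "0 < d"
  shows "{u. \<lceil>u / d\<rceil> + 1 = \<lceil>t / d\<rceil>} = {(of_int (\<lceil>t / d\<rceil> - 1) - 1) * d <.. of_int (\<lceil>t / d\<rceil> - 1) * d}"
    and "{t. \<lceil>u / d\<rceil> + 1 = \<lceil>t / d\<rceil>} = {(of_int (\<lceil>u / d\<rceil> + 1) - 1) * d <.. of_int (\<lceil>u / d\<rceil> + 1) * d}"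
  unfolding cell_eq[OF assms, symmetric] by auto

lemma emeasure_cell:
  assumes "0 < d"
  shows "emeasure lborel {(k - 1) * d <.. k * d} = ennreal d"
proof -
  have "(k - 1) * d \<le> k * d" using assms by (intro mult_right_mono) auto
  then show ?thesis by (simp add: algebra_simps)
qed

lemma lag_avg_diff:
  assumes "0 < d" "integrable lborel f" "integrable lborel g"
  shows "lag_avg d (\<lambda>u. f u - g u) t = lag_avg d f t - lag_avg d g t"
proof -
  have "integrable lborel (\<lambda>u. indicator {u. \<lceil>u / d\<rceil> + 1 = \<lceil>t / d\<rceil>} u *\<^sub>R h u)" if "integrable lborel h" for h :: "real \<Rightarrow> 'a"
    unfolding lag_cell_eq[OF assms(1)] by (rule integrable_mult_indicator[OF _ that]) simp
  from this[OF assms(2)] this[OF assms(3)] show ?thesis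
    by (simp add: lag_avg_def scaleR_diff_right)
qed

lemma lag_measurable:
  fixes d :: real
  shows "(\<lambda>(u, t). if \<lceil>u / d\<rceil> + 1 = \<lceil>t / d\<rceil> then (1 :: real) else 0) \<in> borel_measurable (lborel \<Otimes>\<^sub>M lborel)"
proof -
  have "(\<lambda>(u, t). if real_of_int \<lceil>u / d\<rceil> + 1 = real_of_int \<lceil>t / d\<rceil> then (1 :: real) else 0) \<in> borel_measurable (lborel \<Otimes>\<^sub>M lborel)"
  proof -
    have "(\<lambda>x::real. real_of_int \<lceil>x\<rceil>) \<in> borel_measurable borel" by measurable
    from measurable_compose[OF _ this, of "\<lambda>x::real. x / d" borel]
    have "(\<lambda>x. real_of_int \<lceil>x / d\<rceil>) \<in> borel_measurable borel" by simp
    then have c: "(\<lambda>x. real_of_int \<lceil>x / d\<rceil>) \<in> borel_measurable lborel" by simp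
    have "(\<lambda>p. real_of_int \<lceil>fst p / d\<rceil> + 1) \<in> borel_measurable (lborel \<Otimes>\<^sub>M lborel)"
      "(\<lambda>p. real_of_int \<lceil>snd p / d\<rceil>) \<in> borel_measurable (lborel \<Otimes>\<^sub>M lborel)"
      using measurable_compose[OF measurable_fst c] measurable_compose[OF measurable_snd c] by auto
    from borel_measurable_eq[OF this] show ?thesis
      unfolding split_beta' by (intro measurable_If) auto
  qed
  moreover have "(real_of_int a + 1 = real_of_int b) = (a + 1 = b)" for a b
    by (metis of_int_1 of_int_add of_int_eq_iff)
  ultimately show ?thesis by simp
qed

lemma lag_avg_measurable [measurable]:
  fixes f :: "real \<Rightarrow> 'e::{banach, second_countable_topology}"
  assumes f: "f \<in> borel_measurable borel"
  shows "lag_avg d f \<in> borel_measurable borel"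
proof -
  have [measurable]: "f \<in> borel_measurable lborel" using f by simp
  have m: "(\<lambda>p. if \<lceil>fst p / d\<rceil> + 1 = \<lceil>snd p / d\<rceil> then (1 :: real) else 0) \<in> borel_measurable (lborel \<Otimes>\<^sub>M lborel)"
    using lag_measurable[of d] by (simp add: split_beta')
  have "(\<lambda>p. if \<lceil>snd p / d\<rceil> + 1 = \<lceil>fst p / d\<rceil> then (1 :: real) else 0) \<in> borel_measurable (lborel \<Otimes>\<^sub>M lborel)"
    using measurable_compose[OF measurable_Pair[OF measurable_snd measurable_fst] m] by simp
  moreover have "(\<lambda>p. f (snd p)) \<in> borel_measurable (lborel \<Otimes>\<^sub>M lborel)" by measurable
  ultimately have "(\<lambda>p. (if \<lceil>snd p / d\<rceil> + 1 = \<lceil>fst p / d\<rceil> then 1 else 0 :: real) *\<^sub>R f (snd p)) \<in> borel_measurable (lborel \<Otimes>\<^sub>M lborel)"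
    by (rule borel_measurable_scaleR)
  then have "(\<lambda>t. LINT u|lborel. (if \<lceil>u / d\<rceil> + 1 = \<lceil>t / d\<rceil> then 1 else 0 :: real) *\<^sub>R f u) \<in> borel_measurable lborel"
    by (intro lborel.borel_measurable_lebesgue_integral) (simp add: split_beta')
  then have "(\<lambda>t. (1 / d) *\<^sub>R (LINT u|lborel. (if \<lceil>u / d\<rceil> + 1 = \<lceil>t / d\<rceil> then 1 else 0 :: real) *\<^sub>R f u)) \<in> borel_measurable borel"
    by measurable
  moreover have "lag_avg d f t = (1 / d) *\<^sub>R (LINT u|lborel. (if \<lceil>u / d\<rceil> + 1 = \<lceil>t / d\<rceil> then 1 else 0 :: real) *\<^sub>R f u)" for t
    unfolding lag_avg_def by (intro arg_cong[where f="scaleR (1 / d)"] Bochner_Integration.integral_cong) (auto simp: indicator_def)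
  ultimately show ?thesis by (simp cong: measurable_cong)
qed

text \<open>Lagged averaging is an integral operator with a nonnegative kernel. Each
  \<open>u\<close> enters the average exactly for the \<open>t\<close> in the next cell, of length
  \<open>d\<close>, with weight \<open>1 / d\<close>; so the kernel has mass 1 in \<open>t\<close>,
  and exchanging the integrals gives a contraction in L1.\<close>

lemma lag_avg_contraction:
  fixes f :: "real \<Rightarrow> 'e::{banach, second_countable_topology}"
  assumes d: "0 < d" and f: "integrable lborel f"
  shows "(\<integral>\<^sup>+t. ennreal (norm (lag_avg d f t)) \<partial>lborel) \<le> (\<integral>\<^sup>+u. ennreal (norm (f u)) \<partial>lborel)"
proof -
  let ?k = "\<lambda>u t. if \<lceil>u / d\<rceil> + 1 = \<lceil>t / d\<rceil> then (1 :: real) else 0"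
  have fm[measurable]: "f \<in> borel_measurable lborel" using f by auto
  have kk: "ennreal (?k u t) = indicator {u. \<lceil>u / d\<rceil> + 1 = \<lceil>t / d\<rceil>} u" "ennreal (?k u t) = indicator {t. \<lceil>u / d\<rceil> + 1 = \<lceil>t / d\<rceil>} t" for u t
    by (auto simp: indicator_def)
  have "ennreal (norm (lag_avg d f t)) \<le> (\<integral>\<^sup>+u. ennreal (1 / d) * (ennreal (?k u t) * ennreal (norm (f u))) \<partial>lborel)" for t
  proof -
    let ?g = "\<lambda>u. indicator {u. \<lceil>u / d\<rceil> + 1 = \<lceil>t / d\<rceil>} u *\<^sub>R f u"
    have g: "integrable lborel ?g"
      unfolding lag_cell_eq[OF d] by (rule integrable_mult_indicator[OF _ f]) simp
    have "ennreal (norm (lag_avg d f t)) = ennreal (1 / d) * ennreal (norm (integral\<^sup>L lborel ?g))"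
      unfolding lag_avg_def using d by (subst ennreal_mult'[symmetric]) simp_all
    also have "\<dots> \<le> ennreal (1 / d) * (\<integral>\<^sup>+u. ennreal (norm (?g u)) \<partial>lborel)"
      by (intro mult_left_mono integral_norm_bound_ennreal g) simp
    also have "(\<integral>\<^sup>+u. ennreal (norm (?g u)) \<partial>lborel) = (\<integral>\<^sup>+u. ennreal (?k u t) * ennreal (norm (f u)) \<partial>lborel)"
      by (intro nn_integral_cong) (auto simp: indicator_def)
    also have "ennreal (1 / d) * \<dots> = (\<integral>\<^sup>+u. ennreal (1 / d) * (ennreal (?k u t) * ennreal (norm (f u))) \<partial>lborel)"
    proof (rule nn_integral_cmult[symmetric])
      show "(\<lambda>u. ennreal (?k u t) * ennreal (norm (f u))) \<in> borel_measurable lborel"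
        unfolding kk(1) lag_cell_eq[OF d] by measurable
    qed
    finally show ?thesis .
  qed
  then have "(\<integral>\<^sup>+t. ennreal (norm (lag_avg d f t)) \<partial>lborel) \<le> (\<integral>\<^sup>+t. \<integral>\<^sup>+u. ennreal (1 / d) * (ennreal (?k u t) * ennreal (norm (f u))) \<partial>lborel \<partial>lborel)"
    by (rule nn_integral_mono)
  also have "\<dots> = (\<integral>\<^sup>+u. \<integral>\<^sup>+t. ennreal (1 / d) * (ennreal (?k u t) * ennreal (norm (f u))) \<partial>lborel \<partial>lborel)"
  proof (rule lborel_pair.Fubini')
    have "(\<lambda>p. ennreal (1 / d) * (ennreal (case p of (u, t) \<Rightarrow> ?k u t) * ennreal (norm (f (fst p))))) \<in> borel_measurable (lborel \<Otimes>\<^sub>M lborel)"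
      using lag_measurable[of d] by (intro borel_measurable_times_ennreal measurable_compose[OF _ measurable_ennreal]) measurable
    then show "(\<lambda>(u, t). ennreal (1 / d) * (ennreal (?k u t) * ennreal (norm (f u)))) \<in> borel_measurable (lborel \<Otimes>\<^sub>M lborel)"
      by (simp add: split_beta')
  qed
  also have "\<dots> = (\<integral>\<^sup>+u. ennreal (norm (f u)) \<partial>lborel)"
  proof (rule nn_integral_cong)
    fix u
    have "(\<integral>\<^sup>+t. ennreal (1 / d) * (ennreal (?k u t) * ennreal (norm (f u))) \<partial>lborel)
      = (\<integral>\<^sup>+t. (ennreal (1 / d) * ennreal (norm (f u))) * indicator {(of_int (\<lceil>u / d\<rceil> + 1) - 1) * d <.. of_int (\<lceil>u / d\<rceil> + 1) * d} t \<partial>lborel)"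
      unfolding kk(2) lag_cell_eq[OF d] by (simp only: mult_ac)
    also have "\<dots> = (ennreal (1 / d) * ennreal (norm (f u))) * ennreal d"
      by (subst nn_integral_cmult_indicator) (simp, simp only: emeasure_cell[OF d])
    also have "\<dots> = ennreal (norm (f u))"
      using d by (simp add: ennreal_mult'[symmetric] ennreal_mult''[symmetric])
    finally show "(\<integral>\<^sup>+t. ennreal (1 / d) * (ennreal (?k u t) * ennreal (norm (f u))) \<partial>lborel) = ennreal (norm (f u))" .
  qed
  finally show ?thesis .
qed

definition lag_error :: "real \<Rightarrow> (real \<Rightarrow> 'e::{banach, second_countable_topology}) \<Rightarrow> ennreal" where
  "lag_error d f = (\<integral>\<^sup>+t. ennreal (norm (lag_avg d f t - f t)) \<partial>lborel)"

text \<open>Replacing \<open>f\<close> by \<open>g\<close> costs its L1 distance twice, once under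
  the average and once outside. The constant does not depend on \<open>d\<close>, so convergence of
  the error to 0 is stable under L1 approximation.\<close>

lemma lag_error_triangle:
  fixes f g :: "real \<Rightarrow> 'e::{banach, second_countable_topology}"
  assumes d: "0 < d" and f: "integrable lborel f" and g: "integrable lborel g"
  shows "lag_error d f \<le> lag_error d g + 2 * (\<integral>\<^sup>+t. ennreal (norm (f t - g t)) \<partial>lborel)"
proof -
  have fg: "integrable lborel (\<lambda>u. f u - g u)" using f g by simp
  have [measurable]: "f \<in> borel_measurable borel" "g \<in> borel_measurable borel" using f g by auto
  have "lag_error d f \<le> (\<integral>\<^sup>+t. (ennreal (norm (lag_avg d (\<lambda>u. f u - g u) t)) + ennreal (norm (lag_avg d g t - g t))) + ennreal (norm (f t - g t)) \<partial>lborel)"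
    unfolding lag_error_def
  proof (rule nn_integral_mono)
    fix t
    have "norm (lag_avg d f t - f t) = norm ((lag_avg d (\<lambda>u. f u - g u) t + (lag_avg d g t - g t)) + (g t - f t))"
      by (simp add: lag_avg_diff[OF d f g])
    also have "\<dots> \<le> (norm (lag_avg d (\<lambda>u. f u - g u) t) + norm (lag_avg d g t - g t)) + norm (f t - g t)"
      by (rule order_trans[OF norm_triangle_ineq add_mono[OF norm_triangle_ineq]]) (simp add: norm_minus_commute)
    finally show "ennreal (norm (lag_avg d f t - f t)) \<le> (ennreal (norm (lag_avg d (\<lambda>u. f u - g u) t)) + ennreal (norm (lag_avg d g t - g t))) + ennreal (norm (f t - g t))"
      by (simp add: ennreal_plus[symmetric] del: ennreal_plus)
  qed
  also have "\<dots> = ((\<integral>\<^sup>+t. ennreal (norm (lag_avg d (\<lambda>u. f u - g u) t)) \<partial>lborel) + lag_error d g) + (\<integral>\<^sup>+t. ennreal (norm (f t - g t)) \<partial>lborel)"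
    unfolding lag_error_def by (subst nn_integral_add; measurable?)+
  also have "\<dots> \<le> ((\<integral>\<^sup>+t. ennreal (norm (f t - g t)) \<partial>lborel) + lag_error d g) + (\<integral>\<^sup>+t. ennreal (norm (f t - g t)) \<partial>lborel)"
    by (intro add_right_mono lag_avg_contraction[OF d fg])
  finally show ?thesis by (simp add: mult_2 ac_simps)
qed

section \<open>Convergence in L1 of lagged averages as the mesh vanishes\<close>

context
  fixes d :: "nat \<Rightarrow> real"
  assumes d: "\<And>n. 0 < d n" "d \<longlonglongrightarrow> 0"
begin

text \<open>Closure under dominated pointwise limits, the limit step of the inductions below over
  Borel sets and over integrable functions.\<close>

lemma lag_error_closed:
  fixes f :: "real \<Rightarrow> 'e::{banach, second_countable_topology}"
  assumes s: "\<And>i::nat. integrable lborel (s i)" "\<And>i. (\<lambda>n. lag_error (d n) (s i)) \<longlonglongrightarrow> 0"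
    and f: "integrable lborel f" and lim: "\<And>x. (\<lambda>i. s i x) \<longlonglongrightarrow> f x"
    and w: "integrable lborel w" "\<And>i x. norm (s i x) \<le> w x"
  shows "(\<lambda>n. lag_error (d n) f) \<longlonglongrightarrow> 0"
proof (rule order_tendstoI)
  fix e :: ennreal assume e: "0 < e"
  have w0: "0 \<le> w x" for x by (rule order_trans[OF norm_ge_zero w(2)])
  have "(\<lambda>i. \<integral>\<^sup>+x. norm (f x - s i x) \<partial>lborel) \<longlonglongrightarrow> 0"
  proof (rule nn_integral_dominated_convergence_norm[where w=w])
    show "(\<integral>\<^sup>+x. ennreal (w x) \<partial>lborel) < \<infinity>" using w(1) w0 by (simp add: nn_integral_eq_integral)
  qed (use s(1) f lim w in auto)
  moreover obtain a where a: "0 < a" "2 * a < e"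
  proof -
    from dense[OF e] obtain b where b: "0 < b" "b < e" by auto
    then have "0 < b / 2" "2 * (b / 2) = b" by (auto simp: ennreal_zero_less_divide ennreal_times_divide ennreal_mult_divide_eq mult.commute[of 2])
    then show ?thesis using b by (intro that[of "b / 2"]) auto
  qed
  ultimately have "\<forall>\<^sub>F i in sequentially. (\<integral>\<^sup>+x. norm (f x - s i x) \<partial>lborel) < a" by (intro order_tendstoD(2)) auto
  then obtain i where i: "(\<integral>\<^sup>+x. norm (f x - s i x) \<partial>lborel) < a" by (auto simp: eventually_sequentially)
  have lt: "2 * (\<integral>\<^sup>+x. norm (f x - s i x) \<partial>lborel) < e"
    by (rule le_less_trans[OF mult_left_mono[OF less_imp_le[OF i]] a(2)]) simp
  have "(\<lambda>n. lag_error (d n) (s i) + 2 * (\<integral>\<^sup>+x. norm (f x - s i x) \<partial>lborel)) \<longlonglongrightarrow> 0 + 2 * (\<integral>\<^sup>+x. norm (f x - s i x) \<partial>lborel)"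
    by (intro tendsto_add s(2) tendsto_const)
  then have "\<forall>\<^sub>F n in sequentially. lag_error (d n) (s i) + 2 * (\<integral>\<^sup>+x. norm (f x - s i x) \<partial>lborel) < e"
    by (rule order_tendstoD(2)) (use lt in simp)
  then show "\<forall>\<^sub>F n in sequentially. lag_error (d n) f < e"
    by eventually_elim (rule le_less_trans[OF lag_error_triangle[OF d(1) f s(1)]])
qed auto

text \<open>Stated for differences: complements of sets use it directly, and sums follow by applying
  it twice, with \<open>0 - g\<close> in between.\<close>

lemma lag_error_add:
  fixes f g :: "real \<Rightarrow> 'e::{banach, second_countable_topology}"
  assumes "integrable lborel f" "integrable lborel g"
    "(\<lambda>n. lag_error (d n) f) \<longlonglongrightarrow> 0" "(\<lambda>n. lag_error (d n) g) \<longlonglongrightarrow> 0"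
  shows "(\<lambda>n. lag_error (d n) (\<lambda>u. f u - g u)) \<longlonglongrightarrow> 0"
proof (rule tendsto_sandwich[OF eventuallyI eventuallyI tendsto_const])
  show "(\<lambda>n. lag_error (d n) f + lag_error (d n) g) \<longlonglongrightarrow> 0" using tendsto_add[OF assms(3,4)] by simp
  fix n
  have [measurable]: "f \<in> borel_measurable borel" "g \<in> borel_measurable borel" using assms by auto
  have "lag_error (d n) (\<lambda>u. f u - g u) \<le> (\<integral>\<^sup>+t. ennreal (norm (lag_avg (d n) f t - f t)) + ennreal (norm (lag_avg (d n) g t - g t)) \<partial>lborel)"
    unfolding lag_error_def
  proof (rule nn_integral_mono)
    fix t
    have "norm (lag_avg (d n) (\<lambda>u. f u - g u) t - (f t - g t)) = norm ((lag_avg (d n) f t - f t) - (lag_avg (d n) g t - g t))"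
      by (simp add: lag_avg_diff[OF d(1) assms(1,2)] algebra_simps)
    also have "\<dots> \<le> norm (lag_avg (d n) f t - f t) + norm (lag_avg (d n) g t - g t)" by (rule norm_triangle_ineq4)
    finally show "ennreal (norm (lag_avg (d n) (\<lambda>u. f u - g u) t - (f t - g t))) \<le> ennreal (norm (lag_avg (d n) f t - f t)) + ennreal (norm (lag_avg (d n) g t - g t))"
      by (simp add: ennreal_plus[symmetric] del: ennreal_plus)
  qed
  also have "\<dots> = lag_error (d n) f + lag_error (d n) g"
    unfolding lag_error_def by (rule nn_integral_add) measurable
  finally show "lag_error (d n) (\<lambda>u. f u - g u) \<le> lag_error (d n) f + lag_error (d n) g" .
qed simp

text \<open>The averaged cell lies between \<open>t - 2 * d\<close> and \<open>t\<close>. Unless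
  \<open>t\<close> is within \<open>2 * d\<close> of an end point of the interval, the function is
  constant from that cell to \<open>t\<close> and the error is exactly 0. The exceptional set
  consists of two intervals of length \<open>4 * d\<close>, whence the 8.\<close>

lemma lag_error_interval:
  fixes c :: "'e::{banach, second_countable_topology}"
  shows "(\<lambda>n. lag_error (d n) (\<lambda>u. indicator {a..b} u *\<^sub>R c)) \<longlonglongrightarrow> 0"
proof (rule tendsto_sandwich[OF eventuallyI eventuallyI tendsto_const])
  have "(\<lambda>n. norm c * (8 * d n)) \<longlonglongrightarrow> norm c * (8 * 0)" by (intro tendsto_intros d)
  then show "(\<lambda>n. ennreal (norm c * (8 * d n))) \<longlonglongrightarrow> 0" using tendsto_ennrealI by fastforce
  fix n
  let ?d = "d n" and ?f = "\<lambda>u. indicator {a..b} u *\<^sub>R c"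
  let ?B = "{a - 2 * ?d..a + 2 * ?d} \<union> {b - 2 * ?d..b + 2 * ?d}"
  have bnd: "norm (lag_avg ?d ?f t - ?f t) \<le> norm c * indicator ?B t" for t
  proof -
    define k where "k = real_of_int (\<lceil>t / ?d\<rceil> - 1)"
    let ?C = "{(k - 1) * ?d <.. k * ?d}"
    have k: "k < t / ?d" "t / ?d \<le> k + 1" unfolding k_def by linarith+
    then have kt: "k * ?d < t" "t \<le> (k + 1) * ?d" using d(1)[of n] by (simp_all add: field_simps)
    have "(LINT u|lborel. indicator ?C u *\<^sub>R ?f u) = (LINT u|lborel. indicator (?C \<inter> {a..b}) u *\<^sub>R c)"
      by (intro Bochner_Integration.integral_cong) (auto simp: indicator_def)
    also have "\<dots> = measure lborel (?C \<inter> {a..b}) *\<^sub>R c"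
    proof -
      have "emeasure lborel (?C \<inter> {a..b}) \<le> emeasure lborel ?C" by (intro emeasure_mono) auto
      then have "integrable lborel (indicator (?C \<inter> {a..b}) :: real \<Rightarrow> real)"
        unfolding emeasure_cell[OF d(1)] by (intro integrable_real_indicator) (auto intro: le_less_trans)
      then show ?thesis by (subst integral_scaleR_left) auto
    qed
    finally have L: "lag_avg ?d ?f t = (measure lborel (?C \<inter> {a..b}) / ?d) *\<^sub>R c"
      unfolding lag_avg_def lag_cell_eq[OF d(1)] k_def by simp
    have mC: "measure lborel ?C = ?d" using emeasure_cell[OF d(1)[of n], of k] d(1)[of n] by (simp add: measure_def)
    have "?C \<in> fmeasurable lborel"
      unfolding fmeasurable_def mem_Collect_eq emeasure_cell[OF d(1)] by simp
    then have "measure lborel (?C \<inter> {a..b}) \<le> measure lborel ?C"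
      by (intro measure_mono_fmeasurable) simp_all
    then have "measure lborel (?C \<inter> {a..b}) \<le> ?d" unfolding mC .
    then have r: "0 \<le> measure lborel (?C \<inter> {a..b}) / ?d" "measure lborel (?C \<inter> {a..b}) / ?d \<le> 1"
      using d(1)[of n] by (auto simp: divide_le_eq_1)
    have eq: "norm (lag_avg ?d ?f t - ?f t) = \<bar>measure lborel (?C \<inter> {a..b}) / ?d - indicator {a..b} t\<bar> * norm c"
      unfolding L scaleR_diff_left[symmetric] by simp
    show ?thesis
    proof (cases "t \<in> ?B")
      case True
      have "\<bar>measure lborel (?C \<inter> {a..b}) / ?d - indicator {a..b} t\<bar> \<le> 1" using r by (auto simp: indicator_def)
      from mult_right_mono[OF this norm_ge_zero[of c]] show ?thesis unfolding eq using True by simp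
    next
      case False
      have C: "t - 2 * ?d \<le> u" "u \<le> t" if "u \<in> ?C" for u
        using that kt by (auto simp: algebra_simps)
      have "measure lborel (?C \<inter> {a..b}) / ?d = indicator {a..b} t"
      proof (cases "t \<in> {a..b}")
        case True
        then have "?C \<inter> {a..b} = ?C" using False C d(1)[of n] by fastforce
        then show ?thesis using mC d(1)[of n] True by simp
      next
        case out: False
        then have "?C \<inter> {a..b} = {}" using False C d(1)[of n] by fastforce
        then show ?thesis using out by simp
      qed
      then show ?thesis unfolding eq by simp
    qed
  qed
  have "ennreal (norm (lag_avg ?d ?f t - ?f t)) \<le> ennreal (norm c) * indicator ?B t" for t
    using ennreal_leI[OF bnd[of t]] by (simp only: ennreal_mult'[OF norm_ge_zero] ennreal_indicator)
  then have "lag_error ?d ?f \<le> (\<integral>\<^sup>+t. ennreal (norm c) * indicator ?B t \<partial>lborel)"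
    unfolding lag_error_def by (rule nn_integral_mono)
  also have "\<dots> = ennreal (norm c) * emeasure lborel ?B" by (rule nn_integral_cmult_indicator) auto
  also have "\<dots> \<le> ennreal (norm c) * ennreal (8 * ?d)"
  proof (rule mult_left_mono)
    have "emeasure lborel ?B \<le> emeasure lborel {a - 2 * ?d..a + 2 * ?d} + emeasure lborel {b - 2 * ?d..b + 2 * ?d}"
      by (rule emeasure_subadditive) auto
    also have "\<dots> = ennreal (8 * ?d)" using d(1)[of n] by (simp add: ennreal_plus[symmetric] del: ennreal_plus)
    finally show "emeasure lborel ?B \<le> ennreal (8 * ?d)" .
  qed simp
  also have "\<dots> = ennreal (norm c * (8 * ?d))" by (rule ennreal_mult'[symmetric]) simp
  finally show "lag_error ?d ?f \<le> ennreal (norm c * (8 * ?d))" .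
qed simp

lemma lag_error_zero: "lag_error (d n) (\<lambda>_. 0 :: 'e::{banach, second_countable_topology}) = 0"
  by (simp add: lag_error_def lag_avg_def)

lemma integrable_indicator_Int_interval:
  assumes "A \<in> sets borel"
  shows "integrable lborel (\<lambda>u. indicator (A \<inter> {- N..N :: real}) u *\<^sub>R (c :: 'e::{banach, second_countable_topology}))"
proof (rule integrable_scaleR_left, rule integrable_real_indicator)
  show "A \<inter> {- N..N} \<in> sets lborel" using assms by auto
  have "emeasure lborel (A \<inter> {- N..N}) \<le> emeasure lborel {- N..N}" using assms by (intro emeasure_mono) auto
  also have "\<dots> < \<infinity>" by (simp add: emeasure_lborel_Icc_eq)
  finally show "emeasure lborel (A \<inter> {- N..N}) < \<infinity>" .
qed

text \<open>Induction over Borel sets from the intersection-stable generator of half-lines. The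
  intersection with \<open>{- N..N}\<close> keeps complements and countable unions
  integrable.\<close>

lemma lag_error_indicator_bounded:
  fixes c :: "'e::{banach, second_countable_topology}"
  assumes "A \<in> sets borel"
  shows "(\<lambda>n. lag_error (d n) (\<lambda>u. indicator (A \<inter> {- N..N}) u *\<^sub>R c)) \<longlonglongrightarrow> 0"
proof -
  have ms: "B \<in> sets borel" if "B \<in> sigma_sets UNIV (range (\<lambda>a::real. {..a}))" for B
    using that by (simp add: borel_eq_atMost)
  have "Int_stable (range (\<lambda>a::real. {..a}))" by (auto simp: Int_stable_def)
  moreover have "range (\<lambda>a::real. {..a}) \<subseteq> Pow UNIV" by simp
  moreover have "A \<in> sigma_sets UNIV (range (\<lambda>a::real. {..a}))" using assms by (simp add: borel_eq_atMost)
  ultimately show ?thesis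
  proof (induction A rule: sigma_sets_induct_disjoint)
    case (basic A)
    then obtain a where A: "A = {..a}" by auto
    have "A \<inter> {- N..N} = {- N..min a N}" unfolding A by auto
    then show ?case using lag_error_interval[of "- N" "min a N" c] by simp
  next
    case empty
    show ?case by (simp add: lag_error_zero)
  next
    case (compl A)
    have e: "indicator ((UNIV - A) \<inter> {- N..N}) u *\<^sub>R c = indicator {- N..N} u *\<^sub>R c - indicator (A \<inter> {- N..N}) u *\<^sub>R c" for u
      by (auto simp: indicator_def)
    show ?case unfolding e
      by (intro lag_error_add compl lag_error_interval integrable_indicator_Int_interval ms)
         (use integrable_indicator_Int_interval[of UNIV N c] compl in auto)
  next
    case (union A)
    have Am: "A i \<in> sets borel" for i using union(2) ms by auto
    let ?s = "\<lambda>i u. indicator ((\<Union>j<i. A j) \<inter> {- N..N}) u *\<^sub>R c"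
    have si: "integrable lborel (?s i)" for i by (intro integrable_indicator_Int_interval sets.finite_UN Am) auto
    show ?case
    proof (rule lag_error_closed[where s="?s" and w="\<lambda>u. indicator (UNIV \<inter> {- N..N}) u *\<^sub>R norm c"])
      show "integrable lborel (?s i)" for i by (rule si)
      show "(\<lambda>n. lag_error (d n) (?s i)) \<longlonglongrightarrow> 0" for i
      proof (induction i)
        case 0 show ?case by (simp add: lag_error_zero)
      next
        case (Suc i)
        have n: "integrable lborel (\<lambda>u. 0 - indicator (A i \<inter> {- N..N}) u *\<^sub>R c)"
          by (intro Bochner_Integration.integrable_diff integrable_indicator_Int_interval Am) simp
        have "(\<lambda>n. lag_error (d n) (\<lambda>u. 0 - indicator (A i \<inter> {- N..N}) u *\<^sub>R c)) \<longlonglongrightarrow> 0"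
          by (intro lag_error_add union(3) integrable_indicator_Int_interval Am) (auto simp: lag_error_zero)
        from lag_error_add[OF si n Suc this]
        have "(\<lambda>n. lag_error (d n) (\<lambda>u. ?s i u - (0 - indicator (A i \<inter> {- N..N}) u *\<^sub>R c))) \<longlonglongrightarrow> 0" .
        moreover have "?s i u - (0 - indicator (A i \<inter> {- N..N}) u *\<^sub>R c) = ?s (Suc i) u" for u
        proof -
          have "\<not> (u \<in> A i \<and> (\<exists>j<i. u \<in> A j))"
          proof
            assume "u \<in> A i \<and> (\<exists>j<i. u \<in> A j)"
            then obtain j where "u \<in> A i" "j < i" "u \<in> A j" by auto
            with disjoint_family_onD[OF union(1), of i j] show False by auto
          qed
          then show ?thesis by (auto simp: indicator_def lessThan_Suc)
        qed
        ultimately show ?case by simp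
      qed
      show "integrable lborel (\<lambda>u. indicator (\<Union> (range A) \<inter> {- N..N}) u *\<^sub>R c)"
        by (intro integrable_indicator_Int_interval) (use Am in auto)
      show "(\<lambda>i. ?s i x) \<longlonglongrightarrow> indicator (\<Union> (range A) \<inter> {- N..N}) x *\<^sub>R c" for x
      proof (cases "x \<in> \<Union> (range A)")
        case True
        then obtain j where j: "x \<in> A j" by auto
        show ?thesis
        proof (rule tendsto_eventually, rule eventually_sequentiallyI)
          fix i assume "Suc j \<le> i"
          then have "x \<in> (\<Union>j<i. A j)" using j by auto
          then show "?s i x = indicator (\<Union> (range A) \<inter> {- N..N}) x *\<^sub>R c" using True by (auto simp: indicator_def)
        qed
      next
        case False
        then have e: "?s i x = indicator (\<Union> (range A) \<inter> {- N..N}) x *\<^sub>R c" for i by (auto simp: indicator_def)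
        show ?thesis unfolding e by (rule tendsto_const)
      qed
      show "integrable lborel (\<lambda>u. indicator (UNIV \<inter> {- N..N}) u *\<^sub>R norm c)"
        by (rule integrable_indicator_Int_interval) simp
      show "norm (?s i x) \<le> indicator (UNIV \<inter> {- N..N}) x *\<^sub>R norm c" for i x by (auto simp: indicator_def)
    qed
  qed
qed

lemma lag_error_tendsto_0:
  fixes f :: "real \<Rightarrow> 'e::{banach, second_countable_topology}"
  assumes "integrable lborel f"
  shows "(\<lambda>n. lag_error (d n) f) \<longlonglongrightarrow> 0"
  using assms
proof (induction rule: integrable_induct)
  case (base A c)
  then have Ab: "A \<in> sets borel" by simp
  have iA: "integrable lborel (\<lambda>u. indicator A u *\<^sub>R z)" for z :: "'z::{banach, second_countable_topology}"
    using base by (intro integrable_scaleR_left integrable_real_indicator) auto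
  show ?case
  proof (rule lag_error_closed[where s="\<lambda>i u. indicator (A \<inter> {- real i..real i}) u *\<^sub>R c" and w="\<lambda>u. indicator A u *\<^sub>R norm c"])
    show "(\<lambda>i. indicator (A \<inter> {- real i..real i}) x *\<^sub>R c) \<longlonglongrightarrow> indicator A x *\<^sub>R c" for x
    proof -
      obtain k :: nat where k: "\<bar>x\<bar> \<le> real k" using real_arch_simple by blast
      show ?thesis
      proof (rule tendsto_eventually, rule eventually_sequentiallyI)
        fix i assume "k \<le> i"
        then have "\<bar>x\<bar> \<le> real i" using k by linarith
        then show "indicator (A \<inter> {- real i..real i}) x *\<^sub>R c = indicator A x *\<^sub>R c" by (auto simp: indicator_def)
      qed
    qed
    show "norm (indicator (A \<inter> {- real i..real i}) x *\<^sub>R c) \<le> indicator A x *\<^sub>R norm c" for i x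
      by (auto simp: indicator_def)
  qed (intro integrable_indicator_Int_interval lag_error_indicator_bounded Ab iA)+
next
  case (add f g)
  have n: "integrable lborel (\<lambda>u. 0 - g u)" using add.hyps(2) by simp
  have "(\<lambda>n. lag_error (d n) (\<lambda>u. 0 - g u)) \<longlonglongrightarrow> 0"
    by (rule lag_error_add[OF _ add.hyps(2) _ add.IH(2)]) (simp_all add: lag_error_zero)
  from lag_error_add[OF add.hyps(1) n add.IH(1) this] show ?case by simp
next
  case (lim f s)
  show ?case
  proof (rule lag_error_closed[where s=s and w="\<lambda>x. 2 * norm (f x)"])
    show "integrable lborel (s i)" for i by (rule lim.hyps(1))
    show "(\<lambda>n. lag_error (d n) (s i)) \<longlonglongrightarrow> 0" for i by (rule lim.IH)
    show "(\<lambda>i. s i x) \<longlonglongrightarrow> f x" for x by (rule lim.hyps(2)) simp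
    show "norm (s i x) \<le> 2 * norm (f x)" for i x by (rule lim.hyps(3)) simp
    show f: "integrable lborel f" by (rule lim.hyps(4))
    show "integrable lborel (\<lambda>x. 2 * norm (f x))" by (intro integrable_mult_right integrable_norm f)
  qed
qed

end

section \<open>Weighted path spaces\<close>

lemma clam_norm_upper:
  assumes "bdd_above ((\<lambda>\<theta>. exp (l * \<theta>) * norm (x \<theta>)) ` {..\<tau>})" "\<theta> \<le> \<tau>"
  shows "exp (l * \<theta>) * norm (x \<theta>) \<le> clam_norm l \<tau> x"
  unfolding clam_norm_def using assms by (intro cSUP_upper) auto

lemma clam_norm_least:
  assumes "\<And>\<theta>. \<theta> \<le> \<tau> \<Longrightarrow> exp (l * \<theta>) * norm (x \<theta>) \<le> c"
  shows "clam_norm l \<tau> x \<le> c"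
  unfolding clam_norm_def using assms by (intro cSUP_least) auto

lemma Clam_zero: "(\<lambda>_. 0) \<in> Clam l \<tau>"
  by (auto simp: Clam_def)

lemma Clam_diff:
  assumes x: "x \<in> Clam l \<tau>" and y: "y \<in> Clam l \<tau>"
  shows "(\<lambda>\<theta>. x \<theta> - y \<theta>) \<in> Clam l \<tau>"
proof -
  obtain B where B: "\<And>\<theta>. \<theta> \<le> \<tau> \<Longrightarrow> exp (l * \<theta>) * norm (x \<theta>) \<le> B"
    using x by (auto simp: Clam_def bdd_above_def)
  obtain C where C: "\<And>\<theta>. \<theta> \<le> \<tau> \<Longrightarrow> exp (l * \<theta>) * norm (y \<theta>) \<le> C"
    using y by (auto simp: Clam_def bdd_above_def)
  have "exp (l * \<theta>) * norm (x \<theta> - y \<theta>) \<le> B + C" if "\<theta> \<le> \<tau>" for \<theta>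
  proof -
    have "exp (l * \<theta>) * norm (x \<theta> - y \<theta>) \<le> exp (l * \<theta>) * (norm (x \<theta>) + norm (y \<theta>))"
      by (intro mult_left_mono norm_triangle_ineq4) simp
    with B[OF that] C[OF that] show ?thesis by (simp add: distrib_left)
  qed
  then have "bdd_above ((\<lambda>\<theta>. exp (l * \<theta>) * norm (x \<theta> - y \<theta>)) ` {..\<tau>})"
    by (intro bdd_aboveI[of _ "B + C"]) auto
  moreover have "((\<lambda>\<theta>. exp (l * \<theta>) *\<^sub>R x \<theta> - exp (l * \<theta>) *\<^sub>R y \<theta>) \<longlongrightarrow> 0 - 0) at_bot"
    using x y by (intro tendsto_diff) (auto simp: Clam_def)
  ultimately show ?thesis
    using x y by (auto simp: Clam_def scaleR_diff_right intro: continuous_on_diff)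
qed

lemma Clam_upper:
  assumes "x \<in> Clam l \<tau>" "\<theta> \<le> \<tau>"
  shows "exp (l * \<theta>) * norm (x \<theta>) \<le> clam_norm l \<tau> x"
  using assms by (intro clam_norm_upper) (auto simp: Clam_def)

lemma Clam_diff_upper:
  assumes "x \<in> Clam l \<tau>" "y \<in> Clam l \<tau>" "\<theta> \<le> \<tau>"
  shows "exp (l * \<theta>) * norm (x \<theta> - y \<theta>) \<le> clam_norm l \<tau> (\<lambda>\<theta>. x \<theta> - y \<theta>)"
  using Clam_upper[OF Clam_diff[OF assms(1,2)] assms(3)] .

text \<open>Separability of the weighted path space: step functions with values in a countable dense
  set are uniformly dense around it, and each of them picks a nearby path.\<close>

definition step_path :: "(nat \<Rightarrow> 'h::real_normed_vector) \<Rightarrow> nat \<times> nat \<times> nat list \<Rightarrow> real \<Rightarrow> 'h" where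
  "step_path d = (\<lambda>(k, N, c) \<theta>. if \<theta> \<le> - real N then 0 else d (c ! nat \<lfloor>(\<theta> + real N) * real k\<rfloor>))"

lemma step_path_dense:
  fixes y :: "real \<Rightarrow> 'h::real_normed_vector"
  assumes d: "\<And>z e. e > 0 \<Longrightarrow> \<exists>n. dist (d n) z < e"
    and y: "continuous_on {..\<tau>} y" "(y \<longlongrightarrow> 0) at_bot" and e: "e > 0"
  shows "\<exists>c. \<forall>\<theta>\<le>\<tau>. dist (step_path d c \<theta>) (y \<theta>) \<le> e"
proof -
  from y(2) e have "eventually (\<lambda>\<theta>. dist (y \<theta>) 0 < e) at_bot" by (rule tendstoD)
  then obtain b where b: "\<And>\<theta>. \<theta> \<le> b \<Longrightarrow> dist (y \<theta>) 0 < e" by (auto simp: eventually_at_bot_linorder)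
  obtain N :: nat where N: "- b \<le> real N" using real_arch_simple by blast
  have "uniformly_continuous_on {- real N..\<tau>} y"
    by (intro compact_uniformly_continuous continuous_on_subset[OF y(1)]) auto
  then obtain r where r: "r > 0" "\<And>a b. a \<in> {- real N..\<tau>} \<Longrightarrow> b \<in> {- real N..\<tau>} \<Longrightarrow> dist a b < r \<Longrightarrow> dist (y a) (y b) < e / 2"
    using e unfolding uniformly_continuous_on_def by (metis half_gt_zero)
  obtain k :: nat where k: "1 / real (Suc k) < r" using r(1) nat_approx_posE by blast
  let ?k = "real (Suc k)"
  define t where "t j = - real N + real j / ?k" for j :: nat
  \<comment> \<open>The list must have an entry for every grid cell that meets
    \<open>{- N..\<tau>}\<close>. The cell index of \<theta> can be as large as this ceiling, hence
    the extra 1.\<close>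
  define m where "m = nat \<lceil>(\<tau> + real N) * ?k\<rceil> + 1"
  have "\<forall>j. \<exists>n. dist (d n) (y (t j)) < e / 2" by (intro allI d) (use e in simp)
  from choice[OF this] obtain cc where cc: "\<And>j. dist (d (cc j)) (y (t j)) < e / 2" by auto
  show ?thesis
  proof (intro exI allI impI)
    fix \<theta> assume th: "\<theta> \<le> \<tau>"
    show "dist (step_path d (Suc k, N, map cc [0..<m]) \<theta>) (y \<theta>) \<le> e"
    proof (cases "\<theta> \<le> - real N")
      case True
      then have "dist (y \<theta>) 0 < e" using N by (intro b) linarith
      then show ?thesis using True by (simp add: step_path_def dist_commute)
    next
      case False
      define j where "j = nat \<lfloor>(\<theta> + real N) * ?k\<rfloor>"
      have pos: "0 \<le> (\<theta> + real N) * ?k" using False by simp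
      then have j: "real j \<le> (\<theta> + real N) * ?k" "(\<theta> + real N) * ?k < real j + 1"
        unfolding j_def by linarith+
      have "(\<theta> + real N) * ?k \<le> (\<tau> + real N) * ?k" using th by (intro mult_right_mono) auto
      then have jm: "j < m" unfolding m_def using j(1) by linarith
      have "real j / ?k \<le> \<theta> + real N" "\<theta> + real N < real j / ?k + 1 / ?k"
        using j by (simp_all add: field_simps)
      then have tj: "t j \<le> \<theta>" "\<theta> - t j < r" "- real N \<le> t j" using k unfolding t_def by auto
      have "dist (y (t j)) (y \<theta>) < e / 2"
        using tj th by (intro r(2)) (auto simp: dist_real_def)
      moreover have "step_path d (Suc k, N, map cc [0..<m]) \<theta> = d (cc j)"
        using False jm unfolding step_path_def by (simp del: of_nat_Suc add: j_def[symmetric])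
      ultimately show ?thesis using cc[of j] dist_triangle[of "d (cc j)" "y \<theta>" "y (t j)"] by simp
    qed
  qed
qed

lemma Clam_separable:
  fixes l \<tau> :: real
  shows "\<exists>X :: nat \<Rightarrow> real \<Rightarrow> 'h::{real_normed_vector, second_countable_topology}.
    (\<forall>n. X n \<in> Clam l \<tau>) \<and> (\<forall>x\<in>Clam l \<tau>. \<forall>e>0. \<exists>n. \<forall>\<theta>\<le>\<tau>. exp (l * \<theta>) * norm (X n \<theta> - x \<theta>) \<le> e)"
proof -
  obtain D :: "'h set" where D: "countable D" "\<And>X. open X \<Longrightarrow> X \<noteq> {} \<Longrightarrow> \<exists>d\<in>D. d \<in> X"
    using countable_dense_setE by blast
  have "D \<noteq> {}" using D(2)[of UNIV] by auto
  have d: "\<exists>n. dist (from_nat_into D n) z < e" if "e > 0" for z :: 'h and e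
  proof -
    obtain x where "x \<in> D" "x \<in> ball z e" using D(2)[of "ball z e"] \<open>e > 0\<close> by auto
    then show ?thesis using from_nat_into_surj[OF D(1), of x] by (auto simp: dist_commute)
  qed
  \<comment> \<open>The step functions approximate the weighted path
    \<open>exp (l * \<theta>) *\<^sub>R x \<theta>\<close>, which tends to 0 at minus infinity. They
    need not be continuous, so each code \<open>c\<close> and accuracy \<open>m\<close> selects a
    member of \<open>Clam\<close> close to the step function, if there is one.\<close>
  let ?near = "\<lambda>c (m::nat) x. x \<in> Clam l \<tau> \<and> (\<forall>\<theta>\<le>\<tau>. dist (step_path (from_nat_into D) c \<theta>) (exp (l * \<theta>) *\<^sub>R x \<theta>) \<le> 1 / real (Suc m))"
  define Z where "Z c m = (if \<exists>x. ?near c m x then SOME x. ?near c m x else (\<lambda>_. 0))" for c m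
  have Z: "?near c m (Z c m)" if "\<exists>x. ?near c m x" for c m
    unfolding Z_def if_P[OF that] by (rule someI_ex[OF that])
  have ZC: "Z c m \<in> Clam l \<tau>" for c m
  proof (cases "\<exists>x. ?near c m x")
    case True
    then show ?thesis using Z by blast
  qed (unfold Z_def, simp only: if_False Clam_zero)
  let ?X = "\<lambda>n. case_prod Z (from_nat n)"
  show ?thesis
  proof (rule exI[of _ ?X], intro conjI allI ballI impI)
    show "?X n \<in> Clam l \<tau>" for n by (simp add: ZC split: prod.split)
    fix x :: "real \<Rightarrow> 'h" and e :: real assume x: "x \<in> Clam l \<tau>" and e: "e > 0"
    obtain m :: nat where m: "1 / real (Suc m) < e / 2" using nat_approx_posE[of "e / 2"] e by auto
    have "\<exists>c. \<forall>\<theta>\<le>\<tau>. dist (step_path (from_nat_into D) c \<theta>) (exp (l * \<theta>) *\<^sub>R x \<theta>) \<le> 1 / real (Suc m)"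
      by (rule step_path_dense[OF d]) (use x in \<open>auto simp: Clam_def intro!: continuous_intros\<close>)
    then obtain c where c: "?near c m x" using x by auto
    then have z: "?near c m (Z c m)" by (intro Z) blast
    show "\<exists>n. \<forall>\<theta>\<le>\<tau>. exp (l * \<theta>) * norm (?X n \<theta> - x \<theta>) \<le> e"
    proof (intro exI allI impI)
      fix \<theta> assume th: "\<theta> \<le> \<tau>"
      have "exp (l * \<theta>) * norm (Z c m \<theta> - x \<theta>) = dist (exp (l * \<theta>) *\<^sub>R Z c m \<theta>) (exp (l * \<theta>) *\<^sub>R x \<theta>)"
        by (simp add: dist_norm scaleR_diff_right[symmetric])
      also have "\<dots> \<le> 1 / real (Suc m) + 1 / real (Suc m)"
        by (rule order_trans[OF dist_triangle3[of _ _ "step_path (from_nat_into D) c \<theta>"] add_mono])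
           (use c z th in blast)+
      also have "\<dots> \<le> e" using m by simp
      finally show "exp (l * \<theta>) * norm (?X (to_nat (c, m)) \<theta> - x \<theta>) \<le> e" by simp
    qed
  qed
qed

section \<open>Measurability of coefficients along the past of a process\<close>

context brownian_basis
begin

text \<open>Time is rounded up to the dyadic grid and cut off at \<open>t\<close>. The rounded
  process takes values at countably many times not after \<open>t\<close>, so it is measurable with
  respect to \<open>F t\<close>, and continuity gives the limit.\<close>

lemma adapted_continuous_imp_prog_measurable:
  fixes X :: "real \<Rightarrow> 'w \<Rightarrow> 'h::{metric_space, second_countable_topology}"
  assumes X: "adapted_continuous F {..T} X" and t: "t \<le> T"
  shows "(\<lambda>(s, \<omega>). X s \<omega>) \<in> borel_measurable (restrict_space borel {..t} \<Otimes>\<^sub>M F t)"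
proof (rule borel_measurable_LIMSEQ_metric)
  fix n :: nat
  let ?f = "\<lambda>(i::int) (p :: real \<times> 'w). X (min t (real_of_int i / 2 ^ n)) (snd p)"
  have m1: "?f i \<in> borel_measurable (restrict_space borel {..t} \<Otimes>\<^sub>M F t)" for i
  proof -
    have "X (min t (real_of_int i / 2 ^ n)) \<in> borel_measurable (F (min t (real_of_int i / 2 ^ n)))"
      using X t by (auto simp: adapted_continuous_def)
    then have "X (min t (real_of_int i / 2 ^ n)) \<in> borel_measurable (F t)"
      by (rule measurable_F_mono[rotated]) simp
    then show ?thesis by (rule measurable_compose[OF measurable_snd])
  qed
  have "(\<lambda>s. \<lceil>s * 2 ^ n\<rceil>) \<in> measurable (restrict_space borel {..t}) (count_space UNIV)"
    by (rule measurable_restrict_space1) measurable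
  from measurable_compose[OF measurable_fst this]
  have m2: "(\<lambda>p. \<lceil>fst p * 2 ^ n\<rceil>) \<in> measurable (restrict_space borel {..t} \<Otimes>\<^sub>M F t) (count_space UNIV)" .
  from measurable_compose_countable[of ?f, OF m1 m2]
  show "(\<lambda>p. X (min t (real_of_int \<lceil>fst p * 2 ^ n\<rceil> / 2 ^ n)) (snd p)) \<in> borel_measurable (restrict_space borel {..t} \<Otimes>\<^sub>M F t)" .
next
  fix p assume p: "p \<in> space (restrict_space borel {..t} \<Otimes>\<^sub>M F t)"
  then have s: "fst p \<le> t" and w: "snd p \<in> space M" by (auto simp: space_pair_measure space_restrict_space space_F)
  have near: "\<bar>min t (real_of_int \<lceil>fst p * 2 ^ n\<rceil> / 2 ^ n) - fst p\<bar> \<le> (1/2) ^ n" for n :: nat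
  proof -
    let ?c = "real_of_int \<lceil>fst p * 2 ^ n\<rceil> / 2 ^ n"
    have "fst p * 2 ^ n \<le> real_of_int \<lceil>fst p * 2 ^ n\<rceil>" "real_of_int \<lceil>fst p * 2 ^ n\<rceil> \<le> fst p * 2 ^ n + 1"
      by linarith+
    then have "fst p \<le> ?c" "?c \<le> fst p + 1 / 2 ^ n" by (simp_all add: field_simps)
    then show ?thesis using s by (auto simp: min_def power_one_over)
  qed
  have "(\<lambda>n. (1/2) ^ n) \<longlonglongrightarrow> (0::real)" by (rule LIMSEQ_realpow_zero) auto
  moreover have "\<forall>\<^sub>F n in sequentially. norm (min t (real_of_int \<lceil>fst p * 2 ^ n\<rceil> / 2 ^ n) - fst p) \<le> (1/2) ^ n"
    by (rule eventuallyI) (unfold real_norm_def, rule near)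
  ultimately have "(\<lambda>n. min t (real_of_int \<lceil>fst p * 2 ^ n\<rceil> / 2 ^ n) - fst p) \<longlonglongrightarrow> 0"
    by (rule Lim_null_comparison[rotated])
  then have lim: "(\<lambda>n. min t (real_of_int \<lceil>fst p * 2 ^ n\<rceil> / 2 ^ n)) \<longlonglongrightarrow> fst p" by (rule LIM_zero_cancel)
  have "continuous_on {..T} (\<lambda>s. X s (snd p))" using X w t by (auto simp: adapted_continuous_def space_F)
  moreover have "\<forall>\<^sub>F n in sequentially. min t (real_of_int \<lceil>fst p * 2 ^ n\<rceil> / 2 ^ n) \<in> {..T}"
    by (rule eventuallyI) (use t in auto)
  ultimately have "(\<lambda>n. X (min t (real_of_int \<lceil>fst p * 2 ^ n\<rceil> / 2 ^ n)) (snd p)) \<longlonglongrightarrow> X (fst p) (snd p)"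
    using s t by (intro continuous_on_tendsto_compose[OF _ lim]) auto
  then show "(\<lambda>n. X (min t (real_of_int \<lceil>fst p * 2 ^ n\<rceil> / 2 ^ n)) (snd p)) \<longlonglongrightarrow> (case p of (s, \<omega>) \<Rightarrow> X s \<omega>)"
    by (simp only: case_prod_beta)
qed

lemma past_Clam:
  assumes x: "(\<lambda>\<theta>. X \<theta> \<omega>) \<in> Clam l T" and s: "s \<le> T" and l: "0 < l"
  shows "past X s \<omega> \<in> Clam l T"
proof -
  have e: "past X s \<omega> \<theta> = X (min \<theta> s) \<omega>" for \<theta> by (simp add: past_def)
  have "continuous_on {..T} (\<lambda>\<theta>. X \<theta> \<omega>)" using x by (simp add: Clam_def)
  then have c: "continuous_on {..T} (\<lambda>\<theta>. X (min \<theta> s) \<omega>)"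
    by (rule continuous_on_compose2) (auto intro!: continuous_intros)
  obtain B where B: "\<And>\<theta>. \<theta> \<le> T \<Longrightarrow> exp (l * \<theta>) * norm (X \<theta> \<omega>) \<le> B"
    using x by (auto simp: Clam_def bdd_above_def)
  \<comment> \<open>After time \<open>s\<close> the path is frozen while the weight keeps growing,
    by at most the factor \<open>exp (l * (T - s))\<close>.\<close>
  have "exp (l * \<theta>) * norm (X (min \<theta> s) \<omega>) \<le> exp (l * (T - s)) * B" if "\<theta> \<le> T" for \<theta>
  proof -
    have B0: "0 \<le> B" using B[of s] s by (auto intro: order_trans[rotated])
    have "exp (l * \<theta>) = exp (l * (\<theta> - min \<theta> s)) * exp (l * min \<theta> s)"
      by (subst exp_add[symmetric]) (simp add: right_diff_distrib)
    then have "exp (l * \<theta>) * norm (X (min \<theta> s) \<omega>) = exp (l * (\<theta> - min \<theta> s)) * (exp (l * min \<theta> s) * norm (X (min \<theta> s) \<omega>))"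
      by (simp only: mult.assoc)
    also have "\<dots> \<le> exp (l * (T - s)) * B"
      using that l s B0 by (intro mult_mono B) (auto simp: min_def)
    finally show ?thesis .
  qed
  then have b: "bdd_above ((\<lambda>\<theta>. exp (l * \<theta>) * norm (X (min \<theta> s) \<omega>)) ` {..T})"
    by (intro bdd_aboveI[of _ "exp (l * (T - s)) * B"]) auto
  have "((\<lambda>\<theta>. exp (l * \<theta>) *\<^sub>R X \<theta> \<omega>) \<longlongrightarrow> 0) at_bot" using x by (simp add: Clam_def)
  moreover have "eventually (\<lambda>\<theta>. exp (l * \<theta>) *\<^sub>R X \<theta> \<omega> = exp (l * \<theta>) *\<^sub>R X (min \<theta> s) \<omega>) at_bot"
    using eventually_le_at_bot[of s] by eventually_elim (simp add: min_def)
  ultimately have "((\<lambda>\<theta>. exp (l * \<theta>) *\<^sub>R X (min \<theta> s) \<omega>) \<longlongrightarrow> 0) at_bot" by (rule Lim_transform_eventually)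
  with b c show ?thesis by (simp add: Clam_def e)
qed

text \<open>The coefficient is measurable only for each fixed path. The past is therefore replaced
  by the first member of a dense sequence that is \<open>1 / Suc j\<close>-close to it. The index of
  that member is measurable, because closeness is tested at countably many times, so the replaced
  coefficient is measurable as well; the Lipschitz condition makes it converge to the true
  one.\<close>

lemma prog_measurable_past:
  fixes f :: "real \<Rightarrow> 'w \<Rightarrow> (real \<Rightarrow> 'h::{real_normed_vector, second_countable_topology}) \<Rightarrow> 'e::{real_normed_vector, second_countable_topology}"
  assumes f: "\<And>x. x \<in> Clam l T \<Longrightarrow> prog_measurable F {0..T} (\<lambda>t \<omega>. f t \<omega> x)"
    and lip: "\<And>t \<omega> x y. t \<in> {0..T} \<Longrightarrow> \<omega> \<in> space M \<Longrightarrow> x \<in> Clam l T \<Longrightarrow> y \<in> Clam l T \<Longrightarrow>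
       norm (f t \<omega> x - f t \<omega> y) \<le> L * clam_norm l T (\<lambda>\<theta>. x \<theta> - y \<theta>)"
    and L: "0 \<le> L" and l: "0 < l"
    and X: "adapted_continuous F {..T} X" and XC: "\<And>\<omega>. \<omega> \<in> space M \<Longrightarrow> (\<lambda>\<theta>. X \<theta> \<omega>) \<in> Clam l T"
  shows "prog_measurable F {0..T} (\<lambda>s \<omega>. f s \<omega> (past X s \<omega>))"
  unfolding prog_measurable_def
proof
  fix t assume t: "t \<in> {0..T}"
  let ?N = "restrict_space borel ({0..T} \<inter> {..t}) \<Otimes>\<^sub>M F t"
  obtain Z :: "nat \<Rightarrow> real \<Rightarrow> 'h" where Z: "\<And>n. Z n \<in> Clam l T"
    "\<And>x e. x \<in> Clam l T \<Longrightarrow> e > 0 \<Longrightarrow> \<exists>n. \<forall>\<theta>\<le>T. exp (l * \<theta>) * norm (Z n \<theta> - x \<theta>) \<le> e"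
    using Clam_separable[of l T] by metis
  have spN: "fst p \<in> {0..T}" "fst p \<le> t" "snd p \<in> space M" if "p \<in> space ?N" for p
    using that by (auto simp: space_pair_measure space_restrict_space space_F)
  \<comment> \<open>Enumerates, by all rationals, a countable dense set of times not exceeding
    \<open>T\<close>.\<close>
  define \<theta>' where "\<theta>' q = T - \<bar>real_of_rat q\<bar>" for q
  define Q where "Q = range \<theta>'"
  have Q: "Q \<subseteq> {..T}" by (auto simp: Q_def \<theta>'_def)
  have Qd: "{..T} \<subseteq> closure Q"
  proof
    fix x assume x: "x \<in> {..T}"
    show "x \<in> closure Q" unfolding closure_approachable
    proof (intro allI impI)
      fix e :: real assume "e > 0"
      then obtain r where r: "r \<in> \<rat>" "T - x < r" "r < T - x + e" using Rats_dense_in_real[of "T - x" "T - x + e"] by auto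
      from r(1) obtain q where q: "r = real_of_rat q" by (rule Rats_cases)
      have "0 < r" using x r by simp
      then have "dist (\<theta>' q) x < e" using r by (simp add: \<theta>'_def q dist_real_def)
      then show "\<exists>y\<in>Q. dist y x < e" by (auto simp: Q_def)
    qed
  qed
  let ?P = "\<lambda>j n p. \<forall>q. exp (l * \<theta>' q) * norm (Z n (\<theta>' q) - X (min (\<theta>' q) (fst p)) (snd p)) \<le> 1 / real (Suc j)"
  define m where "m j p = (LEAST n. ?P j n p)" for j p
  have Xm: "(\<lambda>p. X (min \<theta> (fst p)) (snd p)) \<in> borel_measurable ?N" for \<theta>
  proof -
    have X1: "(\<lambda>(s, \<omega>). X s \<omega>) \<in> borel_measurable (restrict_space borel {..t} \<Otimes>\<^sub>M F t)"
      using adapted_continuous_imp_prog_measurable[OF X] t by auto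
    have "(\<lambda>s. min \<theta> s) \<in> measurable (restrict_space borel ({0..T} \<inter> {..t})) (restrict_space borel {..t})"
      by (rule measurable_restrict_space3) auto
    from measurable_compose[OF measurable_fst this]
    have "(\<lambda>p. (min \<theta> (fst p), snd p)) \<in> measurable ?N (restrict_space borel {..t} \<Otimes>\<^sub>M F t)"
      by (rule measurable_Pair) (rule measurable_snd)
    from measurable_compose[OF this X1] show ?thesis by simp
  qed
  have mm: "m j \<in> measurable ?N (count_space UNIV)" for j
    unfolding m_def[abs_def]
  proof (rule measurable_Least)
    fix n
    show "Measurable.pred ?N (?P j n)"
    proof (rule pred_intros_countable)
      fix q note [measurable] = Xm[of "\<theta>' q"]
      show "Measurable.pred ?N (\<lambda>p. exp (l * \<theta>' q) * norm (Z n (\<theta>' q) - X (min (\<theta>' q) (fst p)) (snd p)) \<le> 1 / real (Suc j))"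
        by measurable
    qed
  qed
  have P: "?P j (m j p) p" if "p \<in> space ?N" for j p
    unfolding m_def
  proof (rule LeastI_ex)
    have "past X (fst p) (snd p) \<in> Clam l T" using spN[OF that] by (intro past_Clam XC l) auto
    from Z(2)[OF this, of "1 / real (Suc j)"] obtain n
      where "\<forall>\<theta>\<le>T. exp (l * \<theta>) * norm (Z n \<theta> - past X (fst p) (snd p) \<theta>) \<le> 1 / real (Suc j)" by auto
    then have "?P j n p" by (simp add: past_def \<theta>'_def)
    then show "\<exists>n. ?P j n p" by (rule exI)
  qed
  show "(\<lambda>(s, \<omega>). f s \<omega> (past X s \<omega>)) \<in> borel_measurable ?N"
  proof (rule borel_measurable_LIMSEQ_metric)
    fix j
    show "(\<lambda>p. f (fst p) (snd p) (Z (m j p))) \<in> borel_measurable ?N"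
      by (rule measurable_compose_countable[OF _ mm])
         (use f[OF Z(1)] t in \<open>simp add: prog_measurable_def split_beta'\<close>)
  next
    fix p assume p: "p \<in> space ?N"
    note sp = spN[OF p]
    have pc: "past X (fst p) (snd p) \<in> Clam l T" using sp by (intro past_Clam XC l) auto
    have "clam_norm l T (\<lambda>\<theta>. Z (m j p) \<theta> - past X (fst p) (snd p) \<theta>) \<le> 1 / real (Suc j)" for j
    proof (rule clam_norm_least)
      fix \<theta> assume th: "\<theta> \<le> T"
      have clQ: "closure Q \<subseteq> {..T}" using Q by (rule closure_minimal) simp
      show "exp (l * \<theta>) * norm (Z (m j p) \<theta> - past X (fst p) (snd p) \<theta>) \<le> 1 / real (Suc j)"
      proof (rule continuous_le_on_closure[where S=Q and f="\<lambda>\<theta>. exp (l * \<theta>) * norm (Z (m j p) \<theta> - past X (fst p) (snd p) \<theta>)"])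
        have "continuous_on {..T} (\<lambda>\<theta>. Z (m j p) \<theta> - past X (fst p) (snd p) \<theta>)"
          using Clam_diff[OF Z(1) pc] by (auto simp: Clam_def)
        then have "continuous_on {..T} (\<lambda>\<theta>. exp (l * \<theta>) * norm (Z (m j p) \<theta> - past X (fst p) (snd p) \<theta>))"
          by (intro continuous_on_mult[OF _ continuous_on_norm]) (assumption | intro continuous_intros)+
        then show "continuous_on (closure Q) (\<lambda>\<theta>. exp (l * \<theta>) * norm (Z (m j p) \<theta> - past X (fst p) (snd p) \<theta>))"
          by (rule continuous_on_subset[OF _ clQ])
        show "\<theta> \<in> closure Q" using Qd th by auto
        fix x assume "x \<in> Q"
        then show "exp (l * x) * norm (Z (m j p) x - past X (fst p) (snd p) x) \<le> 1 / real (Suc j)"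
          using P[OF p, of j] by (auto simp: past_def Q_def)
      qed
    qed
    then have le: "norm (f (fst p) (snd p) (Z (m j p)) - f (fst p) (snd p) (past X (fst p) (snd p))) \<le> L * (1 / real (Suc j))" for j
      by (rule order_trans[OF lip[OF sp(1,3) Z(1)[of "m j p"] pc] mult_left_mono[OF _ L]])
    have "\<forall>\<^sub>F j in sequentially. norm (f (fst p) (snd p) (Z (m j p)) - f (fst p) (snd p) (past X (fst p) (snd p))) \<le> L * (1 / real (Suc j))"
      by (rule eventuallyI) (rule le)
    moreover have "(\<lambda>j. L * (1 / real (Suc j))) \<longlonglongrightarrow> 0"
      by (rule tendsto_mult_right_zero) (rule LIMSEQ_Suc[OF lim_1_over_n])
    ultimately have "(\<lambda>j. f (fst p) (snd p) (Z (m j p)) - f (fst p) (snd p) (past X (fst p) (snd p))) \<longlonglongrightarrow> 0"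
      by (rule Lim_null_comparison)
    from LIM_zero_cancel[OF this]
    show "(\<lambda>j. f (fst p) (snd p) (Z (m j p))) \<longlonglongrightarrow> (case p of (s, \<omega>) \<Rightarrow> f s \<omega> (past X s \<omega>))"
      by (simp add: case_prod_beta)
  qed
qed

end

section \<open>The square integrable Ito integral\<close>

lemma nn_integral_tendsto_0_imp_prob:
  assumes "finite_measure M" and g: "\<And>j::nat. g j \<in> borel_measurable M"
    and lim: "(\<lambda>j. \<integral>\<^sup>+\<omega>. g j \<omega> \<partial>M) \<longlonglongrightarrow> 0" and e: "0 < (e::real)"
  shows "(\<lambda>j. measure M {\<omega>\<in>space M. ennreal e < g j \<omega>}) \<longlonglongrightarrow> 0"
proof -
  interpret finite_measure M by fact
  have "emeasure M {\<omega>\<in>space M. ennreal e < g j \<omega>} \<le> ennreal (1 / e) * (\<integral>\<^sup>+\<omega>. g j \<omega> \<partial>M)" for j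
  proof -
    note [measurable] = g[of j]
    have "emeasure M {\<omega>\<in>space M. ennreal e < g j \<omega>} \<le> emeasure M ({\<omega>\<in>space M. 1 \<le> ennreal (1 / e) * g j \<omega>} \<inter> space M)"
    proof (rule emeasure_mono)
      show "{\<omega>\<in>space M. ennreal e < g j \<omega>} \<subseteq> {\<omega>\<in>space M. 1 \<le> ennreal (1 / e) * g j \<omega>} \<inter> space M"
      proof safe
        fix \<omega> assume "ennreal e < g j \<omega>"
        then have "ennreal (1 / e) * ennreal e \<le> ennreal (1 / e) * g j \<omega>" by (intro mult_left_mono) auto
        moreover have "ennreal (1 / e) * ennreal e = 1" using e by (subst ennreal_mult'[symmetric]) simp_all
        ultimately show "1 \<le> ennreal (1 / e) * g j \<omega>" by (simp only:)
      qed
    qed measurable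
    also have "\<dots> \<le> ennreal (1 / e) * (\<integral>\<^sup>+\<omega>. g j \<omega> * indicator (space M) \<omega> \<partial>M)"
    proof -
      have "{\<omega>\<in>space M. 1 \<le> ennreal (1 / e) * g j \<omega>} \<inter> space M = {\<omega>\<in>space M. 1 \<le> ennreal (1 / e) * g j \<omega>}" by auto
      then show ?thesis by (simp only:) (rule nn_integral_Markov_inequality, measurable)
    qed
    also have "(\<integral>\<^sup>+\<omega>. g j \<omega> * indicator (space M) \<omega> \<partial>M) = (\<integral>\<^sup>+\<omega>. g j \<omega> \<partial>M)"
      by (rule nn_integral_cong) simp
    finally show ?thesis .
  qed
  note le = this
  have lim': "(\<lambda>j. ennreal (1 / e) * (\<integral>\<^sup>+\<omega>. g j \<omega> \<partial>M)) \<longlonglongrightarrow> 0"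
    using ennreal_tendsto_cmult[OF _ lim, of "ennreal (1 / e)"] by simp
  have "(\<lambda>j. emeasure M {\<omega>\<in>space M. ennreal e < g j \<omega>}) \<longlonglongrightarrow> 0"
    by (rule tendsto_sandwich[OF eventuallyI eventuallyI tendsto_const lim']) (rule zero_le, rule le)
  then have "(\<lambda>j. ennreal (measure M {\<omega>\<in>space M. ennreal e < g j \<omega>})) \<longlonglongrightarrow> ennreal 0"
    by (simp add: emeasure_eq_measure)
  then show ?thesis by (subst (asm) tendsto_ennreal_iff) auto
qed

section \<open>Energy of progressively measurable integrands\<close>

context brownian_basis
begin

definition energy :: "(real \<Rightarrow> 'w \<Rightarrow> (real ^ 'm) \<Rightarrow>\<^sub>L 'h::real_inner) \<Rightarrow> real \<Rightarrow> 'w \<Rightarrow> ennreal" where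
  "energy \<Phi> t \<omega> = (\<integral>\<^sup>+ s\<in>{0..t}. ennreal ((hs_norm (\<Phi> s \<omega>))\<^sup>2) \<partial>lborel)"

text \<open>Progressive measurability concerns a restricted time interval. Composition with the
  clamping of time to \<open>{0..t}\<close> produces a jointly measurable map on the whole line, to
  which integration over \<open>lborel\<close> and the Fubini theorems apply; on
  \<open>{0..t}\<close> nothing changes.\<close>

lemma prog_measurable_clip:
  assumes \<Phi>: "prog_measurable F {0..T} \<Phi>" and t: "0 \<le> t" "t \<le> T"
  shows "(\<lambda>(s, \<omega>). \<Phi> (max 0 (min t s)) \<omega>) \<in> borel_measurable (lborel \<Otimes>\<^sub>M F t)"
    and "(\<lambda>(\<omega>, s). \<Phi> (max 0 (min t s)) \<omega>) \<in> borel_measurable (F t \<Otimes>\<^sub>M lborel)"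
proof -
  have "(\<lambda>s. max 0 (min t s)) \<in> measurable lborel (restrict_space borel ({0..T} \<inter> {..t}))"
    by (rule measurable_restrict_space2) (use t in auto)
  from measurable_compose[OF measurable_fst this] measurable_compose[OF measurable_snd this]
  have 1: "(\<lambda>p. (max 0 (min t (fst p)), snd p)) \<in> measurable (lborel \<Otimes>\<^sub>M F t) (restrict_space borel ({0..T} \<inter> {..t}) \<Otimes>\<^sub>M F t)"
    and 2: "(\<lambda>p. (max 0 (min t (snd p)), fst p)) \<in> measurable (F t \<Otimes>\<^sub>M lborel) (restrict_space borel ({0..T} \<inter> {..t}) \<Otimes>\<^sub>M F t)"
    by (auto intro!: measurable_Pair measurable_fst measurable_snd)
  have m: "(\<lambda>(s, \<omega>). \<Phi> s \<omega>) \<in> borel_measurable (restrict_space borel ({0..T} \<inter> {..t}) \<Otimes>\<^sub>M F t)"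
    using \<Phi> t by (auto simp: prog_measurable_def)
  show "(\<lambda>(s, \<omega>). \<Phi> (max 0 (min t s)) \<omega>) \<in> borel_measurable (lborel \<Otimes>\<^sub>M F t)"
    using measurable_compose[OF 1 m] by (simp add: split_beta')
  show "(\<lambda>(\<omega>, s). \<Phi> (max 0 (min t s)) \<omega>) \<in> borel_measurable (F t \<Otimes>\<^sub>M lborel)"
    using measurable_compose[OF 2 m] by (simp add: split_beta')
qed

lemma prog_measurable_section:
  assumes \<Phi>: "prog_measurable F {0..T} \<Phi>" and t: "0 \<le> t" "t \<le> T" and w: "\<omega> \<in> space M"
  shows "(\<lambda>s. \<Phi> (max 0 (min t s)) \<omega>) \<in> borel_measurable borel"
proof -
  have "(\<lambda>s. (\<lambda>(s, \<omega>). \<Phi> (max 0 (min t s)) \<omega>) (s, \<omega>)) \<in> borel_measurable lborel"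
    by (rule measurable_Pair1[OF prog_measurable_clip(1)[OF \<Phi> t]]) (simp add: space_F w)
  then show ?thesis by simp
qed

lemma prog_measurable_diff:
  fixes \<Phi> \<Psi> :: "real \<Rightarrow> 'w \<Rightarrow> 'e::{real_normed_vector, second_countable_topology}"
  assumes "prog_measurable F I \<Phi>" "prog_measurable F I \<Psi>"
  shows "prog_measurable F I (\<lambda>s \<omega>. \<Phi> s \<omega> - \<Psi> s \<omega>)"
  unfolding prog_measurable_def
proof
  fix t assume "t \<in> I"
  then have "(\<lambda>p. \<Phi> (fst p) (snd p)) \<in> borel_measurable (restrict_space borel (I \<inter> {..t}) \<Otimes>\<^sub>M F t)"
    "(\<lambda>p. \<Psi> (fst p) (snd p)) \<in> borel_measurable (restrict_space borel (I \<inter> {..t}) \<Otimes>\<^sub>M F t)"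
    using assms by (auto simp: prog_measurable_def split_beta')
  from borel_measurable_diff[OF this]
  show "(\<lambda>(s, \<omega>). \<Phi> s \<omega> - \<Psi> s \<omega>) \<in> borel_measurable (restrict_space borel (I \<inter> {..t}) \<Otimes>\<^sub>M F t)"
    by (simp add: split_beta')
qed

lemma prog_measurable_compose:
  assumes "prog_measurable F I \<Phi>" "h \<in> borel_measurable borel"
  shows "prog_measurable F I (\<lambda>s \<omega>. h (\<Phi> s \<omega>))"
  unfolding prog_measurable_def
proof
  fix t assume "t \<in> I"
  then have "(\<lambda>p. \<Phi> (fst p) (snd p)) \<in> borel_measurable (restrict_space borel (I \<inter> {..t}) \<Otimes>\<^sub>M F t)"
    using assms by (auto simp: prog_measurable_def split_beta')
  from measurable_compose[OF this assms(2)]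
  show "(\<lambda>(s, \<omega>). h (\<Phi> s \<omega>)) \<in> borel_measurable (restrict_space borel (I \<inter> {..t}) \<Otimes>\<^sub>M F t)"
    by (simp add: split_beta')
qed

lemma energy_clip:
  "energy \<Phi> t \<omega> = (\<integral>\<^sup>+ s. ennreal ((hs_norm (\<Phi> (max 0 (min t s)) \<omega>))\<^sup>2) * indicator {0..t} s \<partial>lborel)"
  unfolding energy_def by (rule nn_integral_cong) (auto simp: indicator_def min_def max_def)

lemma energy_measurable:
  fixes \<Phi> :: "real \<Rightarrow> 'w \<Rightarrow> (real ^ 'm) \<Rightarrow>\<^sub>L 'h::{real_inner, banach, second_countable_topology}"
  assumes \<Phi>: "prog_measurable F {0..T} \<Phi>" and t: "0 \<le> t" "t \<le> T"
  shows "energy \<Phi> t \<in> borel_measurable (F t)"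
  unfolding energy_clip[abs_def]
proof (rule lborel.borel_measurable_nn_integral)
  have [measurable]: "(\<lambda>p. \<Phi> (max 0 (min t (snd p))) (fst p)) \<in> borel_measurable (F t \<Otimes>\<^sub>M lborel)"
    using prog_measurable_clip(2)[OF \<Phi> t] by (simp add: split_beta')
  show "(\<lambda>(\<omega>, s). ennreal ((hs_norm (\<Phi> (max 0 (min t s)) \<omega>))\<^sup>2) * indicator {0..t} s) \<in> borel_measurable (F t \<Otimes>\<^sub>M lborel)"
    unfolding split_beta' by measurable
qed

lemma energy_measurable_M:
  fixes \<Phi> :: "real \<Rightarrow> 'w \<Rightarrow> (real ^ 'm) \<Rightarrow>\<^sub>L 'h::{real_inner, banach, second_countable_topology}"
  assumes \<Phi>: "prog_measurable F {0..T} \<Phi>" and t: "0 \<le> t" "t \<le> T"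
  shows "energy \<Phi> t \<in> borel_measurable M"
  by (rule measurable_F_M[OF energy_measurable[OF assms]])

lemma energy_mono: "s \<le> t \<Longrightarrow> energy \<Phi> s \<omega> \<le> energy \<Phi> t \<omega>"
  unfolding energy_def by (intro nn_integral_mono) (auto simp: indicator_def)

lemma energy_add_le:
  fixes \<Phi> \<Psi> :: "real \<Rightarrow> 'w \<Rightarrow> (real ^ 'm) \<Rightarrow>\<^sub>L 'h::{real_inner, banach, second_countable_topology}"
  assumes \<Phi>: "prog_measurable F {0..T} \<Phi>" and \<Psi>: "prog_measurable F {0..T} \<Psi>" and t: "0 \<le> t" "t \<le> T" and w: "\<omega> \<in> space M"
  shows "energy (\<lambda>s \<omega>. \<Phi> s \<omega> + \<Psi> s \<omega>) t \<omega> \<le> 2 * energy \<Phi> t \<omega> + 2 * energy \<Psi> t \<omega>"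
proof -
  note [measurable] = prog_measurable_section[OF \<Phi> t w] prog_measurable_section[OF \<Psi> t w]
  let ?a = "\<lambda>s. ennreal ((hs_norm (\<Phi> (max 0 (min t s)) \<omega>))\<^sup>2) * indicator {0..t} s"
  let ?b = "\<lambda>s. ennreal ((hs_norm (\<Psi> (max 0 (min t s)) \<omega>))\<^sup>2) * indicator {0..t} s"
  have "energy (\<lambda>s \<omega>. \<Phi> s \<omega> + \<Psi> s \<omega>) t \<omega> \<le> (\<integral>\<^sup>+s. 2 * ?a s + 2 * ?b s \<partial>lborel)"
    unfolding energy_clip
  proof (rule nn_integral_mono)
    fix s
    let ?A = "\<Phi> (max 0 (min t s)) \<omega>" and ?B = "\<Psi> (max 0 (min t s)) \<omega>"
    have "ennreal ((hs_norm (?A + ?B))\<^sup>2) \<le> ennreal (2 * (hs_norm ?A)\<^sup>2 + 2 * (hs_norm ?B)\<^sup>2)"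
      by (rule ennreal_leI[OF hs_norm_add_sq_le])
    also have "\<dots> = 2 * ennreal ((hs_norm ?A)\<^sup>2) + 2 * ennreal ((hs_norm ?B)\<^sup>2)"
      by (simp add: ennreal_plus ennreal_mult)
    finally show "ennreal ((hs_norm (?A + ?B))\<^sup>2) * indicator {0..t} s \<le> 2 * ?a s + 2 * ?b s"
      by (auto simp: indicator_def)
  qed
  also have "\<dots> = 2 * energy \<Phi> t \<omega> + 2 * energy \<Psi> t \<omega>"
    unfolding energy_clip
    by (subst nn_integral_add; (subst nn_integral_cmult)?; (subst nn_integral_cmult)?; measurable?)
  finally show ?thesis .
qed

lemma energy_minus_commute: "energy (\<lambda>s \<omega>. \<Phi> s \<omega> - \<Psi> s \<omega>) t \<omega> = energy (\<lambda>s \<omega>. \<Psi> s \<omega> - \<Phi> s \<omega>) t \<omega>"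
  unfolding energy_def by (simp add: hs_norm_minus_commute)

lemma energy_triangle:
  fixes \<Phi> \<Psi> \<Theta> :: "real \<Rightarrow> 'w \<Rightarrow> (real ^ 'm) \<Rightarrow>\<^sub>L 'h::{real_inner, banach, second_countable_topology}"
  assumes "prog_measurable F {0..T} \<Phi>" "prog_measurable F {0..T} \<Psi>" "prog_measurable F {0..T} \<Theta>" and t: "0 \<le> t" "t \<le> T" and w: "\<omega> \<in> space M"
  shows "energy (\<lambda>s \<omega>. \<Phi> s \<omega> - \<Theta> s \<omega>) t \<omega> \<le> 2 * energy (\<lambda>s \<omega>. \<Phi> s \<omega> - \<Psi> s \<omega>) t \<omega> + 2 * energy (\<lambda>s \<omega>. \<Psi> s \<omega> - \<Theta> s \<omega>) t \<omega>"
  using energy_add_le[OF prog_measurable_diff[OF assms(1,2)] prog_measurable_diff[OF assms(2,3)] t w] by simp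

text \<open>The squared L2 distance over outcomes and times up to \<open>t\<close>. It is left
  squared, so its triangle inequality carries the factor 2.\<close>

definition dist2 :: "(real \<Rightarrow> 'w \<Rightarrow> (real ^ 'm) \<Rightarrow>\<^sub>L 'h::real_inner) \<Rightarrow> (real \<Rightarrow> 'w \<Rightarrow> (real ^ 'm) \<Rightarrow>\<^sub>L 'h) \<Rightarrow> real \<Rightarrow> ennreal" where
  "dist2 \<Phi> \<Psi> t = (\<integral>\<^sup>+\<omega>. energy (\<lambda>s \<omega>. \<Phi> s \<omega> - \<Psi> s \<omega>) t \<omega> \<partial>M)"

lemma dist2_triangle:
  fixes \<Phi> \<Psi> \<Theta> :: "real \<Rightarrow> 'w \<Rightarrow> (real ^ 'm) \<Rightarrow>\<^sub>L 'h::{real_inner, banach, second_countable_topology}"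
  assumes "prog_measurable F {0..T} \<Phi>" "prog_measurable F {0..T} \<Psi>" "prog_measurable F {0..T} \<Theta>" and t: "0 \<le> t" "t \<le> T"
  shows "dist2 \<Phi> \<Theta> t \<le> 2 * dist2 \<Phi> \<Psi> t + 2 * dist2 \<Psi> \<Theta> t"
proof -
  have "dist2 \<Phi> \<Theta> t \<le> (\<integral>\<^sup>+\<omega>. 2 * energy (\<lambda>s \<omega>. \<Phi> s \<omega> - \<Psi> s \<omega>) t \<omega> + 2 * energy (\<lambda>s \<omega>. \<Psi> s \<omega> - \<Theta> s \<omega>) t \<omega> \<partial>M)"
    unfolding dist2_def by (intro nn_integral_mono energy_triangle assms)
  also have "\<dots> = 2 * dist2 \<Phi> \<Psi> t + 2 * dist2 \<Psi> \<Theta> t"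
  proof -
    have [measurable]: "energy (\<lambda>s \<omega>. \<Phi> s \<omega> - \<Psi> s \<omega>) t \<in> borel_measurable M" "energy (\<lambda>s \<omega>. \<Psi> s \<omega> - \<Theta> s \<omega>) t \<in> borel_measurable M"
      by (intro energy_measurable_M prog_measurable_diff assms)+
    show ?thesis unfolding dist2_def
      by (subst nn_integral_add; (subst nn_integral_cmult)?; (subst nn_integral_cmult)?; measurable?)
  qed
  finally show ?thesis .
qed

lemma dist2_commute: "dist2 \<Phi> \<Psi> t = dist2 \<Psi> \<Phi> t"
  unfolding dist2_def by (rule nn_integral_cong) (rule energy_minus_commute)

lemma dist2_mono: "s \<le> t \<Longrightarrow> dist2 \<Phi> \<Psi> s \<le> dist2 \<Phi> \<Psi> t"
  unfolding dist2_def by (intro nn_integral_mono energy_mono)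

section \<open>Simple processes as elementary families\<close>

lemma simple_processD:
  assumes S: "simple_process F T n p \<xi>"
  shows "k \<le> n \<Longrightarrow> 0 \<le> p k" "k \<le> n \<Longrightarrow> p k \<le> T"
    "k < n \<Longrightarrow> \<xi> k \<in> borel_measurable (F (p k))"
    "k < n \<Longrightarrow> \<exists>C. \<forall>\<omega>\<in>space M. norm (\<xi> k \<omega>) \<le> C"
    "k < n \<Longrightarrow> p k < p (Suc k)"
proof -
  have inc: "p k < p (Suc k)" if "k < n" for k using S that by (auto simp: simple_process_def)
  have "0 \<le> p k" if "k \<le> n" for k using that
  proof (induction k)
    case 0 then show ?case using S by (simp add: simple_process_def)
  next
    case (Suc k) then show ?case using inc[of k] by simp
  qed
  then show "k \<le> n \<Longrightarrow> 0 \<le> p k" .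
  have "p (n - k) \<le> T" for k
  proof (induction k)
    case 0 then show ?case using S by (simp add: simple_process_def)
  next
    case (Suc k) then show ?case using inc[of "n - Suc k"] by (cases "k < n") (auto simp: Suc_diff_Suc)
  qed
  from this[of "n - k"] show "k \<le> n \<Longrightarrow> p k \<le> T" by simp
  show "k < n \<Longrightarrow> \<xi> k \<in> borel_measurable (F (p k))" "k < n \<Longrightarrow> \<exists>C. \<forall>\<omega>\<in>space M. norm (\<xi> k \<omega>) \<le> C" "k < n \<Longrightarrow> p k < p (Suc k)"
    using S by (auto simp: simple_process_def space_F)
qed

lemma simple_process_elem:
  assumes S: "simple_process F T n p \<xi>"
  shows "elem_family {..<n} p (\<lambda>k. p (Suc k)) \<xi>"
  unfolding elem_family_def
proof (intro conjI ballI)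
  fix k assume "k \<in> {..<n}"
  then have k: "k < n" "k \<le> n" by auto
  show "0 \<le> p k" "p k \<le> p (Suc k)" "\<xi> k \<in> borel_measurable (F (p k))" "\<exists>C. \<forall>\<omega>\<in>space M. norm (\<xi> k \<omega>) \<le> C"
    using simple_processD[OF S] k by (auto intro: less_imp_le)
qed simp

lemma simple_value_elem: "simple_value n p \<xi> = elem_value {..<n} p (\<lambda>k. p (Suc k)) \<xi>"
  by (auto simp: fun_eq_iff simple_value_def elem_value_def)

lemma simple_integral_elem: "simple_integral W n p \<xi> = elem_integral {..<n} p (\<lambda>k. p (Suc k)) \<xi>"
  by (auto simp: fun_eq_iff simple_integral_def elem_integral_def)

lemma elem_value_prog:
  assumes E: "elem_family K p q \<xi>"
  shows "prog_measurable F {0..T} (elem_value K p q \<xi>)"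
  unfolding prog_measurable_def
proof
  fix t assume t: "t \<in> {0..T}"
  let ?N = "restrict_space borel ({0..T} \<inter> {..t}) \<Otimes>\<^sub>M F t"
  have "(\<lambda>x. indicator {p k<..q k} (fst x) *\<^sub>R \<xi> k (snd x)) \<in> borel_measurable ?N" if k: "k \<in> K" for k
  proof (cases "p k < t")
    case True
    then have m[measurable]: "\<xi> k \<in> borel_measurable (F t)"
      using elem_familyD(3)[OF E k] by (intro measurable_F_mono[of "p k" t]) auto
    have "(\<lambda>s. indicator {p k<..q k} s :: real) \<in> borel_measurable (restrict_space borel ({0..T} \<inter> {..t}))"
      by (rule measurable_restrict_space1) measurable
    from measurable_compose[OF measurable_fst this] measurable_compose[OF measurable_snd m]
    show ?thesis by (intro borel_measurable_scaleR)
  next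
    \<comment> \<open>The coefficient may not be known at time \<open>t\<close>, but the indicator
      vanishes at all times up to \<open>t\<close>.\<close>
    case False
    have "(\<lambda>x. 0) \<in> borel_measurable ?N" by simp
    moreover have "indicator {p k<..q k} (fst x) *\<^sub>R \<xi> k (snd x) = 0" if "x \<in> space ?N" for x
      using that False by (auto simp: space_pair_measure space_restrict_space indicator_def)
    ultimately show ?thesis by (subst measurable_cong[where g="\<lambda>_. 0"]) auto
  qed
  then show "(\<lambda>(s, \<omega>). elem_value K p q \<xi> s \<omega>) \<in> borel_measurable ?N"
    unfolding elem_value_def split_beta' by (intro borel_measurable_sum)
qed

lemma elem_isometry:
  assumes E: "elem_family K p q \<xi>" and t: "0 \<le> t"
  shows "(\<integral>\<^sup>+\<omega>. ennreal ((norm (elem_integral K p q \<xi> t \<omega>))\<^sup>2) \<partial>M) = (\<integral>\<^sup>+\<omega>. energy (elem_value K p q \<xi>) t \<omega> \<partial>M)"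
proof -
  have "min (q k) 0 = 0" "min (p k) 0 = 0" if "k \<in> K" for k
    using elem_familyD[OF E that] by auto
  then have 0: "elem_integral K p q \<xi> 0 \<omega> = 0" for \<omega>
    by (simp add: elem_integral_def)
  have en: "energy (elem_value K p q \<xi>) t \<omega> = ennreal (elem_energy K p q \<xi> 0 t \<omega>)" "0 \<le> elem_energy K p q \<xi> 0 t \<omega>" for \<omega>
  proof -
    note H = elem_energy_integral[OF E t, of \<omega>]
    have "energy (elem_value K p q \<xi>) t \<omega> = (\<integral>\<^sup>+s. ennreal (indicator {0..t} s * (hs_norm (elem_value K p q \<xi> s \<omega>))\<^sup>2) \<partial>lborel)"
      unfolding energy_def by (rule nn_integral_cong) (auto simp: indicator_def)
    also have "\<dots> = ennreal (LINT s|lborel. indicator {0..t} s * (hs_norm (elem_value K p q \<xi> s \<omega>))\<^sup>2)"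
      using H by (intro nn_integral_eq_integral) (auto simp: has_bochner_integral_iff)
    finally show "energy (elem_value K p q \<xi>) t \<omega> = ennreal (elem_energy K p q \<xi> 0 t \<omega>)"
      using H by (simp add: has_bochner_integral_iff)
    have "0 \<le> (LINT s|lborel. indicator {0..t} s * (hs_norm (elem_value K p q \<xi> s \<omega>))\<^sup>2)"
      by (intro Bochner_Integration.integral_nonneg) simp
    then show "0 \<le> elem_energy K p q \<xi> 0 t \<omega>" by (simp only: has_bochner_integral_integral_eq[OF H])
  qed
  have W1: "integrable M (\<lambda>\<omega>. (norm (elem_integral K p q \<xi> t \<omega>))\<^sup>2)" "integrable M (elem_energy K p q \<xi> 0 t)"
    "expectation (\<lambda>\<omega>. (norm (elem_integral K p q \<xi> t \<omega>))\<^sup>2) = expectation (elem_energy K p q \<xi> 0 t)"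
    using elem_isometry_weighted[OF E order_refl t, of "\<lambda>_. 1" 1] by (simp_all add: 0)
  show ?thesis unfolding en(1)
    by (subst nn_integral_eq_integral[OF W1(1)], simp, subst nn_integral_eq_integral[OF W1(2)], simp add: en(2), simp add: W1(3))
qed

lemma elem_sup_bound:
  assumes E: "elem_family K p q \<xi>" and t: "0 \<le> t" "t \<le> T"
  shows "(\<integral>\<^sup>+\<omega>. sup_sq (elem_integral K p q \<xi>) t \<omega> \<partial>M) \<le> 4 * (\<integral>\<^sup>+\<omega>. energy (elem_value K p q \<xi>) t \<omega> \<partial>M)"
proof -
  have "AE \<omega> in M. continuous_on {0..T} (\<lambda>s. elem_integral K p q \<xi> s \<omega>)"
  proof -
    have "AE \<omega> in M. continuous_on {0..} (\<lambda>t. W t \<omega>)" using bm by (simp add: brownian_motion_def)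
    then show ?thesis
    proof eventually_elim
      case (elim \<omega>)
      have "continuous_on {0..T} (\<lambda>s. W (min x s) \<omega>)" if "0 \<le> x" for x
        by (rule continuous_on_compose2[OF elim]) (use that in \<open>auto intro!: continuous_intros\<close>)
      then have "continuous_on {0..T} (\<lambda>s. W (min (q k) s) \<omega> - W (min (p k) s) \<omega>)" if "k \<in> K" for k
        using elem_familyD(1,2)[OF E that] by (intro continuous_on_diff) auto
      then show ?case unfolding elem_integral_def
        by (intro continuous_on_sum bounded_linear.continuous_on[OF blinfun.bounded_linear_right])
    qed
  qed
  from doob_L2[OF elem_integral_L2_martingale[OF E] this t] show ?thesis unfolding elem_isometry[OF E t(1)] .
qed

lemma elem_diff:
  assumes E1: "elem_family K1 p1 q1 \<xi>1" and E2: "elem_family K2 p2 q2 \<xi>2"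
  obtains K and p :: "'k + 'l \<Rightarrow> real" and q \<xi> where "elem_family K p q \<xi>"
    "\<And>s \<omega>. elem_value K p q \<xi> s \<omega> = elem_value K1 p1 q1 \<xi>1 s \<omega> - elem_value (K2 :: 'l set) p2 q2 \<xi>2 s \<omega>"
    "\<And>s \<omega>. elem_integral K p q \<xi> s \<omega> = elem_integral (K1 :: 'k set) p1 q1 \<xi>1 s \<omega> - elem_integral K2 p2 q2 \<xi>2 s \<omega>"
proof -
  let ?p = "case_sum p1 p2" and ?q = "case_sum q1 q2" and ?x = "case_sum \<xi>1 (\<lambda>k \<omega>. - \<xi>2 k \<omega>)"
  have fin: "finite K1" "finite K2" using E1 E2 by (auto simp: elem_family_def)
  show ?thesis
  proof (rule that[of "K1 <+> K2" ?p ?q ?x])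
    show "elem_family (K1 <+> K2) ?p ?q ?x"
      using E1 E2 by (auto simp: elem_family_def)
    show "elem_value (K1 <+> K2) ?p ?q ?x s \<omega> = elem_value K1 p1 q1 \<xi>1 s \<omega> - elem_value K2 p2 q2 \<xi>2 s \<omega>" for s \<omega>
      unfolding elem_value_def by (simp add: sum.Plus[OF fin] sum_negf)
    show "elem_integral (K1 <+> K2) ?p ?q ?x s \<omega> = elem_integral K1 p1 q1 \<xi>1 s \<omega> - elem_integral K2 p2 q2 \<xi>2 s \<omega>" for s \<omega>
      unfolding elem_integral_def by (simp add: sum.Plus[OF fin] blinfun.minus_left sum_negf)
  qed
qed

lemma simple_diff_bound:
  assumes S1: "simple_process F T n1 p1 \<xi>1" and S2: "simple_process F T n2 p2 \<xi>2" and t: "0 \<le> t" "t \<le> T"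
  shows "(\<integral>\<^sup>+\<omega>. sup_sq (\<lambda>s \<omega>. simple_integral W n1 p1 \<xi>1 s \<omega> - simple_integral W n2 p2 \<xi>2 s \<omega>) t \<omega> \<partial>M)
    \<le> 4 * dist2 (simple_value n1 p1 \<xi>1) (simple_value n2 p2 \<xi>2) t"
proof -
  obtain K and p :: "nat + nat \<Rightarrow> real" and q \<xi> where E: "elem_family K p q \<xi>"
    "\<And>s \<omega>. elem_value K p q \<xi> s \<omega> = simple_value n1 p1 \<xi>1 s \<omega> - simple_value n2 p2 \<xi>2 s \<omega>"
    "\<And>s \<omega>. elem_integral K p q \<xi> s \<omega> = simple_integral W n1 p1 \<xi>1 s \<omega> - simple_integral W n2 p2 \<xi>2 s \<omega>"
    using elem_diff[OF simple_process_elem[OF S1] simple_process_elem[OF S2]]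
    unfolding simple_value_elem[symmetric] simple_integral_elem[symmetric] by metis
  have "(\<lambda>s \<omega>. simple_integral W n1 p1 \<xi>1 s \<omega> - simple_integral W n2 p2 \<xi>2 s \<omega>) = elem_integral K p q \<xi>"
    "(\<lambda>s \<omega>. simple_value n1 p1 \<xi>1 s \<omega> - simple_value n2 p2 \<xi>2 s \<omega>) = elem_value K p q \<xi>"
    by (simp_all add: fun_eq_iff E)
  with elem_sup_bound[OF E(1) t] show ?thesis unfolding dist2_def by simp
qed

lemma simple_value_prog:
  fixes \<xi> :: "nat \<Rightarrow> 'w \<Rightarrow> (real ^ 'm) \<Rightarrow>\<^sub>L 'h::{real_inner, banach, second_countable_topology}"
  shows "simple_process F T n p \<xi> \<Longrightarrow> prog_measurable F {0..T} (simple_value n p \<xi>)"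
  unfolding simple_value_elem by (intro elem_value_prog simple_process_elem)

text \<open>The mean over the cell from \<open>(k - 1) * d\<close> to \<open>k * d\<close>, which
  becomes the value on the cell that starts at \<open>k * d\<close>; it is thus known when it is
  used. For \<open>k = 0\<close> the averaged cell contains no positive time, and the cut-off to
  \<open>{0<..T}\<close> makes the value 0.\<close>

definition lag_coeff :: "(real \<Rightarrow> 'w \<Rightarrow> 'e::{banach, second_countable_topology}) \<Rightarrow> real \<Rightarrow> nat \<Rightarrow> 'w \<Rightarrow> 'e" where
  "lag_coeff \<Phi> d k \<omega> = (1 / d) *\<^sub>R (LINT u|lborel. indicator {u. \<lceil>u / d\<rceil> = int k} u *\<^sub>R (indicator {0<..T} u *\<^sub>R \<Phi> u \<omega>))"

lemma lag_coeff_measurable: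
  fixes \<Phi> :: "real \<Rightarrow> 'w \<Rightarrow> 'e::{banach, second_countable_topology}"
  assumes \<Phi>: "prog_measurable F {0..T} \<Phi>" and d: "0 < d" "real k * d \<le> T"
  shows "lag_coeff \<Phi> d k \<in> borel_measurable (F (real k * d))"
proof -
  let ?t = "real k * d" and ?C = "{(real_of_int (int k) - 1) * d <.. real_of_int (int k) * d}"
  have t: "0 \<le> ?t" using d by simp
  have m[measurable]: "(\<lambda>p. \<Phi> (max 0 (min ?t (snd p))) (fst p)) \<in> borel_measurable (F ?t \<Otimes>\<^sub>M lborel)"
    using prog_measurable_clip(2)[OF \<Phi> t d(2)] by (simp add: split_beta')
  have e: "indicator {u. \<lceil>u / d\<rceil> = int k} u *\<^sub>R (indicator {0<..T} u *\<^sub>R \<Phi> u \<omega>)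
    = indicator ?C u *\<^sub>R (indicator {0<..T} u *\<^sub>R \<Phi> (max 0 (min ?t u)) \<omega>)" for u \<omega>
    unfolding cell_eq[OF d(1)] by (auto simp: indicator_def min_def max_def)
  have "(\<lambda>\<omega>. LINT u|lborel. indicator ?C u *\<^sub>R (indicator {0<..T} u *\<^sub>R \<Phi> (max 0 (min ?t u)) \<omega>)) \<in> borel_measurable (F ?t)"
  proof (rule lborel.borel_measurable_lebesgue_integral)
    show "(\<lambda>(\<omega>, u). indicator ?C u *\<^sub>R (indicator {0<..T} u *\<^sub>R \<Phi> (max 0 (min ?t u)) \<omega>)) \<in> borel_measurable (F ?t \<Otimes>\<^sub>M lborel)"
      unfolding split_beta' by measurable
  qed
  then show ?thesis unfolding lag_coeff_def[abs_def] e by (intro borel_measurable_scaleR) auto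
qed

lemma bounded_section_integrable:
  fixes \<Phi> :: "real \<Rightarrow> 'w \<Rightarrow> 'e::{banach, second_countable_topology}"
  assumes \<Phi>: "prog_measurable F {0..T} \<Phi>" and w: "\<omega> \<in> space M"
    and K: "\<And>s. s \<in> {0..T} \<Longrightarrow> norm (\<Phi> s \<omega>) \<le> K"
  shows "integrable lborel (\<lambda>u. indicator {0<..T} u *\<^sub>R \<Phi> u \<omega>)"
proof (rule Bochner_Integration.integrable_bound)
  show "integrable lborel (\<lambda>u. indicator {0<..T} u * K)"
    using T_pos by (intro integrable_mult_left integrable_real_indicator) auto
  have [measurable]: "(\<lambda>u. \<Phi> (max 0 (min T u)) \<omega>) \<in> borel_measurable borel"
    by (rule prog_measurable_section[OF \<Phi>]) (use T_pos w in auto)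
  have e: "indicator {0<..T} u *\<^sub>R \<Phi> u \<omega> = indicator {0<..T} u *\<^sub>R \<Phi> (max 0 (min T u)) \<omega>" for u
    by (auto simp: indicator_def min_def max_def)
  show "(\<lambda>u. indicator {0<..T} u *\<^sub>R \<Phi> u \<omega>) \<in> borel_measurable lborel"
    unfolding e by measurable
  show "AE u in lborel. norm (indicator {0<..T} u *\<^sub>R \<Phi> u \<omega>) \<le> norm (indicator {0<..T} u * K)"
  proof (rule AE_I2)
    fix u show "norm (indicator {0<..T} u *\<^sub>R \<Phi> u \<omega>) \<le> norm (indicator {0<..T} u * K)"
      using K[of u] by (cases "u \<in> {0<..T}") (auto intro: order_trans[OF _ abs_ge_self])
  qed
qed

lemma lag_coeff_bound:
  fixes \<Phi> :: "real \<Rightarrow> 'w \<Rightarrow> 'e::{banach, second_countable_topology}"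
  assumes \<Phi>: "prog_measurable F {0..T} \<Phi>" and w: "\<omega> \<in> space M" and d: "0 < d"
    and K: "\<And>s. s \<in> {0..T} \<Longrightarrow> norm (\<Phi> s \<omega>) \<le> K"
  shows "norm (lag_coeff \<Phi> d k \<omega>) \<le> 1 / d * (T * K)"
proof -
  let ?f = "\<lambda>u. indicator {u. \<lceil>u / d\<rceil> = int k} u *\<^sub>R (indicator {0<..T} u *\<^sub>R \<Phi> u \<omega>)"
  note i = bounded_section_integrable[OF \<Phi> w K]
  have K0: "0 \<le> K" using K[of 0] T_pos by (auto intro: order_trans[OF norm_ge_zero])
  have "norm (integral\<^sup>L lborel ?f) \<le> (LINT u|lborel. indicator {0<..T} u * K)"
  proof (rule Bochner_Integration.integral_norm_bound_integral)
    show "integrable lborel ?f" unfolding cell_eq[OF d] by (rule integrable_mult_indicator[OF _ i]) simp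
    show "integrable lborel (\<lambda>u. indicator {0<..T} u * K)"
      using T_pos by (intro integrable_mult_left integrable_real_indicator) auto
    show "norm (?f u) \<le> indicator {0<..T} u * K" for u
      using K[of u] K0 by (auto simp: indicator_def)
  qed
  also have "\<dots> = T * K" using T_pos by simp
  finally show ?thesis using d unfolding lag_coeff_def by (simp add: divide_right_mono)
qed

lemma lag_simple_value:
  fixes \<Phi> :: "real \<Rightarrow> 'w \<Rightarrow> (real ^ 'm) \<Rightarrow>\<^sub>L 'h::{real_inner, banach, second_countable_topology}"
  assumes d: "d = T / real (Suc n)" and s: "0 < s" "s \<le> T"
  shows "simple_value (Suc n) (\<lambda>k. real k * d) (lag_coeff \<Phi> d) s \<omega> = lag_avg d (\<lambda>u. indicator {0<..T} u *\<^sub>R \<Phi> u \<omega>) s"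
proof -
  have d0: "0 < d" using d T_pos by simp
  \<comment> \<open>The cell containing \<open>s\<close> runs from \<open>j * d\<close> to
    \<open>(j + 1) * d\<close>; its coefficient \<open>lag_coeff \<Phi> d j\<close> is the mean over
    the preceding cell, as in \<open>lag_avg\<close>.\<close>
  define j where "j = nat (\<lceil>s / d\<rceil> - 1)"
  have "0 < \<lceil>s / d\<rceil>" using s d0 by simp
  then have j: "\<lceil>s / d\<rceil> = int j + 1" by (simp add: j_def)
  have "s / d \<le> T / d" using s(2) d0 by (simp add: divide_right_mono)
  also have "T / d = real (Suc n)" using T_pos by (simp add: d)
  finally have "s / d \<le> real (Suc n)" .
  then have "\<lceil>s / d\<rceil> \<le> int (Suc n)" unfolding ceiling_le_iff of_int_of_nat_eq .
  then have jn: "j < Suc n" using j by linarith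
  have ind: "indicator {real k * d<..real (Suc k) * d} s = (if k = j then 1 else 0 :: real)" for k
  proof -
    have "{u. \<lceil>u / d\<rceil> = int k + 1} = {real k * d<..real (Suc k) * d}"
      unfolding cell_eq[OF d0] by (simp add: add.commute)
    then have "s \<in> {real k * d<..real (Suc k) * d} \<longleftrightarrow> \<lceil>s / d\<rceil> = int k + 1" by blast
    then show ?thesis using j by (auto simp: indicator_def)
  qed
  have "simple_value (Suc n) (\<lambda>k. real k * d) (lag_coeff \<Phi> d) s \<omega> = (\<Sum>k<Suc n. if k = j then lag_coeff \<Phi> d k \<omega> else 0)"
    unfolding simple_value_def ind by (intro sum.cong) auto
  also have "\<dots> = lag_coeff \<Phi> d j \<omega>" using jn by (subst sum.delta) auto
  also have "\<dots> = lag_avg d (\<lambda>u. indicator {0<..T} u *\<^sub>R \<Phi> u \<omega>) s"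
    unfolding lag_coeff_def lag_avg_def j by simp
  finally show ?thesis .
qed

lemma lag_simple_process:
  fixes \<Phi> :: "real \<Rightarrow> 'w \<Rightarrow> (real ^ 'm) \<Rightarrow>\<^sub>L 'h::{real_inner, banach, second_countable_topology}"
  assumes \<Phi>: "prog_measurable F {0..T} \<Phi>" and d: "d = T / real (Suc n)"
    and K: "\<And>s \<omega>. s \<in> {0..T} \<Longrightarrow> \<omega> \<in> space M \<Longrightarrow> norm (\<Phi> s \<omega>) \<le> K"
  shows "simple_process F T (Suc n) (\<lambda>k. real k * d) (lag_coeff \<Phi> d)"
proof -
  have d0: "0 < d" using d T_pos by simp
  have T: "real (Suc n) * d = T" unfolding d by simp
  show ?thesis unfolding simple_process_def
  proof (intro conjI allI impI)
    show "0 \<le> real 0 * d" by simp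
    show "real (Suc n) * d \<le> T" unfolding T by simp
    fix k assume k: "k < Suc n"
    show "real k * d < real (Suc k) * d" using d0 by (intro mult_strict_right_mono) auto
    have "real k * d \<le> real (Suc n) * d" using d0 k by (intro mult_right_mono) auto
    then have kT: "real k * d \<le> T" unfolding T .
    show "lag_coeff \<Phi> d k \<in> borel_measurable (F (real k * d))" by (rule lag_coeff_measurable[OF \<Phi> d0 kT])
    show "\<exists>C. \<forall>\<omega>\<in>space (F (real k * d)). norm (lag_coeff \<Phi> d k \<omega>) \<le> C"
      using lag_coeff_bound[OF \<Phi> _ d0 K] by (intro exI[of _ "1 / d * (T * K)"]) (auto simp: space_F)
  qed
qed

text \<open>The lagged averages of a bounded path converge in L1 over time. Since the error is at
  most \<open>2 * K\<close>, its square is at most \<open>2 * K\<close> times the error itself, so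
  they also converge in L2; the factor \<open>?m\<close> pays for the change to the Hilbert-Schmidt
  norm. Dominated convergence with a constant bound then handles the expectation.\<close>

lemma simple_approx_bounded:
  fixes \<Phi> :: "real \<Rightarrow> 'w \<Rightarrow> (real ^ 'm) \<Rightarrow>\<^sub>L 'h::{real_inner, banach, second_countable_topology}"
  assumes \<Phi>: "prog_measurable F {0..T} \<Phi>"
    and K: "\<And>s \<omega>. s \<in> {0..T} \<Longrightarrow> \<omega> \<in> space M \<Longrightarrow> norm (\<Phi> s \<omega>) \<le> K"
  obtains n p \<xi> where "\<And>j::nat. simple_process F T (n j) (p j) (\<xi> j)"
    "(\<lambda>j. dist2 (simple_value (n j) (p j) (\<xi> j)) \<Phi> T) \<longlonglongrightarrow> 0"
proof -
  let ?m = "real DIM(real ^ 'm)"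
  define d where "d j = T / real (Suc j)" for j
  have d0: "0 < d j" for j using T_pos by (simp add: d_def)
  have dl: "d \<longlonglongrightarrow> 0" unfolding d_def[abs_def] by (rule LIMSEQ_Suc[OF lim_const_over_n])
  let ?p = "\<lambda>j k. real k * d j" and ?x = "\<lambda>j. lag_coeff \<Phi> (d j)"
  let ?v = "\<lambda>j. simple_value (Suc j) (?p j) (?x j)"
  let ?f = "\<lambda>\<omega> u. indicator {0<..T} u *\<^sub>R \<Phi> u \<omega>"
  have K0: "0 \<le> K" if "\<omega> \<in> space M" for \<omega>
    using K[of 0 \<omega>] T_pos that by (auto intro: order_trans[OF norm_ge_zero])
  have sp: "simple_process F T (Suc j) (?p j) (?x j)" for j
    by (rule lag_simple_process[OF \<Phi> _ K]) (simp add: d_def)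
  have prog: "prog_measurable F {0..T} (\<lambda>s \<omega>. ?v j s \<omega> - \<Phi> s \<omega>)" for j
    by (intro prog_measurable_diff simple_value_prog sp \<Phi>)
  have point: "(hs_norm (?v j s \<omega> - \<Phi> s \<omega>))\<^sup>2 \<le> ?m * (2 * K) * norm (lag_avg (d j) (?f \<omega>) s - ?f \<omega> s)"
    "(hs_norm (?v j s \<omega> - \<Phi> s \<omega>))\<^sup>2 \<le> ?m * (2 * K) * (2 * K)"
    if w: "\<omega> \<in> space M" and s: "0 < s" "s \<le> T" for j s \<omega>
  proof -
    have i: "integrable lborel (?f \<omega>)" by (rule bounded_section_integrable[OF \<Phi> w K[OF _ w]])
    have v: "?v j s \<omega> = lag_avg (d j) (?f \<omega>) s" by (rule lag_simple_value[OF d_def s])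
    have "norm (lag_avg (d j) (?f \<omega>) s) \<le> K"
    proof -
      let ?g = "\<lambda>u. indicator {u. \<lceil>u / d j\<rceil> + 1 = \<lceil>s / d j\<rceil>} u *\<^sub>R ?f \<omega> u"
      let ?C = "{(of_int (\<lceil>s / d j\<rceil> - 1) - 1) * d j <.. of_int (\<lceil>s / d j\<rceil> - 1) * d j}"
      have fin: "emeasure lborel ?C < \<infinity>" unfolding emeasure_cell[OF d0] by simp
      have "norm (integral\<^sup>L lborel ?g) \<le> (LINT u|lborel. indicator ?C u * K)"
      proof (rule Bochner_Integration.integral_norm_bound_integral)
        show "integrable lborel ?g" unfolding lag_cell_eq[OF d0] by (rule integrable_mult_indicator[OF _ i]) simp
        show "integrable lborel (\<lambda>u. indicator ?C u * K)"
          by (intro integrable_mult_left integrable_real_indicator fin) simp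
        show "norm (?g u) \<le> indicator ?C u * K" for u
          using K[OF _ w, of u] K0[OF w] unfolding lag_cell_eq[OF d0] by (auto simp: indicator_def)
      qed
      also have "\<dots> = d j * K"
        using emeasure_cell[OF d0[of j], of "of_int (\<lceil>s / d j\<rceil> - 1)"] d0[of j] by (simp add: measure_def)
      finally show ?thesis unfolding lag_avg_def using d0[of j] by (simp add: divide_le_eq mult.commute)
    qed
    moreover have fs: "?f \<omega> s = \<Phi> s \<omega>" using s by simp
    moreover have "norm (\<Phi> s \<omega>) \<le> K" using s by (intro K w) auto
    ultimately have b: "norm (?v j s \<omega> - \<Phi> s \<omega>) \<le> 2 * K"
      unfolding v using norm_triangle_ineq4[of "lag_avg (d j) (?f \<omega>) s" "\<Phi> s \<omega>"] by linarith
    have "(hs_norm (?v j s \<omega> - \<Phi> s \<omega>))\<^sup>2 \<le> (sqrt ?m * norm (?v j s \<omega> - \<Phi> s \<omega>))\<^sup>2"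
      by (intro power_mono hs_norm_le_norm) simp
    also have "\<dots> = ?m * (norm (?v j s \<omega> - \<Phi> s \<omega>) * norm (?v j s \<omega> - \<Phi> s \<omega>))"
      by (simp only: power_mult_distrib power2_eq_square[of "norm _"]) simp
    finally have h: "(hs_norm (?v j s \<omega> - \<Phi> s \<omega>))\<^sup>2 \<le> ?m * (norm (?v j s \<omega> - \<Phi> s \<omega>) * norm (?v j s \<omega> - \<Phi> s \<omega>))" .
    also have "\<dots> \<le> ?m * (2 * K * norm (?v j s \<omega> - \<Phi> s \<omega>))"
      using b by (intro mult_left_mono mult_right_mono) auto
    finally have h1: "(hs_norm (?v j s \<omega> - \<Phi> s \<omega>))\<^sup>2 \<le> ?m * (2 * K * norm (?v j s \<omega> - \<Phi> s \<omega>))" .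
    then show "(hs_norm (?v j s \<omega> - \<Phi> s \<omega>))\<^sup>2 \<le> ?m * (2 * K) * norm (lag_avg (d j) (?f \<omega>) s - ?f \<omega> s)"
      unfolding v fs by (simp only: mult.assoc)
    have "?m * (2 * K * norm (?v j s \<omega> - \<Phi> s \<omega>)) \<le> ?m * (2 * K * (2 * K))"
      using b K0[OF w] by (intro mult_left_mono) auto
    with h1 show "(hs_norm (?v j s \<omega> - \<Phi> s \<omega>))\<^sup>2 \<le> ?m * (2 * K) * (2 * K)"
      by (simp only: mult.assoc)
  qed
  \<comment> \<open>Simple processes vanish at time 0, where the average is not the value of the
    approximation; this single time is discarded.\<close>
  have AE0: "AE s in lborel. s \<noteq> (0::real)" by (rule AE_lborel_singleton)
  let ?E = "\<lambda>j \<omega>. energy (\<lambda>s \<omega>. ?v j s \<omega> - \<Phi> s \<omega>) T \<omega>"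
  have lim: "(\<lambda>j. ?E j \<omega>) \<longlonglongrightarrow> 0" if w: "\<omega> \<in> space M" for \<omega>
  proof (rule tendsto_sandwich[OF eventuallyI eventuallyI tendsto_const])
    have i: "integrable lborel (?f \<omega>)" by (rule bounded_section_integrable[OF \<Phi> w K[OF _ w]])
    have [measurable]: "?f \<omega> \<in> borel_measurable borel" using i by auto
    show "(\<lambda>j. ennreal (?m * (2 * K)) * lag_error (d j) (?f \<omega>)) \<longlonglongrightarrow> 0"
      using ennreal_tendsto_cmult[OF _ lag_error_tendsto_0[of d, OF d0 dl i], of "ennreal (?m * (2 * K))"] by simp
    fix j
    have "?E j \<omega> \<le> (\<integral>\<^sup>+s. ennreal (?m * (2 * K)) * ennreal (norm (lag_avg (d j) (?f \<omega>) s - ?f \<omega> s)) \<partial>lborel)"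
      unfolding energy_def
    proof (rule nn_integral_mono_AE)
      show "AE s in lborel. ennreal ((hs_norm (?v j s \<omega> - \<Phi> s \<omega>))\<^sup>2) * indicator {0..T} s
        \<le> ennreal (?m * (2 * K)) * ennreal (norm (lag_avg (d j) (?f \<omega>) s - ?f \<omega> s))"
        using AE0
      proof eventually_elim
        case (elim s)
        show ?case
        proof (cases "s \<in> {0..T}")
          case True
          with elim have "0 < s" "s \<le> T" by auto
          from ennreal_leI[OF point(1)[OF w this]] True K0[OF w] show ?thesis
            by (simp add: ennreal_mult)
        qed simp
      qed
    qed
    also have "\<dots> = ennreal (?m * (2 * K)) * lag_error (d j) (?f \<omega>)"
      unfolding lag_error_def by (rule nn_integral_cmult) measurable
    finally show "?E j \<omega> \<le> ennreal (?m * (2 * K)) * lag_error (d j) (?f \<omega>)" .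
  qed simp
  have "(\<lambda>j. \<integral>\<^sup>+\<omega>. ?E j \<omega> \<partial>M) \<longlonglongrightarrow> (\<integral>\<^sup>+\<omega>. 0 \<partial>M)"
  proof (rule nn_integral_dominated_convergence[where w="\<lambda>_. ennreal (?m * (2 * K) * (2 * K)) * ennreal T"])
    show "?E j \<in> borel_measurable M" for j
      by (rule energy_measurable_M[OF prog]) (use T_pos in auto)
    show "AE \<omega> in M. ?E j \<omega> \<le> ennreal (?m * (2 * K) * (2 * K)) * ennreal T" for j
    proof (rule AE_I2)
      fix \<omega> assume w: "\<omega> \<in> space M"
      have "?E j \<omega> \<le> (\<integral>\<^sup>+s. ennreal (?m * (2 * K) * (2 * K)) * indicator {0..T} s \<partial>lborel)"
        unfolding energy_def
      proof (rule nn_integral_mono_AE)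
        show "AE s in lborel. ennreal ((hs_norm (?v j s \<omega> - \<Phi> s \<omega>))\<^sup>2) * indicator {0..T} s
          \<le> ennreal (?m * (2 * K) * (2 * K)) * indicator {0..T} s"
          using AE0
        proof eventually_elim
          case (elim s)
          show ?case
          proof (cases "s \<in> {0..T}")
            case True
            with elim have "0 < s" "s \<le> T" by auto
            from ennreal_leI[OF point(2)[OF w this]] True show ?thesis by simp
          qed simp
        qed
      qed
      also have "\<dots> = ennreal (?m * (2 * K) * (2 * K)) * ennreal T"
        using T_pos by (subst nn_integral_cmult_indicator) auto
      finally show "?E j \<omega> \<le> ennreal (?m * (2 * K) * (2 * K)) * ennreal T" .
    qed
    show "(\<integral>\<^sup>+\<omega>. ennreal (?m * (2 * K) * (2 * K)) * ennreal T \<partial>M) < \<infinity>"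
      by (simp add: emeasure_space_1 ennreal_mult_less_top)
    show "AE \<omega> in M. (\<lambda>j. ?E j \<omega>) \<longlonglongrightarrow> 0" using lim by (rule AE_I2)
  qed auto
  moreover have "(\<integral>\<^sup>+\<omega>. 0 \<partial>M) = (0::ennreal)" by simp
  ultimately have "(\<lambda>j. dist2 (?v j) \<Phi> T) \<longlonglongrightarrow> 0" unfolding dist2_def by (simp only:)
  with sp show ?thesis by (rule that)
qed

text \<open>Reduction to bounded integrands: values of norm above \<open>i\<close> are replaced by
  0. The error is then \<Phi> itself or 0, so the energy of \<Phi> dominates, first for the integral
  over time and then for the expectation.\<close>

lemma simple_approx:
  fixes \<Phi> :: "real \<Rightarrow> 'w \<Rightarrow> (real ^ 'm) \<Rightarrow>\<^sub>L 'h::{real_inner, banach, second_countable_topology}"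
  assumes \<Phi>: "prog_measurable F {0..T} \<Phi>" and fin: "(\<integral>\<^sup>+\<omega>. energy \<Phi> T \<omega> \<partial>M) < \<infinity>" and e: "0 < (e::real)"
  shows "\<exists>n p \<xi>. simple_process F T n p \<xi> \<and> dist2 (simple_value n p \<xi>) \<Phi> T \<le> ennreal e"
proof -
  let ?tr = "\<lambda>i (x :: (real ^ 'm) \<Rightarrow>\<^sub>L 'h). if norm x \<le> real i then x else 0"
  have trm: "?tr i \<in> borel_measurable borel" for i :: nat by measurable
  define \<Psi> where "\<Psi> i s \<omega> = ?tr i (\<Phi> s \<omega>)" for i s \<omega>
  have \<Psi>: "prog_measurable F {0..T} (\<Psi> i)" for i
    unfolding \<Psi>_def[abs_def] by (rule prog_measurable_compose[OF \<Phi> trm])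
  have hs: "hs_norm (\<Psi> i s \<omega> - \<Phi> s \<omega>) \<le> hs_norm (\<Phi> s \<omega>)" for i s \<omega>
    using hs_norm_uminus[of "\<Phi> s \<omega>"] by (simp add: \<Psi>_def)
  have T0: "0 \<le> T" using T_pos by simp
  let ?E = "\<lambda>i \<omega>. energy (\<lambda>s \<omega>. \<Psi> i s \<omega> - \<Phi> s \<omega>) T \<omega>"
  have Ele: "?E i \<omega> \<le> energy \<Phi> T \<omega>" for i \<omega>
    unfolding energy_def by (intro nn_integral_mono mult_right_mono ennreal_leI power_mono hs) auto
  have El: "(\<lambda>i. ?E i \<omega>) \<longlonglongrightarrow> 0" if w: "\<omega> \<in> space M" and f: "energy \<Phi> T \<omega> \<noteq> \<infinity>" for \<omega>
  proof -
    note [measurable] = prog_measurable_section[OF \<Phi> T0 order_refl w] prog_measurable_section[OF \<Psi> T0 order_refl w]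
    have "(\<lambda>i. \<integral>\<^sup>+s. ennreal ((hs_norm (\<Psi> i (max 0 (min T s)) \<omega> - \<Phi> (max 0 (min T s)) \<omega>))\<^sup>2) * indicator {0..T} s \<partial>lborel)
      \<longlonglongrightarrow> (\<integral>\<^sup>+(s::real). 0 \<partial>lborel)"
    proof (rule nn_integral_dominated_convergence[where w="\<lambda>s. ennreal ((hs_norm (\<Phi> (max 0 (min T s)) \<omega>))\<^sup>2) * indicator {0..T} s"
        and u="\<lambda>i s. ennreal ((hs_norm (\<Psi> i (max 0 (min T s)) \<omega> - \<Phi> (max 0 (min T s)) \<omega>))\<^sup>2) * indicator {0..T} s"])
      show "(\<integral>\<^sup>+s. ennreal ((hs_norm (\<Phi> (max 0 (min T s)) \<omega>))\<^sup>2) * indicator {0..T} s \<partial>lborel) < \<infinity>"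
        using f unfolding energy_clip by (simp add: top.not_eq_extremum)
      show "AE s in lborel. ennreal ((hs_norm (\<Psi> i (max 0 (min T s)) \<omega> - \<Phi> (max 0 (min T s)) \<omega>))\<^sup>2) * indicator {0..T} s
         \<le> ennreal ((hs_norm (\<Phi> (max 0 (min T s)) \<omega>))\<^sup>2) * indicator {0..T} s" for i
        by (intro AE_I2 mult_right_mono ennreal_leI power_mono hs) auto
      show "AE s in lborel. (\<lambda>i. ennreal ((hs_norm (\<Psi> i (max 0 (min T s)) \<omega> - \<Phi> (max 0 (min T s)) \<omega>))\<^sup>2) * indicator {0..T} s) \<longlonglongrightarrow> 0"
      proof (rule AE_I2)
        fix s
        obtain k :: nat where k: "norm (\<Phi> (max 0 (min T s)) \<omega>) \<le> real k" using real_arch_simple by blast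
        show "(\<lambda>i. ennreal ((hs_norm (\<Psi> i (max 0 (min T s)) \<omega> - \<Phi> (max 0 (min T s)) \<omega>))\<^sup>2) * indicator {0..T} s) \<longlonglongrightarrow> 0"
        proof (rule tendsto_eventually, rule eventually_sequentiallyI)
          fix i assume "k \<le> i"
          then have "norm (\<Phi> (max 0 (min T s)) \<omega>) \<le> real i" using k by linarith
          then show "ennreal ((hs_norm (\<Psi> i (max 0 (min T s)) \<omega> - \<Phi> (max 0 (min T s)) \<omega>))\<^sup>2) * indicator {0..T} s = 0"
            by (simp add: \<Psi>_def)
        qed
      qed
    qed measurable
    then show ?thesis unfolding energy_clip by simp
  qed
  have fm: "energy \<Phi> T \<in> borel_measurable M" by (rule energy_measurable_M[OF \<Phi> T0 order_refl])
  have "(\<lambda>i. \<integral>\<^sup>+\<omega>. ?E i \<omega> \<partial>M) \<longlonglongrightarrow> (\<integral>\<^sup>+\<omega>. 0 \<partial>M)"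
  proof (rule nn_integral_dominated_convergence[where w="energy \<Phi> T"])
    show "?E i \<in> borel_measurable M" for i
      by (intro energy_measurable_M prog_measurable_diff \<Psi> \<Phi> T0 order_refl)
    show "AE \<omega> in M. ?E i \<omega> \<le> energy \<Phi> T \<omega>" for i using Ele by (intro AE_I2)
    have "AE \<omega> in M. energy \<Phi> T \<omega> \<noteq> \<infinity>" by (rule nn_integral_PInf_AE[OF fm]) (use fin in auto)
    then show "AE \<omega> in M. (\<lambda>i. ?E i \<omega>) \<longlonglongrightarrow> 0" using AE_space by eventually_elim (rule El)
  qed (use fin fm in auto)
  then have "(\<lambda>i. dist2 (\<Psi> i) \<Phi> T) \<longlonglongrightarrow> 0" by (simp add: dist2_def)
  then have "\<forall>\<^sub>F i in sequentially. dist2 (\<Psi> i) \<Phi> T < ennreal (e / 4)" using e by (intro order_tendstoD(2)) auto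
  then obtain i where i: "dist2 (\<Psi> i) \<Phi> T < ennreal (e / 4)" by (auto simp: eventually_sequentially)
  have "norm (\<Psi> i s \<omega>) \<le> real i" for s \<omega> by (simp add: \<Psi>_def)
  then obtain n p \<xi> where S: "\<And>j::nat. simple_process F T (n j) (p j) (\<xi> j)"
    and l: "(\<lambda>j. dist2 (simple_value (n j) (p j) (\<xi> j)) (\<Psi> i) T) \<longlonglongrightarrow> 0"
    using simple_approx_bounded[OF \<Psi>[of i], of "real i"] by blast
  have "\<forall>\<^sub>F j in sequentially. dist2 (simple_value (n j) (p j) (\<xi> j)) (\<Psi> i) T < ennreal (e / 4)" using e l by (intro order_tendstoD(2)) auto
  then obtain j where j: "dist2 (simple_value (n j) (p j) (\<xi> j)) (\<Psi> i) T < ennreal (e / 4)" by (auto simp: eventually_sequentially)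
  have "dist2 (simple_value (n j) (p j) (\<xi> j)) \<Phi> T \<le> 2 * dist2 (simple_value (n j) (p j) (\<xi> j)) (\<Psi> i) T + 2 * dist2 (\<Psi> i) \<Phi> T"
    by (intro dist2_triangle simple_value_prog S \<Psi> \<Phi> T0 order_refl)
  also have "\<dots> \<le> 2 * ennreal (e / 4) + 2 * ennreal (e / 4)"
    using i j by (intro add_mono mult_left_mono) auto
  also have "\<dots> = ennreal (2 * (e / 4) + 2 * (e / 4))"
    using e by (simp only: ennreal_plus ennreal_mult'[of 2] ennreal_numeral[symmetric])
  also have "\<dots> = ennreal e" by simp
  finally show ?thesis using S by blast
qed

text \<open>The square integrable Ito integral; the approximating integrals may be discontinuous on a null set.\<close>

definition ito_L2 :: "(real \<Rightarrow> 'w \<Rightarrow> (real ^ 'm) \<Rightarrow>\<^sub>L 'h::{real_inner, banach, second_countable_topology}) \<Rightarrow> (real \<Rightarrow> 'w \<Rightarrow> 'h) \<Rightarrow> bool" where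
  "ito_L2 \<Phi> I \<longleftrightarrow> prog_measurable F {0..T} \<Phi> \<and> adapted_continuous F {0..T} I \<and>
    (\<exists>n p \<xi>. (\<forall>j::nat. simple_process F T (n j) (p j) (\<xi> j)) \<and>
      (\<lambda>j. dist2 (simple_value (n j) (p j) (\<xi> j)) \<Phi> T) \<longlonglongrightarrow> 0 \<and>
      (\<lambda>j. \<integral>\<^sup>+\<omega>. sup_sq (\<lambda>s \<omega>. simple_integral W (n j) (p j) (\<xi> j) s \<omega> - I s \<omega>) T \<omega> \<partial>M) \<longlonglongrightarrow> 0)"

text \<open>Completeness of the space of continuous processes asks for continuity for every outcome,
  but a simple integral inherits continuity only where the path of \<open>W\<close> is continuous.
  It is set to 0 on the exceptional null set.\<close>

lemma continuous_version:
  assumes S: "simple_process F T n p \<xi>"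
  obtains S' where "adapted_continuous F {0..T} S'"
    "AE \<omega> in M. \<forall>s. S' s \<omega> = simple_integral W n p (\<xi> :: nat \<Rightarrow> 'w \<Rightarrow> (real ^ 'm) \<Rightarrow>\<^sub>L 'h::{real_inner, banach, second_countable_topology}) s \<omega>"
proof -
  have "AE \<omega> in M. continuous_on {0..} (\<lambda>t. W t \<omega>)" using bm by (simp add: brownian_motion_def)
  then obtain N where N: "{\<omega>\<in>space M. \<not> continuous_on {0..} (\<lambda>t. W t \<omega>)} \<subseteq> N" "emeasure M N = 0" "N \<in> sets M"
    by (rule AE_E)
  then have N0: "N \<in> null_sets M" by auto
  define S' where "S' s \<omega> = (if \<omega> \<in> N then 0 else simple_integral W n p \<xi> s \<omega>)" for s \<omega>
  have AE: "AE \<omega> in M. \<forall>s. S' s \<omega> = simple_integral W n p \<xi> s \<omega>"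
    using AE_not_in[OF N0] by eventually_elim (simp add: S'_def)
  have "adapted_continuous F {0..T} S'" unfolding adapted_continuous_def
  proof (intro ballI conjI)
    fix t assume t: "t \<in> {0..T}"
    have m: "simple_integral W n p \<xi> t \<in> borel_measurable (F t)"
      unfolding simple_integral_elem by (rule elem_integral_measurable[OF simple_process_elem[OF S]]) (use t in auto)
    have a: "AE \<omega> in M. simple_integral W n p \<xi> t \<omega> = S' t \<omega>" using AE by eventually_elim simp
    show "S' t \<in> borel_measurable (F t)" by (rule adapted_AE_cong[OF m a])
    fix \<omega> assume "\<omega> \<in> space (F t)"
    then have w: "\<omega> \<in> space M" by (simp add: space_F)
    show "continuous_on {0..T} (\<lambda>s. S' s \<omega>)"
    proof (cases "\<omega> \<in> N")
      case False
      then have c: "continuous_on {0..} (\<lambda>t. W t \<omega>)" using N(1) w by auto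
      have "continuous_on {0..T} (\<lambda>s. W (min x s) \<omega>)" if "0 \<le> x" for x
        by (rule continuous_on_compose2[OF c]) (use that in \<open>auto intro!: continuous_intros\<close>)
      then have "continuous_on {0..T} (\<lambda>s. W (min (p (Suc k)) s) \<omega> - W (min (p k) s) \<omega>)" if "k < n" for k
        using simple_processD(1)[OF S] that by (intro continuous_on_diff) auto
      then have "continuous_on {0..T} (\<lambda>s. simple_integral W n p \<xi> s \<omega>)" unfolding simple_integral_def
        by (intro continuous_on_sum bounded_linear.continuous_on[OF blinfun.bounded_linear_right]) auto
      then show ?thesis using False by (simp add: S'_def)
    qed (simp add: S'_def)
  qed
  then show ?thesis using AE by (rule that)
qed

lemma simple_approx_diff:
  fixes \<Phi> :: "real \<Rightarrow> 'w \<Rightarrow> (real ^ 'm) \<Rightarrow>\<^sub>L 'h::{real_inner, banach, second_countable_topology}"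
  assumes "simple_process F T n1 p1 \<xi>1" "simple_process F T n2 p2 \<xi>2" "prog_measurable F {0..T} \<Phi>"
    "dist2 (simple_value n1 p1 \<xi>1) \<Phi> T \<le> ennreal a" "dist2 (simple_value n2 p2 \<xi>2) \<Phi> T \<le> ennreal a" "0 \<le> a"
  shows "dist2 (simple_value n1 p1 \<xi>1) (simple_value n2 p2 \<xi>2) T \<le> ennreal (4 * a)"
proof -
  have "dist2 (simple_value n1 p1 \<xi>1) (simple_value n2 p2 \<xi>2) T
    \<le> 2 * dist2 (simple_value n1 p1 \<xi>1) \<Phi> T + 2 * dist2 \<Phi> (simple_value n2 p2 \<xi>2) T"
    using T_pos by (intro dist2_triangle simple_value_prog assms) auto
  also have "\<dots> \<le> 2 * ennreal a + 2 * ennreal a"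
    using assms(4,5) by (intro add_mono mult_left_mono) (auto simp: dist2_commute[of \<Phi>])
  also have "\<dots> = ennreal (2 * a + 2 * a)"
    using assms(6) by (simp only: ennreal_plus ennreal_mult'[of 2] ennreal_numeral[symmetric])
  finally show ?thesis by simp
qed

text \<open>Approximations with error 16^-j meet the rate of
  \<open>adapted_continuous_complete\<close>: the triangle inequality and Doob's inequality each
  contribute a factor 4 to the increments of their integrals.\<close>

lemma ito_L2_exists:
  fixes \<Phi> :: "real \<Rightarrow> 'w \<Rightarrow> (real ^ 'm) \<Rightarrow>\<^sub>L 'h::{real_inner, banach, second_countable_topology}"
  assumes \<Phi>: "prog_measurable F {0..T} \<Phi>" and fin: "(\<integral>\<^sup>+\<omega>. energy \<Phi> T \<omega> \<partial>M) < \<infinity>"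
  obtains I where "ito_L2 \<Phi> I"
proof -
  have "\<forall>j::nat. \<exists>z. case z of (n, p, \<xi>) \<Rightarrow> simple_process F T n p \<xi> \<and> dist2 (simple_value n p \<xi>) \<Phi> T \<le> ennreal ((1 / 16) ^ j)"
    using simple_approx[OF \<Phi> fin] by (auto simp: split_paired_Ex)
  from choice[OF this] obtain z where z: "\<And>j. case z j of (n, p, \<xi>) \<Rightarrow> simple_process F T n p \<xi> \<and> dist2 (simple_value n p \<xi>) \<Phi> T \<le> ennreal ((1 / 16) ^ j)"
    by auto
  define n where "n j = fst (z j)" for j
  define p where "p j = fst (snd (z j))" for j
  define \<xi> where "\<xi> j = snd (snd (z j))" for j
  have S: "simple_process F T (n j) (p j) (\<xi> j)" and D: "dist2 (simple_value (n j) (p j) (\<xi> j)) \<Phi> T \<le> ennreal ((1 / 16) ^ j)" for j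
    using z[of j] by (auto simp: n_def p_def \<xi>_def split: prod.splits)
  let ?S = "\<lambda>j. simple_integral W (n j) (p j) (\<xi> j)"
  have "\<forall>j. \<exists>S'. adapted_continuous F {0..T} S' \<and> (AE \<omega> in M. \<forall>s. S' s \<omega> = ?S j s \<omega>)"
    using continuous_version[OF S] by blast
  from choice[OF this] obtain S' where S': "\<And>j. adapted_continuous F {0..T} (S' j)" "\<And>j. AE \<omega> in M. \<forall>s. S' j s \<omega> = ?S j s \<omega>"
    by auto
  have T0: "0 \<le> T" using T_pos by simp
  have bound: "(\<integral>\<^sup>+\<omega>. sup_sq (\<lambda>s \<omega>. S' (Suc j) s \<omega> - S' j s \<omega>) T \<omega> \<partial>M) \<le> ennreal (16 * (1 / 16) ^ j)" for j
  proof -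
    have "(\<integral>\<^sup>+\<omega>. sup_sq (\<lambda>s \<omega>. S' (Suc j) s \<omega> - S' j s \<omega>) T \<omega> \<partial>M) = (\<integral>\<^sup>+\<omega>. sup_sq (\<lambda>s \<omega>. ?S (Suc j) s \<omega> - ?S j s \<omega>) T \<omega> \<partial>M)"
    proof (rule nn_integral_cong_AE)
      show "AE \<omega> in M. sup_sq (\<lambda>s \<omega>. S' (Suc j) s \<omega> - S' j s \<omega>) T \<omega> = sup_sq (\<lambda>s \<omega>. ?S (Suc j) s \<omega> - ?S j s \<omega>) T \<omega>"
        using S'(2)[of "Suc j"] S'(2)[of j] by eventually_elim (simp add: sup_sq_def)
    qed
    also have "\<dots> \<le> 4 * dist2 (simple_value (n (Suc j)) (p (Suc j)) (\<xi> (Suc j))) (simple_value (n j) (p j) (\<xi> j)) T"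
      by (rule simple_diff_bound[OF S S T0 order_refl])
    also have "\<dots> \<le> 4 * ennreal (4 * (1 / 16) ^ j)"
    proof (intro mult_left_mono simple_approx_diff[OF S S \<Phi> _ D])
      show "dist2 (simple_value (n (Suc j)) (p (Suc j)) (\<xi> (Suc j))) \<Phi> T \<le> ennreal ((1 / 16) ^ j)"
        by (rule order_trans[OF D ennreal_leI]) (simp add: field_simps)
    qed auto
    also have "\<dots> = ennreal (16 * (1 / 16) ^ j)"
      by (subst ennreal_numeral[symmetric], subst ennreal_mult'[symmetric]) simp_all
    finally show ?thesis .
  qed
  obtain I where I: "adapted_continuous F {0..T} I"
    "(\<lambda>j. \<integral>\<^sup>+\<omega>. sup_sq (\<lambda>s \<omega>. S' j s \<omega> - I s \<omega>) T \<omega> \<partial>M) \<longlonglongrightarrow> 0"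
    using adapted_continuous_complete[OF S'(1) bound] .
  have e: "(\<integral>\<^sup>+\<omega>. sup_sq (\<lambda>s \<omega>. S' j s \<omega> - I s \<omega>) T \<omega> \<partial>M) = (\<integral>\<^sup>+\<omega>. sup_sq (\<lambda>s \<omega>. ?S j s \<omega> - I s \<omega>) T \<omega> \<partial>M)" for j
  proof (rule nn_integral_cong_AE)
    show "AE \<omega> in M. sup_sq (\<lambda>s \<omega>. S' j s \<omega> - I s \<omega>) T \<omega> = sup_sq (\<lambda>s \<omega>. ?S j s \<omega> - I s \<omega>) T \<omega>"
      using S'(2)[of j] by eventually_elim (simp add: sup_sq_def)
  qed
  have "(\<lambda>j. ennreal ((1 / 16) ^ j)) \<longlonglongrightarrow> ennreal 0"
    by (intro tendsto_ennrealI LIMSEQ_realpow_zero) auto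
  then have l0: "(\<lambda>j. ennreal ((1 / 16) ^ j)) \<longlonglongrightarrow> 0" by simp
  have Dl: "(\<lambda>j. dist2 (simple_value (n j) (p j) (\<xi> j)) \<Phi> T) \<longlonglongrightarrow> 0"
    by (rule tendsto_sandwich[OF eventuallyI eventuallyI tendsto_const l0]) (rule zero_le, rule D)
  have "ito_L2 \<Phi> I" unfolding ito_L2_def
    using \<Phi> I(1) S Dl I(2)[unfolded e] by blast
  then show ?thesis by (rule that)
qed

text \<open>The bound for simple processes passes to the limit. The constant 64 is Doob's 4 times
  four factors 2: two triangle inequalities lead from \<open>I - J\<close> to the approximating
  integrals and two from their integrands back to \<open>\<Phi> - \<Psi>\<close>.\<close>

lemma ito_L2_diff_bound:
  fixes \<Phi> \<Psi> :: "real \<Rightarrow> 'w \<Rightarrow> (real ^ 'm) \<Rightarrow>\<^sub>L 'h::{real_inner, banach, second_countable_topology}"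
  assumes A: "ito_L2 \<Phi> I" and B: "ito_L2 \<Psi> J" and t: "0 \<le> t" "t \<le> T"
  shows "(\<integral>\<^sup>+\<omega>. sup_sq (\<lambda>s \<omega>. I s \<omega> - J s \<omega>) t \<omega> \<partial>M) \<le> 64 * dist2 \<Phi> \<Psi> t"
proof -
  obtain n1 p1 \<xi>1 where S1: "\<And>j::nat. simple_process F T (n1 j) (p1 j) (\<xi>1 j)"
    and d1: "(\<lambda>j. dist2 (simple_value (n1 j) (p1 j) (\<xi>1 j)) \<Phi> T) \<longlonglongrightarrow> 0"
    and i1: "(\<lambda>j. \<integral>\<^sup>+\<omega>. sup_sq (\<lambda>s \<omega>. simple_integral W (n1 j) (p1 j) (\<xi>1 j) s \<omega> - I s \<omega>) T \<omega> \<partial>M) \<longlonglongrightarrow> 0"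
    and \<Phi>: "prog_measurable F {0..T} \<Phi>" and I: "adapted_continuous F {0..T} I"
    using A unfolding ito_L2_def by blast
  obtain n2 p2 \<xi>2 where S2: "\<And>j::nat. simple_process F T (n2 j) (p2 j) (\<xi>2 j)"
    and d2: "(\<lambda>j. dist2 (simple_value (n2 j) (p2 j) (\<xi>2 j)) \<Psi> T) \<longlonglongrightarrow> 0"
    and i2: "(\<lambda>j. \<integral>\<^sup>+\<omega>. sup_sq (\<lambda>s \<omega>. simple_integral W (n2 j) (p2 j) (\<xi>2 j) s \<omega> - J s \<omega>) T \<omega> \<partial>M) \<longlonglongrightarrow> 0"
    and \<Psi>: "prog_measurable F {0..T} \<Psi>" and J: "adapted_continuous F {0..T} J"
    using B unfolding ito_L2_def by blast
  let ?S1 = "\<lambda>j. simple_integral W (n1 j) (p1 j) (\<xi>1 j)" and ?S2 = "\<lambda>j. simple_integral W (n2 j) (p2 j) (\<xi>2 j)"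
  let ?v1 = "\<lambda>j. simple_value (n1 j) (p1 j) (\<xi>1 j)" and ?v2 = "\<lambda>j. simple_value (n2 j) (p2 j) (\<xi>2 j)"
  let ?E1 = "\<lambda>j. \<integral>\<^sup>+\<omega>. sup_sq (\<lambda>s \<omega>. ?S1 j s \<omega> - I s \<omega>) T \<omega> \<partial>M" and ?E2 = "\<lambda>j. \<integral>\<^sup>+\<omega>. sup_sq (\<lambda>s \<omega>. ?S2 j s \<omega> - J s \<omega>) T \<omega> \<partial>M"
  \<comment> \<open>The approximating integrals are continuous only almost surely, so their suprema
    are measurable through continuous versions \<open>X'\<close> and \<open>Y'\<close>.\<close>
  have meas: "sup_sq (\<lambda>s \<omega>. X s \<omega> - Y s \<omega>) t \<in> borel_measurable M"
    if X: "AE \<omega> in M. \<forall>s. X' s \<omega> = X s \<omega>" "adapted_continuous F {0..T} X'" and Y: "AE \<omega> in M. \<forall>s. Y' s \<omega> = Y s \<omega>" "adapted_continuous F {0..T} Y'"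
    for X X' Y Y' :: "real \<Rightarrow> 'w \<Rightarrow> 'h"
  proof (rule measurable_F_M[OF adapted_AE_cong])
    show "sup_sq (\<lambda>s \<omega>. X' s \<omega> - Y' s \<omega>) t \<in> borel_measurable (F t)"
      by (intro sup_sq_measurable adapted_continuous_diff X Y t)
    show "AE \<omega> in M. sup_sq (\<lambda>s \<omega>. X' s \<omega> - Y' s \<omega>) t \<omega> = sup_sq (\<lambda>s \<omega>. X s \<omega> - Y s \<omega>) t \<omega>"
      using X(1) Y(1) by eventually_elim (simp add: sup_sq_def)
  qed
  have bound: "(\<integral>\<^sup>+\<omega>. sup_sq (\<lambda>s \<omega>. I s \<omega> - J s \<omega>) t \<omega> \<partial>M)
    \<le> 2 * ?E1 j + (4 * (4 * (2 * dist2 (?v1 j) \<Phi> T + 2 * (2 * dist2 \<Phi> \<Psi> t + 2 * dist2 (?v2 j) \<Psi> T))) + 4 * ?E2 j)" for j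
  proof -
    obtain S1' where S1': "adapted_continuous F {0..T} S1'" "AE \<omega> in M. \<forall>s. S1' s \<omega> = ?S1 j s \<omega>" by (rule continuous_version[OF S1])
    obtain S2' where S2': "adapted_continuous F {0..T} S2'" "AE \<omega> in M. \<forall>s. S2' s \<omega> = ?S2 j s \<omega>" by (rule continuous_version[OF S2])
    have IAE: "AE \<omega> in M. \<forall>s. X s \<omega> = X s \<omega>" for X :: "real \<Rightarrow> 'w \<Rightarrow> 'h" by simp
    let ?a = "\<lambda>\<omega>. sup_sq (\<lambda>s \<omega>. I s \<omega> - ?S1 j s \<omega>) t \<omega>" and ?b = "\<lambda>\<omega>. sup_sq (\<lambda>s \<omega>. ?S1 j s \<omega> - ?S2 j s \<omega>) t \<omega>"
      and ?c = "\<lambda>\<omega>. sup_sq (\<lambda>s \<omega>. ?S2 j s \<omega> - J s \<omega>) t \<omega>"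
    have [measurable]: "?a \<in> borel_measurable M" by (rule meas[OF IAE I S1'(2,1)])
    have [measurable]: "?b \<in> borel_measurable M" by (rule meas[OF S1'(2,1) S2'(2,1)])
    have [measurable]: "?c \<in> borel_measurable M" by (rule meas[OF S2'(2,1) IAE J])
    have "(\<integral>\<^sup>+\<omega>. sup_sq (\<lambda>s \<omega>. I s \<omega> - J s \<omega>) t \<omega> \<partial>M) \<le> (\<integral>\<^sup>+\<omega>. 2 * ?a \<omega> + 2 * (2 * ?b \<omega> + 2 * ?c \<omega>) \<partial>M)"
      by (intro nn_integral_mono order_trans[OF sup_sq_triangle[where Y="?S1 j"]] add_left_mono mult_left_mono sup_sq_triangle) simp
    also have "\<dots> = 2 * (\<integral>\<^sup>+\<omega>. ?a \<omega> \<partial>M) + 2 * (2 * (\<integral>\<^sup>+\<omega>. ?b \<omega> \<partial>M) + 2 * (\<integral>\<^sup>+\<omega>. ?c \<omega> \<partial>M))"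
      by (simp add: nn_integral_add nn_integral_cmult)
    also have "\<dots> = 2 * (\<integral>\<^sup>+\<omega>. ?a \<omega> \<partial>M) + (4 * (\<integral>\<^sup>+\<omega>. ?b \<omega> \<partial>M) + 4 * (\<integral>\<^sup>+\<omega>. ?c \<omega> \<partial>M))"
      by (simp add: distrib_left mult.assoc[symmetric])
    also have "\<dots> \<le> 2 * ?E1 j + (4 * (4 * (2 * dist2 (?v1 j) \<Phi> T + 2 * (2 * dist2 \<Phi> \<Psi> t + 2 * dist2 (?v2 j) \<Psi> T))) + 4 * ?E2 j)"
    proof (intro add_mono mult_left_mono)
      show "(\<integral>\<^sup>+\<omega>. ?a \<omega> \<partial>M) \<le> ?E1 j"
        unfolding sup_sq_minus_commute[of I] by (intro nn_integral_mono sup_sq_mono t)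
      show "(\<integral>\<^sup>+\<omega>. ?c \<omega> \<partial>M) \<le> ?E2 j" by (intro nn_integral_mono sup_sq_mono t)
      have "(\<integral>\<^sup>+\<omega>. ?b \<omega> \<partial>M) \<le> 4 * dist2 (?v1 j) (?v2 j) t" by (rule simple_diff_bound[OF S1 S2 t])
      also have "\<dots> \<le> 4 * (2 * dist2 (?v1 j) \<Phi> t + 2 * dist2 \<Phi> (?v2 j) t)"
        by (intro mult_left_mono dist2_triangle simple_value_prog S1 S2 \<Phi> t) simp
      also have "\<dots> \<le> 4 * (2 * dist2 (?v1 j) \<Phi> T + 2 * (2 * dist2 \<Phi> \<Psi> t + 2 * dist2 \<Psi> (?v2 j) t))"
        by (intro mult_left_mono add_mono dist2_mono dist2_triangle simple_value_prog S1 S2 \<Phi> \<Psi> t) simp_all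
      also have "\<dots> \<le> 4 * (2 * dist2 (?v1 j) \<Phi> T + 2 * (2 * dist2 \<Phi> \<Psi> t + 2 * dist2 (?v2 j) \<Psi> T))"
        unfolding dist2_commute[of \<Psi>] by (intro mult_left_mono add_left_mono dist2_mono t) simp_all
      finally show "(\<integral>\<^sup>+\<omega>. ?b \<omega> \<partial>M) \<le> 4 * (2 * dist2 (?v1 j) \<Phi> T + 2 * (2 * dist2 \<Phi> \<Psi> t + 2 * dist2 (?v2 j) \<Psi> T))" .
    qed simp_all
    finally show ?thesis .
  qed
  have c: "(\<lambda>j. a * f j) \<longlonglongrightarrow> a * y" if "(f \<longlongrightarrow> y) sequentially" "a < top" for a y and f :: "nat \<Rightarrow> ennreal"
    using that by (rule ennreal_tendsto_cmult[rotated])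
  have "(\<lambda>j. 2 * ?E1 j + (4 * (4 * (2 * dist2 (?v1 j) \<Phi> T + 2 * (2 * dist2 \<Phi> \<Psi> t + 2 * dist2 (?v2 j) \<Psi> T))) + 4 * ?E2 j))
    \<longlonglongrightarrow> 2 * 0 + (4 * (4 * (2 * 0 + 2 * (2 * dist2 \<Phi> \<Psi> t + 2 * 0))) + 4 * 0)"
    by (intro tendsto_add c d1 d2 i1 i2 tendsto_const) simp_all
  moreover have "2 * 0 + (4 * (4 * (2 * 0 + 2 * (2 * dist2 \<Phi> \<Psi> t + 2 * 0))) + 4 * 0) = 64 * dist2 \<Phi> \<Psi> t"
    by (simp add: mult.assoc[symmetric])
  ultimately have l: "(\<lambda>j. 2 * ?E1 j + (4 * (4 * (2 * dist2 (?v1 j) \<Phi> T + 2 * (2 * dist2 \<Phi> \<Psi> t + 2 * dist2 (?v2 j) \<Psi> T))) + 4 * ?E2 j))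
    \<longlonglongrightarrow> 64 * dist2 \<Phi> \<Psi> t" by (simp only:)
  show ?thesis by (rule LIMSEQ_le_const[OF l]) (use bound in blast)
qed

lemma ito_L2_zero: "ito_L2 (\<lambda>_ _. 0 :: (real ^ 'm) \<Rightarrow>\<^sub>L 'h::{real_inner, banach, second_countable_topology}) (\<lambda>_ _. 0)"
  unfolding ito_L2_def
proof (intro conjI exI allI)
  show "prog_measurable F {0..T} (\<lambda>_ _. 0 :: (real ^ 'm) \<Rightarrow>\<^sub>L 'h)"
    by (simp add: prog_measurable_def split_beta')
  show "adapted_continuous F {0..T} (\<lambda>_ _. 0 :: 'h)" by (simp add: adapted_continuous_def)
  show "simple_process F T 0 (\<lambda>_. 0) (\<lambda>_ _. 0 :: (real ^ 'm) \<Rightarrow>\<^sub>L 'h)" for j :: nat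
    using T_pos by (simp add: simple_process_def)
  show "(\<lambda>j. dist2 (simple_value 0 (\<lambda>_. 0) (\<lambda>_ _. 0)) (\<lambda>_ _. 0 :: (real ^ 'm) \<Rightarrow>\<^sub>L 'h) T) \<longlonglongrightarrow> 0"
    by (simp add: dist2_def energy_def simple_value_def)
  show "(\<lambda>j. \<integral>\<^sup>+\<omega>. sup_sq (\<lambda>s \<omega>. simple_integral W 0 (\<lambda>_. 0) (\<lambda>_ _. 0 :: (real ^ 'm) \<Rightarrow>\<^sub>L 'h) s \<omega> - 0) T \<omega> \<partial>M) \<longlonglongrightarrow> 0"
    using T_pos by (simp add: sup_sq_def simple_integral_def)
qed

lemma ito_L2_bound:
  fixes \<Phi> :: "real \<Rightarrow> 'w \<Rightarrow> (real ^ 'm) \<Rightarrow>\<^sub>L 'h::{real_inner, banach, second_countable_topology}"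
  assumes A: "ito_L2 \<Phi> I" and t: "0 \<le> t" "t \<le> T"
  shows "(\<integral>\<^sup>+\<omega>. sup_sq I t \<omega> \<partial>M) \<le> 64 * (\<integral>\<^sup>+\<omega>. energy \<Phi> t \<omega> \<partial>M)"
  using ito_L2_diff_bound[OF A ito_L2_zero t] by (simp add: dist2_def)

lemma ito_L2_is_ito_integral:
  fixes \<Phi> :: "real \<Rightarrow> 'w \<Rightarrow> (real ^ 'm) \<Rightarrow>\<^sub>L 'h::{real_inner, banach, second_countable_topology}"
  assumes A: "ito_L2 \<Phi> I" and fin: "(\<integral>\<^sup>+\<omega>. energy \<Phi> T \<omega> \<partial>M) < \<infinity>"
  shows "is_ito_integral M F W T \<Phi> I"
proof -
  obtain n p \<xi> where S: "\<And>j::nat. simple_process F T (n j) (p j) (\<xi> j)"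
    and d: "(\<lambda>j. dist2 (simple_value (n j) (p j) (\<xi> j)) \<Phi> T) \<longlonglongrightarrow> 0"
    and i: "(\<lambda>j. \<integral>\<^sup>+\<omega>. sup_sq (\<lambda>s \<omega>. simple_integral W (n j) (p j) (\<xi> j) s \<omega> - I s \<omega>) T \<omega> \<partial>M) \<longlonglongrightarrow> 0"
    and \<Phi>: "prog_measurable F {0..T} \<Phi>" and I: "adapted_continuous F {0..T} I"
    using A unfolding ito_L2_def by blast
  have T0: "0 \<le> T" using T_pos by simp
  have AEfin: "AE \<omega> in M. (\<integral>\<^sup>+ s\<in>{0..T}. ennreal ((hs_norm (\<Phi> s \<omega>))\<^sup>2) \<partial>lborel) < \<infinity>"
  proof -
    have "AE \<omega> in M. energy \<Phi> T \<omega> \<noteq> \<infinity>"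
      by (rule nn_integral_PInf_AE[OF energy_measurable_M[OF \<Phi> T0 order_refl]]) (use fin in auto)
    then show ?thesis by eventually_elim (simp add: energy_def top.not_eq_extremum)
  qed
  have fm: "finite_measure M" by unfold_locales
  have 1: "(\<lambda>j. measure M {\<omega>\<in>space M. ennreal \<epsilon> < energy (\<lambda>s \<omega>. simple_value (n j) (p j) (\<xi> j) s \<omega> - \<Phi> s \<omega>) T \<omega>}) \<longlonglongrightarrow> 0"
    if "0 < \<epsilon>" for \<epsilon>
    using nn_integral_tendsto_0_imp_prob[OF fm _ d[unfolded dist2_def] that]
    by (simp add: energy_measurable_M prog_measurable_diff simple_value_prog S \<Phi> T0)
  have 2: "(\<lambda>j. measure M {\<omega>\<in>space M. \<epsilon> < norm (simple_integral W (n j) (p j) (\<xi> j) t \<omega> - I t \<omega>)}) \<longlonglongrightarrow> 0"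
    if t: "t \<in> {0..T}" and e: "0 < \<epsilon>" for t \<epsilon>
  proof -
    let ?g = "\<lambda>j \<omega>. ennreal ((norm (simple_integral W (n j) (p j) (\<xi> j) t \<omega> - I t \<omega>))\<^sup>2)"
    have sm[measurable]: "simple_integral W (n j) (p j) (\<xi> j) t \<in> borel_measurable M" for j
      unfolding simple_integral_elem
      by (rule measurable_F_M[OF elem_integral_measurable[OF simple_process_elem[OF S]]]) (use t in auto)
    have [measurable]: "I t \<in> borel_measurable M" by (rule measurable_F_M[OF adapted_continuousD(1)[OF I t]])
    have gm: "?g j \<in> borel_measurable M" for j by measurable
    have gl: "(\<lambda>j. \<integral>\<^sup>+\<omega>. ?g j \<omega> \<partial>M) \<longlonglongrightarrow> 0"
    proof (rule tendsto_sandwich[OF eventuallyI eventuallyI tendsto_const i])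
      show "(\<integral>\<^sup>+\<omega>. ?g j \<omega> \<partial>M) \<le> (\<integral>\<^sup>+\<omega>. sup_sq (\<lambda>s \<omega>. simple_integral W (n j) (p j) (\<xi> j) s \<omega> - I s \<omega>) T \<omega> \<partial>M)" for j
      proof (rule nn_integral_mono)
        fix \<omega>
        show "?g j \<omega> \<le> sup_sq (\<lambda>s \<omega>. simple_integral W (n j) (p j) (\<xi> j) s \<omega> - I s \<omega>) T \<omega>"
          using sup_sq_upper[of t T "\<lambda>s \<omega>. simple_integral W (n j) (p j) (\<xi> j) s \<omega> - I s \<omega>" \<omega>] t by simp
      qed
    qed simp
    have "(ennreal (\<epsilon>\<^sup>2) < ennreal (x\<^sup>2)) = (\<epsilon> < x)" if "0 \<le> x" for x
      using that e by (auto simp: ennreal_less_iff intro: power_strict_mono power2_less_imp_less)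
    then show ?thesis
      using nn_integral_tendsto_0_imp_prob[OF fm gm gl, of "\<epsilon>\<^sup>2"] e by simp
  qed
  show ?thesis unfolding is_ito_integral_def
    using \<Phi> AEfin I S 1 2 unfolding energy_def by blast
qed

end

section \<open>Locality of the Ito integral\<close>

text \<open>Terms are counted as long as the preceding partial sum has not exceeded \<kappa>, so the
  total can exceed \<kappa> by one term at most. The induction also records that until then nothing
  has been dropped.\<close>

lemma sum_stopped_le:
  fixes a :: "nat \<Rightarrow> real"
  assumes a: "\<And>k. 0 \<le> a k" "\<And>k. k < n \<Longrightarrow> a k \<le> \<beta>" and \<kappa>: "0 \<le> \<kappa>" "0 \<le> \<beta>"
  shows "(\<Sum>k<n. (if (\<Sum>j<k. a j) \<le> \<kappa> then 1 else 0) * a k) \<le> \<kappa> + \<beta>"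
proof -
  let ?L = "\<lambda>n. \<Sum>k<n. (if (\<Sum>j<k. a j) \<le> \<kappa> then 1 else 0) * a k"
  have "?L m \<le> \<kappa> + \<beta> \<and> ((\<Sum>j<m. a j) \<le> \<kappa> \<longrightarrow> ?L m = (\<Sum>j<m. a j))" if "m \<le> n" for m
    using that
  proof (induction m)
    case 0 then show ?case using \<kappa> by simp
  next
    case (Suc m)
    then have IH: "?L m \<le> \<kappa> + \<beta>" "(\<Sum>j<m. a j) \<le> \<kappa> \<Longrightarrow> ?L m = (\<Sum>j<m. a j)" and b: "a m \<le> \<beta>" using a(2)[of m] by auto
    show ?case
    proof (cases "(\<Sum>j<m. a j) \<le> \<kappa>")
      case True
      then show ?thesis using IH(2)[OF True] b by simp
    next
      case False
      then show ?thesis using IH(1) a(1)[of m] by simp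
    qed
  qed
  then show ?thesis by blast
qed

section \<open>Tail bound for elementary integrals in terms of their energy\<close>

context brownian_basis
begin

lemma elem_energy_add:
  assumes E: "elem_family K p q \<xi>" and "r \<le> s" "s \<le> t"
  shows "elem_energy K p q \<xi> r s \<omega> + elem_energy K p q \<xi> s t \<omega> = elem_energy K p q \<xi> r t \<omega>"
proof -
  let ?h = "\<lambda>u. (hs_norm (elem_value K p q \<xi> u \<omega>))\<^sup>2"
  note H1 = elem_energy_integral[OF E assms(2), of \<omega>] and H2 = elem_energy_integral[OF E assms(3), of \<omega>]
    and H3 = elem_energy_integral[OF E order_trans[OF assms(2,3)], of \<omega>]
  have "elem_energy K p q \<xi> r s \<omega> + elem_energy K p q \<xi> s t \<omega> = (LINT u|lborel. indicator {r..s} u * ?h u + indicator {s..t} u * ?h u)"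
    using has_bochner_integral_add[OF H1 H2] by (simp add: has_bochner_integral_integral_eq)
  also have "\<dots> = (LINT u|lborel. indicator {r..t} u * ?h u)"
  proof (rule integral_cong_AE)
    show "(\<lambda>u. indicator {r..s} u * ?h u + indicator {s..t} u * ?h u) \<in> borel_measurable lborel"
      using has_bochner_integral_add[OF H1 H2] by (rule borel_measurable_has_bochner_integral)
    show "(\<lambda>u. indicator {r..t} u * ?h u) \<in> borel_measurable lborel"
      using H3 by (rule borel_measurable_has_bochner_integral)
    show "AE u in lborel. indicator {r..s} u * ?h u + indicator {s..t} u * ?h u = indicator {r..t} u * ?h u"
      using AE_lborel_singleton[of s] by eventually_elim (use assms in \<open>auto simp: indicator_def\<close>)
  qed
  also have "\<dots> = elem_energy K p q \<xi> r t \<omega>" using H3 by (rule has_bochner_integral_integral_eq)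
  finally show ?thesis .
qed

lemma elem_energy_nonneg: "elem_family K p q \<xi> \<Longrightarrow> s \<le> t \<Longrightarrow> 0 \<le> elem_energy K p q \<xi> s t \<omega>"
  using Bochner_Integration.integral_nonneg[of lborel "\<lambda>u. indicator {s..t} u * (hs_norm (elem_value K p q \<xi> u \<omega>))\<^sup>2"]
    has_bochner_integral_integral_eq[OF elem_energy_integral, of K p q \<xi> s t \<omega>] by simp

lemma energy_elem:
  assumes "elem_family K p q \<xi>" "0 \<le> t"
  shows "energy (elem_value K p q \<xi>) t \<omega> = ennreal (elem_energy K p q \<xi> 0 t \<omega>)"
proof -
  note H = elem_energy_integral[OF assms, of \<omega>]
  have "energy (elem_value K p q \<xi>) t \<omega> = (\<integral>\<^sup>+s. ennreal (indicator {0..t} s * (hs_norm (elem_value K p q \<xi> s \<omega>))\<^sup>2) \<partial>lborel)"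
    unfolding energy_def by (rule nn_integral_cong) (auto simp: indicator_def)
  also have "\<dots> = ennreal (LINT s|lborel. indicator {0..t} s * (hs_norm (elem_value K p q \<xi> s \<omega>))\<^sup>2)"
    using H by (intro nn_integral_eq_integral) (auto simp: has_bochner_integral_iff)
  finally show ?thesis by (simp only: has_bochner_integral_integral_eq[OF H])
qed

lemma elem_energy_measurable:
  assumes E: "elem_family K p q \<xi>" and st: "0 \<le> s" "s \<le> t"
  shows "elem_energy K p q \<xi> s t \<in> borel_measurable (F t)"
proof -
  have "early t p \<xi> k \<in> borel_measurable (F t)" if "k \<in> K" for k
    by (rule early_measurable[OF E that st(2)]) (rule clamp_to_le(2)[OF st(2)])
  then show ?thesis unfolding elem_energy_eq[OF E st(2), abs_def]
    by (intro borel_measurable_sum borel_measurable_times borel_measurable_const borel_measurable_hs_inner)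
qed

text \<open>Bounded coefficients make the energy spent in one step of a partition proportional to
  the mesh; this controls the overshoot in \<open>elem_tail_bound\<close>.\<close>

lemma elem_energy_lipschitz:
  assumes E: "elem_family K p q \<xi>"
  obtains B where "0 \<le> B" "\<And>s t \<omega>. s \<le> t \<Longrightarrow> \<omega> \<in> space M \<Longrightarrow> elem_energy K p q \<xi> s t \<omega> \<le> B * (t - s)"
proof -
  obtain C where C: "\<And>k \<omega>. k \<in> K \<Longrightarrow> \<omega> \<in> space M \<Longrightarrow> norm (\<xi> k \<omega>) \<le> C" "0 \<le> C"
    using elem_family_bound[OF E] by metis
  let ?B = "(sqrt DIM(real ^ 'm) * (\<Sum>k\<in>K. C))\<^sup>2"
  show ?thesis
  proof (rule that[of ?B])
    fix s t :: real and \<omega> assume st: "s \<le> t" and w: "\<omega> \<in> space M"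
    have b: "(hs_norm (elem_value K p q \<xi> u \<omega>))\<^sup>2 \<le> ?B" for u
    proof (rule power_mono)
      have "norm (elem_value K p q \<xi> u \<omega>) \<le> (\<Sum>k\<in>K. C)"
        unfolding elem_value_def using C w by (intro sum_norm_le) (auto simp: indicator_def)
      then show "hs_norm (elem_value K p q \<xi> u \<omega>) \<le> sqrt DIM(real ^ 'm) * (\<Sum>k\<in>K. C)"
        by (intro order_trans[OF hs_norm_le_norm] mult_left_mono) auto
    qed simp
    note H = elem_energy_integral[OF E st, of \<omega>]
    have "elem_energy K p q \<xi> s t \<omega> = (LINT u|lborel. indicator {s..t} u * (hs_norm (elem_value K p q \<xi> u \<omega>))\<^sup>2)"
      using H by (simp only: has_bochner_integral_integral_eq)
    also have "\<dots> \<le> (LINT u|lborel. indicator {s..t} u * ?B)"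
    proof (rule integral_mono)
      show "integrable lborel (\<lambda>u. indicator {s..t} u * (hs_norm (elem_value K p q \<xi> u \<omega>))\<^sup>2)" using H by (rule integrable.intros)
      show "integrable lborel (\<lambda>u. indicator {s..t} u * ?B)"
        using st by (intro integrable_mult_left integrable_real_indicator) auto
      show "indicator {s..t} u * (hs_norm (elem_value K p q \<xi> u \<omega>))\<^sup>2 \<le> indicator {s..t} u * ?B" for u
        by (intro mult_left_mono b) simp
    qed
    also have "\<dots> = ?B * (t - s)" using st by simp
    finally show "elem_energy K p q \<xi> s t \<omega> \<le> ?B * (t - s)" .
  qed simp
qed

text \<open>A martingale transform with weights 0 and 1. The sum up to step \<open>n\<close>,
  multiplied by the next weight, is known at \<open>\<tau> n\<close>, so its product with the next
  increment has expectation 0; the square of a weight is the weight itself, and the weighted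
  isometry evaluates the remaining term.\<close>

lemma elem_stopped_second_moment:
  assumes E: "elem_family K p q \<xi>"
    and \<tau>: "0 \<le> \<tau> 0" "\<And>k. \<tau> k \<le> \<tau> (Suc k)"
    and \<rho>: "\<And>k. \<rho> k \<in> borel_measurable (F (\<tau> k))" "\<And>k \<omega>. \<rho> k \<omega> = 0 \<or> \<rho> k \<omega> = (1 :: real)"
  shows "integrable M (\<lambda>\<omega>. (norm (\<Sum>k<n. \<rho> k \<omega> *\<^sub>R (elem_integral K p q \<xi> (\<tau> (Suc k)) \<omega> - elem_integral K p q \<xi> (\<tau> k) \<omega>)))\<^sup>2)
    \<and> expectation (\<lambda>\<omega>. (norm (\<Sum>k<n. \<rho> k \<omega> *\<^sub>R (elem_integral K p q \<xi> (\<tau> (Suc k)) \<omega> - elem_integral K p q \<xi> (\<tau> k) \<omega>)))\<^sup>2)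
      = expectation (\<lambda>\<omega>. \<Sum>k<n. \<rho> k \<omega> * elem_energy K p q \<xi> (\<tau> k) (\<tau> (Suc k)) \<omega>)"
proof (induction n)
  case 0 show ?case by simp
next
  case (Suc n)
  let ?d = "\<lambda>k \<omega>. elem_integral K p q \<xi> (\<tau> (Suc k)) \<omega> - elem_integral K p q \<xi> (\<tau> k) \<omega>"
  let ?N = "\<lambda>n \<omega>. \<Sum>k<n. \<rho> k \<omega> *\<^sub>R ?d k \<omega>"
  let ?e = "\<lambda>k. elem_energy K p q \<xi> (\<tau> k) (\<tau> (Suc k))"
  have mono: "\<tau> i \<le> \<tau> j" if "i \<le> j" for i j using that \<tau>(2) by (rule lift_Suc_mono_le[rotated])
  have pos: "0 \<le> \<tau> k" for k using \<tau>(1) mono[of 0 k] by simp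
  have Sm: "elem_integral K p q \<xi> (\<tau> i) \<in> borel_measurable (F (\<tau> j))" if "i \<le> j" for i j
    by (rule measurable_F_mono[OF mono[OF that] elem_integral_measurable[OF E pos]])
  have \<rho>m: "\<rho> i \<in> borel_measurable (F (\<tau> j))" if "i \<le> j" for i j
    by (rule measurable_F_mono[OF mono[OF that] \<rho>(1)])
  have Nm: "?N n \<in> borel_measurable (F (\<tau> n))"
    by (intro borel_measurable_sum borel_measurable_scaleR borel_measurable_diff Sm \<rho>m) auto
  have \<rho>b: "\<bar>\<rho> k \<omega>\<bar> \<le> 1" for k \<omega> using \<rho>(2)[of k \<omega>] by auto
  have Ni: "integrable M (\<lambda>\<omega>. (norm (?N n \<omega>))\<^sup>2)" using Suc by blast
  note I = elem_isometry_weighted[OF E pos \<tau>(2) \<rho>(1) \<rho>b, of n]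
  let ?\<eta> = "\<lambda>\<omega>. \<rho> n \<omega> *\<^sub>R ?N n \<omega>"
  have \<eta>m: "?\<eta> \<in> borel_measurable (F (\<tau> n))" by (intro borel_measurable_scaleR \<rho>(1) Nm)
  have \<eta>i: "integrable M (\<lambda>\<omega>. norm (?\<eta> \<omega>))"
  proof (rule Bochner_Integration.integrable_bound)
    show "integrable M (\<lambda>\<omega>. 1 + (norm (?N n \<omega>))\<^sup>2)" using Ni by simp
    show "(\<lambda>\<omega>. norm (?\<eta> \<omega>)) \<in> borel_measurable M" by (rule measurable_compose[OF measurable_F_M[OF \<eta>m] borel_measurable_norm])
    have "norm (norm (?\<eta> \<omega>)) \<le> norm (1 + (norm (?N n \<omega>))\<^sup>2)" for \<omega>
    proof -
      have "norm (?\<eta> \<omega>) \<le> norm (?N n \<omega>)" using mult_right_mono[OF \<rho>b[of n \<omega>] norm_ge_zero[of "?N n \<omega>"]] by simp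
      also have "\<dots> \<le> 1 + (norm (?N n \<omega>))\<^sup>2"
        using sum_squares_bound[of "norm (?N n \<omega>)" 1] norm_ge_zero[of "?N n \<omega>"]
        unfolding power_one mult_1_right by linarith
      finally show ?thesis by simp
    qed
    then show "AE \<omega> in M. norm (norm (?\<eta> \<omega>)) \<le> norm (1 + (norm (?N n \<omega>))\<^sup>2)" by (rule AE_I2)
  qed
  note O = elem_orthogonal[OF E pos \<tau>(2) \<eta>m \<eta>i]
  have sq: "(norm (?N (Suc n) \<omega>))\<^sup>2 = (norm (?N n \<omega>))\<^sup>2 + 2 * (?\<eta> \<omega> \<bullet> ?d n \<omega>) + \<rho> n \<omega> * (norm (?d n \<omega>))\<^sup>2" for \<omega>
    using \<rho>(2)[of n \<omega>] by (auto simp: power2_norm_eq_inner inner_add_left inner_add_right inner_commute)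
  have Ei: "integrable M (\<lambda>\<omega>. \<rho> k \<omega> * ?e k \<omega>)" for k
    by (rule elem_isometry_weighted(2)[OF E pos \<tau>(2) \<rho>(1) \<rho>b])
  have gen: "expectation (\<lambda>\<omega>. f \<omega> + 2 * g \<omega> + h \<omega>) = expectation f + 2 * expectation g + expectation h"
    if "integrable M f" "integrable M g" "integrable M h" for f g h :: "'w \<Rightarrow> real"
    using that by simp
  have "integrable M (\<lambda>\<omega>. (norm (?N (Suc n) \<omega>))\<^sup>2)"
    unfolding sq by (intro Bochner_Integration.integrable_add integrable_mult_right Ni O(1) I(1))
  moreover have "expectation (\<lambda>\<omega>. (norm (?N (Suc n) \<omega>))\<^sup>2)
    = expectation (\<lambda>\<omega>. (norm (?N n \<omega>))\<^sup>2) + 2 * expectation (\<lambda>\<omega>. ?\<eta> \<omega> \<bullet> ?d n \<omega>) + expectation (\<lambda>\<omega>. \<rho> n \<omega> * (norm (?d n \<omega>))\<^sup>2)"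
    unfolding sq by (rule gen[OF Ni O(1) I(1)])
  moreover have "expectation (\<lambda>\<omega>. \<Sum>k<Suc n. \<rho> k \<omega> * ?e k \<omega>) = expectation (\<lambda>\<omega>. \<Sum>k<n. \<rho> k \<omega> * ?e k \<omega>) + expectation (\<lambda>\<omega>. \<rho> n \<omega> * ?e n \<omega>)"
    unfolding sum.lessThan_Suc by (intro Bochner_Integration.integral_add Bochner_Integration.integrable_sum Ei)
  ultimately show ?case using Suc O(2) I(3) by simp
qed

text \<open>
  The integral is stopped along a partition as soon as the energy exceeds \<open>\<kappa>\<close>; the overshoot of the
  energy is at most the mesh times a constant and vanishes in the limit.
\<close>

lemma elem_tail_bound:
  assumes E: "elem_family K p q \<xi>" and t: "0 \<le> t" and \<kappa>: "0 \<le> \<kappa>" and c: "0 < c"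
  shows "measure M {\<omega>\<in>space M. c < norm (elem_integral K p q \<xi> t \<omega>) \<and> elem_energy K p q \<xi> 0 t \<omega> \<le> \<kappa>} \<le> \<kappa> / c\<^sup>2"
    (is "measure M ?A \<le> _")
proof -
  obtain B where B: "0 \<le> B" "\<And>s t \<omega>. s \<le> t \<Longrightarrow> \<omega> \<in> space M \<Longrightarrow> elem_energy K p q \<xi> s t \<omega> \<le> B * (t - s)"
    using elem_energy_lipschitz[OF E] by metis
  have "measure M ?A * c\<^sup>2 \<le> \<kappa> + B * (t * inverse (real (Suc n)))" for n
  proof -
    define \<tau> where "\<tau> k = real k * (t * inverse (real (Suc n)))" for k
    have \<tau>0: "\<tau> 0 = 0" and \<tau>n: "\<tau> (Suc n) = t" by (simp_all add: \<tau>_def del: of_nat_Suc)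
    have \<tau>d: "\<tau> (Suc k) - \<tau> k = t * inverse (real (Suc n))" for k
      unfolding \<tau>_def left_diff_distrib[symmetric] by simp
    have \<tau>m: "\<tau> k \<le> \<tau> (Suc k)" for k
    proof -
      have "0 \<le> t * inverse (real (Suc n))" using t by simp
      then show ?thesis using \<tau>d[of k] by linarith
    qed
    have mono: "\<tau> i \<le> \<tau> j" if "i \<le> j" for i j using that \<tau>m by (rule lift_Suc_mono_le[rotated])
    have pos: "0 \<le> \<tau> k" for k using \<tau>0 mono[of 0 k] by simp
    let ?a = "\<lambda>\<omega> k. elem_energy K p q \<xi> (\<tau> k) (\<tau> (Suc k)) \<omega>"
    \<comment> \<open>The weight for the step starting at \<open>\<tau> k\<close> depends on the
      energy spent up to \<open>\<tau> k\<close>, so it is known there.\<close>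
    let ?r = "\<lambda>k \<omega>. if (\<Sum>j<k. ?a \<omega> j) \<le> \<kappa> then 1 else 0 :: real"
    have A: "(\<Sum>j<k. ?a \<omega> j) = elem_energy K p q \<xi> 0 (\<tau> k) \<omega>" for k \<omega>
    proof (induction k)
      case 0
      have "elem_energy K p q \<xi> 0 0 \<omega> + elem_energy K p q \<xi> 0 0 \<omega> = elem_energy K p q \<xi> 0 0 \<omega>"
        by (rule elem_energy_add[OF E]) auto
      then show ?case by (simp add: \<tau>0)
    next
      case (Suc k)
      then show ?case using elem_energy_add[OF E pos \<tau>m, of k \<omega>] by simp
    qed
    have rm: "?r k \<in> borel_measurable (F (\<tau> k))" for k
    proof -
      have [measurable]: "elem_energy K p q \<xi> 0 (\<tau> k) \<in> borel_measurable (F (\<tau> k))"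
        by (rule elem_energy_measurable[OF E order_refl pos])
      show ?thesis unfolding A by measurable
    qed
    let ?N = "\<lambda>\<omega>. \<Sum>k<Suc n. ?r k \<omega> *\<^sub>R (elem_integral K p q \<xi> (\<tau> (Suc k)) \<omega> - elem_integral K p q \<xi> (\<tau> k) \<omega>)"
    have r01: "?r k \<omega> = 0 \<or> ?r k \<omega> = 1" for k \<omega> by simp
    note H = elem_stopped_second_moment[where \<tau>=\<tau> and \<rho>="?r" and n="Suc n", OF E pos \<tau>m rm r01]
    have M2: "integrable M (\<lambda>\<omega>. (norm (?N \<omega>))\<^sup>2)"
      "expectation (\<lambda>\<omega>. (norm (?N \<omega>))\<^sup>2) = expectation (\<lambda>\<omega>. \<Sum>k<Suc n. ?r k \<omega> * ?a \<omega> k)"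
      by (rule conjunct1[OF H], rule conjunct2[OF H])
    have "expectation (\<lambda>\<omega>. \<Sum>k<Suc n. ?r k \<omega> * ?a \<omega> k) \<le> expectation (\<lambda>\<omega>. \<kappa> + B * (t * inverse (real (Suc n))))"
    proof (rule integral_mono_AE)
      show "integrable M (\<lambda>\<omega>. \<Sum>k<Suc n. ?r k \<omega> * ?a \<omega> k)"
      proof (rule Bochner_Integration.integrable_sum)
        fix k
        have "\<bar>?r k \<omega>\<bar> \<le> 1" for \<omega> by simp
        then show "integrable M (\<lambda>\<omega>. ?r k \<omega> * ?a \<omega> k)" by (rule elem_isometry_weighted(2)[OF E pos \<tau>m rm])
      qed
      show "AE \<omega> in M. (\<Sum>k<Suc n. ?r k \<omega> * ?a \<omega> k) \<le> \<kappa> + B * (t * inverse (real (Suc n)))"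
      proof (rule AE_I2)
        fix \<omega> assume w: "\<omega> \<in> space M"
        show "(\<Sum>k<Suc n. ?r k \<omega> * ?a \<omega> k) \<le> \<kappa> + B * (t * inverse (real (Suc n)))"
        proof (rule sum_stopped_le)
          show "0 \<le> ?a \<omega> k" for k by (rule elem_energy_nonneg[OF E \<tau>m])
          show "?a \<omega> k \<le> B * (t * inverse (real (Suc n)))" for k using B(2)[OF \<tau>m w, of k] unfolding \<tau>d .
          show "0 \<le> B * (t * inverse (real (Suc n)))" using B(1) t by simp
        qed (rule \<kappa>)
      qed
    qed simp
    also have "\<dots> = \<kappa> + B * (t * inverse (real (Suc n)))" by (simp add: prob_space)
    finally have up: "expectation (\<lambda>\<omega>. (norm (?N \<omega>))\<^sup>2) \<le> \<kappa> + B * (t * inverse (real (Suc n)))" unfolding M2(2) .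
    have [measurable]: "elem_integral K p q \<xi> t \<in> borel_measurable M" "elem_energy K p q \<xi> 0 t \<in> borel_measurable M"
      using measurable_F_M[OF elem_integral_measurable[OF E t]] measurable_F_M[OF elem_energy_measurable[OF E order_refl t]] by auto
    have Am: "?A \<in> sets M" by measurable
    have "measure M ?A * c\<^sup>2 = expectation (\<lambda>\<omega>. indicator ?A \<omega> * c\<^sup>2)" using Am by simp
    also have "\<dots> \<le> expectation (\<lambda>\<omega>. (norm (?N \<omega>))\<^sup>2)"
    proof (rule integral_mono[OF _ M2(1)])
      show "integrable M (\<lambda>\<omega>. indicator ?A \<omega> * c\<^sup>2)"
        using Am by (intro integrable_mult_left integrable_real_indicator) (auto simp: emeasure_eq_measure)
      fix \<omega> assume w: "\<omega> \<in> space M"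
      show "indicator ?A \<omega> * c\<^sup>2 \<le> (norm (?N \<omega>))\<^sup>2"
      proof (cases "\<omega> \<in> ?A")
        \<comment> \<open>On this event the energy never exceeds \<kappa>, so no weight is 0 and the
          stopped sum telescopes to the full integral.\<close>
        case True
        have "?r k \<omega> = 1" if "k < Suc n" for k
        proof -
          have "elem_energy K p q \<xi> 0 (\<tau> k) \<omega> \<le> elem_energy K p q \<xi> 0 t \<omega>"
            using elem_energy_add[OF E pos[of k], of t \<omega>] elem_energy_nonneg[OF E, of "\<tau> k" t \<omega>] mono[of k "Suc n"] that \<tau>n by simp
          then show ?thesis using True unfolding A by simp
        qed
        then have "?N \<omega> = (\<Sum>k<Suc n. elem_integral K p q \<xi> (\<tau> (Suc k)) \<omega> - elem_integral K p q \<xi> (\<tau> k) \<omega>)"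
          by (intro sum.cong) auto
        also have "\<dots> = elem_integral K p q \<xi> (\<tau> (Suc n)) \<omega> - elem_integral K p q \<xi> (\<tau> 0) \<omega>"
          by (rule sum_lessThan_telescope)
        also have "elem_integral K p q \<xi> (\<tau> 0) \<omega> = 0"
        proof -
          have "min (q k) 0 = 0" "min (p k) 0 = 0" if "k \<in> K" for k using elem_familyD[OF E that] by auto
          then show ?thesis by (simp add: elem_integral_def \<tau>0)
        qed
        finally have "?N \<omega> = elem_integral K p q \<xi> t \<omega>" by (simp add: \<tau>n)
        moreover have "c\<^sup>2 \<le> (norm (elem_integral K p q \<xi> t \<omega>))\<^sup>2" using True c by (intro power_mono) auto
        ultimately show ?thesis using True by (simp only: indicator_simps mult_1)
      qed simp
    qed
    also note up
    finally show ?thesis .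
  qed
  moreover have "(\<lambda>n. \<kappa> + B * (t * inverse (real (Suc n)))) \<longlonglongrightarrow> \<kappa> + B * (t * 0)"
    by (intro tendsto_add tendsto_mult tendsto_const LIMSEQ_inverse_real_of_nat)
  ultimately have "measure M ?A * c\<^sup>2 \<le> \<kappa> + B * (t * 0)" by (intro LIMSEQ_le_const) auto
  then show ?thesis using c by (simp add: le_divide_eq)
qed

text \<open>Like \<open>is_ito_integral\<close>, but approximated by families of possibly overlapping intervals,
  which makes the relation closed under differences.\<close>

definition gen_ito :: "(real \<Rightarrow> 'w \<Rightarrow> (real ^ 'm) \<Rightarrow>\<^sub>L 'h::{real_inner, banach, second_countable_topology}) \<Rightarrow> (real \<Rightarrow> 'w \<Rightarrow> 'h) \<Rightarrow> bool" where
  "gen_ito \<Phi> I \<longleftrightarrow> prog_measurable F {0..T} \<Phi> \<and> adapted_continuous F {0..T} I \<and>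
    (\<exists>(K :: nat \<Rightarrow> nat set) p q \<xi>. (\<forall>j. elem_family (K j) (p j) (q j) (\<xi> j)) \<and>
      (\<forall>\<epsilon>>0. (\<lambda>j. measure M {\<omega>\<in>space M. ennreal \<epsilon> < energy (\<lambda>s \<omega>. elem_value (K j) (p j) (q j) (\<xi> j) s \<omega> - \<Phi> s \<omega>) T \<omega>}) \<longlonglongrightarrow> 0) \<and>
      (\<forall>t\<in>{0..T}. \<forall>\<epsilon>>0. (\<lambda>j. measure M {\<omega>\<in>space M. \<epsilon> < norm (elem_integral (K j) (p j) (q j) (\<xi> j) t \<omega> - I t \<omega>)}) \<longlonglongrightarrow> 0))"

lemma is_ito_integral_gen_ito:
  fixes \<Phi> :: "real \<Rightarrow> 'w \<Rightarrow> (real ^ 'm) \<Rightarrow>\<^sub>L 'h::{real_inner, banach, second_countable_topology}"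
  assumes "is_ito_integral M F W T \<Phi> I"
  shows "gen_ito \<Phi> I"
proof -
  obtain n p \<xi> where S: "\<And>j::nat. simple_process F T (n j) (p j) (\<xi> j)"
    and d: "\<And>\<epsilon>. 0 < \<epsilon> \<Longrightarrow> (\<lambda>j. measure M {\<omega>\<in>space M. ennreal \<epsilon> < energy (\<lambda>s \<omega>. simple_value (n j) (p j) (\<xi> j) s \<omega> - \<Phi> s \<omega>) T \<omega>}) \<longlonglongrightarrow> 0"
    and i: "\<And>t \<epsilon>. t \<in> {0..T} \<Longrightarrow> 0 < \<epsilon> \<Longrightarrow> (\<lambda>j. measure M {\<omega>\<in>space M. \<epsilon> < norm (simple_integral W (n j) (p j) (\<xi> j) t \<omega> - I t \<omega>)}) \<longlonglongrightarrow> 0"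
    and \<Phi>: "prog_measurable F {0..T} \<Phi>" and I: "adapted_continuous F {0..T} I"
    using assms unfolding is_ito_integral_def energy_def by blast
  show ?thesis unfolding gen_ito_def
    using \<Phi> I simple_process_elem[OF S] d i unfolding simple_value_elem simple_integral_elem
    by (intro conjI exI[of _ "\<lambda>j. {..<n j}"] exI[of _ p] exI[of _ "\<lambda>j k. p j (Suc k)"] exI[of _ \<xi>]) auto
qed

lemma measure_split_tendsto_0:
  assumes "\<And>j::nat. A j \<subseteq> B j \<union> C j" and "\<And>j. B j \<in> sets M" "\<And>j. C j \<in> sets M"
    and "(\<lambda>j. measure M (B j)) \<longlonglongrightarrow> 0" "(\<lambda>j. measure M (C j)) \<longlonglongrightarrow> 0"
  shows "(\<lambda>j. measure M (A j)) \<longlonglongrightarrow> 0"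
proof (rule tendsto_sandwich[OF eventuallyI eventuallyI tendsto_const])
  show "(\<lambda>j. measure M (B j) + measure M (C j)) \<longlonglongrightarrow> 0" using tendsto_add[OF assms(4,5)] by simp
  show "measure M (A j) \<le> measure M (B j) + measure M (C j)" for j
    by (rule order_trans[OF finite_measure_mono[OF assms(1)] measure_Un_le]) (intro sets.Un assms)+
qed simp

lemma gen_ito_diff:
  fixes \<Phi> \<Psi> :: "real \<Rightarrow> 'w \<Rightarrow> (real ^ 'm) \<Rightarrow>\<^sub>L 'h::{real_inner, banach, second_countable_topology}"
  assumes A: "gen_ito \<Phi> I" and B: "gen_ito \<Psi> J"
  shows "gen_ito (\<lambda>s \<omega>. \<Phi> s \<omega> - \<Psi> s \<omega>) (\<lambda>s \<omega>. I s \<omega> - J s \<omega>)"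
proof -
  obtain K1 :: "nat \<Rightarrow> nat set" and p1 q1 \<xi>1 where E1: "\<And>j. elem_family (K1 j) (p1 j) (q1 j) (\<xi>1 j)"
    and d1: "\<And>\<epsilon>. 0 < \<epsilon> \<Longrightarrow> (\<lambda>j. measure M {\<omega>\<in>space M. ennreal \<epsilon> < energy (\<lambda>s \<omega>. elem_value (K1 j) (p1 j) (q1 j) (\<xi>1 j) s \<omega> - \<Phi> s \<omega>) T \<omega>}) \<longlonglongrightarrow> 0"
    and i1: "\<And>t \<epsilon>. t \<in> {0..T} \<Longrightarrow> 0 < \<epsilon> \<Longrightarrow> (\<lambda>j. measure M {\<omega>\<in>space M. \<epsilon> < norm (elem_integral (K1 j) (p1 j) (q1 j) (\<xi>1 j) t \<omega> - I t \<omega>)}) \<longlonglongrightarrow> 0"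
    and \<Phi>: "prog_measurable F {0..T} \<Phi>" and I: "adapted_continuous F {0..T} I"
    using A unfolding gen_ito_def by blast
  obtain K2 :: "nat \<Rightarrow> nat set" and p2 q2 \<xi>2 where E2: "\<And>j. elem_family (K2 j) (p2 j) (q2 j) (\<xi>2 j)"
    and d2: "\<And>\<epsilon>. 0 < \<epsilon> \<Longrightarrow> (\<lambda>j. measure M {\<omega>\<in>space M. ennreal \<epsilon> < energy (\<lambda>s \<omega>. elem_value (K2 j) (p2 j) (q2 j) (\<xi>2 j) s \<omega> - \<Psi> s \<omega>) T \<omega>}) \<longlonglongrightarrow> 0"
    and i2: "\<And>t \<epsilon>. t \<in> {0..T} \<Longrightarrow> 0 < \<epsilon> \<Longrightarrow> (\<lambda>j. measure M {\<omega>\<in>space M. \<epsilon> < norm (elem_integral (K2 j) (p2 j) (q2 j) (\<xi>2 j) t \<omega> - J t \<omega>)}) \<longlonglongrightarrow> 0"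
    and \<Psi>: "prog_measurable F {0..T} \<Psi>" and J: "adapted_continuous F {0..T} J"
    using B unfolding gen_ito_def by blast
  let ?v1 = "\<lambda>j. elem_value (K1 j) (p1 j) (q1 j) (\<xi>1 j)" and ?v2 = "\<lambda>j. elem_value (K2 j) (p2 j) (q2 j) (\<xi>2 j)"
  let ?S1 = "\<lambda>j. elem_integral (K1 j) (p1 j) (q1 j) (\<xi>1 j)" and ?S2 = "\<lambda>j. elem_integral (K2 j) (p2 j) (q2 j) (\<xi>2 j)"
  \<comment> \<open>\<open>gen_ito\<close> fixes natural numbers as indices, so the disjoint union
    of the two index sets is encoded by \<open>to_nat\<close>.\<close>
  define K where "K j = (to_nat :: nat + nat \<Rightarrow> nat) ` (K1 j <+> K2 j)" for j
  define p where "p j k = case_sum (p1 j) (p2 j) (from_nat k)" for j k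
  define q where "q j k = case_sum (q1 j) (q2 j) (from_nat k)" for j k
  define \<xi> where "\<xi> j k = case_sum (\<xi>1 j) (\<lambda>k \<omega>. - \<xi>2 j k \<omega>) (from_nat k)" for j k
  have fin: "finite (K1 j)" "finite (K2 j)" for j using E1 E2 by (auto simp: elem_family_def)
  have E: "elem_family (K j) (p j) (q j) (\<xi> j)" for j
    using E1[of j] E2[of j] by (auto simp: elem_family_def K_def p_def q_def \<xi>_def)
  have inj: "inj_on (to_nat :: nat + nat \<Rightarrow> nat) X" for X by (rule inj_on_subset[OF inj_to_nat]) simp
  have v: "elem_value (K j) (p j) (q j) (\<xi> j) s \<omega> = ?v1 j s \<omega> - ?v2 j s \<omega>" for j s \<omega>
    unfolding elem_value_def K_def sum.reindex[OF inj] by (simp add: p_def q_def \<xi>_def sum.Plus[OF fin] sum_negf)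
  have S: "elem_integral (K j) (p j) (q j) (\<xi> j) s \<omega> = ?S1 j s \<omega> - ?S2 j s \<omega>" for j s \<omega>
    unfolding elem_integral_def K_def sum.reindex[OF inj] by (simp add: p_def q_def \<xi>_def sum.Plus[OF fin] blinfun.minus_left sum_negf)
  have T0: "0 \<le> T" using T_pos by simp
  have pm: "prog_measurable F {0..T} (\<lambda>s \<omega>. ?v1 j s \<omega> - \<Phi> s \<omega>)" "prog_measurable F {0..T} (\<lambda>s \<omega>. ?v2 j s \<omega> - \<Psi> s \<omega>)"
    "prog_measurable F {0..T} (\<lambda>s \<omega>. \<Psi> s \<omega> - ?v2 j s \<omega>)" for j
    by (intro prog_measurable_diff elem_value_prog E1 E2 \<Phi> \<Psi>)+
  have em[measurable]: "energy (\<lambda>s \<omega>. ?v1 j s \<omega> - \<Phi> s \<omega>) T \<in> borel_measurable M" "energy (\<lambda>s \<omega>. ?v2 j s \<omega> - \<Psi> s \<omega>) T \<in> borel_measurable M" for j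
    by (rule energy_measurable_M[OF pm(1) T0 order_refl], rule energy_measurable_M[OF pm(2) T0 order_refl])
  have 1: "(\<lambda>j. measure M {\<omega>\<in>space M. ennreal \<epsilon> < energy (\<lambda>s \<omega>. elem_value (K j) (p j) (q j) (\<xi> j) s \<omega> - (\<Phi> s \<omega> - \<Psi> s \<omega>)) T \<omega>}) \<longlonglongrightarrow> 0"
    if e: "0 < \<epsilon>" for \<epsilon>
  proof (rule measure_split_tendsto_0)
    \<comment> \<open>Each of the two energies is doubled by the triangle inequality, so a quarter
      of \<epsilon> is allowed for each.\<close>
    have e4: "0 < \<epsilon> / 4" using e by simp
    let ?B = "\<lambda>j. {\<omega>\<in>space M. ennreal (\<epsilon> / 4) < energy (\<lambda>s \<omega>. ?v1 j s \<omega> - \<Phi> s \<omega>) T \<omega>}"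
    let ?C = "\<lambda>j. {\<omega>\<in>space M. ennreal (\<epsilon> / 4) < energy (\<lambda>s \<omega>. ?v2 j s \<omega> - \<Psi> s \<omega>) T \<omega>}"
    show "(\<lambda>j. measure M (?B j)) \<longlonglongrightarrow> 0" "(\<lambda>j. measure M (?C j)) \<longlonglongrightarrow> 0" by (rule d1[OF e4], rule d2[OF e4])
    show "?B j \<in> sets M" "?C j \<in> sets M" for j by measurable
    show "{\<omega>\<in>space M. ennreal \<epsilon> < energy (\<lambda>s \<omega>. elem_value (K j) (p j) (q j) (\<xi> j) s \<omega> - (\<Phi> s \<omega> - \<Psi> s \<omega>)) T \<omega>} \<subseteq> ?B j \<union> ?C j" for j
    proof (rule subsetI, rule ccontr)
      fix \<omega> assume z: "\<omega> \<in> {\<omega>\<in>space M. ennreal \<epsilon> < energy (\<lambda>s \<omega>. elem_value (K j) (p j) (q j) (\<xi> j) s \<omega> - (\<Phi> s \<omega> - \<Psi> s \<omega>)) T \<omega>}"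
        and n: "\<omega> \<notin> ?B j \<union> ?C j"
      then have w: "\<omega> \<in> space M" by blast
      have b: "energy (\<lambda>s \<omega>. ?v1 j s \<omega> - \<Phi> s \<omega>) T \<omega> \<le> ennreal (\<epsilon> / 4)" "energy (\<lambda>s \<omega>. ?v2 j s \<omega> - \<Psi> s \<omega>) T \<omega> \<le> ennreal (\<epsilon> / 4)"
        using n w by (simp_all add: not_less)
      have eq: "(\<lambda>s \<omega>. elem_value (K j) (p j) (q j) (\<xi> j) s \<omega> - (\<Phi> s \<omega> - \<Psi> s \<omega>)) = (\<lambda>s \<omega>. (?v1 j s \<omega> - \<Phi> s \<omega>) + (\<Psi> s \<omega> - ?v2 j s \<omega>))"
        by (simp add: v fun_eq_iff)
      have "energy (\<lambda>s \<omega>. elem_value (K j) (p j) (q j) (\<xi> j) s \<omega> - (\<Phi> s \<omega> - \<Psi> s \<omega>)) T \<omega>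
        \<le> 2 * energy (\<lambda>s \<omega>. ?v1 j s \<omega> - \<Phi> s \<omega>) T \<omega> + 2 * energy (\<lambda>s \<omega>. \<Psi> s \<omega> - ?v2 j s \<omega>) T \<omega>"
        unfolding eq by (rule energy_add_le[OF pm(1) pm(3) T0 order_refl w])
      also have "energy (\<lambda>s \<omega>. \<Psi> s \<omega> - ?v2 j s \<omega>) T \<omega> = energy (\<lambda>s \<omega>. ?v2 j s \<omega> - \<Psi> s \<omega>) T \<omega>" by (rule energy_minus_commute)
      also have "2 * energy (\<lambda>s \<omega>. ?v1 j s \<omega> - \<Phi> s \<omega>) T \<omega> + 2 * energy (\<lambda>s \<omega>. ?v2 j s \<omega> - \<Psi> s \<omega>) T \<omega> \<le> 2 * ennreal (\<epsilon> / 4) + 2 * ennreal (\<epsilon> / 4)"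
        by (intro add_mono mult_left_mono b) simp_all
      also have "\<dots> = ennreal (2 * (\<epsilon> / 4) + 2 * (\<epsilon> / 4))"
        using e by (simp only: ennreal_plus ennreal_mult'[of 2] ennreal_numeral[symmetric])
      finally show False using z by auto
    qed
  qed
  have 2: "(\<lambda>j. measure M {\<omega>\<in>space M. \<epsilon> < norm (elem_integral (K j) (p j) (q j) (\<xi> j) t \<omega> - (I t \<omega> - J t \<omega>))}) \<longlonglongrightarrow> 0"
    if t: "t \<in> {0..T}" and e: "0 < \<epsilon>" for t \<epsilon>
  proof (rule measure_split_tendsto_0)
    have e2: "0 < \<epsilon> / 2" using e by simp
    have t0: "0 \<le> t" using t by simp
    let ?B = "\<lambda>j. {\<omega>\<in>space M. \<epsilon> / 2 < norm (?S1 j t \<omega> - I t \<omega>)}"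
    let ?C = "\<lambda>j. {\<omega>\<in>space M. \<epsilon> / 2 < norm (?S2 j t \<omega> - J t \<omega>)}"
    have [measurable]: "I t \<in> borel_measurable M" "J t \<in> borel_measurable M"
      by (rule measurable_F_M[OF adapted_continuousD(1)[OF I t]], rule measurable_F_M[OF adapted_continuousD(1)[OF J t]])
    have [measurable]: "?S1 j t \<in> borel_measurable M" "?S2 j t \<in> borel_measurable M" for j
      by (rule measurable_F_M[OF elem_integral_measurable[OF E1 t0]], rule measurable_F_M[OF elem_integral_measurable[OF E2 t0]])
    show "(\<lambda>j. measure M (?B j)) \<longlonglongrightarrow> 0" "(\<lambda>j. measure M (?C j)) \<longlonglongrightarrow> 0" by (rule i1[OF t e2], rule i2[OF t e2])
    show "?B j \<in> sets M" "?C j \<in> sets M" for j by measurable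
    show "{\<omega>\<in>space M. \<epsilon> < norm (elem_integral (K j) (p j) (q j) (\<xi> j) t \<omega> - (I t \<omega> - J t \<omega>))} \<subseteq> ?B j \<union> ?C j" for j
    proof (rule subsetI, rule ccontr)
      fix \<omega> assume z: "\<omega> \<in> {\<omega>\<in>space M. \<epsilon> < norm (elem_integral (K j) (p j) (q j) (\<xi> j) t \<omega> - (I t \<omega> - J t \<omega>))}"
        and n: "\<omega> \<notin> ?B j \<union> ?C j"
      then have b: "norm (?S1 j t \<omega> - I t \<omega>) \<le> \<epsilon> / 2" "norm (?S2 j t \<omega> - J t \<omega>) \<le> \<epsilon> / 2"
        by (simp_all add: not_less)
      have eq: "elem_integral (K j) (p j) (q j) (\<xi> j) t \<omega> - (I t \<omega> - J t \<omega>) = (?S1 j t \<omega> - I t \<omega>) - (?S2 j t \<omega> - J t \<omega>)"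
        by (simp add: S)
      have "norm (elem_integral (K j) (p j) (q j) (\<xi> j) t \<omega> - (I t \<omega> - J t \<omega>)) \<le> \<epsilon>"
        unfolding eq using norm_triangle_ineq4[of "?S1 j t \<omega> - I t \<omega>" "?S2 j t \<omega> - J t \<omega>"] b by linarith
      then show False using z by simp
    qed
  qed
  show ?thesis unfolding gen_ito_def
    using prog_measurable_diff[OF \<Phi> \<Psi>] adapted_continuous_diff[OF I J] E 1 2 by blast
qed

text \<open>Where \<Phi> has no energy up to \<open>t\<close>, an approximating elementary process
  has energy at most \<open>2 * \<kappa>\<close>, up to an event of vanishing probability. By
  \<open>elem_tail_bound\<close> its integral exceeds \<open>c\<close> there with probability at
  most \<open>2 * \<kappa> / c\<^sup>2\<close>. First the approximation index tends to infinity,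
  then \<kappa> to 0.\<close>

lemma gen_ito_local_fixed:
  fixes \<Phi> :: "real \<Rightarrow> 'w \<Rightarrow> (real ^ 'm) \<Rightarrow>\<^sub>L 'h::{real_inner, banach, second_countable_topology}"
  assumes A: "gen_ito \<Phi> I" and t: "t \<in> {0..T}"
  shows "AE \<omega> in M. energy \<Phi> t \<omega> = 0 \<longrightarrow> I t \<omega> = 0"
proof -
  obtain K :: "nat \<Rightarrow> nat set" and p q \<xi> where E: "\<And>j. elem_family (K j) (p j) (q j) (\<xi> j)"
    and d: "\<And>\<epsilon>. 0 < \<epsilon> \<Longrightarrow> (\<lambda>j. measure M {\<omega>\<in>space M. ennreal \<epsilon> < energy (\<lambda>s \<omega>. elem_value (K j) (p j) (q j) (\<xi> j) s \<omega> - \<Phi> s \<omega>) T \<omega>}) \<longlonglongrightarrow> 0"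
    and i: "\<And>t \<epsilon>. t \<in> {0..T} \<Longrightarrow> 0 < \<epsilon> \<Longrightarrow> (\<lambda>j. measure M {\<omega>\<in>space M. \<epsilon> < norm (elem_integral (K j) (p j) (q j) (\<xi> j) t \<omega> - I t \<omega>)}) \<longlonglongrightarrow> 0"
    and \<Phi>: "prog_measurable F {0..T} \<Phi>" and I: "adapted_continuous F {0..T} I"
    using A unfolding gen_ito_def by blast
  have t': "0 \<le> t" "t \<le> T" and T0: "0 \<le> T" using t by auto
  let ?S = "\<lambda>j. elem_integral (K j) (p j) (q j) (\<xi> j)" and ?v = "\<lambda>j. elem_value (K j) (p j) (q j) (\<xi> j)"
  have [measurable]: "I t \<in> borel_measurable M" by (rule measurable_F_M[OF adapted_continuousD(1)[OF I t]])
  have [measurable]: "?S j t \<in> borel_measurable M" for j by (rule measurable_F_M[OF elem_integral_measurable[OF E t'(1)]])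
  have pm: "prog_measurable F {0..T} (\<lambda>s \<omega>. ?v j s \<omega> - \<Phi> s \<omega>)" for j by (intro prog_measurable_diff elem_value_prog E \<Phi>)
  have [measurable]: "energy \<Phi> t \<in> borel_measurable M"
    "energy (\<lambda>s \<omega>. ?v j s \<omega> - \<Phi> s \<omega>) T \<in> borel_measurable M" "elem_energy (K j) (p j) (q j) (\<xi> j) 0 t \<in> borel_measurable M" for j
    by (rule energy_measurable_M[OF \<Phi> t'], rule energy_measurable_M[OF pm T0 order_refl],
        rule measurable_F_M[OF elem_energy_measurable[OF E order_refl t'(1)]])
  have zero: "measure M {\<omega>\<in>space M. 2 * c < norm (I t \<omega>) \<and> energy \<Phi> t \<omega> = 0} = 0"
    (is "measure M ?Z = 0") if c: "0 < c" for c
  proof -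
    have Zm: "?Z \<in> sets M" by measurable
    have le2: "measure M ?Z \<le> 2 * \<kappa> / c\<^sup>2" if \<kappa>: "0 < \<kappa>" for \<kappa>
    proof -
      let ?A = "\<lambda>j. {\<omega>\<in>space M. c < norm (?S j t \<omega> - I t \<omega>)}"
      let ?B = "\<lambda>j. {\<omega>\<in>space M. ennreal \<kappa> < energy (\<lambda>s \<omega>. ?v j s \<omega> - \<Phi> s \<omega>) T \<omega>}"
      let ?C = "\<lambda>j. {\<omega>\<in>space M. c < norm (?S j t \<omega>) \<and> elem_energy (K j) (p j) (q j) (\<xi> j) 0 t \<omega> \<le> 2 * \<kappa>}"
      have sub: "?Z \<subseteq> (?A j \<union> ?B j) \<union> ?C j" for j
      proof (rule subsetI, rule ccontr)
        fix \<omega> assume z: "\<omega> \<in> ?Z" and n: "\<omega> \<notin> (?A j \<union> ?B j) \<union> ?C j"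
        then have w: "\<omega> \<in> space M" and z1: "2 * c < norm (I t \<omega>)" and z2: "energy \<Phi> t \<omega> = 0" by blast+
        have a: "norm (?S j t \<omega> - I t \<omega>) \<le> c" and b: "energy (\<lambda>s \<omega>. ?v j s \<omega> - \<Phi> s \<omega>) T \<omega> \<le> ennreal \<kappa>"
          using n w by (simp_all add: not_less)
        have "norm (I t \<omega>) \<le> norm (?S j t \<omega>) + norm (?S j t \<omega> - I t \<omega>)"
          using norm_triangle_ineq4[of "?S j t \<omega>" "?S j t \<omega> - I t \<omega>"] by simp
        then have n1: "c < norm (?S j t \<omega>)" using z1 a by linarith
        have "ennreal (elem_energy (K j) (p j) (q j) (\<xi> j) 0 t \<omega>) = energy (\<lambda>s \<omega>. (?v j s \<omega> - \<Phi> s \<omega>) + \<Phi> s \<omega>) t \<omega>"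
          using energy_elem[OF E[of j] t'(1), of \<omega>] by simp
        also have "\<dots> \<le> 2 * energy (\<lambda>s \<omega>. ?v j s \<omega> - \<Phi> s \<omega>) t \<omega> + 2 * energy \<Phi> t \<omega>"
          by (rule energy_add_le[OF pm \<Phi> t' w])
        also have "\<dots> \<le> 2 * ennreal \<kappa>"
          using order_trans[OF energy_mono[OF t'(2)] b] unfolding z2 by (simp add: mult_left_mono)
        also have "\<dots> = ennreal (2 * \<kappa>)" by (subst ennreal_mult') simp_all
        finally have "elem_energy (K j) (p j) (q j) (\<xi> j) 0 t \<omega> \<le> 2 * \<kappa>" using \<kappa> by (subst (asm) ennreal_le_iff) simp_all
        then show False using n n1 w by blast
      qed
      have le: "measure M ?Z \<le> (measure M (?A j) + measure M (?B j)) + 2 * \<kappa> / c\<^sup>2" for j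
      proof -
        have ms: "?A j \<in> sets M" "?B j \<in> sets M" "?C j \<in> sets M" by measurable
        have "measure M ?Z \<le> measure M ((?A j \<union> ?B j) \<union> ?C j)"
          by (rule finite_measure_mono[OF sub]) (intro sets.Un ms)
        also have "\<dots> \<le> measure M (?A j \<union> ?B j) + measure M (?C j)"
          by (rule measure_Un_le) (intro sets.Un ms)+
        also have "\<dots> \<le> (measure M (?A j) + measure M (?B j)) + 2 * \<kappa> / c\<^sup>2"
          by (intro add_mono measure_Un_le elem_tail_bound E t' c ms) (use \<kappa> in simp)
        finally show ?thesis .
      qed
      have "(\<lambda>j. (measure M (?A j) + measure M (?B j)) + 2 * \<kappa> / c\<^sup>2) \<longlonglongrightarrow> (0 + 0) + 2 * \<kappa> / c\<^sup>2"
        by (intro tendsto_add tendsto_const i d t c \<kappa>)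
      then have "measure M ?Z \<le> (0 + 0) + 2 * \<kappa> / c\<^sup>2" by (rule LIMSEQ_le_const) (use le in blast)
      then show ?thesis by simp
    qed
    have "measure M ?Z \<le> 0 + e" if "0 < e" for e
    proof -
      have "measure M ?Z \<le> 2 * (e * c\<^sup>2 / 2) / c\<^sup>2" by (rule le2) (use that c in simp)
      also have "\<dots> = 0 + e" using c by simp
      finally show ?thesis .
    qed
    then have "measure M ?Z \<le> 0" by (rule field_le_epsilon)
    with measure_nonneg show ?thesis by (rule antisym[rotated])
  qed
  have "AE \<omega> in M. \<forall>k::nat. \<not> (2 * (1 / real (Suc k)) < norm (I t \<omega>) \<and> energy \<Phi> t \<omega> = 0)"
    unfolding AE_all_countable
  proof
    fix k :: nat
    let ?Z = "{\<omega>\<in>space M. 2 * (1 / real (Suc k)) < norm (I t \<omega>) \<and> energy \<Phi> t \<omega> = 0}"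
    have "?Z \<in> sets M" by measurable
    moreover have "measure M ?Z = 0" by (rule zero) simp
    ultimately have "?Z \<in> null_sets M" by (simp add: null_sets_def emeasure_eq_measure)
    from AE_not_in[OF this] AE_space
    show "AE \<omega> in M. \<not> (2 * (1 / real (Suc k)) < norm (I t \<omega>) \<and> energy \<Phi> t \<omega> = 0)"
      by eventually_elim simp
  qed
  then show ?thesis
  proof eventually_elim
    case (elim \<omega>)
    show ?case
    proof (rule impI, rule ccontr)
      assume e: "energy \<Phi> t \<omega> = 0" and "I t \<omega> \<noteq> 0"
      then have "0 < norm (I t \<omega>) / 2" by simp
      from nat_approx_posE[OF this] obtain k :: nat where "1 / real (Suc k) < norm (I t \<omega>) / 2" .
      then have "2 * (1 / real (Suc k)) < norm (I t \<omega>)" by linarith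
      with elim e show False by blast
    qed
  qed
qed

text \<open>One null set for all times: the exceptional sets at countably many times are united and
  \<open>t\<close> is approached by them from below. The direction matters, since vanishing energy
  at \<open>t\<close> is inherited only by earlier times.\<close>

lemma gen_ito_local:
  fixes \<Phi> :: "real \<Rightarrow> 'w \<Rightarrow> (real ^ 'm) \<Rightarrow>\<^sub>L 'h::{real_inner, banach, second_countable_topology}"
  assumes A: "gen_ito \<Phi> I"
  shows "AE \<omega> in M. \<forall>t\<in>{0..T}. energy \<Phi> t \<omega> = 0 \<longrightarrow> I t \<omega> = 0"
proof -
  have I: "adapted_continuous F {0..T} I" using A by (auto simp: gen_ito_def)
  let ?q = "\<lambda>q. max 0 (min T (real_of_rat q))"
  have "AE \<omega> in M. \<forall>q. energy \<Phi> (?q q) \<omega> = 0 \<longrightarrow> I (?q q) \<omega> = 0"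
    unfolding AE_all_countable by (intro allI gen_ito_local_fixed[OF A]) (use T_pos in auto)
  then show ?thesis using AE_space
  proof eventually_elim
    case (elim \<omega>)
    show ?case
    proof (intro ballI impI)
      fix t assume t: "t \<in> {0..T}" and e: "energy \<Phi> t \<omega> = 0"
      have eq: "I (?q q) \<omega> = 0" if "?q q \<le> t" for q
        using elim(1) energy_mono[OF that, of \<Phi> \<omega>] e by simp
      show "I t \<omega> = 0"
      proof (cases "t = 0")
        case True
        then show ?thesis using eq[of 0] T_pos by simp
      next
        case False
        then have t0: "0 < t" "t \<le> T" using t by auto
        have "\<exists>q. max 0 (t - 1 / real (Suc k)) < real_of_rat q \<and> real_of_rat q < t" for k
          using of_rat_dense[of "max 0 (t - 1 / real (Suc k))" t] t0 by auto
        then have "\<forall>k. \<exists>q. max 0 (t - 1 / real (Suc k)) < real_of_rat q \<and> real_of_rat q < t" by blast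
        from choice[OF this] obtain q where q: "\<And>k. max 0 (t - 1 / real (Suc k)) < real_of_rat (q k)" "\<And>k. real_of_rat (q k) < t" by auto
        have qq: "?q (q k) = real_of_rat (q k)" for k
          using q(1)[of k] q(2)[of k] t0 by simp
        have l1: "(\<lambda>k. t - 1 / real (Suc k)) \<longlonglongrightarrow> t"
          using tendsto_diff[OF tendsto_const[of t] LIMSEQ_Suc[OF lim_1_over_n]] by simp
        have lim: "(\<lambda>k. real_of_rat (q k)) \<longlonglongrightarrow> t"
        proof (rule tendsto_sandwich[OF eventuallyI eventuallyI l1 tendsto_const])
          show "t - 1 / real (Suc k) \<le> real_of_rat (q k)" for k using q(1)[of k] by simp
          show "real_of_rat (q k) \<le> t" for k using q(2)[of k] by simp
        qed
        have ev: "\<forall>\<^sub>F k in sequentially. real_of_rat (q k) \<in> {0..T}"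
        proof (rule eventuallyI)
          show "real_of_rat (q k) \<in> {0..T}" for k using q(1)[of k] q(2)[of k] t0 by simp
        qed
        have lI: "(\<lambda>k. I (real_of_rat (q k)) \<omega>) \<longlonglongrightarrow> I t \<omega>"
          by (rule continuous_on_tendsto_compose[OF adapted_continuousD(2)[OF I t elim(2)] lim t ev])
        have I0: "I (real_of_rat (q k)) \<omega> = 0" for k
          using eq[of "q k"] q(2)[of k] unfolding qq by simp
        show ?thesis by (rule LIMSEQ_unique[OF lI[unfolded I0] tendsto_const])
      qed
    qed
  qed
qed

end

section \<open>The drift and the coefficients along a process\<close>

lemma set_integral_sq_bound:
  fixes f :: "real \<Rightarrow> 'h::{banach, second_countable_topology}"
  assumes f: "set_integrable lborel {0..t} f" and t: "0 \<le> t"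
  shows "ennreal ((norm (LINT s:{0..t}|lborel. f s))\<^sup>2) \<le> ennreal t * (\<integral>\<^sup>+s\<in>{0..t}. ennreal ((norm (f s))\<^sup>2) \<partial>lborel)"
proof -
  let ?g = "\<lambda>s. indicator {0..t} s *\<^sub>R f s" and ?i = "\<lambda>s. indicator {0..t} s :: ennreal"
  have g: "integrable lborel ?g" using f by (simp add: set_integrable_def)
  then have [measurable]: "?g \<in> borel_measurable borel" by auto
  have "ennreal ((norm (LINT s:{0..t}|lborel. f s))\<^sup>2) = (ennreal (norm (LINT s:{0..t}|lborel. f s)))\<^sup>2"
    by (simp add: ennreal_power)
  also have "\<dots> \<le> (\<integral>\<^sup>+s. ennreal (norm (?g s)) \<partial>lborel)\<^sup>2"
    unfolding set_lebesgue_integral_def by (intro power_mono integral_norm_bound_ennreal g) simp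
  also have "(\<integral>\<^sup>+s. ennreal (norm (?g s)) \<partial>lborel) = (\<integral>\<^sup>+s. ennreal (norm (?g s)) * ?i s \<partial>lborel)"
    by (intro nn_integral_cong) (simp add: indicator_def)
  also have "\<dots>\<^sup>2 \<le> (\<integral>\<^sup>+s. (ennreal (norm (?g s)))\<^sup>2 \<partial>lborel) * (\<integral>\<^sup>+s. (?i s)\<^sup>2 \<partial>lborel)"
    by (rule Cauchy_Schwarz_nn_integral) measurable
  also have "(\<integral>\<^sup>+s. (?i s)\<^sup>2 \<partial>lborel) = (\<integral>\<^sup>+s. ?i s \<partial>lborel)"
    by (intro nn_integral_cong) (simp add: indicator_def)
  also have "\<dots> = ennreal t" using t by simp
  also have "(\<integral>\<^sup>+s. (ennreal (norm (?g s)))\<^sup>2 \<partial>lborel) = (\<integral>\<^sup>+s\<in>{0..t}. ennreal ((norm (f s))\<^sup>2) \<partial>lborel)"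
    by (intro nn_integral_cong) (simp add: ennreal_power indicator_def)
  finally show ?thesis by (simp add: mult.commute)
qed

lemma clam_norm_nonneg: "x \<in> Clam l \<tau> \<Longrightarrow> 0 \<le> clam_norm l \<tau> x"
  using Clam_upper[of x l \<tau> \<tau>] by (rule order_trans[rotated]) simp_all

lemma Clam_mono: "x \<in> Clam l T \<Longrightarrow> t \<le> T \<Longrightarrow> x \<in> Clam l t"
  unfolding Clam_def by (auto intro: continuous_on_subset bdd_above_mono)

context brownian_basis
begin

lemma prog_nn_integral_measurable:
  fixes f :: "real \<Rightarrow> 'w \<Rightarrow> ennreal"
  assumes f: "prog_measurable F {0..T} f" and t: "0 \<le> t" "t \<le> T"
  shows "(\<lambda>\<omega>. \<integral>\<^sup>+s\<in>{0..t}. f s \<omega> \<partial>lborel) \<in> borel_measurable (F t)"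
proof -
  have [measurable]: "(\<lambda>p. f (max 0 (min t (snd p))) (fst p)) \<in> borel_measurable (F t \<Otimes>\<^sub>M lborel)"
    using prog_measurable_clip(2)[OF f t] by (simp add: split_beta')
  have "(\<lambda>\<omega>. \<integral>\<^sup>+s. f (max 0 (min t s)) \<omega> * indicator {0..t} s \<partial>lborel) \<in> borel_measurable (F t)"
    by (rule lborel.borel_measurable_nn_integral) (unfold split_beta', measurable)
  moreover have "(\<integral>\<^sup>+s. f (max 0 (min t s)) \<omega> * indicator {0..t} s \<partial>lborel) = (\<integral>\<^sup>+s\<in>{0..t}. f s \<omega> \<partial>lborel)" for \<omega>
    by (intro nn_integral_cong) (auto simp: indicator_def min_def max_def)
  ultimately show ?thesis by simp
qed

lemma prog_nn_integral_Fubini: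
  fixes f :: "real \<Rightarrow> 'w \<Rightarrow> ennreal"
  assumes f: "prog_measurable F {0..T} f" and t: "0 \<le> t" "t \<le> T"
  shows "(\<integral>\<^sup>+\<omega>. (\<integral>\<^sup>+s\<in>{0..t}. f s \<omega> \<partial>lborel) \<partial>M) = (\<integral>\<^sup>+s\<in>{0..t}. (\<integral>\<^sup>+\<omega>. f s \<omega> \<partial>M) \<partial>lborel)"
proof -
  interpret P: pair_sigma_finite lborel M by unfold_locales
  have "(\<lambda>x. x) \<in> measurable M (F t)" by (rule measurable_F_M[of _ t]) simp
  from measurable_compose[OF measurable_snd this]
  have "(\<lambda>p. (fst p, snd p)) \<in> measurable (lborel \<Otimes>\<^sub>M M) (lborel \<Otimes>\<^sub>M F t)" by (intro measurable_Pair measurable_fst)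
  from measurable_compose[OF this prog_measurable_clip(1)[OF f t]]
  have m1: "(\<lambda>p. f (max 0 (min t (fst p))) (snd p)) \<in> borel_measurable (lborel \<Otimes>\<^sub>M M)" by simp
  then have m: "(\<lambda>(s, \<omega>). f (max 0 (min t s)) \<omega> * indicator {0..t} s) \<in> borel_measurable (lborel \<Otimes>\<^sub>M M)"
    unfolding split_beta' by measurable
  have e: "f (max 0 (min t s)) \<omega> * indicator {0..t} s = f s \<omega> * indicator {0..t} s" for s \<omega>
    by (auto simp: indicator_def min_def max_def)
  have "(\<integral>\<^sup>+s. (\<integral>\<^sup>+\<omega>. f (max 0 (min t s)) \<omega> * indicator {0..t} s \<partial>M) \<partial>lborel) = (\<integral>\<^sup>+s\<in>{0..t}. (\<integral>\<^sup>+\<omega>. f s \<omega> \<partial>M) \<partial>lborel)"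
    unfolding e
  proof (rule nn_integral_cong)
    fix s show "(\<integral>\<^sup>+\<omega>. f s \<omega> * indicator {0..t} s \<partial>M) = (\<integral>\<^sup>+\<omega>. f s \<omega> \<partial>M) * indicator {0..t} s"
      by (cases "s \<in> {0..t}") simp_all
  qed
  with P.Fubini'[OF m] show ?thesis unfolding e by simp
qed

text \<open>The supremum over \<open>{0..s}\<close> is taken at the fractions
  \<open>s * k / 2 ^ n\<close> of the running time \<open>s\<close> itself. It is thus a countable
  supremum of maps jointly measurable in \<open>s\<close> and the outcome, none of which looks
  beyond \<open>s\<close>.\<close>

lemma sup_sq_prog:
  fixes X :: "real \<Rightarrow> 'w \<Rightarrow> 'h::{real_normed_vector, second_countable_topology}"
  assumes X: "adapted_continuous F {..T} X"
  shows "prog_measurable F {0..T} (\<lambda>s \<omega>. sup_sq X s \<omega>)"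
  unfolding prog_measurable_def
proof
  fix t assume t: "t \<in> {0..T}"
  let ?N = "restrict_space borel ({0..T} \<inter> {..t}) \<Otimes>\<^sub>M F t"
  have X1: "(\<lambda>(s, \<omega>). X s \<omega>) \<in> borel_measurable (restrict_space borel {..t} \<Otimes>\<^sub>M F t)"
    using adapted_continuous_imp_prog_measurable[OF X] t by auto
  have Xm: "(\<lambda>p. X (fst p * real k / 2 ^ n) (snd p)) \<in> borel_measurable ?N" if k: "k \<in> {..2 ^ n}" for k n :: nat
  proof -
    have "(\<lambda>s. s * real k / 2 ^ n) \<in> measurable (restrict_space borel ({0..T} \<inter> {..t})) (restrict_space borel {..t})"
    proof (rule measurable_restrict_space3)
      show "(\<lambda>s. s * real k / 2 ^ n) \<in> {0..T} \<inter> {..t} \<rightarrow> {..t}"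
        using dyadic_time(2)[of _ k n] k by (fastforce intro: order_trans)
    qed measurable
    from measurable_compose[OF measurable_fst this]
    have "(\<lambda>p. (fst p * real k / 2 ^ n, snd p)) \<in> measurable ?N (restrict_space borel {..t} \<Otimes>\<^sub>M F t)"
      by (rule measurable_Pair) (rule measurable_snd)
    from measurable_compose[OF this X1] show ?thesis by simp
  qed
  have "(\<lambda>p. SUP n. SUP k\<in>{..2 ^ n}. ennreal ((norm (X (fst p * real k / 2 ^ n) (snd p)))\<^sup>2)) \<in> borel_measurable ?N"
  proof (intro borel_measurable_SUP)
    fix n k :: nat assume k: "k \<in> {..2 ^ n}"
    note [measurable] = Xm[OF k]
    show "(\<lambda>p. ennreal ((norm (X (fst p * real k / 2 ^ n) (snd p)))\<^sup>2)) \<in> borel_measurable ?N" by measurable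
  qed auto
  moreover have "sup_sq X (fst p) (snd p) = (SUP n. SUP k\<in>{..2 ^ n}. ennreal ((norm (X (fst p * real k / 2 ^ n) (snd p)))\<^sup>2))"
    if p: "p \<in> space ?N" for p
  proof -
    from p have s: "0 \<le> fst p" "fst p \<le> T" and w: "snd p \<in> space M"
      by (auto simp: space_pair_measure space_restrict_space space_F)
    have "continuous_on {..T} (\<lambda>s. X s (snd p))" using adapted_continuousD(2)[OF X _ w, of T] by simp
    then have "continuous_on {0..fst p} (\<lambda>s. X s (snd p))" by (rule continuous_on_subset) (use s in auto)
    from sup_sq_dyadic[of "fst p" X "snd p", OF this s(1)] show ?thesis by (simp only: dyadic_sup_sq_def)
  qed
  ultimately show "(\<lambda>(s, \<omega>). sup_sq X s \<omega>) \<in> borel_measurable ?N"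
    unfolding split_beta' by (subst measurable_cong) auto
qed

text \<open>The two paths agree up to 0 and are frozen after \<open>s\<close>, so at every time they
  differ by at most the supremum over \<open>{0..s}\<close>; the weight is at most
  \<open>exp (l * T)\<close>. If the supremum is infinite there is nothing to show.\<close>

lemma past_diff_bound:
  fixes X X' :: "real \<Rightarrow> 'w \<Rightarrow> 'h::real_normed_vector"
  assumes X: "(\<lambda>\<theta>. X \<theta> \<omega>) \<in> Clam l T" and X': "(\<lambda>\<theta>. X' \<theta> \<omega>) \<in> Clam l T" and l: "0 < l"
    and eq: "\<And>\<theta>. \<theta> \<le> 0 \<Longrightarrow> X \<theta> \<omega> = X' \<theta> \<omega>" and s: "0 \<le> s" "s \<le> T"
  shows "ennreal ((clam_norm l T (\<lambda>\<theta>. past X s \<omega> \<theta> - past X' s \<omega> \<theta>))\<^sup>2)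
    \<le> ennreal ((exp (l * T))\<^sup>2) * sup_sq (\<lambda>s \<omega>. X s \<omega> - X' s \<omega>) s \<omega>"
proof (cases "sup_sq (\<lambda>s \<omega>. X s \<omega> - X' s \<omega>) s \<omega>")
  case top
  then show ?thesis by (simp add: ennreal_mult_top)
next
  case (real v)
  have b: "norm (X r \<omega> - X' r \<omega>) \<le> sqrt v" if "r \<le> s" for r
  proof (cases "r \<le> 0")
    case True
    then show ?thesis using eq[OF True] real by simp
  next
    case False
    then have "ennreal ((norm (X r \<omega> - X' r \<omega>))\<^sup>2) \<le> ennreal v"
      using sup_sq_upper[of r s "\<lambda>s \<omega>. X s \<omega> - X' s \<omega>" \<omega>] that real by simp
    then have "(norm (X r \<omega> - X' r \<omega>))\<^sup>2 \<le> v" using real by simp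
    then show ?thesis by (rule real_le_rsqrt)
  qed
  have "clam_norm l T (\<lambda>\<theta>. past X s \<omega> \<theta> - past X' s \<omega> \<theta>) \<le> exp (l * T) * sqrt v"
  proof (rule clam_norm_least)
    fix \<theta> assume "\<theta> \<le> T"
    then show "exp (l * \<theta>) * norm (past X s \<omega> \<theta> - past X' s \<omega> \<theta>) \<le> exp (l * T) * sqrt v"
      unfolding past_def using l by (intro mult_mono b) auto
  qed
  moreover have "0 \<le> clam_norm l T (\<lambda>\<theta>. past X s \<omega> \<theta> - past X' s \<omega> \<theta>)"
    using s by (intro clam_norm_nonneg Clam_diff past_Clam X X' l)
  ultimately have "(clam_norm l T (\<lambda>\<theta>. past X s \<omega> \<theta> - past X' s \<omega> \<theta>))\<^sup>2 \<le> (exp (l * T) * sqrt v)\<^sup>2"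
    by (rule power_mono)
  also have "\<dots> = (exp (l * T))\<^sup>2 * v" using real by (simp add: power_mult_distrib)
  finally have "ennreal ((clam_norm l T (\<lambda>\<theta>. past X s \<omega> \<theta> - past X' s \<omega> \<theta>))\<^sup>2) \<le> ennreal ((exp (l * T))\<^sup>2 * v)" by (rule ennreal_leI)
  then show ?thesis using real by (simp add: ennreal_mult)
qed

text \<open>The case distinction makes the paths continuous for every outcome.\<close>

definition drift :: "(real \<Rightarrow> 'w \<Rightarrow> 'h::{banach, second_countable_topology}) \<Rightarrow> real \<Rightarrow> 'w \<Rightarrow> 'h" where
  "drift \<beta> t \<omega> = (if set_integrable lborel {0..T} (\<lambda>s. \<beta> s \<omega>) then LINT s:{0..t}|lborel. \<beta> s \<omega> else 0)"

lemma sq_integrable_imp_set_integrable: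
  fixes \<beta> :: "real \<Rightarrow> 'w \<Rightarrow> 'h::{banach, second_countable_topology}"
  assumes \<beta>: "prog_measurable F {0..T} \<beta>" and fin: "(\<integral>\<^sup>+\<omega>. (\<integral>\<^sup>+s\<in>{0..T}. ennreal ((norm (\<beta> s \<omega>))\<^sup>2) \<partial>lborel) \<partial>M) < \<infinity>"
  shows "AE \<omega> in M. set_integrable lborel {0..T} (\<lambda>s. \<beta> s \<omega>)"
proof -
  have T0: "0 \<le> T" using T_pos by simp
  have "prog_measurable F {0..T} (\<lambda>s \<omega>. ennreal ((norm (\<beta> s \<omega>))\<^sup>2))"
    by (rule prog_measurable_compose[OF \<beta>]) measurable
  from measurable_F_M[OF prog_nn_integral_measurable[OF this T0 order_refl]]
  have "AE \<omega> in M. (\<integral>\<^sup>+s\<in>{0..T}. ennreal ((norm (\<beta> s \<omega>))\<^sup>2) \<partial>lborel) \<noteq> \<infinity>"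
    by (rule nn_integral_PInf_AE) (use fin in auto)
  then show ?thesis using AE_space
  proof eventually_elim
    case (elim \<omega>)
    have [measurable]: "(\<lambda>s. \<beta> (max 0 (min T s)) \<omega>) \<in> borel_measurable borel"
      by (rule prog_measurable_section[OF \<beta> T0 order_refl elim(2)])
    have e: "indicator {0..T} s *\<^sub>R \<beta> s \<omega> = indicator {0..T} s *\<^sub>R \<beta> (max 0 (min T s)) \<omega>" for s
      by (auto simp: indicator_def min_def max_def)
    have e': "ennreal ((norm (\<beta> s \<omega>))\<^sup>2) * indicator {0..T} s = ennreal ((norm (\<beta> (max 0 (min T s)) \<omega>))\<^sup>2) * indicator {0..T} s" for s
      by (auto simp: indicator_def min_def max_def)
    have m: "(\<lambda>s. indicator {0..T} s *\<^sub>R \<beta> s \<omega>) \<in> borel_measurable lborel" unfolding e by measurable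
    have "(\<integral>\<^sup>+s. ennreal (norm (indicator {0..T} s *\<^sub>R \<beta> s \<omega>)) \<partial>lborel)
      \<le> (\<integral>\<^sup>+s. indicator {0..T} s + ennreal ((norm (\<beta> s \<omega>))\<^sup>2) * indicator {0..T} s \<partial>lborel)"
    proof (rule nn_integral_mono)
      fix s
      have "norm (\<beta> s \<omega>) \<le> 1 + (norm (\<beta> s \<omega>))\<^sup>2"
        using sum_squares_bound[of "norm (\<beta> s \<omega>)" 1] norm_ge_zero[of "\<beta> s \<omega>"]
        unfolding power_one mult_1_right by linarith
      then have "ennreal (norm (\<beta> s \<omega>)) \<le> 1 + ennreal ((norm (\<beta> s \<omega>))\<^sup>2)"
        using ennreal_leI[of "norm (\<beta> s \<omega>)" "1 + (norm (\<beta> s \<omega>))\<^sup>2"] ennreal_plus[of 1 "(norm (\<beta> s \<omega>))\<^sup>2"] by simp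
      then show "ennreal (norm (indicator {0..T} s *\<^sub>R \<beta> s \<omega>)) \<le> indicator {0..T} s + ennreal ((norm (\<beta> s \<omega>))\<^sup>2) * indicator {0..T} s"
        by (cases "s \<in> {0..T}") simp_all
    qed
    also have "\<dots> = (\<integral>\<^sup>+s. indicator {0..T} s \<partial>lborel) + (\<integral>\<^sup>+s\<in>{0..T}. ennreal ((norm (\<beta> s \<omega>))\<^sup>2) \<partial>lborel)"
      unfolding e' by (rule nn_integral_add) measurable
    also have "\<dots> < \<infinity>" using elim(1) T0 by (simp add: top.not_eq_extremum)
    finally show ?case unfolding set_integrable_def integrable_iff_bounded using m by simp
  qed
qed

lemma drift_adapted_continuous:
  fixes \<beta> :: "real \<Rightarrow> 'w \<Rightarrow> 'h::{banach, second_countable_topology}"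
  assumes \<beta>: "prog_measurable F {0..T} \<beta>" and ae: "AE \<omega> in M. set_integrable lborel {0..T} (\<lambda>s. \<beta> s \<omega>)"
  shows "adapted_continuous F {0..T} (drift \<beta>)"
  unfolding adapted_continuous_def
proof (intro ballI conjI)
  fix t assume t: "t \<in> {0..T}"
  then have t': "0 \<le> t" "t \<le> T" by auto
  have [measurable]: "(\<lambda>p. \<beta> (max 0 (min t (snd p))) (fst p)) \<in> borel_measurable (F t \<Otimes>\<^sub>M lborel)"
    using prog_measurable_clip(2)[OF \<beta> t'] by (simp add: split_beta')
  have e: "(LINT s:{0..t}|lborel. \<beta> s \<omega>) = (LINT s|lborel. indicator {0..t} s *\<^sub>R \<beta> (max 0 (min t s)) \<omega>)" for \<omega>
    unfolding set_lebesgue_integral_def by (intro Bochner_Integration.integral_cong) (auto simp: indicator_def min_def max_def)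
  have m: "(\<lambda>\<omega>. LINT s:{0..t}|lborel. \<beta> s \<omega>) \<in> borel_measurable (F t)"
    unfolding e by (rule lborel.borel_measurable_lebesgue_integral) (unfold split_beta', measurable)
  have a: "AE \<omega> in M. (LINT s:{0..t}|lborel. \<beta> s \<omega>) = drift \<beta> t \<omega>"
    using ae by eventually_elim (simp add: drift_def)
  show "drift \<beta> t \<in> borel_measurable (F t)" by (rule adapted_AE_cong[OF m a])
  fix \<omega>
  show "continuous_on {0..T} (\<lambda>s. drift \<beta> s \<omega>)"
  proof (cases "set_integrable lborel {0..T} (\<lambda>s. \<beta> s \<omega>)")
    case True
    have "continuous_on {0..T} (\<lambda>t. LINT s:{0..t}|lborel. \<beta> s \<omega>)"
    proof (rule continuous_on_sequentiallyI)
      fix u :: "nat \<Rightarrow> real" and a assume u: "\<forall>n. u n \<in> {0..T}" and a: "a \<in> {0..T}" and lim: "u \<longlonglongrightarrow> a"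
      show "(\<lambda>n. LINT s:{0..u n}|lborel. \<beta> s \<omega>) \<longlonglongrightarrow> (LINT s:{0..a}|lborel. \<beta> s \<omega>)"
        unfolding set_lebesgue_integral_def
      proof (rule integral_dominated_convergence[where w="\<lambda>s. norm (indicator {0..T} s *\<^sub>R \<beta> s \<omega>)"])
        have I: "integrable lborel (\<lambda>s. indicator {0..x} s *\<^sub>R \<beta> s \<omega>)" if "x \<in> {0..T}" for x
          using set_integrable_subset[OF True, of "{0..x}"] that by (simp add: set_integrable_def)
        show "(\<lambda>s. indicator {0..a} s *\<^sub>R \<beta> s \<omega>) \<in> borel_measurable lborel" using I[OF a] by (rule borel_measurable_integrable)
        show "(\<lambda>s. indicator {0..u n} s *\<^sub>R \<beta> s \<omega>) \<in> borel_measurable lborel" for n using I u by (blast intro: borel_measurable_integrable)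
        show "integrable lborel (\<lambda>s. norm (indicator {0..T} s *\<^sub>R \<beta> s \<omega>))"
          using True by (intro integrable_norm) (simp add: set_integrable_def)
        show "AE s in lborel. norm (indicator {0..u n} s *\<^sub>R \<beta> s \<omega>) \<le> norm (indicator {0..T} s *\<^sub>R \<beta> s \<omega>)" for n
        proof (rule AE_I2)
          fix s show "norm (indicator {0..u n} s *\<^sub>R \<beta> s \<omega>) \<le> norm (indicator {0..T} s *\<^sub>R \<beta> s \<omega>)"
            using u[rule_format, of n] by (auto simp: indicator_def)
        qed
        show "AE s in lborel. (\<lambda>n. indicator {0..u n} s *\<^sub>R \<beta> s \<omega>) \<longlonglongrightarrow> indicator {0..a} s *\<^sub>R \<beta> s \<omega>"
          using AE_lborel_singleton[of a]
        proof eventually_elim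
          case (elim s)
          have "\<forall>\<^sub>F n in sequentially. indicator {0..u n} s *\<^sub>R \<beta> s \<omega> = indicator {0..a} s *\<^sub>R \<beta> s \<omega>"
          proof (cases "s < a")
            case True
            from order_tendstoD(1)[OF lim this] show ?thesis
              by eventually_elim (use True in \<open>auto simp: indicator_def\<close>)
          next
            case False
            with elim have "a < s" by simp
            from order_tendstoD(2)[OF lim this] show ?thesis
              by eventually_elim (use \<open>a < s\<close> in \<open>auto simp: indicator_def\<close>)
          qed
          then show ?case by (rule tendsto_eventually)
        qed
      qed
    qed
    then show ?thesis using True by (simp add: drift_def)
  qed (simp add: drift_def)
qed

lemma drift_diff_bound:
  fixes \<beta> \<beta>' :: "real \<Rightarrow> 'w \<Rightarrow> 'h::{banach, second_countable_topology}"
  assumes \<beta>: "set_integrable lborel {0..T} (\<lambda>s. \<beta> s \<omega>)" and \<beta>': "set_integrable lborel {0..T} (\<lambda>s. \<beta>' s \<omega>)" and t: "t \<le> T"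
  shows "sup_sq (\<lambda>s \<omega>. drift \<beta> s \<omega> - drift \<beta>' s \<omega>) t \<omega> \<le> ennreal T * (\<integral>\<^sup>+s\<in>{0..t}. ennreal ((norm (\<beta> s \<omega> - \<beta>' s \<omega>))\<^sup>2) \<partial>lborel)"
proof (rule sup_sq_least)
  fix r assume r: "0 \<le> r" "r \<le> t"
  have I: "set_integrable lborel {0..r} (\<lambda>s. \<beta> s \<omega>)" "set_integrable lborel {0..r} (\<lambda>s. \<beta>' s \<omega>)"
    using r t by (auto intro: set_integrable_subset[OF \<beta>] set_integrable_subset[OF \<beta>'])
  have "drift \<beta> r \<omega> - drift \<beta>' r \<omega> = (LINT s:{0..r}|lborel. \<beta> s \<omega> - \<beta>' s \<omega>)"
    unfolding drift_def using \<beta> \<beta>' set_integral_diff(2)[OF I] by simp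
  then have "ennreal ((norm (drift \<beta> r \<omega> - drift \<beta>' r \<omega>))\<^sup>2) \<le> ennreal r * (\<integral>\<^sup>+s\<in>{0..r}. ennreal ((norm (\<beta> s \<omega> - \<beta>' s \<omega>))\<^sup>2) \<partial>lborel)"
    using set_integral_sq_bound[OF set_integral_diff(1)[OF I] r(1)] by simp
  also have "\<dots> \<le> ennreal T * (\<integral>\<^sup>+s\<in>{0..t}. ennreal ((norm (\<beta> s \<omega> - \<beta>' s \<omega>))\<^sup>2) \<partial>lborel)"
    using r t by (intro mult_mono ennreal_leI nn_integral_mono) (auto simp: indicator_def)
  finally show "ennreal ((norm (drift \<beta> r \<omega> - drift \<beta>' r \<omega>))\<^sup>2) \<le> ennreal T * (\<integral>\<^sup>+s\<in>{0..t}. ennreal ((norm (\<beta> s \<omega> - \<beta>' s \<omega>))\<^sup>2) \<partial>lborel)" .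
qed

end

lemma clam_norm_triangle:
  assumes x: "x \<in> Clam l \<tau>" and y: "y \<in> Clam l \<tau>"
  shows "clam_norm l \<tau> x \<le> clam_norm l \<tau> (\<lambda>\<theta>. y \<theta> - x \<theta>) + clam_norm l \<tau> y"
proof (rule clam_norm_least)
  fix \<theta> assume th: "\<theta> \<le> \<tau>"
  have "norm (x \<theta>) \<le> norm (y \<theta> - x \<theta>) + norm (y \<theta>)"
    using norm_triangle_ineq4[of "y \<theta>" "y \<theta> - x \<theta>"] by simp
  then have "exp (l * \<theta>) * norm (x \<theta>) \<le> exp (l * \<theta>) * (norm (y \<theta> - x \<theta>) + norm (y \<theta>))"
    by (rule mult_left_mono) simp
  also have "\<dots> \<le> clam_norm l \<tau> (\<lambda>\<theta>. y \<theta> - x \<theta>) + clam_norm l \<tau> y"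
    unfolding distrib_left by (intro add_mono Clam_diff_upper[OF y x th] Clam_upper[OF y th])
  finally show "exp (l * \<theta>) * norm (x \<theta>) \<le> clam_norm l \<tau> (\<lambda>\<theta>. y \<theta> - x \<theta>) + clam_norm l \<tau> y" .
qed

section \<open>Borel functions on the weighted path space\<close>

lemma space_clam_borel: "space (clam_borel l \<tau>) = Clam l \<tau>"
  unfolding clam_borel_def by (intro space_measure_of) auto

lemma open_in_clam_borel:
  assumes "U \<subseteq> Clam l \<tau>" "\<And>x. x \<in> U \<Longrightarrow> \<exists>e>0. \<forall>y\<in>Clam l \<tau>. clam_norm l \<tau> (\<lambda>\<theta>. y \<theta> - x \<theta>) < e \<longrightarrow> y \<in> U"
  shows "U \<in> sets (clam_borel l \<tau>)"
proof -
  have "sets (clam_borel l \<tau> :: (real \<Rightarrow> 'a) measure) = sigma_sets (Clam l \<tau>) {U. U \<subseteq> Clam l \<tau> \<and>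
         (\<forall>x\<in>U. \<exists>e>0. \<forall>y\<in>Clam l \<tau>. clam_norm l \<tau> (\<lambda>\<theta>. y \<theta> - x \<theta>) < e \<longrightarrow> y \<in> U)}"
    unfolding clam_borel_def by (intro sets_measure_of) auto
  then show ?thesis using assms by (auto intro: sigma_sets.Basic)
qed

lemma clam_norm_measurable: "clam_norm l \<tau> \<in> borel_measurable (clam_borel l \<tau>)"
proof (rule borel_measurableI_greater)
  fix a
  show "{x \<in> space (clam_borel l \<tau>). a < clam_norm l \<tau> x} \<in> sets (clam_borel l \<tau> :: (real \<Rightarrow> 'a) measure)"
    unfolding space_clam_borel
  proof (rule open_in_clam_borel)
    fix x :: "real \<Rightarrow> 'a" assume x: "x \<in> {x \<in> Clam l \<tau>. a < clam_norm l \<tau> x}"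
    show "\<exists>e>0. \<forall>y\<in>Clam l \<tau>. clam_norm l \<tau> (\<lambda>\<theta>. y \<theta> - x \<theta>) < e \<longrightarrow> y \<in> {x \<in> Clam l \<tau>. a < clam_norm l \<tau> x}"
    proof (intro exI[of _ "clam_norm l \<tau> x - a"] conjI ballI impI)
      fix y assume y: "y \<in> Clam l \<tau>" "clam_norm l \<tau> (\<lambda>\<theta>. y \<theta> - x \<theta>) < clam_norm l \<tau> x - a"
      then show "y \<in> {x \<in> Clam l \<tau>. a < clam_norm l \<tau> x}" using clam_norm_triangle[of x l \<tau> y] x by simp
    qed (use x in simp)
  qed auto
qed

lemma clam_eval_measurable:
  assumes th: "\<theta> \<le> \<tau>"
  shows "(\<lambda>x. x \<theta>) \<in> borel_measurable (clam_borel l \<tau>)"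
proof (rule borel_measurableI)
  fix S :: "'a set" assume S: "open S"
  show "(\<lambda>x. x \<theta>) -` S \<inter> space (clam_borel l \<tau>) \<in> sets (clam_borel l \<tau>)"
    unfolding space_clam_borel
  proof (rule open_in_clam_borel)
    fix x assume x: "x \<in> (\<lambda>x. x \<theta>) -` S \<inter> Clam l \<tau>"
    then obtain e where e: "e > 0" "ball (x \<theta>) e \<subseteq> S" using S openE[of S "x \<theta>"] by auto
    show "\<exists>e>0. \<forall>y\<in>Clam l \<tau>. clam_norm l \<tau> (\<lambda>\<theta>. y \<theta> - x \<theta>) < e \<longrightarrow> y \<in> (\<lambda>x. x \<theta>) -` S \<inter> Clam l \<tau>"
    \<comment> \<open>Evaluation at \<theta> is Lipschitz with constant
      \<open>exp (- l * \<theta>)\<close>, hence this radius.\<close>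
    proof (intro exI[of _ "exp (l * \<theta>) * e"] conjI ballI impI)
      fix y assume y: "y \<in> Clam l \<tau>" "clam_norm l \<tau> (\<lambda>\<theta>. y \<theta> - x \<theta>) < exp (l * \<theta>) * e"
      have "exp (l * \<theta>) * norm (y \<theta> - x \<theta>) < exp (l * \<theta>) * e"
        by (rule le_less_trans[OF Clam_diff_upper[OF y(1) _ th] y(2)]) (use x in simp)
      then have "norm (y \<theta> - x \<theta>) < e" by (subst (asm) mult_less_cancel_left_pos) simp_all
      then have "y \<theta> \<in> ball (x \<theta>) e" by (simp add: dist_norm norm_minus_commute)
      then show "y \<in> (\<lambda>x. x \<theta>) -` S \<inter> Clam l \<tau>" using e(2) y(1) by auto
    qed (use e in simp)
  qed auto
qed

section \<open>The equation and its coefficients along admissible processes\<close>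

locale path_sde = brownian_basis M F W T
  for M :: "'w measure" and F and W :: "real \<Rightarrow> 'w \<Rightarrow> real ^ 'm" and T +
  fixes l L :: real
    and b :: "real \<Rightarrow> 'w \<Rightarrow> (real \<Rightarrow> 'h::{real_inner, banach, second_countable_topology}) \<Rightarrow> 'h"
    and \<sigma> :: "real \<Rightarrow> 'w \<Rightarrow> (real \<Rightarrow> 'h) \<Rightarrow> ((real ^ 'm) \<Rightarrow>\<^sub>L 'h)"
    and \<gamma> :: "real \<Rightarrow> 'w \<Rightarrow> 'h"
  assumes l_pos: "0 < l" and L_pos: "0 < L"
    and b_prog: "\<And>x. x \<in> Clam l T \<Longrightarrow> prog_measurable F {0..T} (\<lambda>t \<omega>. b t \<omega> x)"
    and \<sigma>_prog: "\<And>x. x \<in> Clam l T \<Longrightarrow> prog_measurable F {0..T} (\<lambda>t \<omega>. \<sigma> t \<omega> x)"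
    and lip: "\<And>t \<omega> x x'. t \<in> {0..T} \<Longrightarrow> \<omega> \<in> space M \<Longrightarrow> x \<in> Clam l T \<Longrightarrow> x' \<in> Clam l T \<Longrightarrow>
        norm (b t \<omega> x - b t \<omega> x') + hs_norm (\<sigma> t \<omega> x - \<sigma> t \<omega> x') \<le> L * clam_norm l T (\<lambda>\<theta>. x \<theta> - x' \<theta>)"
    and b_0: "(\<integral>\<^sup>+ \<omega>. (\<integral>\<^sup>+ t\<in>{0..T}. ennreal ((norm (b t \<omega> (\<lambda>_. 0)))\<^sup>2) \<partial>lborel) \<partial>M) < \<infinity>"
    and \<sigma>_0: "(\<integral>\<^sup>+ \<omega>. (\<integral>\<^sup>+ t\<in>{0..T}. ennreal ((hs_norm (\<sigma> t \<omega> (\<lambda>_. 0)))\<^sup>2) \<partial>lborel) \<partial>M) < \<infinity>"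
    and \<gamma>: "\<gamma> \<in> L2_initial M F l"
begin

lemma T_nonneg: "0 \<le> T"
  using T_pos by simp

lemma \<gamma>_path: "\<omega> \<in> space M \<Longrightarrow> (\<lambda>\<theta>. \<gamma> \<theta> \<omega>) \<in> Clam l 0"
  using \<gamma> measurable_space[of "\<lambda>\<omega> \<theta>. \<gamma> \<theta> \<omega>" "F 0" "clam_borel l 0" \<omega>]
  by (simp add: L2_initial_def space_clam_borel space_F)

lemma \<gamma>_measurable:
  assumes "\<theta> \<le> 0"
  shows "\<gamma> \<theta> \<in> borel_measurable (F t)"
proof -
  have "(\<lambda>\<omega> \<theta>. \<gamma> \<theta> \<omega>) \<in> measurable (F 0) (clam_borel l 0)" using \<gamma> by (simp add: L2_initial_def)
  from measurable_compose[OF this clam_eval_measurable[OF assms]]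
  have m: "\<gamma> \<theta> \<in> borel_measurable (F 0)" by simp
  show ?thesis
  proof (cases "t < 0")
    case True
    have "sets (F t) = sets (F 0)" by (rule F_negative[OF True])
    then show ?thesis using m by (simp cong: measurable_cong_sets)
  next
    case False
    then show ?thesis by (intro measurable_F_mono[OF _ m]) simp
  qed
qed

definition admissible :: "(real \<Rightarrow> 'w \<Rightarrow> 'h) \<Rightarrow> bool" where
  "admissible X \<longleftrightarrow> adapted_continuous F {..T} X \<and> (\<forall>\<omega>\<in>space M. (\<lambda>\<theta>. X \<theta> \<omega>) \<in> Clam l T)"

text \<open>
  Only the increments of \<open>Y\<close> enter, which makes the glued path continuous at \<open>0\<close> for every outcome.
\<close>

definition glue :: "(real \<Rightarrow> 'w \<Rightarrow> 'h) \<Rightarrow> real \<Rightarrow> 'w \<Rightarrow> 'h" where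
  "glue Y t \<omega> = \<gamma> (min t 0) \<omega> + (Y (max 0 t) \<omega> - Y 0 \<omega>)"

lemma glue_nonpos: "\<theta> \<le> 0 \<Longrightarrow> glue Y \<theta> \<omega> = \<gamma> \<theta> \<omega>"
  by (simp add: glue_def max_def min_def)

lemma glue_admissible:
  assumes Y: "adapted_continuous F {0..T} Y"
  shows "admissible (glue Y)"
proof -
  have cont: "continuous_on {..T} (\<lambda>s. glue Y s \<omega>)" if w: "\<omega> \<in> space M" for \<omega>
  proof -
    have "continuous_on {..0} (\<lambda>\<theta>. \<gamma> \<theta> \<omega>)" using \<gamma>_path[OF w] by (simp add: Clam_def)
    then have 1: "continuous_on {..T} (\<lambda>s. \<gamma> (min s 0) \<omega>)"
      by (rule continuous_on_compose2) (auto intro!: continuous_intros)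
    have "continuous_on {0..T} (\<lambda>s. Y s \<omega>)" using adapted_continuousD(2)[OF Y _ w, of 0] T_nonneg by simp
    then have "continuous_on {..T} (\<lambda>s. Y (max 0 s) \<omega>)"
      by (rule continuous_on_compose2) (use T_nonneg in \<open>auto intro!: continuous_intros\<close>)
    with 1 show ?thesis unfolding glue_def by (intro continuous_on_add continuous_on_diff continuous_on_const)
  qed
  have "adapted_continuous F {..T} (glue Y)" unfolding adapted_continuous_def
  proof (intro ballI conjI)
    fix t assume t: "t \<in> {..T}"
    show "glue Y t \<in> borel_measurable (F t)"
    proof (cases "t \<le> 0")
      case True
      then have "glue Y t = \<gamma> t" by (auto simp: glue_nonpos)
      then show ?thesis using \<gamma>_measurable[OF True] by simp
    next
      case False
      then have tt: "t \<in> {0..T}" "0 \<in> {0..T}" "0 \<le> t" using t T_nonneg by auto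
      have "Y t \<in> borel_measurable (F t)" "Y 0 \<in> borel_measurable (F t)"
        by (rule adapted_continuousD(1)[OF Y tt(1)], rule measurable_F_mono[OF tt(3) adapted_continuousD(1)[OF Y tt(2)]])
      then have "(\<lambda>\<omega>. \<gamma> 0 \<omega> + (Y t \<omega> - Y 0 \<omega>)) \<in> borel_measurable (F t)"
        by (intro borel_measurable_add borel_measurable_diff \<gamma>_measurable) simp
      moreover have "glue Y t = (\<lambda>\<omega>. \<gamma> 0 \<omega> + (Y t \<omega> - Y 0 \<omega>))" using False by (auto simp: glue_def)
      ultimately show ?thesis by simp
    qed
    fix \<omega> assume "\<omega> \<in> space (F t)"
    then show "continuous_on {..T} (\<lambda>s. glue Y s \<omega>)" by (intro cont) (simp add: space_F)
  qed
  moreover have "(\<lambda>\<theta>. glue Y \<theta> \<omega>) \<in> Clam l T" if w: "\<omega> \<in> space M" for \<omega>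
  proof -
    have g: "(\<lambda>\<theta>. \<gamma> \<theta> \<omega>) \<in> Clam l 0" by (rule \<gamma>_path[OF w])
    have "compact ((\<lambda>\<theta>. exp (l * \<theta>) * norm (glue Y \<theta> \<omega>)) ` {0..T})"
      by (intro compact_continuous_image continuous_on_mult continuous_on_norm continuous_on_subset[OF cont[OF w]])
         (auto intro!: continuous_intros)
    then have "bdd_above ((\<lambda>\<theta>. exp (l * \<theta>) * norm (glue Y \<theta> \<omega>)) ` {0..T})"
      by (intro bounded_imp_bdd_above compact_imp_bounded)
    moreover have "bdd_above ((\<lambda>\<theta>. exp (l * \<theta>) * norm (glue Y \<theta> \<omega>)) ` {..0})"
      using g by (simp add: Clam_def glue_nonpos cong: image_cong_simp)
    moreover have "{..T} = {..0} \<union> {0..T}" using T_nonneg by auto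
    ultimately have "bdd_above ((\<lambda>\<theta>. exp (l * \<theta>) * norm (glue Y \<theta> \<omega>)) ` {..T})"
      by (simp add: image_Un)
    moreover have "((\<lambda>\<theta>. exp (l * \<theta>) *\<^sub>R glue Y \<theta> \<omega>) \<longlongrightarrow> 0) at_bot"
    proof (rule Lim_transform_eventually)
      show "((\<lambda>\<theta>. exp (l * \<theta>) *\<^sub>R \<gamma> \<theta> \<omega>) \<longlongrightarrow> 0) at_bot" using g by (simp add: Clam_def)
      show "\<forall>\<^sub>F \<theta> in at_bot. exp (l * \<theta>) *\<^sub>R \<gamma> \<theta> \<omega> = exp (l * \<theta>) *\<^sub>R glue Y \<theta> \<omega>"
        using eventually_le_at_bot[of 0] by eventually_elim (simp add: glue_nonpos)
    qed
    ultimately show ?thesis using cont[OF w] by (simp add: Clam_def)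
  qed
  ultimately show ?thesis by (simp add: admissible_def)
qed

text \<open>Gluing subtracts the value at time 0, so the difference at 0 enters a second time: 2 + 2
  = 4.\<close>

lemma glue_sup_sq: "0 \<le> t \<Longrightarrow> sup_sq (\<lambda>s \<omega>. glue Y s \<omega> - glue Z s \<omega>) t \<omega> \<le> 4 * sup_sq (\<lambda>s \<omega>. Y s \<omega> - Z s \<omega>) t \<omega>"
proof (rule sup_sq_least)
  fix s assume s: "0 \<le> s" "s \<le> t" and t: "0 \<le> t"
  let ?d = "\<lambda>s. Y s \<omega> - Z s \<omega>"
  have "glue Y s \<omega> - glue Z s \<omega> = ?d s + - ?d 0" using s by (simp add: glue_def)
  then have "(norm (glue Y s \<omega> - glue Z s \<omega>))\<^sup>2 \<le> 2 * (norm (?d s))\<^sup>2 + 2 * (norm (?d 0))\<^sup>2"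
    using norm_add_sq_le[of "?d s" "- ?d 0"] by (simp only: norm_minus_cancel)
  then have "ennreal ((norm (glue Y s \<omega> - glue Z s \<omega>))\<^sup>2) \<le> ennreal (2 * (norm (?d s))\<^sup>2 + 2 * (norm (?d 0))\<^sup>2)" by (rule ennreal_leI)
  also have "\<dots> = 2 * ennreal ((norm (?d s))\<^sup>2) + 2 * ennreal ((norm (?d 0))\<^sup>2)"
    by (simp add: ennreal_plus ennreal_mult)
  also have "\<dots> \<le> 2 * sup_sq (\<lambda>s \<omega>. Y s \<omega> - Z s \<omega>) t \<omega> + 2 * sup_sq (\<lambda>s \<omega>. Y s \<omega> - Z s \<omega>) t \<omega>"
    using s t by (intro add_mono mult_left_mono sup_sq_upper[where X="\<lambda>s \<omega>. Y s \<omega> - Z s \<omega>"]) auto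
  also have "\<dots> = 4 * sup_sq (\<lambda>s \<omega>. Y s \<omega> - Z s \<omega>) t \<omega>" by (simp add: distrib_right[symmetric])
  finally show "ennreal ((norm (glue Y s \<omega> - glue Z s \<omega>))\<^sup>2) \<le> 4 * sup_sq (\<lambda>s \<omega>. Y s \<omega> - Z s \<omega>) t \<omega>" .
qed

abbreviation bX :: "(real \<Rightarrow> 'w \<Rightarrow> 'h) \<Rightarrow> real \<Rightarrow> 'w \<Rightarrow> 'h" where
  "bX X \<equiv> \<lambda>s \<omega>. b s \<omega> (past X s \<omega>)"

abbreviation sX :: "(real \<Rightarrow> 'w \<Rightarrow> 'h) \<Rightarrow> real \<Rightarrow> 'w \<Rightarrow> (real ^ 'm) \<Rightarrow>\<^sub>L 'h" where
  "sX X \<equiv> \<lambda>s \<omega>. \<sigma> s \<omega> (past X s \<omega>)"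

lemma lip_b:
  assumes "t \<in> {0..T}" "\<omega> \<in> space M" "x \<in> Clam l T" "x' \<in> Clam l T"
  shows "norm (b t \<omega> x - b t \<omega> x') \<le> L * clam_norm l T (\<lambda>\<theta>. x \<theta> - x' \<theta>)"
    and "hs_norm (\<sigma> t \<omega> x - \<sigma> t \<omega> x') \<le> L * clam_norm l T (\<lambda>\<theta>. x \<theta> - x' \<theta>)"
  using lip[OF assms] hs_norm_nonneg[of "\<sigma> t \<omega> x - \<sigma> t \<omega> x'"] norm_ge_zero[of "b t \<omega> x - b t \<omega> x'"] by linarith+

lemma bX_prog:
  assumes "admissible X"
  shows "prog_measurable F {0..T} (bX X)"
  by (rule prog_measurable_past[where L=L, OF b_prog lip_b(1)]) (use assms L_pos l_pos in \<open>auto simp: admissible_def\<close>)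

lemma sX_prog:
  assumes "admissible X"
  shows "prog_measurable F {0..T} (sX X)"
\<comment> \<open>Measurability uses the Lipschitz condition in the operator norm; the factor
  \<open>sqrt DIM\<close> converts the Hilbert-Schmidt bound.\<close>
proof (rule prog_measurable_past[where L="sqrt DIM(real ^ 'm) * L", OF \<sigma>_prog])
  fix t \<omega> and x y :: "real \<Rightarrow> 'h" assume "t \<in> {0..T}" "\<omega> \<in> space M" "x \<in> Clam l T" "y \<in> Clam l T"
  then have "sqrt DIM(real ^ 'm) * hs_norm (\<sigma> t \<omega> x - \<sigma> t \<omega> y) \<le> sqrt DIM(real ^ 'm) * (L * clam_norm l T (\<lambda>\<theta>. x \<theta> - y \<theta>))"
    by (intro mult_left_mono lip_b(2)) auto
  with norm_le_hs_norm show "norm (\<sigma> t \<omega> x - \<sigma> t \<omega> y) \<le> sqrt DIM(real ^ 'm) * L * clam_norm l T (\<lambda>\<theta>. x \<theta> - y \<theta>)"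
    unfolding mult.assoc by (rule order_trans)
qed (use assms L_pos l_pos in \<open>auto simp: admissible_def\<close>)

text \<open>The squared Lipschitz constant times the constant of \<open>past_diff_bound\<close>:
  squared differences of coefficients along two processes are at most \<kappa> times the running
  supremum of their squared distance.\<close>

definition \<kappa> :: real where
  "\<kappa> = L\<^sup>2 * (exp (l * T))\<^sup>2"

lemma \<kappa>_pos: "0 < \<kappa>"
  using L_pos by (simp add: \<kappa>_def)

lemma sq_le_clam:
  assumes "0 \<le> r" "r \<le> L * c"
  shows "ennreal (r\<^sup>2) \<le> ennreal (L\<^sup>2) * ennreal (c\<^sup>2)"
proof -
  have "r\<^sup>2 \<le> (L * c)\<^sup>2" using assms by (intro power_mono)
  then have "ennreal (r\<^sup>2) \<le> ennreal (L\<^sup>2 * c\<^sup>2)" by (intro ennreal_leI) (simp only: power_mult_distrib)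
  then show ?thesis by (simp add: ennreal_mult)
qed

lemma coeff_diff_bound:
  assumes w: "\<omega> \<in> space M" and X: "(\<lambda>\<theta>. X \<theta> \<omega>) \<in> Clam l T" and Z: "(\<lambda>\<theta>. Z \<theta> \<omega>) \<in> Clam l T"
    and eq: "\<And>\<theta>. \<theta> \<le> 0 \<Longrightarrow> X \<theta> \<omega> = Z \<theta> \<omega>" and s: "s \<in> {0..T}"
  shows "ennreal ((norm (bX X s \<omega> - bX Z s \<omega>))\<^sup>2) \<le> ennreal \<kappa> * sup_sq (\<lambda>s \<omega>. X s \<omega> - Z s \<omega>) s \<omega>"
    and "ennreal ((hs_norm (sX X s \<omega> - sX Z s \<omega>))\<^sup>2) \<le> ennreal \<kappa> * sup_sq (\<lambda>s \<omega>. X s \<omega> - Z s \<omega>) s \<omega>"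
proof -
  have s': "0 \<le> s" "s \<le> T" using s by auto
  have p: "past X s \<omega> \<in> Clam l T" "past Z s \<omega> \<in> Clam l T" by (intro past_Clam X Z s' l_pos)+
  have "ennreal (L\<^sup>2) * ennreal ((clam_norm l T (\<lambda>\<theta>. past X s \<omega> \<theta> - past Z s \<omega> \<theta>))\<^sup>2)
    \<le> ennreal (L\<^sup>2) * (ennreal ((exp (l * T))\<^sup>2) * sup_sq (\<lambda>s \<omega>. X s \<omega> - Z s \<omega>) s \<omega>)"
    by (intro mult_left_mono past_diff_bound[where X=X and X'=Z and \<omega>=\<omega>, OF X Z l_pos eq s']) simp_all
  also have "\<dots> = ennreal \<kappa> * sup_sq (\<lambda>s \<omega>. X s \<omega> - Z s \<omega>) s \<omega>"
    unfolding \<kappa>_def by (subst ennreal_mult) (simp_all add: mult.assoc)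
  finally have le: "ennreal (L\<^sup>2) * ennreal ((clam_norm l T (\<lambda>\<theta>. past X s \<omega> \<theta> - past Z s \<omega> \<theta>))\<^sup>2) \<le> ennreal \<kappa> * sup_sq (\<lambda>s \<omega>. X s \<omega> - Z s \<omega>) s \<omega>" .
  show "ennreal ((norm (bX X s \<omega> - bX Z s \<omega>))\<^sup>2) \<le> ennreal \<kappa> * sup_sq (\<lambda>s \<omega>. X s \<omega> - Z s \<omega>) s \<omega>"
    by (rule order_trans[OF sq_le_clam le]) (simp, rule lip_b(1)[OF s w p])
  show "ennreal ((hs_norm (sX X s \<omega> - sX Z s \<omega>))\<^sup>2) \<le> ennreal \<kappa> * sup_sq (\<lambda>s \<omega>. X s \<omega> - Z s \<omega>) s \<omega>"
    by (rule order_trans[OF sq_le_clam le]) (simp, rule lip_b(2)[OF s w p])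
qed

section \<open>Square integrability of the coefficients along a process\<close>

definition Eint :: "(real \<Rightarrow> 'w \<Rightarrow> ennreal) \<Rightarrow> real \<Rightarrow> ennreal" where
  "Eint f t = (\<integral>\<^sup>+\<omega>. (\<integral>\<^sup>+s\<in>{0..t}. f s \<omega> \<partial>lborel) \<partial>M)"

lemma Eint_mono:
  assumes "\<And>s \<omega>. s \<in> {0..t} \<Longrightarrow> \<omega> \<in> space M \<Longrightarrow> f s \<omega> \<le> g s \<omega>"
  shows "Eint f t \<le> Eint g t"
  unfolding Eint_def using assms by (intro nn_integral_mono) (auto simp: indicator_def)

lemma Eint_le_add:
  assumes g: "prog_measurable F {0..T} g" and h: "prog_measurable F {0..T} h" and t: "0 \<le> t" "t \<le> T"
    and le: "\<And>s \<omega>. s \<in> {0..t} \<Longrightarrow> \<omega> \<in> space M \<Longrightarrow> f s \<omega> \<le> 2 * g s \<omega> + 2 * h s \<omega>"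
  shows "Eint f t \<le> 2 * Eint g t + 2 * Eint h t"
proof -
  have [measurable]: "(\<lambda>\<omega>. \<integral>\<^sup>+s\<in>{0..t}. g s \<omega> \<partial>lborel) \<in> borel_measurable M" "(\<lambda>\<omega>. \<integral>\<^sup>+s\<in>{0..t}. h s \<omega> \<partial>lborel) \<in> borel_measurable M"
    by (rule measurable_F_M[OF prog_nn_integral_measurable[OF g t]], rule measurable_F_M[OF prog_nn_integral_measurable[OF h t]])
  have "Eint f t \<le> (\<integral>\<^sup>+\<omega>. 2 * (\<integral>\<^sup>+s\<in>{0..t}. g s \<omega> \<partial>lborel) + 2 * (\<integral>\<^sup>+s\<in>{0..t}. h s \<omega> \<partial>lborel) \<partial>M)"
    unfolding Eint_def
  proof (rule nn_integral_mono)
    fix \<omega> assume w: "\<omega> \<in> space M"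
    note [measurable] = prog_measurable_section[OF g t w] prog_measurable_section[OF h t w]
    have e: "k s \<omega> * indicator {0..t} s = k (max 0 (min t s)) \<omega> * indicator {0..t} s" for k :: "real \<Rightarrow> 'w \<Rightarrow> ennreal" and s
      by (auto simp: indicator_def min_def max_def)
    have "(\<integral>\<^sup>+s\<in>{0..t}. f s \<omega> \<partial>lborel) \<le> (\<integral>\<^sup>+s. 2 * (g s \<omega> * indicator {0..t} s) + 2 * (h s \<omega> * indicator {0..t} s) \<partial>lborel)"
      using le w by (intro nn_integral_mono) (auto simp: indicator_def)
    also have "\<dots> = 2 * (\<integral>\<^sup>+s\<in>{0..t}. g s \<omega> \<partial>lborel) + 2 * (\<integral>\<^sup>+s\<in>{0..t}. h s \<omega> \<partial>lborel)"
      unfolding e[of g] e[of h]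
      by (subst nn_integral_add; (subst nn_integral_cmult)?; (subst nn_integral_cmult)?; measurable?)
    finally show "(\<integral>\<^sup>+s\<in>{0..t}. f s \<omega> \<partial>lborel) \<le> 2 * (\<integral>\<^sup>+s\<in>{0..t}. g s \<omega> \<partial>lborel) + 2 * (\<integral>\<^sup>+s\<in>{0..t}. h s \<omega> \<partial>lborel)" .
  qed
  also have "\<dots> = 2 * Eint g t + 2 * Eint h t"
    unfolding Eint_def by (subst nn_integral_add; (subst nn_integral_cmult)?; (subst nn_integral_cmult)?; measurable?)
  finally show ?thesis .
qed

lemma Eint_finite:
  assumes "prog_measurable F {0..T} g" "prog_measurable F {0..T} h" "Eint g T < \<infinity>" "Eint h T < \<infinity>"
    and "\<And>s \<omega>. s \<in> {0..T} \<Longrightarrow> \<omega> \<in> space M \<Longrightarrow> f s \<omega> \<le> 2 * g s \<omega> + 2 * h s \<omega>"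
  shows "Eint f T < \<infinity>"
proof -
  have "Eint f T \<le> 2 * Eint g T + 2 * Eint h T"
    by (rule Eint_le_add[OF assms(1,2) T_nonneg order_refl assms(5)])
  also have "\<dots> < \<infinity>" using assms(3,4) by (simp add: ennreal_mult_less_top)
  finally show ?thesis .
qed

lemma Eint_cmult:
  assumes g: "prog_measurable F {0..T} g" and t: "0 \<le> t" "t \<le> T"
  shows "Eint (\<lambda>s \<omega>. c * g s \<omega>) t = c * (\<integral>\<^sup>+s\<in>{0..t}. (\<integral>\<^sup>+\<omega>. g s \<omega> \<partial>M) \<partial>lborel)"
proof -
  have "Eint (\<lambda>s \<omega>. c * g s \<omega>) t = (\<integral>\<^sup>+\<omega>. c * (\<integral>\<^sup>+s\<in>{0..t}. g s \<omega> \<partial>lborel) \<partial>M)"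
    unfolding Eint_def
  proof (rule nn_integral_cong)
    fix \<omega> assume w: "\<omega> \<in> space M"
    note [measurable] = prog_measurable_section[OF g t w]
    have e: "g s \<omega> * indicator {0..t} s = g (max 0 (min t s)) \<omega> * indicator {0..t} s" for s
      by (auto simp: indicator_def min_def max_def)
    show "(\<integral>\<^sup>+s\<in>{0..t}. c * g s \<omega> \<partial>lborel) = c * (\<integral>\<^sup>+s\<in>{0..t}. g s \<omega> \<partial>lborel)"
      unfolding mult.assoc e by (rule nn_integral_cmult) measurable
  qed
  also have "\<dots> = c * (\<integral>\<^sup>+\<omega>. (\<integral>\<^sup>+s\<in>{0..t}. g s \<omega> \<partial>lborel) \<partial>M)"
    by (rule nn_integral_cmult) (rule measurable_F_M[OF prog_nn_integral_measurable[OF g t]])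
  finally show ?thesis unfolding prog_nn_integral_Fubini[OF g t] .
qed

lemma prog_measurable_F0:
  assumes "g \<in> borel_measurable (F 0)"
  shows "prog_measurable F {0..T} (\<lambda>_. g)"
  unfolding prog_measurable_def
proof
  fix t assume "t \<in> {0..T}"
  then have "g \<in> borel_measurable (F t)" by (intro measurable_F_mono[OF _ assms]) simp
  from measurable_compose[OF measurable_snd this]
  show "(\<lambda>(s, \<omega>). g \<omega>) \<in> borel_measurable (restrict_space borel ({0..T} \<inter> {..t}) \<Otimes>\<^sub>M F t)" by (simp add: split_beta')
qed

text \<open>The initial path, continued after 0 by the constant \<open>\<gamma> 0\<close>: the
  reference process against which square integrability is measured.\<close>

abbreviation X0 :: "real \<Rightarrow> 'w \<Rightarrow> 'h" where
  "X0 \<equiv> glue (\<lambda>_ _. 0)"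

lemma zero_adapted: "adapted_continuous F I (\<lambda>_ _. 0 :: 'h)"
  by (simp add: adapted_continuous_def)

lemma X0_admissible: "admissible X0"
  by (rule glue_admissible[OF zero_adapted])

lemma past_X0_bound:
  assumes w: "\<omega> \<in> space M" and s: "s \<in> {0..T}"
  shows "clam_norm l T (\<lambda>\<theta>. past X0 s \<omega> \<theta> - 0) \<le> exp (l * T) * clam_norm l 0 (\<lambda>\<theta>. \<gamma> \<theta> \<omega>)"
proof (rule clam_norm_least)
  fix \<theta> assume th: "\<theta> \<le> T"
  note g = \<gamma>_path[OF w]
  have "past X0 s \<omega> \<theta> = \<gamma> (min \<theta> 0) \<omega>" using s by (cases "\<theta> \<le> s") (auto simp: past_def glue_def min_def max_def)
  \<comment> \<open>The weight is split at time 0: its part up to 0 goes with \<gamma>, and the part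
    after 0, where the path is frozen, is at most \<open>exp (l * T)\<close>.\<close>
  then have "exp (l * \<theta>) * norm (past X0 s \<omega> \<theta> - 0) = exp (l * max 0 \<theta>) * (exp (l * min \<theta> 0) * norm (\<gamma> (min \<theta> 0) \<omega>))"
    by (cases "\<theta> \<le> 0") (simp_all add: max_def min_def)
  also have "\<dots> \<le> exp (l * T) * clam_norm l 0 (\<lambda>\<theta>. \<gamma> \<theta> \<omega>)"
    using l_pos th T_nonneg by (intro mult_mono Clam_upper[OF g]) auto
  finally show "exp (l * \<theta>) * norm (past X0 s \<omega> \<theta> - 0) \<le> exp (l * T) * clam_norm l 0 (\<lambda>\<theta>. \<gamma> \<theta> \<omega>)" .
qed

text \<open>The affine space on which the iteration acts. Subtracting \<open>X0\<close> removes the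
  initial path, so that only the supremum over \<open>{0..T}\<close> has to be square
  integrable.\<close>

definition square_int :: "(real \<Rightarrow> 'w \<Rightarrow> 'h) \<Rightarrow> bool" where
  "square_int X \<longleftrightarrow> admissible X \<and> (\<forall>\<theta>\<le>0. \<forall>\<omega>\<in>space M. X \<theta> \<omega> = \<gamma> \<theta> \<omega>) \<and> (\<integral>\<^sup>+\<omega>. sup_sq (\<lambda>s \<omega>. X s \<omega> - X0 s \<omega>) T \<omega> \<partial>M) < \<infinity>"

lemma X0_square_int: "square_int X0"
  using T_nonneg by (simp add: square_int_def X0_admissible glue_nonpos sup_sq_def)

lemma square_intD:
  assumes "square_int X"
  shows "admissible X" "adapted_continuous F {..T} X" "\<omega> \<in> space M \<Longrightarrow> (\<lambda>\<theta>. X \<theta> \<omega>) \<in> Clam l T"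
    "\<theta> \<le> 0 \<Longrightarrow> \<omega> \<in> space M \<Longrightarrow> X \<theta> \<omega> = \<gamma> \<theta> \<omega>"
  using assms by (auto simp: square_int_def admissible_def)

lemma sup_sq_diff_prog:
  assumes "adapted_continuous F {..T} X" "adapted_continuous F {..T} Z"
  shows "prog_measurable F {0..T} (\<lambda>s \<omega>. sup_sq (\<lambda>s \<omega>. X s \<omega> - (Z s \<omega> :: 'h)) s \<omega>)"
  by (intro sup_sq_prog adapted_continuous_diff assms)

lemma Eint_le_of_sup:
  assumes X: "square_int X" and Z: "square_int Z" and t: "0 \<le> t" "t \<le> T"
    and le: "\<And>s \<omega>. s \<in> {0..t} \<Longrightarrow> \<omega> \<in> space M \<Longrightarrow> f s \<omega> \<le> ennreal \<kappa> * sup_sq (\<lambda>s \<omega>. X s \<omega> - Z s \<omega>) s \<omega>"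
  shows "Eint f t \<le> ennreal \<kappa> * (\<integral>\<^sup>+s\<in>{0..t}. (\<integral>\<^sup>+\<omega>. sup_sq (\<lambda>s \<omega>. X s \<omega> - Z s \<omega>) s \<omega> \<partial>M) \<partial>lborel)"
  unfolding Eint_cmult[OF sup_sq_diff_prog[OF square_intD(2)[OF X] square_intD(2)[OF Z]] t, symmetric]
  by (rule Eint_mono[OF le])

lemma coeff_diff_int:
  assumes X: "square_int X" and Z: "square_int Z" and t: "0 \<le> t" "t \<le> T"
  shows "Eint (\<lambda>s \<omega>. ennreal ((norm (bX X s \<omega> - bX Z s \<omega>))\<^sup>2)) t \<le> ennreal \<kappa> * (\<integral>\<^sup>+s\<in>{0..t}. (\<integral>\<^sup>+\<omega>. sup_sq (\<lambda>s \<omega>. X s \<omega> - Z s \<omega>) s \<omega> \<partial>M) \<partial>lborel)"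
    and "Eint (\<lambda>s \<omega>. ennreal ((hs_norm (sX X s \<omega> - sX Z s \<omega>))\<^sup>2)) t \<le> ennreal \<kappa> * (\<integral>\<^sup>+s\<in>{0..t}. (\<integral>\<^sup>+\<omega>. sup_sq (\<lambda>s \<omega>. X s \<omega> - Z s \<omega>) s \<omega> \<partial>M) \<partial>lborel)"
proof -
  have B: "ennreal ((norm (bX X s \<omega> - bX Z s \<omega>))\<^sup>2) \<le> ennreal \<kappa> * sup_sq (\<lambda>s \<omega>. X s \<omega> - Z s \<omega>) s \<omega>"
    "ennreal ((hs_norm (sX X s \<omega> - sX Z s \<omega>))\<^sup>2) \<le> ennreal \<kappa> * sup_sq (\<lambda>s \<omega>. X s \<omega> - Z s \<omega>) s \<omega>"
    if s: "s \<in> {0..t}" and w: "\<omega> \<in> space M" for s \<omega>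
    using s t w by (auto intro!: coeff_diff_bound square_intD(3)[OF X] square_intD(3)[OF Z] simp: square_intD(4)[OF X] square_intD(4)[OF Z])
  show "Eint (\<lambda>s \<omega>. ennreal ((norm (bX X s \<omega> - bX Z s \<omega>))\<^sup>2)) t \<le> ennreal \<kappa> * (\<integral>\<^sup>+s\<in>{0..t}. (\<integral>\<^sup>+\<omega>. sup_sq (\<lambda>s \<omega>. X s \<omega> - Z s \<omega>) s \<omega> \<partial>M) \<partial>lborel)"
    by (rule Eint_le_of_sup[OF X Z t]) (rule B(1))
  show "Eint (\<lambda>s \<omega>. ennreal ((hs_norm (sX X s \<omega> - sX Z s \<omega>))\<^sup>2)) t \<le> ennreal \<kappa> * (\<integral>\<^sup>+s\<in>{0..t}. (\<integral>\<^sup>+\<omega>. sup_sq (\<lambda>s \<omega>. X s \<omega> - Z s \<omega>) s \<omega> \<partial>M) \<partial>lborel)"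
    by (rule Eint_le_of_sup[OF X Z t]) (rule B(2))
qed

lemma sup_int_le:
  assumes t: "0 \<le> t" "t \<le> T"
  shows "(\<integral>\<^sup>+s\<in>{0..t}. (\<integral>\<^sup>+\<omega>. sup_sq X s \<omega> \<partial>M) \<partial>lborel) \<le> ennreal T * (\<integral>\<^sup>+\<omega>. sup_sq X T \<omega> \<partial>M)"
proof -
  have "(\<integral>\<^sup>+s\<in>{0..t}. (\<integral>\<^sup>+\<omega>. sup_sq X s \<omega> \<partial>M) \<partial>lborel) \<le> (\<integral>\<^sup>+s. (\<integral>\<^sup>+\<omega>. sup_sq X T \<omega> \<partial>M) * indicator {0..T} s \<partial>lborel)"
    using t by (intro nn_integral_mono) (auto simp: indicator_def intro!: nn_integral_mono sup_sq_mono)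
  also have "\<dots> = ennreal T * (\<integral>\<^sup>+\<omega>. sup_sq X T \<omega> \<partial>M)"
    using T_nonneg by (subst nn_integral_cmult_indicator) (simp_all add: mult.commute)
  finally show ?thesis .
qed

lemma initial_int: "Eint (\<lambda>_ \<omega>. ennreal \<kappa> * ennreal ((clam_norm l 0 (\<lambda>\<theta>. \<gamma> \<theta> \<omega>))\<^sup>2)) T < \<infinity>"
  and initial_prog: "prog_measurable F {0..T} (\<lambda>_ \<omega>. ennreal \<kappa> * ennreal ((clam_norm l 0 (\<lambda>\<theta>. \<gamma> \<theta> \<omega>))\<^sup>2))"
proof -
  have "(\<lambda>\<omega> \<theta>. \<gamma> \<theta> \<omega>) \<in> measurable (F 0) (clam_borel l 0)" using \<gamma> by (simp add: L2_initial_def)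
  from measurable_compose[OF this clam_norm_measurable]
  have [measurable]: "(\<lambda>\<omega>. clam_norm l 0 (\<lambda>\<theta>. \<gamma> \<theta> \<omega>)) \<in> borel_measurable (F 0)" .
  show "prog_measurable F {0..T} (\<lambda>_ \<omega>. ennreal \<kappa> * ennreal ((clam_norm l 0 (\<lambda>\<theta>. \<gamma> \<theta> \<omega>))\<^sup>2))"
    by (rule prog_measurable_F0) measurable
  have p: "prog_measurable F {0..T} (\<lambda>_ \<omega>. ennreal ((clam_norm l 0 (\<lambda>\<theta>. \<gamma> \<theta> \<omega>))\<^sup>2))"
    by (rule prog_measurable_F0) measurable
  have "integrable M (\<lambda>\<omega>. (clam_norm l 0 (\<lambda>\<theta>. \<gamma> \<theta> \<omega>))\<^sup>2)" using \<gamma> by (simp add: L2_initial_def)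
  then have fin: "(\<integral>\<^sup>+\<omega>. ennreal ((clam_norm l 0 (\<lambda>\<theta>. \<gamma> \<theta> \<omega>))\<^sup>2) \<partial>M) < \<infinity>" by (simp add: nn_integral_eq_integral)
  have "Eint (\<lambda>_ \<omega>. ennreal \<kappa> * ennreal ((clam_norm l 0 (\<lambda>\<theta>. \<gamma> \<theta> \<omega>))\<^sup>2)) T
    = ennreal \<kappa> * (\<integral>\<^sup>+s. (\<integral>\<^sup>+\<omega>. ennreal ((clam_norm l 0 (\<lambda>\<theta>. \<gamma> \<theta> \<omega>))\<^sup>2) \<partial>M) * indicator {0..T} s \<partial>lborel)"
    by (rule Eint_cmult[OF p T_nonneg order_refl])
  also have "\<dots> = ennreal \<kappa> * ((\<integral>\<^sup>+\<omega>. ennreal ((clam_norm l 0 (\<lambda>\<theta>. \<gamma> \<theta> \<omega>))\<^sup>2) \<partial>M) * ennreal T)"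
    using T_nonneg by (subst nn_integral_cmult_indicator) simp_all
  also have "\<dots> < \<infinity>" using fin by (simp add: ennreal_mult_less_top)
  finally show "Eint (\<lambda>_ \<omega>. ennreal \<kappa> * ennreal ((clam_norm l 0 (\<lambda>\<theta>. \<gamma> \<theta> \<omega>))\<^sup>2)) T < \<infinity>" .
qed

lemma sq_diff_le: "ennreal ((norm x)\<^sup>2) \<le> 2 * ennreal ((norm y)\<^sup>2) + 2 * ennreal ((norm (x - y :: 'h))\<^sup>2)"
  "ennreal ((hs_norm A)\<^sup>2) \<le> 2 * ennreal ((hs_norm B)\<^sup>2) + 2 * ennreal ((hs_norm (A - B :: (real ^ 'm) \<Rightarrow>\<^sub>L 'h))\<^sup>2)"
proof -
  have "ennreal ((norm x)\<^sup>2) \<le> ennreal (2 * (norm y)\<^sup>2 + 2 * (norm (x - y))\<^sup>2)"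
    using norm_add_sq_le[of y "x - y"] by (intro ennreal_leI) simp
  then show "ennreal ((norm x)\<^sup>2) \<le> 2 * ennreal ((norm y)\<^sup>2) + 2 * ennreal ((norm (x - y))\<^sup>2)"
    by (simp add: ennreal_plus ennreal_mult)
  have "ennreal ((hs_norm A)\<^sup>2) \<le> ennreal (2 * (hs_norm B)\<^sup>2 + 2 * (hs_norm (A - B))\<^sup>2)"
    using hs_norm_add_sq_le[of B "A - B"] by (intro ennreal_leI) simp
  then show "ennreal ((hs_norm A)\<^sup>2) \<le> 2 * ennreal ((hs_norm B)\<^sup>2) + 2 * ennreal ((hs_norm (A - B))\<^sup>2)"
    by (simp add: ennreal_plus ennreal_mult)
qed

lemma coeff_X0_bound:
  assumes w: "\<omega> \<in> space M" and s: "s \<in> {0..T}"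
  shows "ennreal ((norm (bX X0 s \<omega> - b s \<omega> (\<lambda>_. 0)))\<^sup>2) \<le> ennreal \<kappa> * ennreal ((clam_norm l 0 (\<lambda>\<theta>. \<gamma> \<theta> \<omega>))\<^sup>2)"
    and "ennreal ((hs_norm (sX X0 s \<omega> - \<sigma> s \<omega> (\<lambda>_. 0)))\<^sup>2) \<le> ennreal \<kappa> * ennreal ((clam_norm l 0 (\<lambda>\<theta>. \<gamma> \<theta> \<omega>))\<^sup>2)"
proof -
  let ?c = "clam_norm l T (\<lambda>\<theta>. past X0 s \<omega> \<theta> - 0)" and ?g = "clam_norm l 0 (\<lambda>\<theta>. \<gamma> \<theta> \<omega>)"
  have p: "past X0 s \<omega> \<in> Clam l T" using X0_admissible w s by (intro past_Clam l_pos) (auto simp: admissible_def)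
  have c0: "0 \<le> ?c" using p by (intro clam_norm_nonneg) simp
  have "?c\<^sup>2 \<le> (exp (l * T) * ?g)\<^sup>2" using past_X0_bound[OF w s] c0 by (rule power_mono)
  then have "L\<^sup>2 * ?c\<^sup>2 \<le> L\<^sup>2 * ((exp (l * T))\<^sup>2 * ?g\<^sup>2)"
    by (intro mult_left_mono) (simp_all add: power_mult_distrib)
  then have "ennreal (L\<^sup>2 * ?c\<^sup>2) \<le> ennreal (\<kappa> * ?g\<^sup>2)" unfolding \<kappa>_def by (intro ennreal_leI) (simp add: mult.assoc)
  then have le: "ennreal (L\<^sup>2) * ennreal (?c\<^sup>2) \<le> ennreal \<kappa> * ennreal (?g\<^sup>2)"
    using \<kappa>_pos by (simp add: ennreal_mult)
  show "ennreal ((norm (bX X0 s \<omega> - b s \<omega> (\<lambda>_. 0)))\<^sup>2) \<le> ennreal \<kappa> * ennreal (?g\<^sup>2)"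
    by (rule order_trans[OF sq_le_clam le]) (simp, rule lip_b(1)[OF s w p Clam_zero])
  show "ennreal ((hs_norm (sX X0 s \<omega> - \<sigma> s \<omega> (\<lambda>_. 0)))\<^sup>2) \<le> ennreal \<kappa> * ennreal (?g\<^sup>2)"
    by (rule order_trans[OF sq_le_clam le]) (simp, rule lip_b(2)[OF s w p Clam_zero])
qed

text \<open>Two Lipschitz comparisons: from the zero path, where integrability is assumed, to
  \<open>X0\<close> at the cost of the squared norm of the initial path, and from \<open>X0\<close>
  to X at the cost of the squared supremum distance.\<close>

lemma coeff_square_int:
  assumes X: "square_int X"
  shows "Eint (\<lambda>s \<omega>. ennreal ((norm (bX X s \<omega>))\<^sup>2)) T < \<infinity>"
    and "Eint (\<lambda>s \<omega>. ennreal ((hs_norm (sX X s \<omega>))\<^sup>2)) T < \<infinity>"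
proof -
  let ?nb = "\<lambda>\<beta> s \<omega>. ennreal ((norm (\<beta> s \<omega> :: 'h))\<^sup>2)" and ?ns = "\<lambda>\<beta> s \<omega>. ennreal ((hs_norm (\<beta> s \<omega> :: (real ^ 'm) \<Rightarrow>\<^sub>L 'h))\<^sup>2)"
  have nbp: "prog_measurable F {0..T} (?nb \<beta>)" if "prog_measurable F {0..T} \<beta>" for \<beta>
    by (rule prog_measurable_compose[OF that]) measurable
  have nsp: "prog_measurable F {0..T} (?ns \<beta>)" if "prog_measurable F {0..T} \<beta>" for \<beta>
    by (rule prog_measurable_compose[OF that]) measurable
  note prog = bX_prog[OF X0_admissible] bX_prog[OF square_intD(1)[OF X]] sX_prog[OF X0_admissible] sX_prog[OF square_intD(1)[OF X]]
  have supfin: "ennreal \<kappa> * (\<integral>\<^sup>+s\<in>{0..T}. (\<integral>\<^sup>+\<omega>. sup_sq (\<lambda>s \<omega>. X s \<omega> - X0 s \<omega>) s \<omega> \<partial>M) \<partial>lborel) < \<infinity>"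
  proof -
    have "(\<integral>\<^sup>+s\<in>{0..T}. (\<integral>\<^sup>+\<omega>. sup_sq (\<lambda>s \<omega>. X s \<omega> - X0 s \<omega>) s \<omega> \<partial>M) \<partial>lborel)
      \<le> ennreal T * (\<integral>\<^sup>+\<omega>. sup_sq (\<lambda>s \<omega>. X s \<omega> - X0 s \<omega>) T \<omega> \<partial>M)"
      by (rule sup_int_le[OF T_nonneg order_refl])
    also have "\<dots> < \<infinity>" using X by (simp add: square_int_def ennreal_mult_less_top)
    finally show ?thesis by (simp add: ennreal_mult_less_top)
  qed
  have b0: "Eint (?nb (bX X0)) T < \<infinity>"
  proof (rule Eint_finite[OF nbp[OF b_prog[OF Clam_zero]] initial_prog _ initial_int])
    show "Eint (?nb (\<lambda>s \<omega>. b s \<omega> (\<lambda>_. 0))) T < \<infinity>" unfolding Eint_def by (rule b_0)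
    fix s \<omega> assume s: "s \<in> {0..T}" "\<omega> \<in> space M"
    have "2 * ?nb (\<lambda>s \<omega>. b s \<omega> (\<lambda>_. 0)) s \<omega> + 2 * ennreal ((norm (bX X0 s \<omega> - b s \<omega> (\<lambda>_. 0)))\<^sup>2)
      \<le> 2 * ?nb (\<lambda>s \<omega>. b s \<omega> (\<lambda>_. 0)) s \<omega> + 2 * (ennreal \<kappa> * ennreal ((clam_norm l 0 (\<lambda>\<theta>. \<gamma> \<theta> \<omega>))\<^sup>2))"
      by (intro add_left_mono mult_left_mono coeff_X0_bound(1)[OF s(2,1)]) simp
    with sq_diff_le(1) show "?nb (bX X0) s \<omega> \<le> 2 * ?nb (\<lambda>s \<omega>. b s \<omega> (\<lambda>_. 0)) s \<omega> + 2 * (ennreal \<kappa> * ennreal ((clam_norm l 0 (\<lambda>\<theta>. \<gamma> \<theta> \<omega>))\<^sup>2))"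
      by (rule order_trans)
  qed
  have s0: "Eint (?ns (sX X0)) T < \<infinity>"
  proof (rule Eint_finite[OF nsp[OF \<sigma>_prog[OF Clam_zero]] initial_prog _ initial_int])
    show "Eint (?ns (\<lambda>s \<omega>. \<sigma> s \<omega> (\<lambda>_. 0))) T < \<infinity>" unfolding Eint_def by (rule \<sigma>_0)
    fix s \<omega> assume s: "s \<in> {0..T}" "\<omega> \<in> space M"
    have "2 * ?ns (\<lambda>s \<omega>. \<sigma> s \<omega> (\<lambda>_. 0)) s \<omega> + 2 * ennreal ((hs_norm (sX X0 s \<omega> - \<sigma> s \<omega> (\<lambda>_. 0)))\<^sup>2)
      \<le> 2 * ?ns (\<lambda>s \<omega>. \<sigma> s \<omega> (\<lambda>_. 0)) s \<omega> + 2 * (ennreal \<kappa> * ennreal ((clam_norm l 0 (\<lambda>\<theta>. \<gamma> \<theta> \<omega>))\<^sup>2))"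
      by (intro add_left_mono mult_left_mono coeff_X0_bound(2)[OF s(2,1)]) simp
    with sq_diff_le(2) show "?ns (sX X0) s \<omega> \<le> 2 * ?ns (\<lambda>s \<omega>. \<sigma> s \<omega> (\<lambda>_. 0)) s \<omega> + 2 * (ennreal \<kappa> * ennreal ((clam_norm l 0 (\<lambda>\<theta>. \<gamma> \<theta> \<omega>))\<^sup>2))"
      by (rule order_trans)
  qed
  have d: "Eint (?nb (\<lambda>s \<omega>. bX X s \<omega> - bX X0 s \<omega>)) T < \<infinity>" "Eint (?ns (\<lambda>s \<omega>. sX X s \<omega> - sX X0 s \<omega>)) T < \<infinity>"
    by (rule le_less_trans[OF coeff_diff_int(1)[OF X X0_square_int T_nonneg order_refl] supfin],
        rule le_less_trans[OF coeff_diff_int(2)[OF X X0_square_int T_nonneg order_refl] supfin])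
  show "Eint (?nb (bX X)) T < \<infinity>"
    by (rule Eint_finite[OF nbp[OF prog(1)] nbp[OF prog_measurable_diff[OF prog(2,1)]] b0 d(1)]) (rule sq_diff_le(1))
  show "Eint (?ns (sX X)) T < \<infinity>"
    by (rule Eint_finite[OF nsp[OF prog(3)] nsp[OF prog_measurable_diff[OF prog(4,3)]] s0 d(2)]) (rule sq_diff_le(2))
qed

end

section \<open>Picard iteration\<close>

lemma exp_nn_integral_le:
  assumes "0 < a" "0 \<le> t"
  shows "(\<integral>\<^sup>+s\<in>{0..t}. ennreal (exp (a * s)) \<partial>lborel) \<le> ennreal (exp (a * t) / a)"
proof -
  have "(\<integral>\<^sup>+s. ennreal (exp (a * s)) * indicator {0..t} s \<partial>lborel) = ennreal (exp (a * t) / a - exp (a * 0) / a)"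
  proof (rule nn_integral_FTC_Icc[where F="\<lambda>s. exp (a * s) / a" and f="\<lambda>s. exp (a * s)"])
    fix x show "((\<lambda>s. exp (a * s) / a) has_real_derivative exp (a * x)) (at x)"
      using assms by (auto intro!: derivative_eq_intros)
  qed (use assms in auto)
  also have "\<dots> \<le> ennreal (exp (a * t) / a)" using assms by (intro ennreal_leI) simp
  finally show ?thesis .
qed

lemma adapted_continuous_subset: "adapted_continuous F I X \<Longrightarrow> J \<subseteq> I \<Longrightarrow> adapted_continuous F J X"
  unfolding adapted_continuous_def by (auto intro: continuous_on_subset)

lemma adapted_continuous_add:
  fixes X Y :: "real \<Rightarrow> 'w \<Rightarrow> 'h::{real_normed_vector, second_countable_topology}"
  assumes "adapted_continuous F I X" "adapted_continuous F I Y"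
  shows "adapted_continuous F I (\<lambda>s \<omega>. X s \<omega> + Y s \<omega>)"
  using assms unfolding adapted_continuous_def
  by (intro ballI conjI borel_measurable_add continuous_on_add) auto

context path_sde
begin

definition msup_dist :: "(real \<Rightarrow> 'w \<Rightarrow> 'h) \<Rightarrow> (real \<Rightarrow> 'w \<Rightarrow> 'h) \<Rightarrow> real \<Rightarrow> ennreal" where
  "msup_dist X Z t = (\<integral>\<^sup>+\<omega>. sup_sq (\<lambda>s \<omega>. X s \<omega> - Z s \<omega>) t \<omega> \<partial>M)"

lemma sup_sq_diff_measurable:
  assumes "adapted_continuous F {0..T} X" "adapted_continuous F {0..T} Z" "0 \<le> t" "t \<le> T"
  shows "sup_sq (\<lambda>s \<omega>. X s \<omega> - (Z s \<omega> :: 'h)) t \<in> borel_measurable M"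
  by (rule measurable_F_M[OF sup_sq_measurable[OF adapted_continuous_diff[OF assms(1,2)] assms(3,4)]])

lemma msup_dist_mono: "s \<le> t \<Longrightarrow> msup_dist X Z s \<le> msup_dist X Z t"
  unfolding msup_dist_def by (intro nn_integral_mono sup_sq_mono)

lemma msup_dist_commute: "msup_dist X Z t = msup_dist Z X t"
  unfolding msup_dist_def by (intro nn_integral_cong sup_sq_minus_commute)

lemma msup_dist_triangle:
  assumes X: "adapted_continuous F {0..T} X" and Y: "adapted_continuous F {0..T} Y" and Z: "adapted_continuous F {0..T} Z"
    and t: "0 \<le> t" "t \<le> T"
  shows "msup_dist X Z t \<le> 2 * msup_dist X Y t + 2 * msup_dist Y Z t"
proof -
  note [measurable] = sup_sq_diff_measurable[OF X Y t] sup_sq_diff_measurable[OF Y Z t]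
  have "msup_dist X Z t \<le> (\<integral>\<^sup>+\<omega>. 2 * sup_sq (\<lambda>s \<omega>. X s \<omega> - Y s \<omega>) t \<omega> + 2 * sup_sq (\<lambda>s \<omega>. Y s \<omega> - Z s \<omega>) t \<omega> \<partial>M)"
    unfolding msup_dist_def by (intro nn_integral_mono sup_sq_triangle)
  also have "\<dots> = 2 * msup_dist X Y t + 2 * msup_dist Y Z t"
    unfolding msup_dist_def by (subst nn_integral_add; (subst nn_integral_cmult)?; (subst nn_integral_cmult)?; measurable?)
  finally show ?thesis .
qed

lemma msup_dist_eq_0D:
  assumes X: "adapted_continuous F {0..T} X" and Z: "adapted_continuous F {0..T} Z" and eq: "msup_dist X Z T = 0"
  shows "AE \<omega> in M. \<forall>t\<in>{0..T}. X t \<omega> = Z t \<omega>"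
proof -
  note m = sup_sq_diff_measurable[OF X Z T_nonneg order_refl]
  have "AE \<omega> in M. sup_sq (\<lambda>s \<omega>. X s \<omega> - Z s \<omega>) T \<omega> = 0"
    using eq unfolding msup_dist_def nn_integral_0_iff_AE[OF m] .
  then show ?thesis
  proof eventually_elim
    case (elim \<omega>)
    show ?case
    proof
      fix t assume "t \<in> {0..T}"
      then have "ennreal ((norm (X t \<omega> - Z t \<omega>))\<^sup>2) \<le> 0"
        using sup_sq_upper[where X="\<lambda>s \<omega>. X s \<omega> - Z s \<omega>" and s=t and t=T and \<omega>=\<omega>] elim by simp
      then show "X t \<omega> = Z t \<omega>" by simp
    qed
  qed
qed

lemma glue_msup_dist:
  assumes X: "adapted_continuous F {0..T} X" and Z: "adapted_continuous F {0..T} Z" and t: "0 \<le> t" "t \<le> T"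
  shows "msup_dist (glue X) (glue Z) t \<le> 4 * msup_dist X Z t"
proof -
  have "msup_dist (glue X) (glue Z) t \<le> (\<integral>\<^sup>+\<omega>. 4 * sup_sq (\<lambda>s \<omega>. X s \<omega> - Z s \<omega>) t \<omega> \<partial>M)"
    unfolding msup_dist_def by (intro nn_integral_mono glue_sup_sq t)
  also have "\<dots> = 4 * msup_dist X Z t"
    unfolding msup_dist_def by (rule nn_integral_cmult[OF sup_sq_diff_measurable[OF X Z t]])
  finally show ?thesis .
qed

lemma drift_msup_dist:
  fixes \<beta> \<beta>' :: "real \<Rightarrow> 'w \<Rightarrow> 'h"
  assumes \<beta>: "prog_measurable F {0..T} \<beta>" "AE \<omega> in M. set_integrable lborel {0..T} (\<lambda>s. \<beta> s \<omega>)"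
    and \<beta>': "prog_measurable F {0..T} \<beta>'" "AE \<omega> in M. set_integrable lborel {0..T} (\<lambda>s. \<beta>' s \<omega>)"
    and t: "0 \<le> t" "t \<le> T"
  shows "msup_dist (drift \<beta>) (drift \<beta>') t \<le> ennreal T * Eint (\<lambda>s \<omega>. ennreal ((norm (\<beta> s \<omega> - \<beta>' s \<omega>))\<^sup>2)) t"
proof -
  have "prog_measurable F {0..T} (\<lambda>s \<omega>. ennreal ((norm (\<beta> s \<omega> - \<beta>' s \<omega>))\<^sup>2))"
    by (rule prog_measurable_compose[OF prog_measurable_diff[OF \<beta>(1) \<beta>'(1)]]) measurable
  note m = measurable_F_M[OF prog_nn_integral_measurable[OF this t]]
  have "msup_dist (drift \<beta>) (drift \<beta>') t \<le> (\<integral>\<^sup>+\<omega>. ennreal T * (\<integral>\<^sup>+s\<in>{0..t}. ennreal ((norm (\<beta> s \<omega> - \<beta>' s \<omega>))\<^sup>2) \<partial>lborel) \<partial>M)"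
    unfolding msup_dist_def
  proof (rule nn_integral_mono_AE)
    show "AE \<omega> in M. sup_sq (\<lambda>s \<omega>. drift \<beta> s \<omega> - drift \<beta>' s \<omega>) t \<omega> \<le> ennreal T * (\<integral>\<^sup>+s\<in>{0..t}. ennreal ((norm (\<beta> s \<omega> - \<beta>' s \<omega>))\<^sup>2) \<partial>lborel)"
      using \<beta>(2) \<beta>'(2) by eventually_elim (rule drift_diff_bound[OF _ _ t(2)])
  qed
  also have "\<dots> = ennreal T * Eint (\<lambda>s \<omega>. ennreal ((norm (\<beta> s \<omega> - \<beta>' s \<omega>))\<^sup>2)) t"
    unfolding Eint_def by (rule nn_integral_cmult[OF m])
  finally show ?thesis .
qed

lemma msup_dist_add:
  assumes ac: "adapted_continuous F {0..T} X" "adapted_continuous F {0..T} X'" "adapted_continuous F {0..T} Z" "adapted_continuous F {0..T} Z'"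
    and t: "0 \<le> t" "t \<le> T"
  shows "msup_dist (\<lambda>s \<omega>. X s \<omega> + X' s \<omega>) (\<lambda>s \<omega>. Z s \<omega> + Z' s \<omega>) t \<le> 2 * msup_dist X Z t + 2 * msup_dist X' Z' t"
proof -
  note [measurable] = sup_sq_diff_measurable[OF ac(1,3) t] sup_sq_diff_measurable[OF ac(2,4) t]
  have "msup_dist (\<lambda>s \<omega>. X s \<omega> + X' s \<omega>) (\<lambda>s \<omega>. Z s \<omega> + Z' s \<omega>) t
    \<le> (\<integral>\<^sup>+\<omega>. 2 * sup_sq (\<lambda>s \<omega>. X s \<omega> - Z s \<omega>) t \<omega> + 2 * sup_sq (\<lambda>s \<omega>. X' s \<omega> - Z' s \<omega>) t \<omega> \<partial>M)"
    unfolding msup_dist_def add_diff_add by (intro nn_integral_mono sup_sq_add_le)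
  also have "\<dots> = 2 * msup_dist X Z t + 2 * msup_dist X' Z' t"
    unfolding msup_dist_def by (subst nn_integral_add; (subst nn_integral_cmult)?; (subst nn_integral_cmult)?; measurable?)
  finally show ?thesis .
qed

lemma bX_integrable:
  assumes "square_int X"
  shows "AE \<omega> in M. set_integrable lborel {0..T} (\<lambda>s. bX X s \<omega>)"
  by (rule sq_integrable_imp_set_integrable[OF bX_prog[OF square_intD(1)[OF assms]] coeff_square_int(1)[OF assms, unfolded Eint_def]])

lemma sX_energy: "square_int X \<Longrightarrow> (\<integral>\<^sup>+\<omega>. energy (sX X) T \<omega> \<partial>M) < \<infinity>"
  using coeff_square_int(2)[of X] by (simp only: Eint_def energy_def)

text \<open>One Picard iteration. It is a relation and not a function because the integral is
  determined only up to indistinguishability; iterates are obtained by dependent choice.\<close>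

definition step :: "(real \<Rightarrow> 'w \<Rightarrow> 'h) \<Rightarrow> (real \<Rightarrow> 'w \<Rightarrow> 'h) \<Rightarrow> bool" where
  "step X X' \<longleftrightarrow> (\<exists>I. ito_L2 (sX X) I \<and> X' = glue (\<lambda>s \<omega>. drift (bX X) s \<omega> + I s \<omega>))"

lemma ito_L2_ac: "ito_L2 \<Phi> I \<Longrightarrow> adapted_continuous F {0..T} I"
  by (simp add: ito_L2_def)

text \<open>Gluing contributes the factor 4 and the separation of drift and stochastic integral the
  factor 2. The drift then adds \<open>T\<close> from Cauchy-Schwarz in time and the integral its
  constant 64, so the totals are \<open>8 * T\<close> and 512.\<close>

lemma step_bound:
  fixes \<beta> \<beta>' :: "real \<Rightarrow> 'w \<Rightarrow> 'h"
  assumes \<beta>: "prog_measurable F {0..T} \<beta>" "AE \<omega> in M. set_integrable lborel {0..T} (\<lambda>s. \<beta> s \<omega>)"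
    and \<beta>': "prog_measurable F {0..T} \<beta>'" "AE \<omega> in M. set_integrable lborel {0..T} (\<lambda>s. \<beta>' s \<omega>)"
    and I: "ito_L2 \<Phi> I" and J: "ito_L2 \<Psi> J" and t: "0 \<le> t" "t \<le> T"
  shows "msup_dist (glue (\<lambda>s \<omega>. drift \<beta> s \<omega> + I s \<omega>)) (glue (\<lambda>s \<omega>. drift \<beta>' s \<omega> + J s \<omega>)) t
    \<le> ennreal (8 * T) * Eint (\<lambda>s \<omega>. ennreal ((norm (\<beta> s \<omega> - \<beta>' s \<omega>))\<^sup>2)) t
      + 512 * Eint (\<lambda>s \<omega>. ennreal ((hs_norm (\<Phi> s \<omega> - \<Psi> s \<omega>))\<^sup>2)) t"
    (is "?D \<le> ennreal (8 * T) * ?A + 512 * ?B")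
proof -
  note ac = drift_adapted_continuous[OF \<beta>] drift_adapted_continuous[OF \<beta>'] ito_L2_ac[OF I] ito_L2_ac[OF J]
  have "?D \<le> 4 * msup_dist (\<lambda>s \<omega>. drift \<beta> s \<omega> + I s \<omega>) (\<lambda>s \<omega>. drift \<beta>' s \<omega> + J s \<omega>) t"
    by (rule glue_msup_dist[OF adapted_continuous_add[OF ac(1,3)] adapted_continuous_add[OF ac(2,4)] t])
  also have "\<dots> \<le> 4 * (2 * msup_dist (drift \<beta>) (drift \<beta>') t + 2 * msup_dist I J t)"
    by (rule mult_left_mono[OF msup_dist_add[OF ac(1,3,2,4) t]]) simp
  also have "\<dots> \<le> 4 * (2 * (ennreal T * ?A) + 2 * (64 * ?B))"
  proof -
    have "msup_dist I J t \<le> 64 * ?B"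
      using ito_L2_diff_bound[OF I J t] by (simp only: msup_dist_def dist2_def energy_def Eint_def)
    with drift_msup_dist[OF \<beta> \<beta>' t] show ?thesis by (intro mult_left_mono add_mono) simp_all
  qed
  also have "\<dots> = ennreal (8 * T) * ?A + 512 * ?B"
    using T_nonneg by (simp add: distrib_left ennreal_mult mult.assoc[symmetric])
  finally show ?thesis .
qed

lemma step_exists:
  assumes "square_int X"
  obtains X' where "step X X'"
  using ito_L2_exists[OF sX_prog[OF square_intD(1)[OF assms]] sX_energy[OF assms]] unfolding step_def by metis

text \<open>\<open>X0\<close> is the glued path for zero drift and zero integrand, so its distance
  to the new iterate is an instance of \<open>step_bound\<close>.\<close>

lemma step_square_int:
  assumes X: "square_int X" and S: "step X X'"
  shows "square_int X'"
proof -
  obtain I where I: "ito_L2 (sX X) I" and X': "X' = glue (\<lambda>s \<omega>. drift (bX X) s \<omega> + I s \<omega>)"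
    using S by (auto simp: step_def)
  note bp = bX_prog[OF square_intD(1)[OF X]]
  have ac: "adapted_continuous F {0..T} (\<lambda>s \<omega>. drift (bX X) s \<omega> + I s \<omega>)"
    by (rule adapted_continuous_add[OF drift_adapted_continuous[OF bp bX_integrable[OF X]] ito_L2_ac[OF I]])
  have z: "prog_measurable F {0..T} (\<lambda>_ _. 0 :: 'h)" by (rule prog_measurable_F0) simp
  have d0: "drift (\<lambda>_ _. 0 :: 'h) s \<omega> = 0" for s \<omega>
    by (simp add: drift_def set_lebesgue_integral_def)
  have zi: "AE \<omega> in M. set_integrable lborel {0..T} (\<lambda>s. 0 :: 'h)"
    by (simp add: set_integrable_def)
  have "msup_dist X' (glue (\<lambda>s \<omega>. drift (\<lambda>_ _. 0) s \<omega> + 0)) T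
    \<le> ennreal (8 * T) * Eint (\<lambda>s \<omega>. ennreal ((norm (bX X s \<omega> - 0))\<^sup>2)) T + 512 * Eint (\<lambda>s \<omega>. ennreal ((hs_norm (sX X s \<omega> - 0))\<^sup>2)) T"
    unfolding X' by (rule step_bound[OF bp bX_integrable[OF X] z zi I ito_L2_zero T_nonneg order_refl])
  also have "\<dots> < \<infinity>"
    using coeff_square_int[OF X] by (simp only: diff_zero) (simp add: ennreal_mult_less_top)
  finally have "msup_dist X' X0 T < \<infinity>" by (simp only: d0 add_0_left)
  then show ?thesis
    unfolding square_int_def msup_dist_def using glue_admissible[OF ac] by (simp add: X' glue_nonpos)
qed

text \<open>The constants of \<open>step_bound\<close>, each multiplied by \<kappa> from the
  Lipschitz estimate of the corresponding coefficient.\<close>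

definition rate :: real where
  "rate = 8 * T * \<kappa> + 512 * \<kappa>"

lemma rate_pos: "0 < rate"
  using T_pos \<kappa>_pos by (simp add: rate_def add_pos_pos)

lemma step_contraction:
  assumes X: "square_int X" and Z: "square_int Z" and S: "step X X'" "step Z Z'" and t: "0 \<le> t" "t \<le> T"
  shows "msup_dist X' Z' t \<le> ennreal rate * (\<integral>\<^sup>+s\<in>{0..t}. msup_dist X Z s \<partial>lborel)"
proof -
  let ?S = "\<integral>\<^sup>+s\<in>{0..t}. msup_dist X Z s \<partial>lborel"
  obtain I where I: "ito_L2 (sX X) I" and X': "X' = glue (\<lambda>s \<omega>. drift (bX X) s \<omega> + I s \<omega>)"
    using S by (auto simp: step_def)
  obtain J where J: "ito_L2 (sX Z) J" and Z': "Z' = glue (\<lambda>s \<omega>. drift (bX Z) s \<omega> + J s \<omega>)"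
    using S by (auto simp: step_def)
  have "msup_dist X' Z' t \<le> ennreal (8 * T) * Eint (\<lambda>s \<omega>. ennreal ((norm (bX X s \<omega> - bX Z s \<omega>))\<^sup>2)) t
      + 512 * Eint (\<lambda>s \<omega>. ennreal ((hs_norm (sX X s \<omega> - sX Z s \<omega>))\<^sup>2)) t"
    unfolding X' Z'
    by (rule step_bound[OF bX_prog[OF square_intD(1)[OF X]] bX_integrable[OF X] bX_prog[OF square_intD(1)[OF Z]] bX_integrable[OF Z] I J t])
  also have "\<dots> \<le> ennreal (8 * T) * (ennreal \<kappa> * ?S) + 512 * (ennreal \<kappa> * ?S)"
    unfolding msup_dist_def by (intro add_mono mult_left_mono coeff_diff_int[OF X Z t]) simp_all
  also have "\<dots> = ennreal rate * ?S"
  proof -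
    have "ennreal rate = ennreal (8 * T) * ennreal \<kappa> + 512 * ennreal \<kappa>"
      using T_pos \<kappa>_pos unfolding rate_def by (simp add: ennreal_plus ennreal_mult)
    then show ?thesis by (simp only: distrib_right mult.assoc)
  qed
  finally show ?thesis .
qed

lemma square_int_ac: "square_int X \<Longrightarrow> adapted_continuous F {0..T} X"
  by (rule adapted_continuous_subset[OF square_intD(2)]) auto

text \<open>
  The exponential weight turns every iteration into a factor \<open>1/16\<close>, the rate required by
  \<open>adapted_continuous_complete\<close>.
\<close>

lemma picard_bound:
  fixes X :: "nat \<Rightarrow> real \<Rightarrow> 'w \<Rightarrow> 'h"
  assumes X: "\<And>n. square_int (X n)" and S: "\<And>n. step (X n) (X (Suc n))"
    and k: "msup_dist (X (Suc 0)) (X 0) T = ennreal k" "0 \<le> k" and t: "0 \<le> t" "t \<le> T"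
  shows "msup_dist (X (Suc n)) (X n) t \<le> ennreal (k * (1/16) ^ n * exp (16 * rate * t))"
  using t
proof (induction n arbitrary: t)
  case 0
  have "msup_dist (X (Suc 0)) (X 0) t \<le> ennreal k" unfolding k(1)[symmetric] by (rule msup_dist_mono[OF 0(2)])
  also have "\<dots> \<le> ennreal (k * (1/16) ^ 0 * exp (16 * rate * t))"
    using k(2) 0 rate_pos by (intro ennreal_leI) (simp add: mult_left_le mult_le_cancel_left1)
  finally show ?case .
next
  case (Suc n)
  let ?c = "k * (1/16) ^ n"
  have c: "0 \<le> ?c" using k by simp
  have "msup_dist (X (Suc (Suc n))) (X (Suc n)) t \<le> ennreal rate * (\<integral>\<^sup>+s\<in>{0..t}. msup_dist (X (Suc n)) (X n) s \<partial>lborel)"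
    by (rule step_contraction[OF X X S S Suc.prems])
  also have "(\<integral>\<^sup>+s\<in>{0..t}. msup_dist (X (Suc n)) (X n) s \<partial>lborel) \<le> (\<integral>\<^sup>+s. ennreal ?c * (ennreal (exp (16 * rate * s)) * indicator {0..t} s) \<partial>lborel)"
    using Suc.IH Suc.prems c by (intro nn_integral_mono) (auto simp: indicator_def ennreal_mult[symmetric])
  also have "\<dots> = ennreal ?c * (\<integral>\<^sup>+s\<in>{0..t}. ennreal (exp (16 * rate * s)) \<partial>lborel)"
    by (rule nn_integral_cmult) measurable
  also have "\<dots> \<le> ennreal ?c * ennreal (exp (16 * rate * t) / (16 * rate))"
    using rate_pos Suc.prems by (intro mult_left_mono exp_nn_integral_le) simp_all
  finally have "msup_dist (X (Suc (Suc n))) (X (Suc n)) t \<le> ennreal rate * (ennreal ?c * ennreal (exp (16 * rate * t) / (16 * rate)))"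
    by (simp add: mult_left_mono)
  also have "\<dots> = ennreal (k * (1/16) ^ Suc n * exp (16 * rate * t))"
    using c rate_pos by (simp add: ennreal_mult[symmetric])
  finally show ?case .
qed

text \<open>Completeness yields a limit on \<open>{0..T}\<close> only; glued to the initial path it
  is an admissible argument of \<open>step\<close>. The result Z of that step is compared with the
  limit through the iterates \<open>X (Suc n)\<close>: one distance vanishes by convergence, the
  other by \<open>step_contraction\<close>. Equality holds only almost surely, so the statement
  speaks of two processes.\<close>

lemma fixpoint_exists:
  obtains X X' where "square_int X" "step X X'" "AE \<omega> in M. \<forall>t\<in>{0..T}. X t \<omega> = X' t \<omega>"
proof -
  have "\<exists>X. \<forall>n. square_int (X n) \<and> step (X n) (X (Suc n))"
  proof (rule dependent_nat_choice)
    show "\<exists>x. square_int x" using X0_square_int by blast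
    show "\<exists>y. square_int y \<and> step x y" if "square_int x" for x and n :: nat
      using step_exists[OF that] step_square_int[OF that] by metis
  qed
  then obtain X where X: "\<And>n. square_int (X n)" and S: "\<And>n. step (X n) (X (Suc n))" by metis
  note ac = square_int_ac[OF X]
  have "msup_dist (X (Suc 0)) (X 0) T \<le> 2 * msup_dist (X (Suc 0)) X0 T + 2 * msup_dist X0 (X 0) T"
    by (rule msup_dist_triangle[OF ac square_int_ac[OF X0_square_int] ac T_nonneg order_refl])
  also have "\<dots> < \<infinity>"
  proof -
    have "msup_dist (X n) X0 T < \<infinity>" for n using X[of n] by (simp add: square_int_def msup_dist_def)
    then show ?thesis unfolding msup_dist_commute[of X0] by (simp add: ennreal_mult_less_top)
  qed
  finally obtain k where k: "msup_dist (X (Suc 0)) (X 0) T = ennreal k" "0 \<le> k"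
    by (cases "msup_dist (X (Suc 0)) (X 0) T") auto
  have "(\<integral>\<^sup>+\<omega>. sup_sq (\<lambda>s \<omega>. X (Suc n) s \<omega> - X n s \<omega>) T \<omega> \<partial>M) \<le> ennreal ((k * exp (16 * rate * T)) * (1/16) ^ n)" for n
    using picard_bound[where X=X, OF X S k T_nonneg order_refl, of n] by (simp only: msup_dist_def mult.assoc mult.commute[of "(1/16) ^ n"])
  then obtain Y where Y: "adapted_continuous F {0..T} Y"
    and lim: "(\<lambda>n. \<integral>\<^sup>+\<omega>. sup_sq (\<lambda>s \<omega>. X n s \<omega> - Y s \<omega>) T \<omega> \<partial>M) \<longlonglongrightarrow> 0"
    by (rule adapted_continuous_complete[OF ac])
  let ?X = "glue Y"
  have gac: "adapted_continuous F {0..T} ?X"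
    by (rule adapted_continuous_subset[where I="{..T}"]) (use glue_admissible[OF Y] in \<open>auto simp: admissible_def\<close>)
  \<comment> \<open>The iterates already equal \<gamma> up to time 0, so gluing does not change them
    and the convergence to \<open>Y\<close> carries over to the glued limit.\<close>
  have glue_eq: "X n t \<omega> = glue (X n) t \<omega>" if "\<omega> \<in> space M" for n t \<omega>
    using square_intD(4)[OF X _ that] by (simp add: glue_def min_def max_def)
  have le: "msup_dist (X n) ?X T \<le> 4 * (\<integral>\<^sup>+\<omega>. sup_sq (\<lambda>s \<omega>. X n s \<omega> - Y s \<omega>) T \<omega> \<partial>M)" for n
  proof -
    have "msup_dist (X n) ?X T = msup_dist (glue (X n)) ?X T"
      unfolding msup_dist_def by (intro nn_integral_cong) (simp add: sup_sq_def glue_eq[symmetric])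
    then show ?thesis using glue_msup_dist[OF ac[of n] Y T_nonneg order_refl] by (simp only: msup_dist_def)
  qed
  have lim4: "(\<lambda>n. 4 * (\<integral>\<^sup>+\<omega>. sup_sq (\<lambda>s \<omega>. X n s \<omega> - Y s \<omega>) T \<omega> \<partial>M)) \<longlonglongrightarrow> 0"
    using ennreal_tendsto_cmult[OF _ lim, of 4] by simp
  have lim': "(\<lambda>n. msup_dist (X n) ?X T) \<longlonglongrightarrow> 0"
    by (rule tendsto_sandwich[OF eventuallyI eventuallyI tendsto_const lim4]) (rule zero_le, rule le)
  have "\<forall>\<^sub>F n in sequentially. msup_dist (X n) ?X T < 1" by (rule order_tendstoD(2)[OF lim']) simp
  then obtain n0 where n0: "msup_dist (X n0) ?X T < 1" unfolding eventually_sequentially by blast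
  have "msup_dist ?X X0 T \<le> 2 * msup_dist ?X (X n0) T + 2 * msup_dist (X n0) X0 T"
    by (rule msup_dist_triangle[OF gac ac square_int_ac[OF X0_square_int] T_nonneg order_refl])
  also have "\<dots> < \<infinity>"
  proof -
    have "msup_dist (X n0) X0 T < \<infinity>" using X[of n0] by (simp add: square_int_def msup_dist_def)
    moreover have "msup_dist ?X (X n0) T < \<infinity>" using n0 unfolding msup_dist_commute[of ?X] by (rule order.strict_trans) simp
    ultimately show ?thesis by (simp add: ennreal_mult_less_top)
  qed
  finally have sq: "square_int ?X"
    unfolding square_int_def msup_dist_def using glue_admissible[OF Y] by (simp add: glue_nonpos)
  then obtain Z where Z: "step ?X Z" by (rule step_exists)
  note Zs = step_square_int[OF sq Z]
  have "msup_dist ?X Z T \<le> 2 * msup_dist (X (Suc n)) ?X T + 2 * (ennreal rate * (ennreal T * msup_dist (X n) ?X T))" for n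
  proof -
    have "msup_dist (X (Suc n)) Z T \<le> ennreal rate * (\<integral>\<^sup>+s\<in>{0..T}. msup_dist (X n) ?X s \<partial>lborel)"
      by (rule step_contraction[OF X sq S Z T_nonneg order_refl])
    also have "\<dots> \<le> ennreal rate * (ennreal T * msup_dist (X n) ?X T)"
      unfolding msup_dist_def by (intro mult_left_mono sup_int_le T_nonneg order_refl) simp
    finally have "2 * msup_dist (X (Suc n)) ?X T + 2 * msup_dist (X (Suc n)) Z T
      \<le> 2 * msup_dist (X (Suc n)) ?X T + 2 * (ennreal rate * (ennreal T * msup_dist (X n) ?X T))"
      by (intro add_left_mono mult_left_mono) simp_all
    with msup_dist_triangle[OF gac ac[of "Suc n"] square_int_ac[OF Zs] T_nonneg order_refl, unfolded msup_dist_commute[of ?X "X (Suc n)" T]]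
    show ?thesis by (rule order_trans)
  qed
  moreover have "(\<lambda>n. 2 * msup_dist (X (Suc n)) ?X T + 2 * (ennreal rate * (ennreal T * msup_dist (X n) ?X T))) \<longlonglongrightarrow> 2 * 0 + 2 * (ennreal rate * (ennreal T * 0))"
    by (intro tendsto_add ennreal_tendsto_cmult lim' LIMSEQ_Suc[OF lim']) simp_all
  ultimately have "msup_dist ?X Z T \<le> 0"
    by (intro LIMSEQ_le_const[where a="msup_dist ?X Z T"]) (auto simp only: mult_zero_right add_0)
  then have "AE \<omega> in M. \<forall>t\<in>{0..T}. ?X t \<omega> = Z t \<omega>"
    by (intro msup_dist_eq_0D gac square_int_ac[OF Zs]) simp
  with sq Z show thesis by (rule that)
qed

lemma solution_exists:
  obtains X where "is_solution M F W l T b \<sigma> \<gamma> X"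
proof -
  obtain X X' where X: "square_int X" and S: "step X X'" and ae: "AE \<omega> in M. \<forall>t\<in>{0..T}. X t \<omega> = X' t \<omega>"
    by (rule fixpoint_exists)
  obtain I where I: "ito_L2 (sX X) I" and X': "X' = glue (\<lambda>s \<omega>. drift (bX X) s \<omega> + I s \<omega>)"
    using S by (auto simp: step_def)
  have ito: "is_ito_integral M F W T (sX X) I" by (rule ito_L2_is_ito_integral[OF I sX_energy[OF X]])
  \<comment> \<open>\<open>glue\<close> subtracts the values of drift and integral at time 0, while
    the equation does not. Both must be 0 there; for the integral this follows from locality, since
    the energy over a single time vanishes.\<close>
  have e0: "energy (sX X) 0 \<omega> = 0" for \<omega>
  proof -
    have "energy (sX X) 0 \<omega> \<le> (\<integral>\<^sup>+s. \<infinity> * indicator {0} (s::real) \<partial>lborel)"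
      unfolding energy_def by (intro nn_integral_mono) (auto simp: indicator_def)
    also have "\<dots> = 0" by (subst nn_integral_cmult_indicator) simp_all
    finally show ?thesis by simp
  qed
  have I0: "AE \<omega> in M. I 0 \<omega> = 0"
    using gen_ito_local_fixed[OF is_ito_integral_gen_ito[OF ito], of 0] T_nonneg e0 by simp
  have "AE \<omega> in M. (\<forall>t\<le>0. X t \<omega> = \<gamma> t \<omega>) \<and>
         (\<forall>t\<in>{0..T}. X t \<omega> = \<gamma> 0 \<omega> + (LINT s:{0..t}|lborel. b s \<omega> (past X s \<omega>)) + I t \<omega>)"
    using ae I0 bX_integrable[OF X] AE_space
  proof eventually_elim
    case (elim \<omega>)
    have "norm (LINT s:{0..0}|lborel. bX X s \<omega>) = 0"
    proof -
      have "set_integrable lborel {0..0} (\<lambda>s. bX X s \<omega>)"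
        by (rule set_integrable_subset[OF elim(3)]) (use T_nonneg in auto)
      from set_integral_sq_bound[OF this order_refl] show ?thesis by simp
    qed
    then have "drift (bX X) 0 \<omega> = 0" by (simp add: drift_def)
    then have "X t \<omega> = \<gamma> 0 \<omega> + (LINT s:{0..t}|lborel. b s \<omega> (past X s \<omega>)) + I t \<omega>" if "t \<in> {0..T}" for t
    proof -
      have m: "min t 0 = 0" "max 0 t = t" using that by auto
      show ?thesis using that elim \<open>drift (bX X) 0 \<omega> = 0\<close> by (simp add: X' glue_def m) (simp add: drift_def add.assoc)
    qed
    then show ?case using square_intD(4)[OF X] elim by blast
  qed
  moreover have "(\<lambda>\<theta>. X \<theta> \<omega>) \<in> Clam l t" if "t \<in> {0..T}" "\<omega> \<in> space M" for t \<omega>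
    by (rule Clam_mono[OF square_intD(3)[OF X that(2)]]) (use that in simp)
  ultimately have "is_solution M F W l T b \<sigma> \<gamma> X"
    unfolding is_solution_def using square_intD(2)[OF X] bX_integrable[OF X] ito by blast
  then show thesis by (rule that)
qed

end

section \<open>Uniqueness\<close>

text \<open>Each application of the integral inequality to a bound with the weight
  \<open>exp (2 * c * t)\<close> halves it, so the initial bound \<open>R\<close> is driven to
  0.\<close>

lemma gronwall_zero:
  fixes g :: "real \<Rightarrow> ennreal"
  assumes c: "0 < c" and R: "0 \<le> R" and bound: "\<And>t. 0 \<le> t \<Longrightarrow> t \<le> T \<Longrightarrow> g t \<le> ennreal R"
    and int: "\<And>t. 0 \<le> t \<Longrightarrow> t \<le> T \<Longrightarrow> g t \<le> ennreal c * (\<integral>\<^sup>+s\<in>{0..t}. g s \<partial>lborel)" and t: "0 \<le> t" "t \<le> T"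
  shows "g t = 0"
proof -
  have it: "g t \<le> ennreal (R * (1/2) ^ n * exp (2 * c * t))" if "0 \<le> t" "t \<le> T" for n t
    using that
  proof (induction n arbitrary: t)
    case 0
    have "g t \<le> ennreal R" by (rule bound[OF 0])
    also have "\<dots> \<le> ennreal (R * (1/2) ^ 0 * exp (2 * c * t))"
      using R c 0 by (intro ennreal_leI) (simp add: mult_le_cancel_left1)
    finally show ?case .
  next
    case (Suc n)
    let ?c = "R * (1/2) ^ n"
    have c0: "0 \<le> ?c" using R by simp
    have "(\<integral>\<^sup>+s\<in>{0..t}. g s \<partial>lborel) \<le> (\<integral>\<^sup>+s. ennreal ?c * (ennreal (exp (2 * c * s)) * indicator {0..t} s) \<partial>lborel)"
      using Suc.IH Suc.prems c0 by (intro nn_integral_mono) (auto simp: indicator_def ennreal_mult[symmetric])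
    also have "\<dots> = ennreal ?c * (\<integral>\<^sup>+s\<in>{0..t}. ennreal (exp (2 * c * s)) \<partial>lborel)"
      by (rule nn_integral_cmult) measurable
    also have "\<dots> \<le> ennreal ?c * ennreal (exp (2 * c * t) / (2 * c))"
      using c Suc.prems by (intro mult_left_mono exp_nn_integral_le) simp_all
    finally have "ennreal c * (\<integral>\<^sup>+s\<in>{0..t}. g s \<partial>lborel) \<le> ennreal c * (ennreal ?c * ennreal (exp (2 * c * t) / (2 * c)))"
      by (rule mult_left_mono) simp
    also have "\<dots> = ennreal (R * (1/2) ^ Suc n * exp (2 * c * t))"
      using c c0 by (simp add: ennreal_mult[symmetric])
    finally show ?case by (rule order_trans[OF int[OF Suc.prems]])
  qed
  have "(\<lambda>n. ennreal (R * (1/2) ^ n * exp (2 * c * t))) \<longlonglongrightarrow> ennreal (R * 0 * exp (2 * c * t))"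
    by (intro tendsto_ennrealI tendsto_mult tendsto_const LIMSEQ_realpow_zero) simp_all
  then have "g t \<le> ennreal (R * 0 * exp (2 * c * t))"
    by (rule LIMSEQ_le_const) (use it[OF t] in blast)
  then show ?thesis by simp
qed

lemma sup_sq_finite:
  assumes "continuous_on {0..t} (\<lambda>s. X s \<omega>)"
  shows "sup_sq X t \<omega> < \<infinity>"
proof -
  have "bounded ((\<lambda>s. X s \<omega>) ` {0..t})"
    by (intro compact_imp_bounded compact_continuous_image assms compact_Icc)
  then obtain B where B: "\<And>s. 0 \<le> s \<Longrightarrow> s \<le> t \<Longrightarrow> norm (X s \<omega>) \<le> B" unfolding bounded_iff by fastforce
  have "sup_sq X t \<omega> \<le> ennreal (B\<^sup>2)"
    by (rule sup_sq_least) (intro ennreal_leI power_mono B norm_ge_zero)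
  also have "\<dots> < \<infinity>" by simp
  finally show ?thesis .
qed

lemma sup_sq_cong: "(\<And>s. 0 \<le> s \<Longrightarrow> s \<le> t \<Longrightarrow> X s \<omega> = Y s \<omega>) \<Longrightarrow> sup_sq X t \<omega> = sup_sq Y t \<omega>"
  unfolding sup_sq_def by (intro SUP_cong) auto

context path_sde
begin

lemma Eint_mono_AE:
  assumes "AE \<omega> in M. \<forall>s\<in>{0..t}. f s \<omega> \<le> g s \<omega>"
  shows "Eint f t \<le> Eint g t"
  unfolding Eint_def
proof (rule nn_integral_mono_AE)
  show "AE \<omega> in M. (\<integral>\<^sup>+s\<in>{0..t}. f s \<omega> \<partial>lborel) \<le> (\<integral>\<^sup>+s\<in>{0..t}. g s \<omega> \<partial>lborel)"
    using assms by eventually_elim (intro nn_integral_mono, auto simp: indicator_def)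
qed

lemma solutionD:
  assumes "is_solution M F W l T b \<sigma> \<gamma> X"
  obtains I where "admissible X" "gen_ito (sX X) I"
    "AE \<omega> in M. (\<forall>t\<le>0. X t \<omega> = \<gamma> t \<omega>) \<and> set_integrable lborel {0..T} (\<lambda>s. bX X s \<omega>) \<and>
      (\<forall>t\<in>{0..T}. X t \<omega> = \<gamma> 0 \<omega> + drift (bX X) t \<omega> + I t \<omega>)"
proof -
  obtain I where I: "is_ito_integral M F W T (sX X) I"
    and eq: "AE \<omega> in M. (\<forall>t\<le>0. X t \<omega> = \<gamma> t \<omega>) \<and>
         (\<forall>t\<in>{0..T}. X t \<omega> = \<gamma> 0 \<omega> + (LINT s:{0..t}|lborel. b s \<omega> (past X s \<omega>)) + I t \<omega>)"
    using assms unfolding is_solution_def by blast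
  have int: "AE \<omega> in M. set_integrable lborel {0..T} (\<lambda>s. bX X s \<omega>)"
    using assms unfolding is_solution_def by blast
  have "admissible X" using assms T_nonneg unfolding is_solution_def admissible_def by auto
  moreover have "AE \<omega> in M. (\<forall>t\<le>0. X t \<omega> = \<gamma> t \<omega>) \<and> set_integrable lborel {0..T} (\<lambda>s. bX X s \<omega>) \<and>
      (\<forall>t\<in>{0..T}. X t \<omega> = \<gamma> 0 \<omega> + drift (bX X) t \<omega> + I t \<omega>)"
    using eq int by eventually_elim (simp add: drift_def)
  ultimately show thesis using is_ito_integral_gen_ito[OF I] that by blast
qed

text \<open>
  Solutions are not known to be square integrable, so the difference of two solutions is estimated
  on the event that its running supremum does not exceed \<open>R\<close>.  There the stochastic integral agrees
  with that of the integrand cut off as soon as the supremum exceeds \<open>R\<close>, by locality.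
\<close>

lemma truncated_difference_vanishes:
  assumes X: "is_solution M F W l T b \<sigma> \<gamma> X" and Y: "is_solution M F W l T b \<sigma> \<gamma> Y" and R: "0 \<le> R"
  shows "AE \<omega> in M. sup_sq (\<lambda>s \<omega>. X s \<omega> - Y s \<omega>) T \<omega> \<le> ennreal R \<longrightarrow> sup_sq (\<lambda>s \<omega>. X s \<omega> - Y s \<omega>) T \<omega> = 0"
proof -
  obtain I where aX: "admissible X" and gI: "gen_ito (sX X) I"
    and eX: "AE \<omega> in M. (\<forall>t\<le>0. X t \<omega> = \<gamma> t \<omega>) \<and> set_integrable lborel {0..T} (\<lambda>s. bX X s \<omega>) \<and>
      (\<forall>t\<in>{0..T}. X t \<omega> = \<gamma> 0 \<omega> + drift (bX X) t \<omega> + I t \<omega>)" by (rule solutionD[OF X])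
  obtain J where aY: "admissible Y" and gJ: "gen_ito (sX Y) J"
    and eY: "AE \<omega> in M. (\<forall>t\<le>0. Y t \<omega> = \<gamma> t \<omega>) \<and> set_integrable lborel {0..T} (\<lambda>s. bX Y s \<omega>) \<and>
      (\<forall>t\<in>{0..T}. Y t \<omega> = \<gamma> 0 \<omega> + drift (bX Y) t \<omega> + J t \<omega>)" by (rule solutionD[OF Y])
  define S where "S = sup_sq (\<lambda>s \<omega>. X s \<omega> - Y s \<omega>)"
  \<comment> \<open>\<open>S\<close> is nondecreasing in time, so on the event
    \<open>S t <= R\<close> the cut-off has not acted anywhere in \<open>{0..t}\<close>. The cut
    integrand is nevertheless square integrable for all outcomes together, being controlled by
    \<open>h <= R\<close>.\<close>
  define \<theta> where "\<theta> = (\<lambda>s \<omega>. if S s \<omega> \<le> ennreal R then sX X s \<omega> - sX Y s \<omega> else 0)"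
  define h where "h = (\<lambda>s \<omega>. if S s \<omega> \<le> ennreal R then S s \<omega> else 0)"
  have acX: "adapted_continuous F {..T} X" "adapted_continuous F {..T} Y"
    and Cl: "\<And>\<omega>. \<omega> \<in> space M \<Longrightarrow> (\<lambda>\<theta>. X \<theta> \<omega>) \<in> Clam l T" "\<And>\<omega>. \<omega> \<in> space M \<Longrightarrow> (\<lambda>\<theta>. Y \<theta> \<omega>) \<in> Clam l T"
    using aX aY by (auto simp: admissible_def)
  have Sp: "prog_measurable F {0..T} S" unfolding S_def by (rule sup_sq_diff_prog[OF acX])
  have hp: "prog_measurable F {0..T} h"
    unfolding h_def by (rule prog_measurable_compose[OF Sp, where h="\<lambda>x. if x \<le> ennreal R then x else 0"]) measurable
  have dp: "prog_measurable F {0..T} (\<lambda>s \<omega>. sX X s \<omega> - sX Y s \<omega>)"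
    by (rule prog_measurable_diff[OF sX_prog[OF aX] sX_prog[OF aY]])
  have \<theta>p: "prog_measurable F {0..T} \<theta>"
    unfolding prog_measurable_def
  proof
    fix t assume t: "t \<in> {0..T}"
    let ?N = "restrict_space borel ({0..T} \<inter> {..t}) \<Otimes>\<^sub>M F t"
    have [measurable]: "(\<lambda>p. S (fst p) (snd p)) \<in> borel_measurable ?N" "(\<lambda>p. sX X (fst p) (snd p) - sX Y (fst p) (snd p)) \<in> borel_measurable ?N"
      using Sp dp t by (simp_all only: prog_measurable_def split_beta')
    show "(\<lambda>(s, \<omega>). \<theta> s \<omega>) \<in> borel_measurable ?N" unfolding \<theta>_def split_beta' by measurable
  qed
  have diff: "AE \<omega> in M. \<forall>s\<in>{0..T}. ennreal ((norm (bX X s \<omega> - bX Y s \<omega>))\<^sup>2) \<le> ennreal \<kappa> * S s \<omega>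
      \<and> ennreal ((hs_norm (\<theta> s \<omega>))\<^sup>2) \<le> ennreal \<kappa> * h s \<omega>"
    using eX eY AE_space
  proof eventually_elim
    case (elim \<omega>)
    have eq: "\<And>\<theta>. \<theta> \<le> 0 \<Longrightarrow> X \<theta> \<omega> = Y \<theta> \<omega>" using elim by simp
    show ?case
    proof
      fix s assume s: "s \<in> {0..T}"
      note B = coeff_diff_bound[where X=X and Z=Y and \<omega>=\<omega>, OF elim(3) Cl(1)[OF elim(3)] Cl(2)[OF elim(3)] eq s, folded S_def]
      show "ennreal ((norm (bX X s \<omega> - bX Y s \<omega>))\<^sup>2) \<le> ennreal \<kappa> * S s \<omega> \<and> ennreal ((hs_norm (\<theta> s \<omega>))\<^sup>2) \<le> ennreal \<kappa> * h s \<omega>"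
        using B by (simp add: \<theta>_def h_def)
    qed
  qed
  have hR: "h s \<omega> \<le> ennreal R" for s \<omega> by (simp add: h_def)
  define g where "g t = (\<integral>\<^sup>+\<omega>. h t \<omega> \<partial>M)" for t
  have gR: "g t \<le> ennreal R" for t
  proof -
    have "g t \<le> (\<integral>\<^sup>+\<omega>. ennreal R \<partial>M)" unfolding g_def by (intro nn_integral_mono hR)
    then show ?thesis by (simp add: emeasure_space_1)
  qed
  have \<theta>E: "(\<integral>\<^sup>+\<omega>. energy \<theta> t \<omega> \<partial>M) \<le> ennreal \<kappa> * (\<integral>\<^sup>+s\<in>{0..t}. g s \<partial>lborel)" if t: "0 \<le> t" "t \<le> T" for t
  proof -
    have "(\<integral>\<^sup>+\<omega>. energy \<theta> t \<omega> \<partial>M) = Eint (\<lambda>s \<omega>. ennreal ((hs_norm (\<theta> s \<omega>))\<^sup>2)) t" by (simp only: energy_def Eint_def)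
    also have "\<dots> \<le> Eint (\<lambda>s \<omega>. ennreal \<kappa> * h s \<omega>) t"
      by (rule Eint_mono_AE) (use diff t in \<open>auto elim: eventually_mono\<close>)
    also have "\<dots> = ennreal \<kappa> * (\<integral>\<^sup>+s\<in>{0..t}. g s \<partial>lborel)" unfolding g_def by (rule Eint_cmult[OF hp t])
    finally show ?thesis .
  qed
  have gint: "(\<integral>\<^sup>+s\<in>{0..T}. g s \<partial>lborel) < \<infinity>"
  proof -
    have "(\<integral>\<^sup>+s\<in>{0..T}. g s \<partial>lborel) \<le> (\<integral>\<^sup>+s\<in>{0..T}. ennreal R \<partial>lborel)"
      by (intro nn_integral_mono mult_right_mono gR) simp
    also have "\<dots> < \<infinity>" using T_nonneg by (subst nn_integral_cmult_indicator) (simp_all add: ennreal_mult_less_top)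
    finally show ?thesis .
  qed
  have \<theta>fin: "(\<integral>\<^sup>+\<omega>. energy \<theta> T \<omega> \<partial>M) < \<infinity>"
    by (rule le_less_trans[OF \<theta>E[OF T_nonneg order_refl]]) (use gint in \<open>simp add: ennreal_mult_less_top\<close>)
  obtain N where N: "ito_L2 \<theta> N" by (rule ito_L2_exists[OF \<theta>p \<theta>fin])
  have gN: "gen_ito \<theta> N"
    by (rule is_ito_integral_gen_ito[OF ito_L2_is_ito_integral[OF N \<theta>fin]])
  have gIJ: "gen_ito (\<lambda>s \<omega>. sX X s \<omega> - sX Y s \<omega>) (\<lambda>s \<omega>. I s \<omega> - J s \<omega>)"
    by (rule gen_ito_diff[OF gI gJ])
  \<comment> \<open>This integrand has no energy up to \<open>t\<close> when
    \<open>S t <= R\<close>. Locality then identifies \<open>I - J\<close>, for which no moments are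
    known, with the square integrable integral \<open>N\<close>, which satisfies
    \<open>ito_L2_bound\<close>.\<close>
  have "gen_ito (\<lambda>s \<omega>. sX X s \<omega> - sX Y s \<omega> - \<theta> s \<omega>) (\<lambda>s \<omega>. I s \<omega> - J s \<omega> - N s \<omega>)"
    by (rule gen_ito_diff[where \<Phi>="\<lambda>s \<omega>. sX X s \<omega> - sX Y s \<omega>" and \<Psi>=\<theta> and I="\<lambda>s \<omega>. I s \<omega> - J s \<omega>" and J=N, OF gIJ gN])
  note loc = gen_ito_local[OF this]
  have key: "AE \<omega> in M. h t \<omega> \<le> 2 * (ennreal T * (ennreal \<kappa> * (\<integral>\<^sup>+s\<in>{0..t}. h s \<omega> \<partial>lborel))) + 2 * sup_sq N t \<omega>" if t: "0 \<le> t" "t \<le> T" for t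
    using eX eY loc diff AE_space
  proof eventually_elim
    case (elim \<omega>)
    show ?case
    proof (cases "S t \<omega> \<le> ennreal R")
      case True
      have SR: "S s \<omega> \<le> ennreal R" if "s \<le> t" for s
        by (rule order_trans[OF _ True]) (unfold S_def, rule sup_sq_mono[OF that])
      have E0: "energy (\<lambda>s \<omega>. sX X s \<omega> - sX Y s \<omega> - \<theta> s \<omega>) r \<omega> = 0" if "r \<le> t" for r
      proof -
        have "energy (\<lambda>s \<omega>. sX X s \<omega> - sX Y s \<omega> - \<theta> s \<omega>) r \<omega> = (\<integral>\<^sup>+s. 0 \<partial>(lborel :: real measure))"
          unfolding energy_def using SR that by (intro nn_integral_cong) (auto simp: indicator_def \<theta>_def)
        then show ?thesis by simp
      qed
      have "X r \<omega> - Y r \<omega> = (drift (bX X) r \<omega> - drift (bX Y) r \<omega>) + N r \<omega>" if r: "0 \<le> r" "r \<le> t" for r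
      proof -
        have rT: "r \<in> {0..T}" using r t by simp
        have "I r \<omega> - J r \<omega> - N r \<omega> = 0" using elim(3) rT E0[OF r(2)] by blast
        moreover have "X r \<omega> = \<gamma> 0 \<omega> + drift (bX X) r \<omega> + I r \<omega>" "Y r \<omega> = \<gamma> 0 \<omega> + drift (bX Y) r \<omega> + J r \<omega>"
          using elim(1,2) rT by blast+
        ultimately show ?thesis by (simp add: algebra_simps)
      qed
      then have "S t \<omega> = sup_sq (\<lambda>r \<omega>. (drift (bX X) r \<omega> - drift (bX Y) r \<omega>) + N r \<omega>) t \<omega>"
        unfolding S_def by (rule sup_sq_cong)
      also have "\<dots> \<le> 2 * sup_sq (\<lambda>r \<omega>. drift (bX X) r \<omega> - drift (bX Y) r \<omega>) t \<omega> + 2 * sup_sq N t \<omega>"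
        by (rule sup_sq_add_le)
      also have "sup_sq (\<lambda>r \<omega>. drift (bX X) r \<omega> - drift (bX Y) r \<omega>) t \<omega> \<le> ennreal T * (\<integral>\<^sup>+s\<in>{0..t}. ennreal ((norm (bX X s \<omega> - bX Y s \<omega>))\<^sup>2) \<partial>lborel)"
        by (rule drift_diff_bound) (use elim t in auto)
      also have "(\<integral>\<^sup>+s\<in>{0..t}. ennreal ((norm (bX X s \<omega> - bX Y s \<omega>))\<^sup>2) \<partial>lborel) \<le> ennreal \<kappa> * (\<integral>\<^sup>+s\<in>{0..t}. h s \<omega> \<partial>lborel)"
      proof -
        note [measurable] = prog_measurable_section[OF hp t elim(5)]
        have e: "h s \<omega> * indicator {0..t} s = h (max 0 (min t s)) \<omega> * indicator {0..t} s" for s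
          by (auto simp: indicator_def min_def max_def)
        have "(\<integral>\<^sup>+s\<in>{0..t}. ennreal ((norm (bX X s \<omega> - bX Y s \<omega>))\<^sup>2) \<partial>lborel) \<le> (\<integral>\<^sup>+s. ennreal \<kappa> * (h s \<omega> * indicator {0..t} s) \<partial>lborel)"
          using elim(4) t SR by (intro nn_integral_mono) (auto simp: indicator_def h_def)
        also have "\<dots> = ennreal \<kappa> * (\<integral>\<^sup>+s\<in>{0..t}. h s \<omega> \<partial>lborel)"
          unfolding e by (rule nn_integral_cmult) measurable
        finally show ?thesis .
      qed
      finally show ?thesis using True by (simp add: h_def mult_left_mono add_mono)
    qed (simp add: h_def)
  qed
  \<comment> \<open>The drift contributes \<open>2 * T * \<kappa>\<close> and the integral 2 times
    the 64 of \<open>ito_L2_bound\<close> times \<kappa>.\<close>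
  define c where "c = 2 * T * \<kappa> + 128 * \<kappa>"
  have c: "0 < c" using T_pos \<kappa>_pos by (simp add: c_def add_pos_pos)
  have gle: "g t \<le> ennreal c * (\<integral>\<^sup>+s\<in>{0..t}. g s \<partial>lborel)" if t: "0 \<le> t" "t \<le> T" for t
  proof -
    let ?G = "\<integral>\<^sup>+s\<in>{0..t}. g s \<partial>lborel"
    have [measurable]: "(\<lambda>\<omega>. \<integral>\<^sup>+s\<in>{0..t}. h s \<omega> \<partial>lborel) \<in> borel_measurable M" "sup_sq N t \<in> borel_measurable M"
      by (rule measurable_F_M[OF prog_nn_integral_measurable[OF hp t]], rule measurable_F_M[OF sup_sq_measurable[OF ito_L2_ac[OF N] t]])
    have "g t \<le> (\<integral>\<^sup>+\<omega>. 2 * (ennreal T * (ennreal \<kappa> * (\<integral>\<^sup>+s\<in>{0..t}. h s \<omega> \<partial>lborel))) + 2 * sup_sq N t \<omega> \<partial>M)"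
      unfolding g_def by (rule nn_integral_mono_AE[OF key[OF t]])
    also have "\<dots> = 2 * (ennreal T * (ennreal \<kappa> * (\<integral>\<^sup>+\<omega>. (\<integral>\<^sup>+s\<in>{0..t}. h s \<omega> \<partial>lborel) \<partial>M))) + 2 * (\<integral>\<^sup>+\<omega>. sup_sq N t \<omega> \<partial>M)"
      by (simp add: nn_integral_add nn_integral_cmult)
    also have "(\<integral>\<^sup>+\<omega>. (\<integral>\<^sup>+s\<in>{0..t}. h s \<omega> \<partial>lborel) \<partial>M) = ?G" unfolding g_def by (rule prog_nn_integral_Fubini[OF hp t])
    also have "2 * (ennreal T * (ennreal \<kappa> * ?G)) + 2 * (\<integral>\<^sup>+\<omega>. sup_sq N t \<omega> \<partial>M) \<le> 2 * (ennreal T * (ennreal \<kappa> * ?G)) + 2 * (64 * (ennreal \<kappa> * ?G))"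
      by (intro add_left_mono mult_left_mono order_trans[OF ito_L2_bound[OF N t] mult_left_mono[OF \<theta>E[OF t]]]) simp_all
    also have "\<dots> = ennreal c * ?G"
    proof -
      have "ennreal c = 2 * (ennreal T * ennreal \<kappa>) + 2 * (64 * ennreal \<kappa>)"
        using T_pos \<kappa>_pos unfolding c_def by (simp add: ennreal_plus ennreal_mult mult.assoc[symmetric])
      then show ?thesis by (simp only: distrib_right mult.assoc)
    qed
    finally show ?thesis .
  qed
  have "g T = 0" by (rule gronwall_zero[OF c R gR gle T_nonneg order_refl])
  moreover have "h T \<in> borel_measurable M"
  proof -
    have "S T \<in> borel_measurable M" unfolding S_def
      by (rule sup_sq_diff_measurable[OF adapted_continuous_subset[OF acX(1)] adapted_continuous_subset[OF acX(2)] T_nonneg order_refl]) auto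
    then show ?thesis unfolding h_def by measurable
  qed
  ultimately have "AE \<omega> in M. h T \<omega> = 0" unfolding g_def by (simp add: nn_integral_0_iff_AE)
  then show ?thesis by eventually_elim (auto simp: h_def S_def)
qed

text \<open>Continuous paths are bounded on \<open>{0..T}\<close>, so for each outcome the supremum
  of the difference lies below some natural number; countably many truncation levels therefore
  suffice.\<close>

lemma solution_unique:
  assumes X: "is_solution M F W l T b \<sigma> \<gamma> X" and Y: "is_solution M F W l T b \<sigma> \<gamma> Y"
  shows "AE \<omega> in M. \<forall>t\<le>T. Y t \<omega> = X t \<omega>"
proof -
  have "AE \<omega> in M. \<forall>n::nat. sup_sq (\<lambda>s \<omega>. X s \<omega> - Y s \<omega>) T \<omega> \<le> ennreal (real n) \<longrightarrow> sup_sq (\<lambda>s \<omega>. X s \<omega> - Y s \<omega>) T \<omega> = 0"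
    unfolding AE_all_countable by (intro allI truncated_difference_vanishes[OF X Y]) simp
  moreover have "AE \<omega> in M. \<forall>t\<le>0. X t \<omega> = \<gamma> t \<omega>" "AE \<omega> in M. \<forall>t\<le>0. Y t \<omega> = \<gamma> t \<omega>"
    by (rule solutionD[OF X], force elim: eventually_mono) (rule solutionD[OF Y], force elim: eventually_mono)
  ultimately show ?thesis using AE_space
  proof eventually_elim
    case (elim \<omega>)
    have ac: "adapted_continuous F {..T} X" "adapted_continuous F {..T} Y" using X Y by (auto simp: is_solution_def)
    have "continuous_on {0..T} (\<lambda>s. X s \<omega> - Y s \<omega>)"
      by (rule continuous_on_subset[OF adapted_continuousD(2)[OF adapted_continuous_diff[OF ac], of T]]) (use elim in auto)
    then have "sup_sq (\<lambda>s \<omega>. X s \<omega> - Y s \<omega>) T \<omega> < \<infinity>" by (rule sup_sq_finite)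
    then obtain n :: nat where "sup_sq (\<lambda>s \<omega>. X s \<omega> - Y s \<omega>) T \<omega> \<le> ennreal (real n)"
      using ennreal_Ex_less_of_nat[of "sup_sq (\<lambda>s \<omega>. X s \<omega> - Y s \<omega>) T \<omega>"] by (auto simp: ennreal_of_nat_eq_real_of_nat intro: less_imp_le)
    then have z: "sup_sq (\<lambda>s \<omega>. X s \<omega> - Y s \<omega>) T \<omega> = 0" using elim(1) by blast
    show ?case
    proof (intro allI impI)
      fix t assume t: "t \<le> T"
      show "Y t \<omega> = X t \<omega>"
      proof (cases "t \<le> 0")
        case True then show ?thesis using elim by simp
      next
        case False
        then have "ennreal ((norm (X t \<omega> - Y t \<omega>))\<^sup>2) \<le> 0"
          using sup_sq_upper[where X="\<lambda>s \<omega>. X s \<omega> - Y s \<omega>" and s=t and t=T and \<omega>=\<omega>] t z by simp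
        then show ?thesis by simp
      qed
    qed
  qed
qed

end

theorem theorem2p9:
  fixes M :: "'w measure"
    and F :: "real \<Rightarrow> 'w measure"
    and W :: "real \<Rightarrow> 'w \<Rightarrow> real ^ 'm"
    and T l :: real
    and b :: "real \<Rightarrow> 'w \<Rightarrow> (real \<Rightarrow> 'h::{real_inner, banach, second_countable_topology}) \<Rightarrow> 'h"
    and \<sigma> :: "real \<Rightarrow> 'w \<Rightarrow> (real \<Rightarrow> 'h) \<Rightarrow> ((real ^ 'm) \<Rightarrow>\<^sub>L 'h)"
    and \<gamma> :: "real \<Rightarrow> 'w \<Rightarrow> 'h"
  assumes "usual_filtered_prob_space M F"
    and "brownian_motion M F W"
    and "T > 0" and "l > 0"
    and b_prog: "\<forall>x\<in>Clam l T. prog_measurable F {0..T} (\<lambda>t \<omega>. b t \<omega> x)"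
    and sigma_prog: "\<forall>x\<in>Clam l T. prog_measurable F {0..T} (\<lambda>t \<omega>. \<sigma> t \<omega> x)"
    and lipschitz: "\<exists>L1>0. \<forall>t\<in>{0..T}. \<forall>\<omega>\<in>space M. \<forall>x\<in>Clam l T. \<forall>x'\<in>Clam l T.
        norm (b t \<omega> x - b t \<omega> x') + hs_norm (\<sigma> t \<omega> x - \<sigma> t \<omega> x')
          \<le> L1 * clam_norm l T (\<lambda>\<theta>. x \<theta> - x' \<theta>)"
    and square_integrable:
      "(\<integral>\<^sup>+ \<omega>. (\<integral>\<^sup>+ t\<in>{0..T}. ennreal ((norm (b t \<omega> (\<lambda>_. 0)))\<^sup>2) \<partial>lborel) \<partial>M) +
       (\<integral>\<^sup>+ \<omega>. (\<integral>\<^sup>+ t\<in>{0..T}. ennreal ((hs_norm (\<sigma> t \<omega> (\<lambda>_. 0)))\<^sup>2) \<partial>lborel) \<partial>M) < \<infinity>"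
    and "\<gamma> \<in> L2_initial M F l"
    and "\<gamma> \<in> M2_space M F {..0}"
  shows "\<exists>X. is_solution M F W l T b \<sigma> \<gamma> X \<and>
    (\<forall>Y. is_solution M F W l T b \<sigma> \<gamma> Y \<longrightarrow> (AE \<omega> in M. \<forall>t\<le>T. Y t \<omega> = X t \<omega>))"
proof -
  from lipschitz obtain L where L: "0 < L" and lipL: "\<forall>t\<in>{0..T}. \<forall>\<omega>\<in>space M. \<forall>x\<in>Clam l T. \<forall>x'\<in>Clam l T.
      norm (b t \<omega> x - b t \<omega> x') + hs_norm (\<sigma> t \<omega> x - \<sigma> t \<omega> x') \<le> L * clam_norm l T (\<lambda>\<theta>. x \<theta> - x' \<theta>)"
    by (elim exE conjE) (rule that)
  note lip = bspec[OF bspec[OF bspec[OF bspec[OF lipL]]]]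
  have fin: "u < \<infinity> \<and> v < \<infinity>" if "u + v < \<infinity>" for u v :: ennreal
    using that by simp
  have sq: "(\<integral>\<^sup>+ \<omega>. (\<integral>\<^sup>+ t\<in>{0..T}. ennreal ((norm (b t \<omega> (\<lambda>_. 0)))\<^sup>2) \<partial>lborel) \<partial>M) < \<infinity>"
    "(\<integral>\<^sup>+ \<omega>. (\<integral>\<^sup>+ t\<in>{0..T}. ennreal ((hs_norm (\<sigma> t \<omega> (\<lambda>_. 0)))\<^sup>2) \<partial>lborel) \<partial>M) < \<infinity>"
    by (rule conjunct1[OF fin[OF square_integrable]], rule conjunct2[OF fin[OF square_integrable]])
  have bb: "brownian_basis M F W T"
    by (rule brownian_basis.intro[OF assms(1) brownian_basis_axioms.intro[OF assms(2,3)]])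
  have ax: "path_sde_axioms M F T l L b \<sigma> \<gamma>"
    by (rule path_sde_axioms.intro[OF assms(4) L bspec[OF b_prog] bspec[OF sigma_prog] lip sq assms(9)])
  interpret path_sde M F W T l L b \<sigma> \<gamma>
    by (rule path_sde.intro[OF bb ax])
  obtain X where X: "is_solution M F W l T b \<sigma> \<gamma> X" by (rule solution_exists)
  with solution_unique[OF X] show ?thesis by blast
qed

end
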